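(* Let $K$ be an algebraically closed field, $G$ a finite group, $D=D(G)$ its Drinfel'd double and $g\ge0$. For all $m\ge0$, the derived block space $\mathcal Z^m(\Sigma_g)=\mathrm{Ext}^m_D(K,L^{\otimes g})$, $L=D^*$, satisfies $$\mathcal Z^m(\Sigma_g)\cong H^m(G,M^g)$$ as modules over the mapping class group $\Gamma_g$ of the closed surface $\Sigma_g$, where $M^g=K[\mathrm{Hom}(\pi_1(\Sigma_g,x),G)]$ is the linearized representation variety.
   Context: Let $e$ be the unit of $G$ and $[a,b]=aba^{-1}b^{-1}$. $D=D(G)$ has basis $\delta_a\otimes b$ ($a,b\in G$), product $(\delta_a\otimes b)(\delta_c\otimes d)=\delta_{a,bcb^{-1}}\,\delta_a\otimes bd$, unit $\varepsilon\otimes e$ with $\varepsilon=\sum_a\delta_a$, coproduct $\Delta(\delta_a\otimes b)=\sum_{c}(\delta_c\otimes b)\otimes(\delta_{ac^{-1}}\otimes b)$ and counit $\delta_a\otimes b\mapsto\delta_{a,e}$; $K$ is the trivial $D$-module. $L=D^*$ has the dual basis $u(a,b)$ and is a $D$-module via $(\varepsilon\otimes h).u(a,b)=u(hah^{-1},hbh^{-1})$, $(\delta_h\otimes e).u(a,b)=\delta_{h,[b^{-1},a]}u(a,b)$; $L^{\otimes g}$ is a $D$-module via the coproduct, $L^{\otimes0}=K$. $H^m(G,-)=\mathrm{Ext}^m_{K[G]}(K,-)$. $\Sigma_g$ is the closed oriented surface of genus $g$ with base point $x$; $\pi_1(\Sigma_g,x)$ is generated by $[\alpha_1],[\beta_1],\dots,[\alpha_g],[\beta_g]$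 with the single relation $[[\alpha_1],[\beta_1]]\cdots[[\alpha_g],[\beta_g]]=1$. $\Gamma_g$ (resp. $\Gamma_g(x)$) is the group of isotopy classes of orientation-preserving diffeomorphisms of $\Sigma_g$ (resp. fixing $x$, with isotopies fixing $x$); forgetting $x$ gives a surjection $\Gamma_g(x)\to\Gamma_g$; for $g=0$ both are trivial. For $g\ge 1$, $\Gamma_g(x)$ acts faithfully on $\pi_1(\Sigma_g,x)$ and is generated by classes $\mathfrak t_i,\mathfrak s_i$ ($1\le i\le g$), $\mathfrak n_l$ ($1\le l\le g-1$) acting by (generators not mentioned are fixed) $\mathfrak t_i\colon\beta_i\mapsto\beta_i\alpha_i$; $\mathfrak s_i\colon\alpha_i\mapsto\alpha_i\beta_i\alpha_i^{-1},\ \beta_i\mapsto\alpha_i^{-1}$; $\mathfrak n_l\colon\beta_l\mapsto\mu_l\beta_l,\ \alpha_{l+1}\mapsto\mu_l\alpha_{l+1}\mu_l^{-1},\ \beta_{l+1}\mapsto\beta_{l+1}\mu_l^{-1}$, with $\mu_l=\alpha_{l+1}^{-1}\beta_l\alpha_l\beta_l^{-1}$. Action on $\mathcal Z^m(\Sigma_g)$: define $D$-linear maps $\tilde{\mathfrak T}(u(c,d))=u(c,cd)$, $\tilde{\mathfrak S}(u(c,d))=u(d,d^{-1}c^{-1}d)$ on $L$ and $\tilde{\mathfrak N}(u(c,d)\otimes u(c',d'))=u(c,dn)\otimes u(n^{-1}c'n,n^{-1}d')$, $n=c'^{-1}d^{-1}cd$, on $L\otimes L$. There is an action of $\Gamma_g$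 on $\mathrm{Ext}^m_D(K,L^{\otimes g})$ in which the images of $\mathfrak t_i,\mathfrak s_i,\mathfrak n_l$ act by the maps induced functorially by applying $\tilde{\mathfrak T}$, $\tilde{\mathfrak S}$ in the $i$-th tensor factor and $\tilde{\mathfrak N}$ in the $l$-th and $(l+1)$-st tensor factors of $L^{\otimes g}$. (This is the action coming from the R-matrix $\tilde R=\sum_{a,b}(\delta_a\otimes e)\otimes(\delta_b\otimes a^{-1})$ of $D$; the other standard R-matrix, for which $\tilde{\mathfrak T},\tilde{\mathfrak S},\tilde{\mathfrak N}$ are replaced by their inverses, gives an isomorphic action.) Action on $H^m(G,M^g)$: $G$ acts on $\Omega^g=\mathrm{Hom}(\pi_1(\Sigma_g,x),G)$ by $(a.f)([\gamma])=af([\gamma])a^{-1}$, and $\Gamma_g(x)$ acts by $([\psi].f)([\gamma])=f([\psi^{-1}\circ\gamma])$; these actions commute and extend linearly to $M^g=K[\Omega^g]$, the vector space with basis $\Omega^g$. The induced action of $\Gamma_g(x)$ on $H^m(G,M^g)$ descends to $\Gamma_g$. *)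

theory Defs
  imports
    "HOL-Analysis.Analysis"
    "HOL-Algebra.Module"
    "HOL-Algebra.AbelCoset"
    "HOL-Algebra.Bij"
    "HOL-Computational_Algebra.Polynomial"
begin

section \<open>Modules over noncommutative rings, Ext\<close>

text \<open>
  HOL-Algebra's \<open>module\<close> locale requires a commutative ring; its record type is reused here for
  left modules over an arbitrary ring. The fields \<open>mult\<close> and \<open>one\<close> of a module are meaningless
  and left \<open>undefined\<close>.
\<close>

locale left_module = R?: ring R + M?: abelian_group M for R (structure) and M (structure) +
  assumes smult_closed: "\<lbrakk>a \<in> carrier R; x \<in> carrier M\<rbrakk> \<Longrightarrow> a \<odot>\<^bsub>M\<^esub> x \<in> carrier M"
    and smult_l_distr: "\<lbrakk>a \<in> carrier R; b \<in> carrier R; x \<in> carrier M\<rbrakk>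
      \<Longrightarrow> (a \<oplus>\<^bsub>R\<^esub> b) \<odot>\<^bsub>M\<^esub> x = a \<odot>\<^bsub>M\<^esub> x \<oplus>\<^bsub>M\<^esub> b \<odot>\<^bsub>M\<^esub> x"
    and smult_r_distr: "\<lbrakk>a \<in> carrier R; x \<in> carrier M; y \<in> carrier M\<rbrakk>
      \<Longrightarrow> a \<odot>\<^bsub>M\<^esub> (x \<oplus>\<^bsub>M\<^esub> y) = a \<odot>\<^bsub>M\<^esub> x \<oplus>\<^bsub>M\<^esub> a \<odot>\<^bsub>M\<^esub> y"
    and smult_assoc: "\<lbrakk>a \<in> carrier R; b \<in> carrier R; x \<in> carrier M\<rbrakk>
      \<Longrightarrow> (a \<otimes>\<^bsub>R\<^esub> b) \<odot>\<^bsub>M\<^esub> x = a \<odot>\<^bsub>M\<^esub> (b \<odot>\<^bsub>M\<^esub> x)"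
    and smult_one: "x \<in> carrier M \<Longrightarrow> \<one>\<^bsub>R\<^esub> \<odot>\<^bsub>M\<^esub> x = x"

definition mod_hom ::
    "'r ring \<Rightarrow> ('r, 'm) module \<Rightarrow> ('r, 'n) module \<Rightarrow> ('m \<Rightarrow> 'n) set" where
  "mod_hom R M N = {f \<in> carrier M \<rightarrow>\<^sub>E carrier N.
     (\<forall>x\<in>carrier M. \<forall>y\<in>carrier M. f (x \<oplus>\<^bsub>M\<^esub> y) = f x \<oplus>\<^bsub>N\<^esub> f y) \<and>
     (\<forall>a\<in>carrier R. \<forall>x\<in>carrier M. f (a \<odot>\<^bsub>M\<^esub> x) = a \<odot>\<^bsub>N\<^esub> f x)}"

definition free_module :: "'r ring \<Rightarrow> 'x set \<Rightarrow> ('r, 'x \<Rightarrow> 'r) module" where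
  "free_module R X =
    \<lparr>carrier = {v \<in> X \<rightarrow>\<^sub>E carrier R. finite {x \<in> X. v x \<noteq> \<zero>\<^bsub>R\<^esub>}},
     mult = undefined, one = undefined,
     zero = (\<lambda>x\<in>X. \<zero>\<^bsub>R\<^esub>),
     add = (\<lambda>v w. \<lambda>x\<in>X. v x \<oplus>\<^bsub>R\<^esub> w x),
     smult = (\<lambda>r v. \<lambda>x\<in>X. r \<otimes>\<^bsub>R\<^esub> v x)\<rparr>"

text \<open>
  \<open>M\<close> is projective iff the canonical epimorphism onto \<open>M\<close> from the free module on the
  underlying set of \<open>M\<close> splits; this avoids quantifying over modules of other types.
\<close>

definition projective_module :: "'r ring \<Rightarrow> ('r, 'm) module \<Rightarrow> bool" where
  "projective_module R M \<longleftrightarrow> left_module R M \<and>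
     (\<exists>s \<in> mod_hom R M (free_module R (carrier M)). \<forall>p\<in>carrier M.
        finsum M (\<lambda>x. s p x \<odot>\<^bsub>M\<^esub> x) {x \<in> carrier M. s p x \<noteq> \<zero>\<^bsub>R\<^esub>} = p)"

definition projective_resolution ::
    "'r ring \<Rightarrow> ('r, 't) module \<Rightarrow> (nat \<Rightarrow> ('r, 'p) module) \<Rightarrow> (nat \<Rightarrow> 'p \<Rightarrow> 'p) \<Rightarrow> ('p \<Rightarrow> 't) \<Rightarrow> bool"
  where
  "projective_resolution R T P d \<epsilon> \<longleftrightarrow>
     (\<forall>n. projective_module R (P n)) \<and>
     (\<forall>n. d n \<in> mod_hom R (P (Suc n)) (P n)) \<and>
     \<epsilon> \<in> mod_hom R (P 0) T \<and>
     \<epsilon> ` carrier (P 0) = carrier T \<and>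
     {p \<in> carrier (P 0). \<epsilon> p = \<zero>\<^bsub>T\<^esub>} = d 0 ` carrier (P 1) \<and>
     (\<forall>n. {p \<in> carrier (P (Suc n)). d n p = \<zero>\<^bsub>P n\<^esub>} = d (Suc n) ` carrier (P (Suc (Suc n))))"

text \<open>
  The rings below are algebras over the field \<open>'k\<close> whose elements are coefficient functions
  \<open>'b \<Rightarrow> 'k\<close> with respect to a basis; a scalar \<open>c\<close> acts on modules through \<open>c 1\<close>.
\<close>

definition hom_space ::
    "('b \<Rightarrow> 'k::field) ring \<Rightarrow> ('b \<Rightarrow> 'k, 'm) module \<Rightarrow> ('b \<Rightarrow> 'k, 'n) module
      \<Rightarrow> ('k, 'm \<Rightarrow> 'n) module" where
  "hom_space R M N =
    \<lparr>carrier = mod_hom R M N,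
     mult = undefined, one = undefined,
     zero = (\<lambda>x\<in>carrier M. \<zero>\<^bsub>N\<^esub>),
     add = (\<lambda>f g. \<lambda>x\<in>carrier M. f x \<oplus>\<^bsub>N\<^esub> g x),
     smult = (\<lambda>c f. \<lambda>x\<in>carrier M. (\<lambda>b. c * \<one>\<^bsub>R\<^esub> b) \<odot>\<^bsub>N\<^esub> f x)\<rparr>"

definition cocycles ::
    "('b \<Rightarrow> 'k::field) ring \<Rightarrow> (nat \<Rightarrow> ('b \<Rightarrow> 'k, 'p) module) \<Rightarrow> (nat \<Rightarrow> 'p \<Rightarrow> 'p)
      \<Rightarrow> ('b \<Rightarrow> 'k, 'n) module \<Rightarrow> nat \<Rightarrow> ('p \<Rightarrow> 'n) set" where
  "cocycles R P d N m = {f \<in> mod_hom R (P m) N.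
     compose (carrier (P (Suc m))) f (d m) = \<zero>\<^bsub>hom_space R (P (Suc m)) N\<^esub>}"

primrec coboundaries ::
    "('b \<Rightarrow> 'k::field) ring \<Rightarrow> (nat \<Rightarrow> ('b \<Rightarrow> 'k, 'p) module) \<Rightarrow> (nat \<Rightarrow> 'p \<Rightarrow> 'p)
      \<Rightarrow> ('b \<Rightarrow> 'k, 'n) module \<Rightarrow> nat \<Rightarrow> ('p \<Rightarrow> 'n) set" where
  "coboundaries R P d N 0 = {\<zero>\<^bsub>hom_space R (P 0) N\<^esub>}"
| "coboundaries R P d N (Suc m) =
     (\<lambda>f. compose (carrier (P (Suc m))) f (d m)) ` mod_hom R (P m) N"

definition Ext_class ::
    "('b \<Rightarrow> 'k::field) ring \<Rightarrow> (nat \<Rightarrow> ('b \<Rightarrow> 'k, 'p) module) \<Rightarrow> (nat \<Rightarrow> 'p \<Rightarrow> 'p)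
      \<Rightarrow> ('b \<Rightarrow> 'k, 'n) module \<Rightarrow> nat \<Rightarrow> ('p \<Rightarrow> 'n) \<Rightarrow> ('p \<Rightarrow> 'n) set" where
  "Ext_class R P d N m f = coboundaries R P d N m +>\<^bsub>hom_space R (P m) N\<^esub> f"

text \<open>\<open>Ext R P d N m\<close> is the vector space \<open>Ext\<^sup>m(T, N)\<close> over \<open>R\<close>, computed by means
  of a projective resolution \<open>(P, d)\<close> of \<open>T\<close>.\<close>

definition Ext ::
    "('b \<Rightarrow> 'k::field) ring \<Rightarrow> (nat \<Rightarrow> ('b \<Rightarrow> 'k, 'p) module) \<Rightarrow> (nat \<Rightarrow> 'p \<Rightarrow> 'p)
      \<Rightarrow> ('b \<Rightarrow> 'k, 'n) module \<Rightarrow> nat \<Rightarrow> ('k, ('p \<Rightarrow> 'n) set) module" where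
  "Ext R P d N m =
    \<lparr>carrier = Ext_class R P d N m ` cocycles R P d N m,
     mult = undefined, one = undefined,
     zero = coboundaries R P d N m,
     add = (\<lambda>X Y. X <+>\<^bsub>hom_space R (P m) N\<^esub> Y),
     smult = (\<lambda>c X. \<Union>f\<in>X. Ext_class R P d N m (c \<odot>\<^bsub>hom_space R (P m) N\<^esub> f))\<rparr>"

text \<open>The endomorphism of \<open>Ext\<^sup>m(T, N)\<close> induced by an endomorphism \<open>\<theta>\<close> of the module \<open>N\<close>.\<close>

definition Ext_map ::
    "('b \<Rightarrow> 'k::field) ring \<Rightarrow> (nat \<Rightarrow> ('b \<Rightarrow> 'k, 'p) module) \<Rightarrow> (nat \<Rightarrow> 'p \<Rightarrow> 'p)
      \<Rightarrow> ('b \<Rightarrow> 'k, 'n) module \<Rightarrow> nat \<Rightarrow> ('n \<Rightarrow> 'n) \<Rightarrow> ('p \<Rightarrow> 'n) set \<Rightarrow> ('p \<Rightarrow> 'n) set" where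
  "Ext_map R P d N m \<theta> X = (\<Union>f\<in>X. Ext_class R P d N m (compose (carrier (P m)) \<theta> f))"


section \<open>Algebras and modules with a distinguished basis\<close>

definition lin_space :: "'x set \<Rightarrow> ('x \<Rightarrow> 'k::field) set" where
  "lin_space X = {v. finite {x. v x \<noteq> 0} \<and> {x. v x \<noteq> 0} \<subseteq> X}"

definition basis_vec :: "'x \<Rightarrow> 'x \<Rightarrow> 'k::field" where
  "basis_vec x = (\<lambda>y. if y = x then 1 else 0)"

definition lin_ext :: "('x \<Rightarrow> 'z \<Rightarrow> 'k::field) \<Rightarrow> ('x \<Rightarrow> 'k) \<Rightarrow> 'z \<Rightarrow> 'k" where
  "lin_ext \<phi> v = (\<lambda>z. \<Sum>x | v x \<noteq> 0. v x * \<phi> x z)"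

definition bilin_ext :: "('y \<Rightarrow> 'x \<Rightarrow> 'z \<Rightarrow> 'k::field) \<Rightarrow> ('y \<Rightarrow> 'k) \<Rightarrow> ('x \<Rightarrow> 'k) \<Rightarrow> 'z \<Rightarrow> 'k" where
  "bilin_ext \<beta> r v = (\<lambda>z. \<Sum>y | r y \<noteq> 0. \<Sum>x | v x \<noteq> 0. r y * v x * \<beta> y x z)"

definition based_algebra ::
    "'y set \<Rightarrow> ('y \<Rightarrow> 'y \<Rightarrow> 'y \<Rightarrow> 'k::field) \<Rightarrow> ('y \<Rightarrow> 'k) \<Rightarrow> ('y \<Rightarrow> 'k) ring" where
  "based_algebra Y \<mu> u =
    \<lparr>carrier = lin_space Y, mult = bilin_ext \<mu>, one = u,
     zero = (\<lambda>_. 0), add = (\<lambda>v w y. v y + w y)\<rparr>"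

definition based_module ::
    "'x set \<Rightarrow> ('y \<Rightarrow> 'x \<Rightarrow> 'x \<Rightarrow> 'k::field) \<Rightarrow> ('y \<Rightarrow> 'k, 'x \<Rightarrow> 'k) module" where
  "based_module X \<beta> =
    \<lparr>carrier = lin_space X, mult = undefined, one = undefined,
     zero = (\<lambda>_. 0), add = (\<lambda>v w x. v x + w x), smult = bilin_ext \<beta>\<rparr>"

text \<open>The one-dimensional module on which basis elements of the algebra act by the scalars \<open>\<kappa>\<close>.\<close>

definition character_module :: "('y \<Rightarrow> 'k::field) \<Rightarrow> ('y \<Rightarrow> 'k, 'k) module" where
  "character_module \<kappa> =
    \<lparr>carrier = UNIV, mult = undefined, one = undefined,
     zero = 0, add = (+), smult = (\<lambda>r c. (\<Sum>y | r y \<noteq> 0. r y * \<kappa> y) * c)\<rparr>"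


section \<open>The group algebra and the Drinfel'd double\<close>

definition group_algebra :: "('g, 'c) monoid_scheme \<Rightarrow> ('g \<Rightarrow> 'k::field) ring" where
  "group_algebra G =
     based_algebra (carrier G) (\<lambda>a b. basis_vec (a \<otimes>\<^bsub>G\<^esub> b)) (basis_vec \<one>\<^bsub>G\<^esub>)"

definition trivial_group_module :: "('g \<Rightarrow> 'k::field, 'k) module" where
  "trivial_group_module = character_module (\<lambda>_. 1)"

text \<open>The pair \<open>(a, b)\<close> stands for the basis vector \<open>\<delta>\<^sub>a \<otimes> b\<close> of the Drinfel'd double.\<close>

definition drinfeld_double :: "('g, 'c) monoid_scheme \<Rightarrow> ('g \<times> 'g \<Rightarrow> 'k::field) ring" where
  "drinfeld_double G = based_algebra (carrier G \<times> carrier G)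
     (\<lambda>(a, b) (c, d). if a = b \<otimes>\<^bsub>G\<^esub> c \<otimes>\<^bsub>G\<^esub> inv\<^bsub>G\<^esub> b then basis_vec (a, b \<otimes>\<^bsub>G\<^esub> d) else (\<lambda>_. 0))
     (\<lambda>(a, b). if a \<in> carrier G \<and> b = \<one>\<^bsub>G\<^esub> then 1 else 0)"

definition trivial_double_module ::
    "('g, 'c) monoid_scheme \<Rightarrow> ('g \<times> 'g \<Rightarrow> 'k::field, 'k) module" where
  "trivial_double_module G = character_module (\<lambda>(a, b). if a = \<one>\<^bsub>G\<^esub> then 1 else 0)"

definition commutator :: "('g, 'c) monoid_scheme \<Rightarrow> 'g \<Rightarrow> 'g \<Rightarrow> 'g" where
  "commutator G a b = a \<otimes>\<^bsub>G\<^esub> b \<otimes>\<^bsub>G\<^esub> inv\<^bsub>G\<^esub> a \<otimes>\<^bsub>G\<^esub> inv\<^bsub>G\<^esub> b"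

text \<open>
  Action of \<open>\<delta>\<^sub>h \<otimes> k = (\<delta>\<^sub>h \<otimes> e)(\<epsilon> \<otimes> k)\<close> on the basis vector \<open>u(a, b)\<close> of
  the dual \<open>L\<close> of the double: first conjugate by \<open>k\<close>, then project onto the component of
  degree \<open>h\<close>.
\<close>

definition dual_act ::
    "('g, 'c) monoid_scheme \<Rightarrow> 'g \<times> 'g \<Rightarrow> 'g \<times> 'g \<Rightarrow> 'g \<times> 'g \<Rightarrow> 'k::field" where
  "dual_act G = (\<lambda>(h, k) (a, b).
     let a' = k \<otimes>\<^bsub>G\<^esub> a \<otimes>\<^bsub>G\<^esub> inv\<^bsub>G\<^esub> k; b' = k \<otimes>\<^bsub>G\<^esub> b \<otimes>\<^bsub>G\<^esub> inv\<^bsub>G\<^esub> k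
     in if h = commutator G (inv\<^bsub>G\<^esub> b') a' then basis_vec (a', b') else (\<lambda>_. 0))"

text \<open>
  The list \<open>[(a\<^sub>1, b\<^sub>1), \<dots>, (a\<^sub>n, b\<^sub>n)]\<close> stands for
  \<open>u(a\<^sub>1, b\<^sub>1) \<otimes> \<dots> \<otimes> u(a\<^sub>n, b\<^sub>n)\<close>. The action on the tensor power is
  given by the counit on the empty tensor, and by the coproduct of
  \<open>\<delta>\<^sub>h \<otimes> k\<close>, the sum over \<open>c\<close> of
  \<open>(\<delta>\<^sub>c \<otimes> k) \<otimes> (\<delta>\<^sub>d \<otimes> k)\<close> with \<open>d = h c\<^sup>-\<^sup>1\<close>,
  acting on the first factor and on the tensor product of the remaining ones.
\<close>

primrec dual_power_act ::
    "('g, 'c) monoid_scheme \<Rightarrow> 'g \<times> 'g \<Rightarrow> ('g \<times> 'g) list \<Rightarrow> ('g \<times> 'g) list \<Rightarrow> 'k::field" where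
  "dual_power_act G hk [] = (if fst hk = \<one>\<^bsub>G\<^esub> then basis_vec [] else (\<lambda>_. 0))"
| "dual_power_act G hk (u # us) = (\<lambda>ws. case ws of [] \<Rightarrow> 0
     | w # ws' \<Rightarrow> \<Sum>c\<in>carrier G. dual_act G (c, snd hk) u w *
         dual_power_act G (fst hk \<otimes>\<^bsub>G\<^esub> inv\<^bsub>G\<^esub> c, snd hk) us ws')"

definition dual_power ::
    "('g, 'c) monoid_scheme \<Rightarrow> nat \<Rightarrow> ('g \<times> 'g \<Rightarrow> 'k::field, ('g \<times> 'g) list \<Rightarrow> 'k) module" where
  "dual_power G g =
     based_module {us. length us = g \<and> set us \<subseteq> carrier G \<times> carrier G} (dual_power_act G)"

text \<open>
  The maps obtained by applying \<open>T\<close>, \<open>S\<close> in the tensor factor \<open>i\<close>, and \<open>N\<close> in the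
  factors \<open>l\<close> and \<open>l + 1\<close>. Factors are counted from \<open>0\<close>.
\<close>

definition T_at :: "('g, 'c) monoid_scheme \<Rightarrow> nat
    \<Rightarrow> (('g \<times> 'g) list \<Rightarrow> 'k::field) \<Rightarrow> ('g \<times> 'g) list \<Rightarrow> 'k" where
  "T_at G i = lin_ext (\<lambda>us. case us ! i of (c, d) \<Rightarrow> basis_vec (us[i := (c, c \<otimes>\<^bsub>G\<^esub> d)]))"

definition S_at :: "('g, 'c) monoid_scheme \<Rightarrow> nat
    \<Rightarrow> (('g \<times> 'g) list \<Rightarrow> 'k::field) \<Rightarrow> ('g \<times> 'g) list \<Rightarrow> 'k" where
  "S_at G i = lin_ext (\<lambda>us. case us ! i of (c, d) \<Rightarrow>
     basis_vec (us[i := (d, inv\<^bsub>G\<^esub> d \<otimes>\<^bsub>G\<^esub> inv\<^bsub>G\<^esub> c \<otimes>\<^bsub>G\<^esub> d)]))"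

definition N_at :: "('g, 'c) monoid_scheme \<Rightarrow> nat
    \<Rightarrow> (('g \<times> 'g) list \<Rightarrow> 'k::field) \<Rightarrow> ('g \<times> 'g) list \<Rightarrow> 'k" where
  "N_at G l = lin_ext (\<lambda>us. case (us ! l, us ! Suc l) of ((c, d), (c', d')) \<Rightarrow>
     let n = inv\<^bsub>G\<^esub> c' \<otimes>\<^bsub>G\<^esub> inv\<^bsub>G\<^esub> d \<otimes>\<^bsub>G\<^esub> c \<otimes>\<^bsub>G\<^esub> d
     in basis_vec (us[l := (c, d \<otimes>\<^bsub>G\<^esub> n),
                      Suc l := (inv\<^bsub>G\<^esub> n \<otimes>\<^bsub>G\<^esub> c' \<otimes>\<^bsub>G\<^esub> n, inv\<^bsub>G\<^esub> n \<otimes>\<^bsub>G\<^esub> d')]))"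


section \<open>Closed oriented surfaces and their mapping class groups\<close>

primrec Ck_on ::
    "nat \<Rightarrow> 'a::real_normed_vector set \<Rightarrow> ('a \<Rightarrow> 'b::real_normed_vector) \<Rightarrow> bool" where
  "Ck_on 0 U f \<longleftrightarrow> continuous_on U f"
| "Ck_on (Suc k) U f \<longleftrightarrow> (\<forall>x\<in>U. f differentiable (at x)) \<and>
     (\<forall>v. Ck_on k U (\<lambda>x. frechet_derivative f (at x) v))"

text \<open>On a set that is not open, smoothness means local extendability to smooth functions on
  open sets.\<close>

definition smooth_on ::
    "'a::real_normed_vector set \<Rightarrow> ('a \<Rightarrow> 'b::real_normed_vector) \<Rightarrow> bool" where
  "smooth_on D f \<longleftrightarrow> (\<forall>x\<in>D. \<exists>U F. open U \<and> x \<in> U \<and> (\<forall>k. Ck_on k U F) \<and> (\<forall>y\<in>U \<inter> D. F y = f y))"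

text \<open>A chart \<open>(U, \<phi>)\<close> consists of a coordinate domain \<open>U\<close> and the coordinates \<open>\<phi>\<close> on \<open>U\<close>.\<close>

type_synonym 'a chart = "'a set \<times> ('a \<Rightarrow> real^2)"

definition coord_dom :: "'a chart \<Rightarrow> 'a chart \<Rightarrow> ('a \<Rightarrow> 'a) \<Rightarrow> (real^2) set" where
  "coord_dom c c' f = {p \<in> snd c ` fst c. f (inv_into (fst c) (snd c) p) \<in> fst c'}"

definition coord_map :: "'a chart \<Rightarrow> 'a chart \<Rightarrow> ('a \<Rightarrow> 'a) \<Rightarrow> real^2 \<Rightarrow> real^2" where
  "coord_map c c' f = (\<lambda>p. snd c' (f (inv_into (fst c) (snd c) p)))"

definition smooth_in_charts :: "'a chart set \<Rightarrow> ('a \<Rightarrow> 'a) \<Rightarrow> bool" where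
  "smooth_in_charts \<A> f \<longleftrightarrow> (\<forall>c\<in>\<A>. \<forall>c'\<in>\<A>. smooth_on (coord_dom c c' f) (coord_map c c' f))"

definition orientation_preserving :: "'a chart set \<Rightarrow> ('a \<Rightarrow> 'a) \<Rightarrow> bool" where
  "orientation_preserving \<A> f \<longleftrightarrow> (\<forall>c\<in>\<A>. \<forall>c'\<in>\<A>. \<forall>p\<in>coord_dom c c' f.
     det (matrix (frechet_derivative (coord_map c c' f) (at p))) > 0)"

text \<open>The last two conditions of the following definition concern the transition maps, which are
  the coordinate expressions of the identity.\<close>

definition closed_oriented_surface :: "'a::t2_space set \<Rightarrow> 'a chart set \<Rightarrow> bool" where
  "closed_oriented_surface S \<A> \<longleftrightarrow>
     compact S \<and> connected S \<and> S \<noteq> {} \<and> S = (\<Union>c\<in>\<A>. fst c) \<and>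
     (\<forall>(U, \<phi>)\<in>\<A>. openin (top_of_set S) U \<and> open (\<phi> ` U) \<and>
        homeomorphism U (\<phi> ` U) \<phi> (inv_into U \<phi>)) \<and>
     smooth_in_charts \<A> (\<lambda>y. y) \<and> orientation_preserving \<A> (\<lambda>y. y)"

definition diffeo_group :: "'a::t2_space set \<Rightarrow> 'a chart set \<Rightarrow> ('a \<Rightarrow> 'a) monoid" where
  "diffeo_group S \<A> = BijGroup S\<lparr>carrier := {f \<in> Bij S.
     continuous_on S f \<and> smooth_in_charts \<A> f \<and>
     continuous_on S (inv_into S f) \<and> smooth_in_charts \<A> (inv_into S f) \<and>
     orientation_preserving \<A> f}\<rparr>"

definition isotopic ::
    "'a::t2_space set \<Rightarrow> 'a chart set \<Rightarrow> ('a \<Rightarrow> 'a) \<Rightarrow> ('a \<Rightarrow> 'a) \<Rightarrow> bool" where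
  "isotopic S \<A> f f' \<longleftrightarrow> (\<exists>H :: real \<times> 'a \<Rightarrow> 'a.
     continuous_on ({0..1} \<times> S) H \<and>
     (\<forall>c\<in>\<A>. \<forall>c'\<in>\<A>. smooth_on
        {(t, p). t \<in> {0..1} \<and> p \<in> coord_dom c c' (\<lambda>y. H (t, y))}
        (\<lambda>(t, p). coord_map c c' (\<lambda>y. H (t, y)) p)) \<and>
     (\<forall>t\<in>{0..1}. (\<lambda>y\<in>S. H (t, y)) \<in> carrier (diffeo_group S \<A>)) \<and>
     (\<forall>y\<in>S. H (0, y) = f y \<and> H (1, y) = f' y))"

definition diffeos_isotopic_to_id :: "'a::t2_space set \<Rightarrow> 'a chart set \<Rightarrow> ('a \<Rightarrow> 'a) set" where
  "diffeos_isotopic_to_id S \<A> = {f \<in> carrier (diffeo_group S \<A>). isotopic S \<A> \<one>\<^bsub>diffeo_group S \<A>\<^esub> f}"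

text \<open>Two diffeomorphisms are isotopic iff they lie in the same coset of the normal subgroup of
  diffeomorphisms isotopic to the identity.\<close>

definition mapping_class_group ::
    "'a::t2_space set \<Rightarrow> 'a chart set \<Rightarrow> ('a \<Rightarrow> 'a) set monoid" where
  "mapping_class_group S \<A> = diffeo_group S \<A> Mod diffeos_isotopic_to_id S \<A>"

definition mapping_class ::
    "'a::t2_space set \<Rightarrow> 'a chart set \<Rightarrow> ('a \<Rightarrow> 'a) \<Rightarrow> ('a \<Rightarrow> 'a) set" where
  "mapping_class S \<A> \<psi> = diffeos_isotopic_to_id S \<A> #>\<^bsub>diffeo_group S \<A>\<^esub> \<psi>"

text \<open>The elements of the mapping class group of the surface with base point \<open>x\<close> are represented
  by the diffeomorphisms fixing \<open>x\<close>; \<open>mapping_class S \<A> \<psi>\<close> is the image under the map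
  forgetting \<open>x\<close> of the class represented by \<open>\<psi>\<close>.\<close>

definition pointed_diffeos :: "'a::t2_space set \<Rightarrow> 'a chart set \<Rightarrow> 'a \<Rightarrow> ('a \<Rightarrow> 'a) set" where
  "pointed_diffeos S \<A> x = {\<psi> \<in> carrier (diffeo_group S \<A>). \<psi> x = x}"


section \<open>The fundamental group of a surface of genus \<open>g\<close>\<close>

definition loops_at :: "'a::topological_space set \<Rightarrow> 'a \<Rightarrow> (real \<Rightarrow> 'a) set" where
  "loops_at S x = {p. path p \<and> path_image p \<subseteq> S \<and> pathstart p = x \<and> pathfinish p = x}"

definition path_class :: "'a::topological_space set \<Rightarrow> (real \<Rightarrow> 'a) \<Rightarrow> (real \<Rightarrow> 'a) set" where
  "path_class S p = {q. homotopic_paths S p q}"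

text \<open>In the product of two classes the path on the left is traversed first.\<close>

definition fundamental_group ::
    "'a::topological_space set \<Rightarrow> 'a \<Rightarrow> (real \<Rightarrow> 'a) set monoid" where
  "fundamental_group S x =
    \<lparr>carrier = path_class S ` loops_at S x,
     mult = (\<lambda>X Y. \<Union>p\<in>X. \<Union>q\<in>Y. path_class S (p +++ q)),
     one = path_class S (\<lambda>_. x)\<rparr>"

definition pi1_map ::
    "'a::topological_space set \<Rightarrow> ('a \<Rightarrow> 'a) \<Rightarrow> (real \<Rightarrow> 'a) set \<Rightarrow> (real \<Rightarrow> 'a) set" where
  "pi1_map S \<psi> X = (\<Union>p\<in>X. path_class S (\<psi> \<circ> p))"

datatype surface_gen = Alpha nat | Beta nat

primrec gen_index :: "surface_gen \<Rightarrow> nat" where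
  "gen_index (Alpha i) = i"
| "gen_index (Beta i) = i"

text \<open>Words in the generators and their inverses; the letter \<open>(s, False)\<close> is the inverse of
  \<open>(s, True)\<close>.\<close>

type_synonym surface_word = "(surface_gen \<times> bool) list"

definition surface_words :: "nat \<Rightarrow> surface_word set" where
  "surface_words g = {w. \<forall>l\<in>set w. gen_index (fst l) < g}"

definition surface_relator :: "nat \<Rightarrow> surface_word" where
  "surface_relator g = concat (map (\<lambda>i.
     [(Alpha i, True), (Beta i, True), (Alpha i, False), (Beta i, False)]) [0..<g])"

inductive word_equiv :: "nat \<Rightarrow> surface_word \<Rightarrow> surface_word \<Rightarrow> bool" for g where
  refl: "word_equiv g w w"
| sym: "word_equiv g v w \<Longrightarrow> word_equiv g w v"
| trans: "word_equiv g u v \<Longrightarrow> word_equiv g v w \<Longrightarrow> word_equiv g u w"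
| cancel: "gen_index s < g \<Longrightarrow> word_equiv g (v @ [(s, b), (s, \<not> b)] @ w) (v @ w)"
| relation: "word_equiv g (v @ surface_relator g @ w) (v @ w)"

primrec gen_value :: "(nat \<Rightarrow> 'h) \<Rightarrow> (nat \<Rightarrow> 'h) \<Rightarrow> surface_gen \<Rightarrow> 'h" where
  "gen_value A B (Alpha i) = A i"
| "gen_value A B (Beta i) = B i"

definition word_value ::
    "('h, 'c) monoid_scheme \<Rightarrow> (nat \<Rightarrow> 'h) \<Rightarrow> (nat \<Rightarrow> 'h) \<Rightarrow> surface_word \<Rightarrow> 'h" where
  "word_value P A B w = foldr (\<lambda>(s, b) y.
     (if b then gen_value A B s else inv\<^bsub>P\<^esub> gen_value A B s) \<otimes>\<^bsub>P\<^esub> y) w \<one>\<^bsub>P\<^esub>"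

definition surface_presentation ::
    "('h, 'c) monoid_scheme \<Rightarrow> nat \<Rightarrow> (nat \<Rightarrow> 'h) \<Rightarrow> (nat \<Rightarrow> 'h) \<Rightarrow> bool" where
  "surface_presentation P g A B \<longleftrightarrow>
     carrier P = word_value P A B ` surface_words g \<and>
     (\<forall>w\<in>surface_words g. word_value P A B w = \<one>\<^bsub>P\<^esub> \<longleftrightarrow> word_equiv g w [])"

text \<open>A closed oriented surface of genus \<open>g\<close> with base point \<open>x\<close> and loops
  \<open>\<alpha> i\<close>, \<open>\<beta> i\<close> for \<open>i < g\<close> that generate the fundamental group subject only to the
  standard relation. The existence of such a presentation forces the genus to be \<open>g\<close>.\<close>

definition genus_surface ::
    "nat \<Rightarrow> 'a::t2_space set \<Rightarrow> 'a chart set \<Rightarrow> 'a \<Rightarrow> (nat \<Rightarrow> real \<Rightarrow> 'a) \<Rightarrow> (nat \<Rightarrow> real \<Rightarrow> 'a) \<Rightarrow> bool"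
  where
  "genus_surface g S \<A> x \<alpha> \<beta> \<longleftrightarrow>
     closed_oriented_surface S \<A> \<and> x \<in> S \<and>
     (\<forall>i<g. \<alpha> i \<in> loops_at S x \<and> \<beta> i \<in> loops_at S x) \<and>
     surface_presentation (fundamental_group S x) g
       (\<lambda>i. path_class S (\<alpha> i)) (\<lambda>i. path_class S (\<beta> i))"

text \<open>The automorphism \<open>F\<close> maps the generators \<open>A i\<close>, \<open>B i\<close> to \<open>A' i\<close>, \<open>B' i\<close>.\<close>

definition acts_on_gens ::
    "nat \<Rightarrow> ('h \<Rightarrow> 'h) \<Rightarrow> (nat \<Rightarrow> 'h) \<Rightarrow> (nat \<Rightarrow> 'h) \<Rightarrow> (nat \<Rightarrow> 'h) \<Rightarrow> (nat \<Rightarrow> 'h) \<Rightarrow> bool" where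
  "acts_on_gens g F A B A' B' \<longleftrightarrow> (\<forall>i<g. F (A i) = A' i \<and> F (B i) = B' i)"

definition acts_as_t ::
    "('h, 'c) monoid_scheme \<Rightarrow> nat \<Rightarrow> (nat \<Rightarrow> 'h) \<Rightarrow> (nat \<Rightarrow> 'h) \<Rightarrow> nat \<Rightarrow> ('h \<Rightarrow> 'h) \<Rightarrow> bool" where
  "acts_as_t P g A B i F \<longleftrightarrow> acts_on_gens g F A B A (B(i := B i \<otimes>\<^bsub>P\<^esub> A i))"

definition acts_as_s ::
    "('h, 'c) monoid_scheme \<Rightarrow> nat \<Rightarrow> (nat \<Rightarrow> 'h) \<Rightarrow> (nat \<Rightarrow> 'h) \<Rightarrow> nat \<Rightarrow> ('h \<Rightarrow> 'h) \<Rightarrow> bool" where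
  "acts_as_s P g A B i F \<longleftrightarrow> acts_on_gens g F A B
     (A(i := A i \<otimes>\<^bsub>P\<^esub> B i \<otimes>\<^bsub>P\<^esub> inv\<^bsub>P\<^esub> A i)) (B(i := inv\<^bsub>P\<^esub> A i))"

definition acts_as_n ::
    "('h, 'c) monoid_scheme \<Rightarrow> nat \<Rightarrow> (nat \<Rightarrow> 'h) \<Rightarrow> (nat \<Rightarrow> 'h) \<Rightarrow> nat \<Rightarrow> ('h \<Rightarrow> 'h) \<Rightarrow> bool" where
  "acts_as_n P g A B l F \<longleftrightarrow>
     (let \<mu> = inv\<^bsub>P\<^esub> A (Suc l) \<otimes>\<^bsub>P\<^esub> B l \<otimes>\<^bsub>P\<^esub> A l \<otimes>\<^bsub>P\<^esub> inv\<^bsub>P\<^esub> B l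
      in acts_on_gens g F A B
        (A(Suc l := \<mu> \<otimes>\<^bsub>P\<^esub> A (Suc l) \<otimes>\<^bsub>P\<^esub> inv\<^bsub>P\<^esub> \<mu>))
        (B(l := \<mu> \<otimes>\<^bsub>P\<^esub> B l, Suc l := B (Suc l) \<otimes>\<^bsub>P\<^esub> inv\<^bsub>P\<^esub> \<mu>)))"


section \<open>The linearized representation variety\<close>

definition rep_variety ::
    "'a::topological_space set \<Rightarrow> 'a \<Rightarrow> ('g, 'c) monoid_scheme \<Rightarrow> ((real \<Rightarrow> 'a) set \<Rightarrow> 'g) set" where
  "rep_variety S x G =
     hom (fundamental_group S x) G \<inter> extensional (carrier (fundamental_group S x))"

definition rep_conj ::
    "'a::topological_space set \<Rightarrow> 'a \<Rightarrow> ('g, 'c) monoid_scheme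
      \<Rightarrow> 'g \<Rightarrow> ((real \<Rightarrow> 'a) set \<Rightarrow> 'g) \<Rightarrow> (real \<Rightarrow> 'a) set \<Rightarrow> 'g" where
  "rep_conj S x G a f =
     (\<lambda>X\<in>carrier (fundamental_group S x). a \<otimes>\<^bsub>G\<^esub> f X \<otimes>\<^bsub>G\<^esub> inv\<^bsub>G\<^esub> a)"

definition rep_diffeo ::
    "'a::topological_space set \<Rightarrow> 'a \<Rightarrow> ('a \<Rightarrow> 'a)
      \<Rightarrow> ((real \<Rightarrow> 'a) set \<Rightarrow> 'g) \<Rightarrow> (real \<Rightarrow> 'a) set \<Rightarrow> 'g" where
  "rep_diffeo S x \<psi> f =
     (\<lambda>X\<in>carrier (fundamental_group S x). f (pi1_map S (inv_into S \<psi>) X))"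

definition rep_module ::
    "'a::topological_space set \<Rightarrow> 'a \<Rightarrow> ('g, 'c) monoid_scheme
      \<Rightarrow> ('g \<Rightarrow> 'k::field, ((real \<Rightarrow> 'a) set \<Rightarrow> 'g) \<Rightarrow> 'k) module" where
  "rep_module S x G =
     based_module (rep_variety S x G) (\<lambda>a f. basis_vec (rep_conj S x G a f))"

definition rep_module_diffeo ::
    "'a::topological_space set \<Rightarrow> 'a \<Rightarrow> ('a \<Rightarrow> 'a)
      \<Rightarrow> (((real \<Rightarrow> 'a) set \<Rightarrow> 'g) \<Rightarrow> 'k::field) \<Rightarrow> ((real \<Rightarrow> 'a) set \<Rightarrow> 'g) \<Rightarrow> 'k" where
  "rep_module_diffeo S x \<psi> = lin_ext (\<lambda>f. basis_vec (rep_diffeo S x \<psi> f))"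


section \<open>Actions of the mapping class group\<close>

definition linear_iso ::
    "('k, 'v) module \<Rightarrow> ('k, 'w) module \<Rightarrow> ('v \<Rightarrow> 'w) \<Rightarrow> bool" where
  "linear_iso V W \<phi> \<longleftrightarrow> bij_betw \<phi> (carrier V) (carrier W) \<and>
     (\<forall>v\<in>carrier V. \<forall>w\<in>carrier V. \<phi> (v \<oplus>\<^bsub>V\<^esub> w) = \<phi> v \<oplus>\<^bsub>W\<^esub> \<phi> w) \<and>
     (\<forall>c. \<forall>v\<in>carrier V. \<phi> (c \<odot>\<^bsub>V\<^esub> v) = c \<odot>\<^bsub>W\<^esub> \<phi> v)"

definition linear_action ::
    "('h, 'c) monoid_scheme \<Rightarrow> ('k, 'v) module \<Rightarrow> ('h \<Rightarrow> 'v \<Rightarrow> 'v) \<Rightarrow> bool" where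
  "linear_action \<Gamma> V \<rho> \<longleftrightarrow>
     (\<forall>X\<in>carrier \<Gamma>. linear_iso V V (\<rho> X)) \<and>
     (\<forall>v\<in>carrier V. \<rho> \<one>\<^bsub>\<Gamma>\<^esub> v = v) \<and>
     (\<forall>X\<in>carrier \<Gamma>. \<forall>Y\<in>carrier \<Gamma>. \<forall>v\<in>carrier V. \<rho> (X \<otimes>\<^bsub>\<Gamma>\<^esub> Y) v = \<rho> X (\<rho> Y v))"

definition equivariant_iso ::
    "('h, 'c) monoid_scheme \<Rightarrow> ('k, 'v) module \<Rightarrow> ('h \<Rightarrow> 'v \<Rightarrow> 'v)
      \<Rightarrow> ('k, 'w) module \<Rightarrow> ('h \<Rightarrow> 'w \<Rightarrow> 'w) \<Rightarrow> ('v \<Rightarrow> 'w) \<Rightarrow> bool" where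
  "equivariant_iso \<Gamma> V \<rho> W \<sigma> \<phi> \<longleftrightarrow> linear_iso V W \<phi> \<and>
     (\<forall>X\<in>carrier \<Gamma>. \<forall>v\<in>carrier V. \<phi> (\<rho> X v) = \<sigma> X (\<phi> v))"

text \<open>
  \<open>block_action\<close>: an action of the mapping class group on \<open>Ext\<^sup>m(K, L\<^sup>g)\<close> in which the
  images of the generators \<open>t\<close>, \<open>s\<close>, \<open>n\<close>, recognized by their (faithful) action on the
  fundamental group, act by the induced maps of \<open>T\<close>, \<open>S\<close>, \<open>N\<close>. As these elements generate
  the mapping class group, there is at most one such action.
\<close>

definition block_action ::
    "('g, 'c) monoid_scheme \<Rightarrow> nat \<Rightarrow> 'a::t2_space set \<Rightarrow> 'a chart set \<Rightarrow> 'a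
      \<Rightarrow> (nat \<Rightarrow> real \<Rightarrow> 'a) \<Rightarrow> (nat \<Rightarrow> real \<Rightarrow> 'a)
      \<Rightarrow> (nat \<Rightarrow> ('g \<times> 'g \<Rightarrow> 'k::field, 'p) module) \<Rightarrow> (nat \<Rightarrow> 'p \<Rightarrow> 'p) \<Rightarrow> nat
      \<Rightarrow> (('a \<Rightarrow> 'a) set \<Rightarrow> ('p \<Rightarrow> ('g \<times> 'g) list \<Rightarrow> 'k) set \<Rightarrow> ('p \<Rightarrow> ('g \<times> 'g) list \<Rightarrow> 'k) set)
      \<Rightarrow> bool" where
  "block_action G g S \<A> x \<alpha> \<beta> P d m \<rho> \<longleftrightarrow>
     (let D = drinfeld_double G; L = dual_power G g;
          V = Ext D P d L m; E = Ext_map D P d L m;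
          H = fundamental_group S x;
          A = (\<lambda>i. path_class S (\<alpha> i)); B = (\<lambda>i. path_class S (\<beta> i))
      in linear_action (mapping_class_group S \<A>) V \<rho> \<and>
         (\<forall>\<psi>\<in>pointed_diffeos S \<A> x. \<forall>v\<in>carrier V.
            (\<forall>i<g. acts_as_t H g A B i (pi1_map S \<psi>) \<longrightarrow>
               \<rho> (mapping_class S \<A> \<psi>) v = E (T_at G i) v) \<and>
            (\<forall>i<g. acts_as_s H g A B i (pi1_map S \<psi>) \<longrightarrow>
               \<rho> (mapping_class S \<A> \<psi>) v = E (S_at G i) v) \<and>
            (\<forall>l. Suc l < g \<longrightarrow> acts_as_n H g A B l (pi1_map S \<psi>) \<longrightarrow>
               \<rho> (mapping_class S \<A> \<psi>) v = E (N_at G l) v)))"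

text \<open>
  \<open>cohomology_action\<close>: an action of the mapping class group on \<open>H\<^sup>m(G, K[Hom(\<pi>\<^sub>1, G)])\<close>
  from which the induced action of the mapping class group with base point is obtained by
  restriction along the (surjective) map forgetting the base point. By surjectivity there is at
  most one such action.
\<close>

definition cohomology_action ::
    "('g, 'c) monoid_scheme \<Rightarrow> 'a::t2_space set \<Rightarrow> 'a chart set \<Rightarrow> 'a
      \<Rightarrow> (nat \<Rightarrow> ('g \<Rightarrow> 'k::field, 'q) module) \<Rightarrow> (nat \<Rightarrow> 'q \<Rightarrow> 'q) \<Rightarrow> nat
      \<Rightarrow> (('a \<Rightarrow> 'a) set \<Rightarrow> ('q \<Rightarrow> ((real \<Rightarrow> 'a) set \<Rightarrow> 'g) \<Rightarrow> 'k) set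
             \<Rightarrow> ('q \<Rightarrow> ((real \<Rightarrow> 'a) set \<Rightarrow> 'g) \<Rightarrow> 'k) set)
      \<Rightarrow> bool" where
  "cohomology_action G S \<A> x Q d m \<sigma> \<longleftrightarrow>
     (let A = group_algebra G; M = rep_module S x G; W = Ext A Q d M m
      in linear_action (mapping_class_group S \<A>) W \<sigma> \<and>
         (\<forall>\<psi>\<in>pointed_diffeos S \<A> x. \<forall>w\<in>carrier W.
            \<sigma> (mapping_class S \<A> \<psi>) w = Ext_map A Q d M m (rep_module_diffeo S x \<psi>) w))"

end

theory Submission
  imports Defs
begin

text \<open>
  The basis vectors \<open>\<delta>\<^sub>1 \<otimes> b\<close> span a direct factor of the double that is isomorphic to the
  group algebra, and the trivial module is a module over this factor. Hence a projective resolution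
  over the group algebra is also one over the double, and only the component of degree \<open>1\<close> of
  \<open>L\<^sup>g\<close> contributes to the Ext groups. A basis vector of \<open>L\<^sup>g\<close> is a \<open>g\<close>-tuple of pairs
  \<open>(a\<^sub>i, b\<^sub>i)\<close>; with \<open>a\<^sub>i = f(\<alpha>\<^sub>i)\<close> and \<open>b\<^sub>i = f(\<beta>\<^sub>i)\<^sup>-\<^sup>1\<close> its degree is the inverse of
  the value of the surface relator, so that the component of degree \<open>1\<close> is \<open>K[Hom(\<pi>\<^sub>1, G)]\<close>,
  and the maps \<open>T\<close>, \<open>S\<close>, \<open>N\<close> become precomposition with the inverses of the generators.

  For the action of the mapping class group, a homeomorphism \<open>\<psi>\<close> together with a path from \<open>x\<close> to
  \<open>\<psi>(x)\<close> induces an automorphism of the fundamental group, and another path changes it by an inner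
  automorphism. Precomposition with conjugation by \<open>c\<close> is the twist \<open>f \<mapsto> f(c) \<cdot> f\<close> of the
  representation variety, and such a twist acts trivially on group cohomology. So every
  homeomorphism acts on \<open>H\<^sup>m(G, K[Hom(\<pi>\<^sub>1, G)])\<close>, those isotopic to the identity act trivially, and it
  is not necessary to move diffeomorphisms into ones that fix the base point.
\<close>

section \<open>Module homomorphisms\<close>

text \<open>The obstacle is that the twist is not translation by one group element: on degree h it
  translates by h, so homotopies s_h are needed for all h at once, subject to s_{ghg^-1}(g q) = g
  s_h(q). Such a family is one G-linear map into \<open>conj_maps\<close>, where G also acts on the
  index h by conjugation, so ordinary projectivity produces it. The inverse in b_i = f(\<beta>_i)^-1
  comes from the degree [b^-1, a] of u(a, b), which it turns into [f(\<beta>_i), f(\<alpha>_i)]. The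
  factors enter the degree in reversed order because the coproduct splits h as (h c^-1) c with c on
  the first factor; inverting the relator reverses it likewise. Independence of the connecting path
  is a twist only if the conjugator is a function of the pulled-back representation; writing the
  conjugating loop as the image of another loop achieves this. The predicate
  \<open>left_module\<close> contains the ring axioms, so those of the double and of the group
  algebra are read off from the given resolutions.\<close>

lemma mod_homI:
  assumes "f \<in> carrier M \<rightarrow>\<^sub>E carrier N"
    and "\<And>x y. \<lbrakk>x \<in> carrier M; y \<in> carrier M\<rbrakk> \<Longrightarrow> f (x \<oplus>\<^bsub>M\<^esub> y) = f x \<oplus>\<^bsub>N\<^esub> f y"
    and "\<And>a x. \<lbrakk>a \<in> carrier R; x \<in> carrier M\<rbrakk> \<Longrightarrow> f (a \<odot>\<^bsub>M\<^esub> x) = a \<odot>\<^bsub>N\<^esub> f x"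
  shows "f \<in> mod_hom R M N"
  using assms by (simp add: mod_hom_def)

lemma mod_hom_closed: "\<lbrakk>f \<in> mod_hom R M N; x \<in> carrier M\<rbrakk> \<Longrightarrow> f x \<in> carrier N"
  by (auto simp: mod_hom_def)

lemma mod_hom_PiE: "f \<in> mod_hom R M N \<Longrightarrow> f \<in> carrier M \<rightarrow>\<^sub>E carrier N"
  by (simp add: mod_hom_def)

lemma mod_hom_add:
  "\<lbrakk>f \<in> mod_hom R M N; x \<in> carrier M; y \<in> carrier M\<rbrakk> \<Longrightarrow> f (x \<oplus>\<^bsub>M\<^esub> y) = f x \<oplus>\<^bsub>N\<^esub> f y"
  by (simp add: mod_hom_def)

lemma mod_hom_smult:
  "\<lbrakk>f \<in> mod_hom R M N; a \<in> carrier R; x \<in> carrier M\<rbrakk> \<Longrightarrow> f (a \<odot>\<^bsub>M\<^esub> x) = a \<odot>\<^bsub>N\<^esub> f x"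
  by (simp add: mod_hom_def)

lemma left_module_abelian_group: "left_module R M \<Longrightarrow> abelian_group M"
  by (simp add: left_module_def)

lemma left_module_ring: "left_module R M \<Longrightarrow> ring R"
  by (simp add: left_module_def)

lemma mod_hom_abelian_group_hom:
  assumes "f \<in> mod_hom R M N" "abelian_group M" "abelian_group N"
  shows "abelian_group_hom M N f"
proof -
  interpret M: abelian_group M by fact
  interpret N: abelian_group N by fact
  show ?thesis
    using assms(1)
    by unfold_locales (auto simp: hom_def mod_hom_closed mod_hom_add)
qed

lemma mod_hom_zero:
  assumes "f \<in> mod_hom R M N" "abelian_group M" "abelian_group N"
  shows "f \<zero>\<^bsub>M\<^esub> = \<zero>\<^bsub>N\<^esub>"
  using abelian_group_hom.hom_zero[OF mod_hom_abelian_group_hom[OF assms]] .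

lemma mod_hom_minus:
  assumes "f \<in> mod_hom R M N" "abelian_group M" "abelian_group N" "x \<in> carrier M" "y \<in> carrier M"
  shows "f (x \<ominus>\<^bsub>M\<^esub> y) = f x \<ominus>\<^bsub>N\<^esub> f y"
proof -
  interpret abelian_group_hom M N f
    using mod_hom_abelian_group_hom[OF assms(1-3)] .
  show ?thesis using assms(4,5) by (simp add: a_minus_def)
qed

lemma mod_hom_finsum:
  assumes "f \<in> mod_hom R M N" "abelian_group M" "abelian_group N" "finite X" "c \<in> X \<rightarrow> carrier M"
  shows "f (finsum M c X) = finsum N (\<lambda>x. f (c x)) X"
proof -
  interpret h: abelian_group_hom M N f
    using mod_hom_abelian_group_hom[OF assms(1-3)] .
  show ?thesis using assms(4,5)
  proof (induction X rule: finite_induct)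
    case (insert x X)
    have "(\<lambda>x. f (c x)) \<in> X \<rightarrow> carrier N" "c \<in> X \<rightarrow> carrier M" "c x \<in> carrier M"
      using insert.prems h.hom_closed by (auto simp: Pi_iff)
    then show ?case using insert by simp
  qed simp
qed

lemma mod_hom_compose:
  assumes "f \<in> mod_hom R M N" "g \<in> mod_hom R N L" "left_module R M"
  shows "compose (carrier M) g f \<in> mod_hom R M L"
proof -
  interpret left_module R M by fact
  show ?thesis
    using assms by (intro mod_homI) (auto simp: compose_def mod_hom_closed mod_hom_add mod_hom_smult smult_closed)
qed

section \<open>Zero, negatives and finite sums under the scalar action\<close>

context left_module
begin

lemma smult_zero_right: "a \<in> carrier R \<Longrightarrow> a \<odot>\<^bsub>M\<^esub> \<zero>\<^bsub>M\<^esub> = \<zero>\<^bsub>M\<^esub>"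
  using smult_r_distr[of a "\<zero>\<^bsub>M\<^esub>" "\<zero>\<^bsub>M\<^esub>"] smult_closed[of a "\<zero>\<^bsub>M\<^esub>"]
  by (metis M.add.one_closed M.add.r_cancel_one' M.l_zero)

lemma smult_zero_left: "x \<in> carrier M \<Longrightarrow> \<zero> \<odot>\<^bsub>M\<^esub> x = \<zero>\<^bsub>M\<^esub>"
  using smult_l_distr[of \<zero> \<zero> x] smult_closed[of \<zero> x]
  by (metis M.add.r_cancel_one' R.l_zero R.zero_closed)

lemma smult_minus: "\<lbrakk>a \<in> carrier R; x \<in> carrier M\<rbrakk> \<Longrightarrow> a \<odot>\<^bsub>M\<^esub> (\<ominus>\<^bsub>M\<^esub> x) = \<ominus>\<^bsub>M\<^esub> (a \<odot>\<^bsub>M\<^esub> x)"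
  by (metis M.add.inv_closed M.l_neg M.minus_equality smult_closed smult_r_distr smult_zero_right)

lemma smult_diff:
  "\<lbrakk>a \<in> carrier R; x \<in> carrier M; y \<in> carrier M\<rbrakk>
    \<Longrightarrow> a \<odot>\<^bsub>M\<^esub> (x \<ominus>\<^bsub>M\<^esub> y) = a \<odot>\<^bsub>M\<^esub> x \<ominus>\<^bsub>M\<^esub> a \<odot>\<^bsub>M\<^esub> y"
  by (simp add: a_minus_def smult_r_distr smult_minus)

lemma smult_finsum:
  assumes "a \<in> carrier R" "finite X" "c \<in> X \<rightarrow> carrier M"
  shows "a \<odot>\<^bsub>M\<^esub> finsum M c X = finsum M (\<lambda>x. a \<odot>\<^bsub>M\<^esub> c x) X"
  using assms(2,3)
proof (induction X rule: finite_induct)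
  case (insert x X)
  have "(\<lambda>x. a \<odot>\<^bsub>M\<^esub> c x) \<in> X \<rightarrow> carrier M" "c \<in> X \<rightarrow> carrier M" "c x \<in> carrier M"
    using insert.prems assms(1) by (auto simp: smult_closed Pi_iff)
  then show ?case using insert assms(1) by (simp add: smult_closed smult_r_distr)
qed (simp add: smult_zero_right assms)

end

lemma (in abelian_group) minus_interchange:
  assumes "a \<in> carrier G" "b \<in> carrier G" "c \<in> carrier G" "d \<in> carrier G"
  shows "(a \<oplus> b) \<ominus> (c \<oplus> d) = (a \<ominus> c) \<oplus> (b \<ominus> d)"
  using assms by (simp add: a_minus_def minus_add a_ac)

lemma (in abelian_group) add_minus_cancel:
  assumes "a \<in> carrier G" "b \<in> carrier G"
  shows "(a \<ominus> b) \<oplus> b = a"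
  using assms by (simp add: a_minus_def a_assoc l_neg)

lemma (in abelian_group) minus_zero_iff:
  assumes "a \<in> carrier G" "b \<in> carrier G"
  shows "a \<ominus> b = \<zero> \<longleftrightarrow> a = b"
  using assms by (metis add_minus_cancel add.l_one a_minus_def r_neg)

lemma mod_hom_diff:
  assumes "f \<in> mod_hom R M N" "g \<in> mod_hom R M N" "left_module R M" "left_module R N"
  shows "(\<lambda>x\<in>carrier M. f x \<ominus>\<^bsub>N\<^esub> g x) \<in> mod_hom R M N"
proof -
  interpret M: left_module R M by fact
  interpret N: left_module R N by fact
  show ?thesis
    using assms(1,2)
    by (intro mod_homI)
      (auto simp: mod_hom_closed mod_hom_add mod_hom_smult M.smult_closed N.smult_diff N.minus_interchange)
qed

section \<open>Projective modules and null-homotopies\<close>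

text \<open>The splitting \<open>s\<close> gives every p coordinates, with p the sum of the s p x .
  x. Sending p to the sum of the s p x . c x, for arbitrary preimages c x of f x, is then a lift.
  Asking for an inclusion of images lets \<open>g\<close> be a differential of an exact complex,
  without forming its image as a module of its own.\<close>

lemma projective_lift:
  assumes proj: "projective_module R P" and A: "left_module R A" and B: "left_module R B"
    and g: "g \<in> mod_hom R A B" and f: "f \<in> mod_hom R P B"
    and im: "f ` carrier P \<subseteq> g ` carrier A"
  shows "\<exists>h\<in>mod_hom R P A. \<forall>p\<in>carrier P. g (h p) = f p"
proof -
  interpret P: left_module R P using proj by (simp add: projective_module_def)
  interpret A: left_module R A by fact
  interpret B: left_module R B by fact
  obtain s where s: "s \<in> mod_hom R P (free_module R (carrier P))"
    and sp: "\<And>p. p \<in> carrier P \<Longrightarrow>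
       finsum P (\<lambda>x. s p x \<odot>\<^bsub>P\<^esub> x) {x \<in> carrier P. s p x \<noteq> \<zero>\<^bsub>R\<^esub>} = p"
    using proj unfolding projective_module_def by blast
  define supp where "supp p = {x \<in> carrier P. s p x \<noteq> \<zero>\<^bsub>R\<^esub>}" for p
  have s_carr: "s p \<in> carrier (free_module R (carrier P))" if "p \<in> carrier P" for p
    using mod_hom_closed[OF s that] .
  have supp_fin: "finite (supp p)" if "p \<in> carrier P" for p
    using s_carr[OF that] by (simp add: free_module_def supp_def)
  have s_in: "s p x \<in> carrier R" if "p \<in> carrier P" "x \<in> carrier P" for p x
    using s_carr[OF that(1)] that by (auto simp: free_module_def)
  have s_add: "s (p \<oplus>\<^bsub>P\<^esub> q) x = s p x \<oplus>\<^bsub>R\<^esub> s q x" if "p \<in> carrier P" "q \<in> carrier P" "x \<in> carrier P" for p q x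
    using mod_hom_add[OF s that(1,2)] that(3) by (simp add: free_module_def)
  have s_smult: "s (a \<odot>\<^bsub>P\<^esub> p) x = a \<otimes>\<^bsub>R\<^esub> s p x" if "a \<in> carrier R" "p \<in> carrier P" "x \<in> carrier P" for a p x
    using mod_hom_smult[OF s that(1,2)] that(3) by (simp add: free_module_def)
  \<comment> \<open>Preimages are picked point by point without any linearity; the linearity of
    \<open>h\<close> comes from that of the coordinates.\<close>
  define c where "c x = (SOME a. a \<in> carrier A \<and> g a = f x)" for x
  have c: "c x \<in> carrier A" "g (c x) = f x" if "x \<in> carrier P" for x
  proof -
    have "f x \<in> g ` carrier A" using im that by blast
    then have "\<exists>a. a \<in> carrier A \<and> g a = f x" by (elim imageE) metis
    then have "c x \<in> carrier A \<and> g (c x) = f x" unfolding c_def by (rule someI_ex)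
    then show "c x \<in> carrier A" "g (c x) = f x" by auto
  qed
  define h where "h = (\<lambda>p\<in>carrier P. finsum A (\<lambda>x. s p x \<odot>\<^bsub>A\<^esub> c x) (supp p))"
  \<comment> \<open>The support of the coordinates moves with p, so sums are compared over a common
    finite set containing the supports involved.\<close>
  have h_eq: "h p = finsum A (\<lambda>x. s p x \<odot>\<^bsub>A\<^esub> c x) F"
    if "p \<in> carrier P" "finite F" "supp p \<subseteq> F" "F \<subseteq> carrier P" for p F
  proof -
    have "finsum A (\<lambda>x. s p x \<odot>\<^bsub>A\<^esub> c x) (supp p) = finsum A (\<lambda>x. s p x \<odot>\<^bsub>A\<^esub> c x) F"
    proof (rule A.add.finprod_mono_neutral_cong_left[OF that(2,3)])
      show "s p x \<odot>\<^bsub>A\<^esub> c x = \<zero>\<^bsub>A\<^esub>" if "x \<in> F - supp p" for x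
        using that \<open>F \<subseteq> carrier P\<close> c by (auto simp: supp_def A.smult_zero_left)
    qed (use that c s_in in \<open>auto simp: A.smult_closed\<close>)
    then show ?thesis using that by (simp add: h_def)
  qed
  have term_in: "(\<lambda>x. s p x \<odot>\<^bsub>A\<^esub> c x) \<in> F \<rightarrow> carrier A" if "p \<in> carrier P" "F \<subseteq> carrier P" for p F
    using that c s_in by (auto simp: A.smult_closed subset_iff)
  have "h \<in> mod_hom R P A"
  proof (rule mod_homI)
    show "h \<in> carrier P \<rightarrow>\<^sub>E carrier A"
      using term_in by (auto simp: h_def supp_def intro!: A.finsum_closed)
  next
    fix p q assume pq: "p \<in> carrier P" "q \<in> carrier P"
    let ?F = "supp p \<union> supp q"
    have F: "finite ?F" "?F \<subseteq> carrier P" using supp_fin pq by (auto simp: supp_def)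
    have sub: "supp (p \<oplus>\<^bsub>P\<^esub> q) \<subseteq> ?F"
      using pq by (auto simp: supp_def s_add)
    have "h (p \<oplus>\<^bsub>P\<^esub> q) = finsum A (\<lambda>x. s p x \<odot>\<^bsub>A\<^esub> c x \<oplus>\<^bsub>A\<^esub> s q x \<odot>\<^bsub>A\<^esub> c x) ?F"
      unfolding h_eq[OF P.add.m_closed[OF pq] F(1) sub F(2)]
      using pq F(2) c s_in by (intro A.finsum_cong') (auto simp: s_add A.smult_l_distr subset_iff A.smult_closed)
    also have "\<dots> = finsum A (\<lambda>x. s p x \<odot>\<^bsub>A\<^esub> c x) ?F \<oplus>\<^bsub>A\<^esub> finsum A (\<lambda>x. s q x \<odot>\<^bsub>A\<^esub> c x) ?F"
      by (intro A.finsum_addf term_in pq F)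
    also have "\<dots> = h p \<oplus>\<^bsub>A\<^esub> h q"
      using h_eq[of p ?F] h_eq[of q ?F] pq F by simp
    finally show "h (p \<oplus>\<^bsub>P\<^esub> q) = h p \<oplus>\<^bsub>A\<^esub> h q" .
  next
    fix a p assume ap: "a \<in> carrier R" "p \<in> carrier P"
    have F: "finite (supp p)" "supp p \<subseteq> carrier P" using supp_fin ap by (auto simp: supp_def)
    have sub: "supp (a \<odot>\<^bsub>P\<^esub> p) \<subseteq> supp p"
      using ap by (auto simp: supp_def s_smult)
    have "h (a \<odot>\<^bsub>P\<^esub> p) = finsum A (\<lambda>x. a \<odot>\<^bsub>A\<^esub> (s p x \<odot>\<^bsub>A\<^esub> c x)) (supp p)"
      unfolding h_eq[OF P.smult_closed[OF ap] F(1) sub F(2)]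
      using ap F(2) c s_in by (intro A.finsum_cong') (auto simp: s_smult A.smult_assoc subset_iff A.smult_closed)
    also have "\<dots> = a \<odot>\<^bsub>A\<^esub> finsum A (\<lambda>x. s p x \<odot>\<^bsub>A\<^esub> c x) (supp p)"
      using ap F term_in by (simp add: A.smult_finsum)
    finally show "h (a \<odot>\<^bsub>P\<^esub> p) = a \<odot>\<^bsub>A\<^esub> h p" using ap by (simp add: h_def)
  qed
  moreover have "g (h p) = f p" if p: "p \<in> carrier P" for p
  proof -
    have F: "finite (supp p)" "supp p \<subseteq> carrier P" using supp_fin p by (auto simp: supp_def)
    have "g (h p) = finsum B (\<lambda>x. g (s p x \<odot>\<^bsub>A\<^esub> c x)) (supp p)"
      using p mod_hom_finsum[OF g A.abelian_group_axioms B.abelian_group_axioms F(1) term_in[OF p F(2)]] by (simp add: h_def)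
    also have "\<dots> = finsum B (\<lambda>x. f (s p x \<odot>\<^bsub>P\<^esub> x)) (supp p)"
      using F(2) p c s_in
      by (intro B.finsum_cong')
        (auto simp: subset_iff mod_hom_smult[OF g] mod_hom_smult[OF f] mod_hom_closed[OF f] B.smult_closed)
    also have "\<dots> = f (finsum P (\<lambda>x. s p x \<odot>\<^bsub>P\<^esub> x) (supp p))"
      using p F s_in
      by (intro mod_hom_finsum[symmetric, OF f P.abelian_group_axioms B.abelian_group_axioms])
        (auto simp: subset_iff P.smult_closed)
    also have "\<dots> = f p" using sp[OF p] by (simp add: supp_def)
    finally show ?thesis .
  qed
  ultimately show ?thesis by blast
qed

text \<open>E (Suc n) - s n d is a cycle of C, because E is a chain map and s n already solves the
  previous equation; exactness makes it a boundary and projectivity of P lifts it. C is asked to be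
  exact in positive degrees, with \<open>E0\<close> in place of an augmentation, so the statement
  also serves for a complex that is no projective resolution.\<close>

lemma null_homotopy:
  assumes P: "\<And>n. projective_module R (P n)" and d: "\<And>n. d n \<in> mod_hom R (P (Suc n)) (P n)"
    and dd: "\<And>n p. p \<in> carrier (P (Suc (Suc n))) \<Longrightarrow> d n (d (Suc n) p) = \<zero>\<^bsub>P n\<^esub>"
    and C: "\<And>n. left_module R (C n)" and e: "\<And>n. e n \<in> mod_hom R (C (Suc n)) (C n)"
    and exact: "\<And>n y. \<lbrakk>y \<in> carrier (C (Suc n)); e n y = \<zero>\<^bsub>C n\<^esub>\<rbrakk> \<Longrightarrow> y \<in> e (Suc n) ` carrier (C (Suc (Suc n)))"
    and E: "\<And>n. E n \<in> mod_hom R (P n) (C n)"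
    and Ed: "\<And>n p. p \<in> carrier (P (Suc n)) \<Longrightarrow> e n (E (Suc n) p) = E n (d n p)"
    and E0: "E 0 ` carrier (P 0) \<subseteq> e 0 ` carrier (C (Suc 0))"
  shows "\<exists>s. (\<forall>n. s n \<in> mod_hom R (P n) (C (Suc n))) \<and> (\<forall>p\<in>carrier (P 0). E 0 p = e 0 (s 0 p)) \<and>
    (\<forall>n. \<forall>p\<in>carrier (P (Suc n)). E (Suc n) p = e (Suc n) (s (Suc n) p) \<oplus>\<^bsub>C (Suc n)\<^esub> s n (d n p))"
proof -
  have Pm: "left_module R (P n)" for n using P by (simp add: projective_module_def)
  \<comment> \<open>The last clause, that e s and E agree on boundaries, is what makes the next
    difference a cycle. \<open>J\<close> ties consecutive homotopies together, so the sequence comes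
    from dependent choice.\<close>
  define I where "I n s \<longleftrightarrow> s \<in> mod_hom R (P n) (C (Suc n)) \<and>
    (n = 0 \<longrightarrow> (\<forall>p\<in>carrier (P 0). E 0 p = e 0 (s p))) \<and>
    (\<forall>p\<in>carrier (P (Suc n)). e n (s (d n p)) = E n (d n p))" for n s
  define J where "J n s s' \<longleftrightarrow> (\<forall>p\<in>carrier (P (Suc n)).
    E (Suc n) p = e (Suc n) (s' p) \<oplus>\<^bsub>C (Suc n)\<^esub> s (d n p))" for n s s'
  have "\<exists>s. \<forall>n. I n (s n) \<and> J n (s n) (s (Suc n))"
  proof (rule dependent_nat_choice)
    obtain s where "s \<in> mod_hom R (P 0) (C (Suc 0))" "\<forall>p\<in>carrier (P 0). e 0 (s p) = E 0 p"
      using projective_lift[OF P C C e E E0] by blast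
    then show "\<exists>s. I 0 s" using mod_hom_closed[OF d] by (auto simp: I_def)
  next
    fix s n assume I: "I n s"
    then have s: "s \<in> mod_hom R (P n) (C (Suc n))" by (simp add: I_def)
    interpret Pn: left_module R "P n" by (rule Pm)
    interpret Cn: left_module R "C n" by (rule C)
    interpret Cn': left_module R "C (Suc n)" by (rule C)
    let ?r = "\<lambda>p\<in>carrier (P (Suc n)). E (Suc n) p \<ominus>\<^bsub>C (Suc n)\<^esub> compose (carrier (P (Suc n))) s (d n) p"
    have sd: "compose (carrier (P (Suc n))) s (d n) \<in> mod_hom R (P (Suc n)) (C (Suc n))"
      using mod_hom_compose[OF d s Pm] .
    have r: "?r \<in> mod_hom R (P (Suc n)) (C (Suc n))"
      by (rule mod_hom_diff[OF E sd Pm C])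
    have "?r ` carrier (P (Suc n)) \<subseteq> e (Suc n) ` carrier (C (Suc (Suc n)))"
    proof (rule image_subsetI)
      fix p assume p: "p \<in> carrier (P (Suc n))"
      have in1: "E (Suc n) p \<in> carrier (C (Suc n))" "s (d n p) \<in> carrier (C (Suc n))" "E n (d n p) \<in> carrier (C n)"
        using p mod_hom_closed[OF E] mod_hom_closed[OF s] mod_hom_closed[OF d] by auto
      have "e n (?r p) = e n (E (Suc n) p) \<ominus>\<^bsub>C n\<^esub> e n (s (d n p))"
        using p in1 by (simp add: compose_def mod_hom_minus[OF e Cn'.abelian_group_axioms Cn.abelian_group_axioms])
      also have "\<dots> = \<zero>\<^bsub>C n\<^esub>"
        using I p Ed[OF p] in1 by (simp add: I_def a_minus_def Cn.r_neg)
      finally show "?r p \<in> e (Suc n) ` carrier (C (Suc (Suc n)))"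
        using exact mod_hom_closed[OF r p] by blast
    qed
    then obtain t where t: "t \<in> mod_hom R (P (Suc n)) (C (Suc (Suc n)))"
      and te: "\<And>p. p \<in> carrier (P (Suc n)) \<Longrightarrow> e (Suc n) (t p) = ?r p"
      using projective_lift[OF P C C e r] by blast
    have J: "J n s t"
      unfolding J_def
    proof
      fix p assume p: "p \<in> carrier (P (Suc n))"
      have in1: "E (Suc n) p \<in> carrier (C (Suc n))" "s (d n p) \<in> carrier (C (Suc n))"
        using p mod_hom_closed[OF E] mod_hom_closed[OF s] mod_hom_closed[OF d] by auto
      show "E (Suc n) p = e (Suc n) (t p) \<oplus>\<^bsub>C (Suc n)\<^esub> s (d n p)"
        using te[OF p] p in1 by (simp add: compose_def Cn'.add_minus_cancel)
    qed
    have "e (Suc n) (t (d (Suc n) p)) = E (Suc n) (d (Suc n) p)" if p: "p \<in> carrier (P (Suc (Suc n)))" for p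
    proof -
      have dp: "d (Suc n) p \<in> carrier (P (Suc n))" using mod_hom_closed[OF d p] .
      \<comment> \<open>On boundaries the term s d vanishes, so the agreement on boundaries passes
        to the next degree.\<close>
      have "s (d n (d (Suc n) p)) = \<zero>\<^bsub>C (Suc n)\<^esub>"
        using dd[OF p] mod_hom_zero[OF s Pn.abelian_group_axioms Cn'.abelian_group_axioms] by simp
      then show ?thesis using J dp mod_hom_closed[OF e mod_hom_closed[OF t dp]]
        by (simp add: J_def)
    qed
    then have "I (Suc n) t" using t by (simp add: I_def)
    then show "\<exists>t. I (Suc n) t \<and> J n s t" using J by blast
  qed
  then obtain s where s: "\<And>n. I n (s n)" "\<And>n. J n (s n) (s (Suc n))" by blast
  have "s n \<in> mod_hom R (P n) (C (Suc n))" for n using s(1)[of n] by (simp add: I_def)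
  moreover have "E 0 p = e 0 (s 0 p)" if "p \<in> carrier (P 0)" for p
    using s(1)[of 0] that by (simp add: I_def)
  ultimately show ?thesis using s(2) unfolding J_def by (intro exI[of _ s]) blast
qed

text \<open>The comparison theorem: the augmentation of P is lifted through that of C; afterwards F
  d has values in the cycles of C, which are boundaries.\<close>

lemma chain_map_lift:
  assumes P: "projective_resolution R T P d \<epsilon>" and C: "projective_resolution R T C e \<eta>"
    and T: "left_module R T"
  shows "\<exists>F. (\<forall>n. F n \<in> mod_hom R (P n) (C n)) \<and> (\<forall>p\<in>carrier (P 0). \<eta> (F 0 p) = \<epsilon> p) \<and>
    (\<forall>n. \<forall>p\<in>carrier (P (Suc n)). e n (F (Suc n) p) = F n (d n p))"
proof -
  have Pp: "projective_module R (P n)" "left_module R (P n)" and d: "d n \<in> mod_hom R (P (Suc n)) (P n)"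
    and Cm: "left_module R (C n)" and e: "e n \<in> mod_hom R (C (Suc n)) (C n)" for n
    using P C by (auto simp: projective_resolution_def projective_module_def)
  have eps: "\<epsilon> \<in> mod_hom R (P 0) T" and eta: "\<eta> \<in> mod_hom R (C 0) T" and "\<eta> ` carrier (C 0) = carrier T"
    and ex0: "{y \<in> carrier (C 0). \<eta> y = \<zero>\<^bsub>T\<^esub>} = e 0 ` carrier (C 1)"
    and ex0P: "{p \<in> carrier (P 0). \<epsilon> p = \<zero>\<^bsub>T\<^esub>} = d 0 ` carrier (P 1)"
    and ex: "\<And>n. {y \<in> carrier (C (Suc n)). e n y = \<zero>\<^bsub>C n\<^esub>} = e (Suc n) ` carrier (C (Suc (Suc n)))"
    and exP: "\<And>n. {p \<in> carrier (P (Suc n)). d n p = \<zero>\<^bsub>P n\<^esub>} = d (Suc n) ` carrier (P (Suc (Suc n)))"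
    using P C by (auto simp: projective_resolution_def)
  \<comment> \<open>The last clause is the image condition for lifting the next component. It is
    part of the invariant because degree 0 gets it from the augmentation and higher degrees from the
    differential.\<close>
  define I where "I n F \<longleftrightarrow> F \<in> mod_hom R (P n) (C n) \<and>
    (n = 0 \<longrightarrow> (\<forall>p\<in>carrier (P 0). \<eta> (F p) = \<epsilon> p)) \<and>
    (\<forall>p\<in>carrier (P (Suc n)). F (d n p) \<in> e n ` carrier (C (Suc n)))" for n F
  define J where "J n F F' \<longleftrightarrow> (\<forall>p\<in>carrier (P (Suc n)). e n (F' p) = F (d n p))" for n F F'
  have "\<exists>F. \<forall>n. I n (F n) \<and> J n (F n) (F (Suc n))"
  proof (rule dependent_nat_choice)
    have "\<epsilon> ` carrier (P 0) \<subseteq> \<eta> ` carrier (C 0)"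
      using mod_hom_closed[OF eps] \<open>\<eta> ` carrier (C 0) = carrier T\<close> by auto
    then obtain F where F: "F \<in> mod_hom R (P 0) (C 0)" "\<forall>p\<in>carrier (P 0). \<eta> (F p) = \<epsilon> p"
      using projective_lift[OF Pp(1) Cm T eta eps] by blast
    have "F (d 0 p) \<in> e 0 ` carrier (C 1)" if "p \<in> carrier (P 1)" for p
    proof -
      have "d 0 p \<in> carrier (P 0)" "\<epsilon> (d 0 p) = \<zero>\<^bsub>T\<^esub>" using ex0P that by auto
      then have "F (d 0 p) \<in> {y \<in> carrier (C 0). \<eta> y = \<zero>\<^bsub>T\<^esub>}"
        using F mod_hom_closed[OF F(1)] by auto
      then show ?thesis using ex0 by simp
    qed
    then show "\<exists>F. I 0 F" using F by (auto simp: I_def)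
  next
    fix F n assume I: "I n F"
    then have F: "F \<in> mod_hom R (P n) (C n)" by (simp add: I_def)
    have Fd: "compose (carrier (P (Suc n))) F (d n) \<in> mod_hom R (P (Suc n)) (C n)"
      using mod_hom_compose[OF d F Pp(2)] .
    have "compose (carrier (P (Suc n))) F (d n) ` carrier (P (Suc n)) \<subseteq> e n ` carrier (C (Suc n))"
      using I by (auto simp: I_def compose_def)
    then obtain F' where F': "F' \<in> mod_hom R (P (Suc n)) (C (Suc n))"
      and eF: "\<And>p. p \<in> carrier (P (Suc n)) \<Longrightarrow> e n (F' p) = F (d n p)"
      using projective_lift[OF Pp(1) Cm Cm e Fd] by (auto simp: compose_def)
    have "F' (d (Suc n) p) \<in> e (Suc n) ` carrier (C (Suc (Suc n)))" if p: "p \<in> carrier (P (Suc (Suc n)))" for p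
    proof -
      have dp: "d (Suc n) p \<in> carrier (P (Suc n))" "d n (d (Suc n) p) = \<zero>\<^bsub>P n\<^esub>" using exP p by auto
      then have "F' (d (Suc n) p) \<in> {y \<in> carrier (C (Suc n)). e n y = \<zero>\<^bsub>C n\<^esub>}"
        using eF mod_hom_closed[OF F']
          mod_hom_zero[OF F left_module_abelian_group[OF Pp(2)] left_module_abelian_group[OF Cm]] by auto
      then show ?thesis using ex by simp
    qed
    then show "\<exists>F'. I (Suc n) F' \<and> J n F F'" using F' eF by (auto simp: I_def J_def)
  qed
  then obtain F where F: "\<And>n. I n (F n)" "\<And>n. J n (F n) (F (Suc n))" by blast
  have "F n \<in> mod_hom R (P n) (C n)" for n using F(1)[of n] by (simp add: I_def)
  moreover have "\<eta> (F 0 p) = \<epsilon> p" if "p \<in> carrier (P 0)" for p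
    using F(1)[of 0] that by (simp add: I_def)
  ultimately show ?thesis using F(2) unfolding J_def by (intro exI[of _ F]) blast
qed

text \<open>F - id is a chain map killed by the augmentation, so \<open>null_homotopy\<close>
  applies with P itself as the exact complex.\<close>

lemma chain_map_homotopic_id:
  assumes P: "projective_resolution R T P d \<epsilon>" and T: "left_module R T"
    and F: "\<And>n. F n \<in> mod_hom R (P n) (P n)"
    and Fd: "\<And>n p. p \<in> carrier (P (Suc n)) \<Longrightarrow> d n (F (Suc n) p) = F n (d n p)"
    and F0: "\<And>p. p \<in> carrier (P 0) \<Longrightarrow> \<epsilon> (F 0 p) = \<epsilon> p"
  shows "\<exists>s. (\<forall>n. s n \<in> mod_hom R (P n) (P (Suc n))) \<and>
    (\<forall>p\<in>carrier (P 0). F 0 p \<ominus>\<^bsub>P 0\<^esub> p = d 0 (s 0 p)) \<and>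
    (\<forall>n. \<forall>p\<in>carrier (P (Suc n)). F (Suc n) p \<ominus>\<^bsub>P (Suc n)\<^esub> p = d (Suc n) (s (Suc n) p) \<oplus>\<^bsub>P (Suc n)\<^esub> s n (d n p))"
proof -
  have Pp: "projective_module R (P n)" "left_module R (P n)" and d: "d n \<in> mod_hom R (P (Suc n)) (P n)" for n
    using P by (auto simp: projective_resolution_def projective_module_def)
  have eps: "\<epsilon> \<in> mod_hom R (P 0) T"
    and ex0: "{p \<in> carrier (P 0). \<epsilon> p = \<zero>\<^bsub>T\<^esub>} = d 0 ` carrier (P 1)"
    and ex: "\<And>n. {p \<in> carrier (P (Suc n)). d n p = \<zero>\<^bsub>P n\<^esub>} = d (Suc n) ` carrier (P (Suc (Suc n)))"
    using P by (auto simp: projective_resolution_def)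
  note ag = left_module_abelian_group[OF Pp(2)]
  have idh: "(\<lambda>p\<in>carrier (P n). p) \<in> mod_hom R (P n) (P n)" for n
  proof -
    interpret left_module R "P n" by (rule Pp)
    show ?thesis by (intro mod_homI) (auto simp: smult_closed)
  qed
  define E where "E n = (\<lambda>p\<in>carrier (P n). F n p \<ominus>\<^bsub>P n\<^esub> (\<lambda>p\<in>carrier (P n). p) p)" for n
  have E_eq: "E n p = F n p \<ominus>\<^bsub>P n\<^esub> p" if "p \<in> carrier (P n)" for n p using that by (simp add: E_def)
  have E: "E n \<in> mod_hom R (P n) (P n)" for n
    unfolding E_def by (rule mod_hom_diff[OF F idh Pp(2) Pp(2)])
  have dcl: "d n p \<in> carrier (P n)" if "p \<in> carrier (P (Suc n))" for n p using mod_hom_closed[OF d that] .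
  have Ed: "d n (E (Suc n) p) = E n (d n p)" if p: "p \<in> carrier (P (Suc n))" for n p
    using p mod_hom_closed[OF F p] by (simp add: E_eq mod_hom_minus[OF d ag ag] Fd dcl)
  have "E 0 ` carrier (P 0) \<subseteq> d 0 ` carrier (P (Suc 0))"
  proof (rule image_subsetI)
    fix p assume p: "p \<in> carrier (P 0)"
    interpret T: left_module R T by fact
    have "\<epsilon> (E 0 p) = \<zero>\<^bsub>T\<^esub>"
      using p mod_hom_closed[OF F p] F0[OF p] mod_hom_closed[OF eps p]
      by (simp add: E_eq mod_hom_minus[OF eps ag T.abelian_group_axioms] T.minus_zero_iff)
    then show "E 0 p \<in> d 0 ` carrier (P (Suc 0))" using ex0 mod_hom_closed[OF E p] by auto
  qed
  moreover have "d n (d (Suc n) p) = \<zero>\<^bsub>P n\<^esub>" if "p \<in> carrier (P (Suc (Suc n)))" for n p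
    using ex that by auto
  moreover have "y \<in> d (Suc n) ` carrier (P (Suc (Suc n)))" if "y \<in> carrier (P (Suc n))" "d n y = \<zero>\<^bsub>P n\<^esub>" for n y
    using ex that by auto
  ultimately have "\<exists>s. (\<forall>n. s n \<in> mod_hom R (P n) (P (Suc n))) \<and> (\<forall>p\<in>carrier (P 0). E 0 p = d 0 (s 0 p)) \<and>
    (\<forall>n. \<forall>p\<in>carrier (P (Suc n)). E (Suc n) p = d (Suc n) (s (Suc n) p) \<oplus>\<^bsub>P (Suc n)\<^esub> s n (d n p))"
    using Pp d E Ed by (intro null_homotopy) simp_all
  then show ?thesis by (simp add: E_eq)
qed

section \<open>Ext groups\<close>

lemma abelian_group_hom_space:
  fixes R :: "('b \<Rightarrow> 'k::field) ring"
  assumes M: "left_module R M" and N: "left_module R N"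
  shows "abelian_group (hom_space R M N)"
proof -
  interpret M: left_module R M by fact
  interpret N: left_module R N by fact
  show ?thesis
  proof (rule abelian_groupI)
    fix f g assume fg: "f \<in> carrier (hom_space R M N)" "g \<in> carrier (hom_space R M N)"
    then have fg': "f \<in> mod_hom R M N" "g \<in> mod_hom R M N" by (simp_all add: hom_space_def)
    show "f \<oplus>\<^bsub>hom_space R M N\<^esub> g \<in> carrier (hom_space R M N)"
      using fg' by (auto simp: hom_space_def mod_hom_add mod_hom_smult mod_hom_closed N.smult_r_distr
          M.smult_closed N.a_ac intro!: mod_homI)
    show "f \<oplus>\<^bsub>hom_space R M N\<^esub> g = g \<oplus>\<^bsub>hom_space R M N\<^esub> f"
      using fg' by (auto simp: hom_space_def mod_hom_closed N.a_comm intro!: restrict_ext)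
    fix h assume "h \<in> carrier (hom_space R M N)"
    then have "h \<in> mod_hom R M N" by (simp add: hom_space_def)
    then show "f \<oplus>\<^bsub>hom_space R M N\<^esub> g \<oplus>\<^bsub>hom_space R M N\<^esub> h = f \<oplus>\<^bsub>hom_space R M N\<^esub> (g \<oplus>\<^bsub>hom_space R M N\<^esub> h)"
      using fg' by (auto simp: hom_space_def mod_hom_closed N.a_assoc intro!: restrict_ext)
  next
    show z: "\<zero>\<^bsub>hom_space R M N\<^esub> \<in> carrier (hom_space R M N)"
      by (auto simp: hom_space_def N.smult_zero_right M.smult_closed intro!: mod_homI)
    fix f assume "f \<in> carrier (hom_space R M N)"
    then have f: "f \<in> mod_hom R M N" by (simp add: hom_space_def)
    show "\<zero>\<^bsub>hom_space R M N\<^esub> \<oplus>\<^bsub>hom_space R M N\<^esub> f = f"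
      using f mod_hom_PiE[OF f] by (auto simp: hom_space_def mod_hom_closed fun_eq_iff PiE_iff extensional_def)
    let ?g = "\<lambda>x\<in>carrier M. (\<lambda>x\<in>carrier M. \<zero>\<^bsub>N\<^esub>) x \<ominus>\<^bsub>N\<^esub> f x"
    have z0: "(\<lambda>x\<in>carrier M. \<zero>\<^bsub>N\<^esub>) \<in> mod_hom R M N"
      using z by (simp add: hom_space_def)
    have "?g \<in> mod_hom R M N"
      by (rule mod_hom_diff[OF z0 f M N])
    moreover have "(\<lambda>x\<in>carrier M. ?g x \<oplus>\<^bsub>N\<^esub> f x) = (\<lambda>x\<in>carrier M. \<zero>\<^bsub>N\<^esub>)"
      using f by (auto simp: N.add_minus_cancel mod_hom_closed intro!: restrict_ext)
    ultimately show "\<exists>g\<in>carrier (hom_space R M N). g \<oplus>\<^bsub>hom_space R M N\<^esub> f = \<zero>\<^bsub>hom_space R M N\<^esub>"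
      by (intro bexI[of _ ?g]) (simp_all add: hom_space_def)
  qed
qed

text \<open>\<open>Ext_map\<close> and the scalar action of \<open>Ext\<close> are unions over all
  representatives of a class. As \<open>u\<close> sends the subgroup B into B', all members of such
  a union are the same coset, and the union can be evaluated at one representative.\<close>

lemma UN_coset_map:
  assumes B: "abelian_subgroup B V" and B': "abelian_subgroup B' V'"
    and f: "f \<in> carrier V" and u: "u \<in> carrier V \<rightarrow> carrier V'"
    and u_add: "\<And>x y. \<lbrakk>x \<in> carrier V; y \<in> carrier V\<rbrakk> \<Longrightarrow> u (x \<oplus>\<^bsub>V\<^esub> y) = u x \<oplus>\<^bsub>V'\<^esub> u y"
    and u_sub: "\<And>b. b \<in> B \<Longrightarrow> u b \<in> B'"
  shows "(\<Union>f'\<in>B +>\<^bsub>V\<^esub> f. B' +>\<^bsub>V'\<^esub> u f') = B' +>\<^bsub>V'\<^esub> u f"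
proof -
  interpret B: abelian_subgroup B V by fact
  interpret B': abelian_subgroup B' V' by fact
  have "B' +>\<^bsub>V'\<^esub> u f' = B' +>\<^bsub>V'\<^esub> u f" if "f' \<in> B +>\<^bsub>V\<^esub> f" for f'
  proof -
    from that obtain b where b: "b \<in> B" "f' = b \<oplus>\<^bsub>V\<^esub> f" unfolding a_r_coset_def' by blast
    have "u f' = u b \<oplus>\<^bsub>V'\<^esub> u f" using b f B.a_subset by (simp add: u_add subset_iff)
    then have "u f' \<in> B' +>\<^bsub>V'\<^esub> u f" using u_sub[OF b(1)] unfolding a_r_coset_def' by blast
    moreover have "u f \<in> carrier V'" using u f by blast
    ultimately show ?thesis using B'.a_repr_independence' by simp
  qed
  moreover have "f \<in> B +>\<^bsub>V\<^esub> f" using B.a_rcos_self[OF f] .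
  ultimately show ?thesis by blast
qed

text \<open>Scalars act on homomorphisms through the multiples c 1 of the unit; their centrality is
  what keeps c f linear over R.\<close>

locale ext_complex =
  fixes R :: "('b \<Rightarrow> 'k::field) ring" and P :: "nat \<Rightarrow> ('b \<Rightarrow> 'k, 'p) module"
    and d :: "nat \<Rightarrow> 'p \<Rightarrow> 'p" and N :: "('b \<Rightarrow> 'k, 'n) module"
  assumes P_module: "\<And>n. left_module R (P n)" and N_module: "left_module R N"
    and d_hom: "\<And>n. d n \<in> mod_hom R (P (Suc n)) (P n)"
    and scalar_closed: "\<And>c. (\<lambda>b. c * \<one>\<^bsub>R\<^esub> b) \<in> carrier R"
    and scalar_central: "\<And>a c. a \<in> carrier R \<Longrightarrow> a \<otimes>\<^bsub>R\<^esub> (\<lambda>b. c * \<one>\<^bsub>R\<^esub> b) = (\<lambda>b. c * \<one>\<^bsub>R\<^esub> b) \<otimes>\<^bsub>R\<^esub> a"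
begin

abbreviation V where "V m \<equiv> hom_space R (P m) N"

lemma carrier_V [simp]: "carrier (V m) = mod_hom R (P m) N"
  by (simp add: hom_space_def)

lemma add_V: "f \<oplus>\<^bsub>V m\<^esub> g = (\<lambda>x\<in>carrier (P m). f x \<oplus>\<^bsub>N\<^esub> g x)"
  by (simp add: hom_space_def)

lemma smult_V: "c \<odot>\<^bsub>V m\<^esub> f = (\<lambda>x\<in>carrier (P m). (\<lambda>b. c * \<one>\<^bsub>R\<^esub> b) \<odot>\<^bsub>N\<^esub> f x)"
  by (simp add: hom_space_def)

lemma zero_V: "\<zero>\<^bsub>V m\<^esub> = (\<lambda>x\<in>carrier (P m). \<zero>\<^bsub>N\<^esub>)"
  by (simp add: hom_space_def)

lemma abelian_group_V: "abelian_group (V m)"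
  by (rule abelian_group_hom_space[OF P_module N_module])

lemma smult_V_closed:
  assumes "f \<in> mod_hom R (P m) N"
  shows "c \<odot>\<^bsub>V m\<^esub> f \<in> mod_hom R (P m) N"
proof -
  interpret P: left_module R "P m" by (rule P_module)
  interpret N: left_module R N by (rule N_module)
  show ?thesis
    unfolding smult_V
    using assms scalar_closed
    by (intro mod_homI)
      (auto simp: mod_hom_closed mod_hom_add mod_hom_smult N.smult_closed N.smult_r_distr P.smult_closed
        N.smult_assoc[symmetric] scalar_central)
qed

lemma smult_V_add:
  assumes "f \<in> mod_hom R (P m) N" "g \<in> mod_hom R (P m) N"
  shows "c \<odot>\<^bsub>V m\<^esub> (f \<oplus>\<^bsub>V m\<^esub> g) = c \<odot>\<^bsub>V m\<^esub> f \<oplus>\<^bsub>V m\<^esub> c \<odot>\<^bsub>V m\<^esub> g"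
proof -
  interpret N: left_module R N by (rule N_module)
  show ?thesis
    using assms scalar_closed
    by (auto simp: smult_V add_V N.smult_r_distr mod_hom_closed intro!: restrict_ext)
qed

lemma compose_d_hom:
  "f \<in> mod_hom R (P m) N \<Longrightarrow> compose (carrier (P (Suc m))) f (d m) \<in> mod_hom R (P (Suc m)) N"
  using mod_hom_compose[OF d_hom _ P_module] .

lemma compose_d_add:
  "compose (carrier (P (Suc m))) (f \<oplus>\<^bsub>V m\<^esub> g) (d m) =
    compose (carrier (P (Suc m))) f (d m) \<oplus>\<^bsub>V (Suc m)\<^esub> compose (carrier (P (Suc m))) g (d m)"
  using mod_hom_closed[OF d_hom] by (auto simp: add_V compose_def intro!: restrict_ext)

lemma compose_d_smult:
  "compose (carrier (P (Suc m))) (c \<odot>\<^bsub>V m\<^esub> f) (d m) = c \<odot>\<^bsub>V (Suc m)\<^esub> compose (carrier (P (Suc m))) f (d m)"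
  using mod_hom_closed[OF d_hom] by (auto simp: smult_V compose_def intro!: restrict_ext)

lemma abelian_group_hom_compose_d:
  "abelian_group_hom (V m) (V (Suc m)) (\<lambda>f. compose (carrier (P (Suc m))) f (d m))"
proof -
  interpret M: abelian_group "V m" by (rule abelian_group_V)
  interpret N: abelian_group "V (Suc m)" by (rule abelian_group_V)
  show ?thesis
    by unfold_locales (auto simp: hom_def compose_d_hom compose_d_add)
qed

lemma abelian_subgroup_coboundaries: "abelian_subgroup (coboundaries R P d N m) (V m)"
proof -
  interpret abelian_group "V m" by (rule abelian_group_V)
  have "subgroup (coboundaries R P d N m) (add_monoid (V m))"
  proof (cases m)
    case 0
    then show ?thesis using add.triv_subgroup by simp
  next
    case (Suc k)
    interpret h: abelian_group_hom "V k" "V (Suc k)" "\<lambda>f. compose (carrier (P (Suc k))) f (d k)"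
      by (rule abelian_group_hom_compose_d)
    have "subgroup ((\<lambda>f. compose (carrier (P (Suc k))) f (d k)) ` carrier (add_monoid (V k))) (add_monoid (V (Suc k)))"
      using group_hom.img_is_subgroup[OF h.a_group_hom] .
    then show ?thesis using Suc by simp
  qed
  then show ?thesis
    by (intro abelian_subgroupI3 abelian_group_axioms additive_subgroup.intro)
qed

lemma cocycles_subset: "cocycles R P d N m \<subseteq> mod_hom R (P m) N"
  by (auto simp: cocycles_def)

lemma cocycles_iff:
  "f \<in> cocycles R P d N m \<longleftrightarrow> f \<in> mod_hom R (P m) N \<and> (\<forall>p\<in>carrier (P (Suc m)). f (d m p) = \<zero>\<^bsub>N\<^esub>)"
  by (auto simp: cocycles_def zero_V compose_def restrict_def fun_eq_iff)

lemma cocycles_add: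
  "\<lbrakk>f \<in> cocycles R P d N m; g \<in> cocycles R P d N m\<rbrakk> \<Longrightarrow> f \<oplus>\<^bsub>V m\<^esub> g \<in> cocycles R P d N m"
  using abelian_group.minus_closed
    abelian_groupE(1)[OF abelian_group_V, of _ m] mod_hom_closed[OF d_hom]
    left_module_abelian_group[OF N_module]
  by (simp add: cocycles_iff add_V abelian_group.axioms(1) abelian_monoid.l_zero abelian_groupE)

lemma cocycles_smult:
  assumes "f \<in> cocycles R P d N m"
  shows "c \<odot>\<^bsub>V m\<^esub> f \<in> cocycles R P d N m"
  using assms smult_V_closed mod_hom_closed[OF d_hom] left_module.smult_zero_right[OF N_module scalar_closed]
  by (simp add: cocycles_iff) (simp add: smult_V)

lemma coboundaries_smult:
  assumes "f \<in> coboundaries R P d N m"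
  shows "c \<odot>\<^bsub>V m\<^esub> f \<in> coboundaries R P d N m"
proof (cases m)
  case 0
  then show ?thesis using assms left_module.smult_zero_right[OF N_module scalar_closed]
    by (auto simp: zero_V smult_V)
next
  case (Suc k)
  then show ?thesis using assms smult_V_closed by (auto simp: compose_d_smult[symmetric])
qed

section \<open>Classes of cocycles and the operations on Ext\<close>

abbreviation "cls m f \<equiv> Ext_class R P d N m f"

lemma cls_def: "cls m f = coboundaries R P d N m +>\<^bsub>V m\<^esub> f"
  by (simp add: Ext_class_def)

lemma cls_eqI:
  assumes "f = b \<oplus>\<^bsub>V m\<^esub> g" "b \<in> coboundaries R P d N m" "g \<in> mod_hom R (P m) N"
  shows "cls m f = cls m g"
proof -
  have "f \<in> cls m g" using assms by (auto simp: cls_def a_r_coset_def')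
  then show ?thesis
    unfolding cls_def
    using abelian_subgroup.a_repr_independence'[OF abelian_subgroup_coboundaries] assms(3) by simp
qed

lemma Ext_carrierE:
  assumes "X \<in> carrier (Ext R P d N m)"
  obtains f where "f \<in> cocycles R P d N m" "X = cls m f"
  using assms by (auto simp: Ext_def)

lemma cls_in_Ext: "f \<in> cocycles R P d N m \<Longrightarrow> cls m f \<in> carrier (Ext R P d N m)"
  by (simp add: Ext_def)

lemma Ext_add:
  assumes "f \<in> mod_hom R (P m) N" "g \<in> mod_hom R (P m) N"
  shows "cls m f \<oplus>\<^bsub>Ext R P d N m\<^esub> cls m g = cls m (f \<oplus>\<^bsub>V m\<^esub> g)"
  using abelian_subgroup.a_rcos_sum[OF abelian_subgroup_coboundaries] assms
  by (simp add: Ext_def cls_def)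

lemma Ext_smult:
  assumes "f \<in> mod_hom R (P m) N"
  shows "c \<odot>\<^bsub>Ext R P d N m\<^esub> cls m f = cls m (c \<odot>\<^bsub>V m\<^esub> f)"
  unfolding Ext_def Ext_class_def module.simps
  by (intro UN_coset_map abelian_subgroup_coboundaries)
    (auto simp: assms smult_V_closed smult_V_add coboundaries_smult)

end

text \<open>\<open>u\<close> and \<open>w\<close> are inverse to each other up to coboundaries, as
  maps induced by homotopy equivalences are. The map on classes comes from \<open>u\<close>, and
  \<open>w\<close> shows that it is bijective.\<close>

lemma Ext_iso:
  fixes R :: "('b \<Rightarrow> 'k::field) ring" and R' :: "('b2 \<Rightarrow> 'k) ring"
  assumes "ext_complex R P d N" and "ext_complex R' P' d' N'"
    and u: "\<And>f. f \<in> mod_hom R (P m) N \<Longrightarrow> u f \<in> mod_hom R' (P' m) N'"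
    and u_add: "\<And>f g. \<lbrakk>f \<in> mod_hom R (P m) N; g \<in> mod_hom R (P m) N\<rbrakk> \<Longrightarrow>
       u (f \<oplus>\<^bsub>hom_space R (P m) N\<^esub> g) = u f \<oplus>\<^bsub>hom_space R' (P' m) N'\<^esub> u g"
    and u_smult: "\<And>f c. f \<in> mod_hom R (P m) N \<Longrightarrow>
       u (c \<odot>\<^bsub>hom_space R (P m) N\<^esub> f) = c \<odot>\<^bsub>hom_space R' (P' m) N'\<^esub> u f"
    and u_coc: "\<And>f. f \<in> cocycles R P d N m \<Longrightarrow> u f \<in> cocycles R' P' d' N' m"
    and u_cob: "\<And>f. f \<in> coboundaries R P d N m \<Longrightarrow> u f \<in> coboundaries R' P' d' N' m"
    and w: "\<And>f. f \<in> mod_hom R' (P' m) N' \<Longrightarrow> w f \<in> mod_hom R (P m) N"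
    and w_add: "\<And>f g. \<lbrakk>f \<in> mod_hom R' (P' m) N'; g \<in> mod_hom R' (P' m) N'\<rbrakk> \<Longrightarrow>
       w (f \<oplus>\<^bsub>hom_space R' (P' m) N'\<^esub> g) = w f \<oplus>\<^bsub>hom_space R (P m) N\<^esub> w g"
    and w_coc: "\<And>f. f \<in> cocycles R' P' d' N' m \<Longrightarrow> w f \<in> cocycles R P d N m"
    and w_cob: "\<And>f. f \<in> coboundaries R' P' d' N' m \<Longrightarrow> w f \<in> coboundaries R P d N m"
    and wu: "\<And>f. f \<in> cocycles R P d N m \<Longrightarrow>
       \<exists>b\<in>coboundaries R P d N m. w (u f) = b \<oplus>\<^bsub>hom_space R (P m) N\<^esub> f"
    and uw: "\<And>f. f \<in> cocycles R' P' d' N' m \<Longrightarrow>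
       \<exists>b\<in>coboundaries R' P' d' N' m. u (w f) = b \<oplus>\<^bsub>hom_space R' (P' m) N'\<^esub> f"
  shows "\<exists>\<phi>. linear_iso (Ext R P d N m) (Ext R' P' d' N' m) \<phi> \<and>
    (\<forall>f\<in>cocycles R P d N m. \<phi> (Ext_class R P d N m f) = Ext_class R' P' d' N' m (u f))"
proof -
  interpret E: ext_complex R P d N by fact
  interpret E': ext_complex R' P' d' N' by fact
  define \<phi> where "\<phi> X = (\<Union>f\<in>X. E'.cls m (u f))" for X
  define \<psi> where "\<psi> X = (\<Union>f\<in>X. E.cls m (w f))" for X
  have \<phi>: "\<phi> (E.cls m f) = E'.cls m (u f)" if "f \<in> mod_hom R (P m) N" for f
    unfolding \<phi>_def Ext_class_def
    using that by (intro UN_coset_map E.abelian_subgroup_coboundaries E'.abelian_subgroup_coboundaries)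
      (auto simp: u u_add u_cob)
  have \<psi>: "\<psi> (E'.cls m f) = E.cls m (w f)" if "f \<in> mod_hom R' (P' m) N'" for f
    unfolding \<psi>_def Ext_class_def
    using that by (intro UN_coset_map E.abelian_subgroup_coboundaries E'.abelian_subgroup_coboundaries)
      (auto simp: w w_add w_cob)
  note coc = E.cocycles_subset[THEN subsetD] and coc' = E'.cocycles_subset[THEN subsetD]
  have "bij_betw \<phi> (carrier (Ext R P d N m)) (carrier (Ext R' P' d' N' m))"
  proof (rule bij_betw_byWitness[where f' = \<psi>])
    show "\<forall>X\<in>carrier (Ext R P d N m). \<psi> (\<phi> X) = X"
    proof
      fix X assume "X \<in> carrier (Ext R P d N m)"
      then obtain f where f: "f \<in> cocycles R P d N m" "X = E.cls m f" by (rule E.Ext_carrierE)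
      obtain b where "b \<in> coboundaries R P d N m" "w (u f) = b \<oplus>\<^bsub>hom_space R (P m) N\<^esub> f"
        using wu[OF f(1)] by blast
      then have "E.cls m (w (u f)) = E.cls m f" using E.cls_eqI coc[OF f(1)] by blast
      then show "\<psi> (\<phi> X) = X" using f coc[OF f(1)] by (simp add: \<phi> \<psi> u)
    qed
    show "\<forall>X\<in>carrier (Ext R' P' d' N' m). \<phi> (\<psi> X) = X"
    proof
      fix X assume "X \<in> carrier (Ext R' P' d' N' m)"
      then obtain f where f: "f \<in> cocycles R' P' d' N' m" "X = E'.cls m f" by (rule E'.Ext_carrierE)
      obtain b where "b \<in> coboundaries R' P' d' N' m" "u (w f) = b \<oplus>\<^bsub>hom_space R' (P' m) N'\<^esub> f"
        using uw[OF f(1)] by blast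
      then have "E'.cls m (u (w f)) = E'.cls m f" using E'.cls_eqI coc'[OF f(1)] by blast
      then show "\<phi> (\<psi> X) = X" using f coc'[OF f(1)] by (simp add: \<phi> \<psi> w)
    qed
    show "\<phi> ` carrier (Ext R P d N m) \<subseteq> carrier (Ext R' P' d' N' m)"
      by (auto elim!: E.Ext_carrierE simp: \<phi> coc u_coc E'.cls_in_Ext)
    show "\<psi> ` carrier (Ext R' P' d' N' m) \<subseteq> carrier (Ext R P d N m)"
      by (auto elim!: E'.Ext_carrierE simp: \<psi> coc' w_coc E.cls_in_Ext)
  qed
  moreover have "\<phi> (X \<oplus>\<^bsub>Ext R P d N m\<^esub> Y) = \<phi> X \<oplus>\<^bsub>Ext R' P' d' N' m\<^esub> \<phi> Y"
    if "X \<in> carrier (Ext R P d N m)" "Y \<in> carrier (Ext R P d N m)" for X Y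
    using that abelian_groupE(1)[OF E.abelian_group_V, of _ m]
    by (auto elim!: E.Ext_carrierE simp: \<phi> E.Ext_add E'.Ext_add coc u u_add)
  moreover have "\<phi> (c \<odot>\<^bsub>Ext R P d N m\<^esub> X) = c \<odot>\<^bsub>Ext R' P' d' N' m\<^esub> \<phi> X"
    if "X \<in> carrier (Ext R P d N m)" for c X
    using that by (auto elim!: E.Ext_carrierE simp: \<phi> E.Ext_smult E'.Ext_smult E.smult_V_closed coc u u_smult)
  ultimately show ?thesis
    unfolding linear_iso_def using \<phi> coc by (intro exI[of _ \<phi>]) blast
qed

subsection \<open>Functoriality in the second argument\<close>

context ext_complex
begin

text \<open>Unlike the elements of \<open>mod_hom R N N\<close>, the maps on \<open>N\<close> that occur in \<open>Ext_map\<close>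
  need not be extensional.\<close>

lemma compose_restrict_hom:
  "f \<in> mod_hom R (P m) N \<Longrightarrow>
    compose (carrier (P m)) \<theta> f = compose (carrier (P m)) (restrict \<theta> (carrier N)) f"
  by (auto simp: compose_def mod_hom_closed intro!: restrict_ext)

lemma compose_hom:
  assumes "restrict \<theta> (carrier N) \<in> mod_hom R N N" "f \<in> mod_hom R (P m) N"
  shows "compose (carrier (P m)) \<theta> f \<in> mod_hom R (P m) N"
  using mod_hom_compose[OF assms(2,1) P_module] by (subst compose_restrict_hom[OF assms(2)])

lemma compose_cocycles:
  assumes "restrict \<theta> (carrier N) \<in> mod_hom R N N" "f \<in> cocycles R P d N m"
  shows "compose (carrier (P m)) \<theta> f \<in> cocycles R P d N m"
proof -
  have "\<theta> \<zero>\<^bsub>N\<^esub> = \<zero>\<^bsub>N\<^esub>"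
    using mod_hom_zero[OF assms(1)] left_module_abelian_group[OF N_module] abelian_groupE(2) by fastforce
  then show ?thesis
    using assms compose_hom[OF assms(1)] mod_hom_closed[OF d_hom]
    by (simp add: cocycles_iff) (simp add: compose_def)
qed

lemma compose_coboundaries:
  assumes th: "restrict \<theta> (carrier N) \<in> mod_hom R N N" and f: "f \<in> coboundaries R P d N m"
  shows "compose (carrier (P m)) \<theta> f \<in> coboundaries R P d N m"
proof (cases m)
  case 0
  have "\<theta> \<zero>\<^bsub>N\<^esub> = \<zero>\<^bsub>N\<^esub>"
    using mod_hom_zero[OF th] left_module_abelian_group[OF N_module] abelian_groupE(2) by fastforce
  then show ?thesis using f 0 by (auto simp: zero_V compose_def)
next
  case (Suc k)
  then obtain h where h: "h \<in> mod_hom R (P k) N" "f = compose (carrier (P (Suc k))) h (d k)" using f by auto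
  have "compose (carrier (P (Suc k))) \<theta> f = compose (carrier (P (Suc k))) (compose (carrier (P k)) \<theta> h) (d k)"
    using h mod_hom_closed[OF d_hom] by (auto simp: compose_def intro!: restrict_ext)
  then show ?thesis using Suc compose_hom[OF th h(1)] by auto
qed

lemma Ext_map_cls:
  assumes "restrict \<theta> (carrier N) \<in> mod_hom R N N" "f \<in> mod_hom R (P m) N"
  shows "Ext_map R P d N m \<theta> (cls m f) = cls m (compose (carrier (P m)) \<theta> f)"
  unfolding Ext_map_def Ext_class_def
proof (intro UN_coset_map abelian_subgroup_coboundaries)
  fix x y assume xy: "x \<in> carrier (V m)" "y \<in> carrier (V m)"
  have *: "\<theta> (a \<oplus>\<^bsub>N\<^esub> b) = \<theta> a \<oplus>\<^bsub>N\<^esub> \<theta> b" if "a \<in> carrier N" "b \<in> carrier N" for a b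
    using mod_hom_add[OF assms(1) that] that abelian_groupE(1)[OF left_module_abelian_group[OF N_module]] by simp
  show "compose (carrier (P m)) \<theta> (x \<oplus>\<^bsub>V m\<^esub> y) = compose (carrier (P m)) \<theta> x \<oplus>\<^bsub>V m\<^esub> compose (carrier (P m)) \<theta> y"
    using xy by (auto simp: add_V compose_def mod_hom_closed * intro!: restrict_ext)
qed (use assms compose_hom compose_coboundaries in auto)

lemma Ext_map_closed:
  assumes "restrict \<theta> (carrier N) \<in> mod_hom R N N" "X \<in> carrier (Ext R P d N m)"
  shows "Ext_map R P d N m \<theta> X \<in> carrier (Ext R P d N m)"
  using assms(2)
proof (rule Ext_carrierE)
  fix f assume "f \<in> cocycles R P d N m" "X = cls m f"
  then show ?thesis
    using assms(1) cocycles_subset by (auto simp: Ext_map_cls compose_cocycles cls_in_Ext subset_iff)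
qed

text \<open>The maps enter through composition with homomorphisms whose values lie in N, so the
  factorization of \<zeta> is asked on the carrier alone.\<close>

lemma Ext_map_compose:
  assumes "restrict \<theta> (carrier N) \<in> mod_hom R N N" "restrict \<eta> (carrier N) \<in> mod_hom R N N"
    and "\<And>v. v \<in> carrier N \<Longrightarrow> \<zeta> v = \<theta> (\<eta> v)" and "X \<in> carrier (Ext R P d N m)"
  shows "Ext_map R P d N m \<zeta> X = Ext_map R P d N m \<theta> (Ext_map R P d N m \<eta> X)"
  using assms(4)
proof (rule Ext_carrierE)
  fix f assume f: "f \<in> cocycles R P d N m" "X = cls m f"
  then have f': "f \<in> mod_hom R (P m) N" using cocycles_subset by auto
  have \<eta>: "\<eta> v \<in> carrier N" if "v \<in> carrier N" for v using mod_hom_closed[OF assms(2) that] that by simp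
  have "restrict \<zeta> (carrier N) = compose (carrier N) (restrict \<theta> (carrier N)) (restrict \<eta> (carrier N))"
    using assms(3) \<eta> by (auto simp: compose_def intro!: restrict_ext)
  then have "restrict \<zeta> (carrier N) \<in> mod_hom R N N"
    using mod_hom_compose[OF assms(2,1) N_module] by simp
  moreover have "compose (carrier (P m)) \<theta> (compose (carrier (P m)) \<eta> f) = compose (carrier (P m)) \<zeta> f"
    using assms(3) mod_hom_closed[OF f'] by (auto simp: compose_def intro!: restrict_ext)
  ultimately show ?thesis
    using f f' assms by (simp add: Ext_map_cls compose_hom)
qed

lemma Ext_map_linear:
  assumes th: "restrict \<theta> (carrier N) \<in> mod_hom R N N"
  shows "\<lbrakk>X \<in> carrier (Ext R P d N m); Y \<in> carrier (Ext R P d N m)\<rbrakk> \<Longrightarrow>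
      Ext_map R P d N m \<theta> (X \<oplus>\<^bsub>Ext R P d N m\<^esub> Y) =
        Ext_map R P d N m \<theta> X \<oplus>\<^bsub>Ext R P d N m\<^esub> Ext_map R P d N m \<theta> Y"
    and "X \<in> carrier (Ext R P d N m) \<Longrightarrow>
      Ext_map R P d N m \<theta> (c \<odot>\<^bsub>Ext R P d N m\<^esub> X) = c \<odot>\<^bsub>Ext R P d N m\<^esub> Ext_map R P d N m \<theta> X"
proof -
  have *: "\<theta> (a \<oplus>\<^bsub>N\<^esub> b) = \<theta> a \<oplus>\<^bsub>N\<^esub> \<theta> b" if "a \<in> carrier N" "b \<in> carrier N" for a b
    using mod_hom_add[OF th that] that abelian_groupE(1)[OF left_module_abelian_group[OF N_module]] by simp
  have **: "\<theta> ((\<lambda>b. c * \<one>\<^bsub>R\<^esub> b) \<odot>\<^bsub>N\<^esub> a) = (\<lambda>b. c * \<one>\<^bsub>R\<^esub> b) \<odot>\<^bsub>N\<^esub> \<theta> a" if "a \<in> carrier N" for a c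
    using mod_hom_smult[OF th scalar_closed that] that left_module.smult_closed[OF N_module scalar_closed that] by simp
  note coc = cocycles_subset[THEN subsetD]
  show "Ext_map R P d N m \<theta> (X \<oplus>\<^bsub>Ext R P d N m\<^esub> Y) =
        Ext_map R P d N m \<theta> X \<oplus>\<^bsub>Ext R P d N m\<^esub> Ext_map R P d N m \<theta> Y"
    if "X \<in> carrier (Ext R P d N m)" "Y \<in> carrier (Ext R P d N m)"
  proof -
    from that(1) obtain f where f: "f \<in> cocycles R P d N m" "X = cls m f" by (rule Ext_carrierE)
    from that(2) obtain g where g: "g \<in> cocycles R P d N m" "Y = cls m g" by (rule Ext_carrierE)
    note fg = f(1) g(1) f(2) g(2)
    have "compose (carrier (P m)) \<theta> (f \<oplus>\<^bsub>V m\<^esub> g) = compose (carrier (P m)) \<theta> f \<oplus>\<^bsub>V m\<^esub> compose (carrier (P m)) \<theta> g"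
      using fg(1,2)[THEN coc] by (auto simp: add_V compose_def mod_hom_closed * intro!: restrict_ext)
    then show ?thesis
      using fg th cocycles_add[OF fg(1,2), THEN coc]
      by (simp add: Ext_add Ext_map_cls compose_hom coc)
  qed
  show "Ext_map R P d N m \<theta> (c \<odot>\<^bsub>Ext R P d N m\<^esub> X) = c \<odot>\<^bsub>Ext R P d N m\<^esub> Ext_map R P d N m \<theta> X"
    if "X \<in> carrier (Ext R P d N m)"
  proof -
    from that obtain f where f: "f \<in> cocycles R P d N m" "X = cls m f"
      by (rule Ext_carrierE)
    have "compose (carrier (P m)) \<theta> (c \<odot>\<^bsub>V m\<^esub> f) = c \<odot>\<^bsub>V m\<^esub> compose (carrier (P m)) \<theta> f"
      using f(1)[THEN coc] by (auto simp: smult_V compose_def mod_hom_closed ** intro!: restrict_ext)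
    then show ?thesis
      using f th by (simp add: Ext_smult Ext_map_cls compose_hom coc smult_V_closed)
  qed
qed

end

section \<open>Change of rings\<close>

text \<open>Applying f to F - id = d s + s d gives f d s + f s d: the first term vanishes for a
  cocycle, and the second is the coboundary of f s. In degree 0 there is no second term, and f F
  equals f.\<close>

lemma (in ext_complex) chain_homotopy_cohomologous:
  assumes F: "\<And>p. p \<in> carrier (P m) \<Longrightarrow> F m p \<in> carrier (P m)"
    and s: "\<And>n. s n \<in> mod_hom R (P n) (P (Suc n))"
    and s0: "\<And>p. p \<in> carrier (P 0) \<Longrightarrow> F 0 p \<ominus>\<^bsub>P 0\<^esub> p = d 0 (s 0 p)"
    and sSuc: "\<And>n p. p \<in> carrier (P (Suc n)) \<Longrightarrow>
      F (Suc n) p \<ominus>\<^bsub>P (Suc n)\<^esub> p = d (Suc n) (s (Suc n) p) \<oplus>\<^bsub>P (Suc n)\<^esub> s n (d n p)"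
    and f: "f \<in> cocycles R P d N m"
  shows "\<exists>b\<in>coboundaries R P d N m. (\<lambda>p\<in>carrier (P m). f (F m p)) = b \<oplus>\<^bsub>V m\<^esub> f"
proof -
  interpret N: left_module R N by (rule N_module)
  interpret P: left_module R "P m" by (rule P_module)
  have fh: "f \<in> mod_hom R (P m) N" and fd: "\<And>p. p \<in> carrier (P (Suc m)) \<Longrightarrow> f (d m p) = \<zero>\<^bsub>N\<^esub>"
    using f by (auto simp: cocycles_iff)
  have sc: "s n p \<in> carrier (P (Suc n))" if "p \<in> carrier (P n)" for n p using mod_hom_closed[OF s that] .
  have dc: "d n p \<in> carrier (P n)" if "p \<in> carrier (P (Suc n))" for n p using mod_hom_closed[OF d_hom that] .
  have diff: "f (F m p) = f (F m p \<ominus>\<^bsub>P m\<^esub> p) \<oplus>\<^bsub>N\<^esub> f p" if "p \<in> carrier (P m)" for p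
    using that F[OF that] mod_hom_closed[OF fh]
    by (simp add: mod_hom_minus[OF fh P.abelian_group_axioms N.abelian_group_axioms] N.add_minus_cancel)
  show ?thesis
  proof (cases m)
    case 0
    have "f (F 0 p) = f p" if "p \<in> carrier (P 0)" for p
      using diff[of p] that fd[of "s 0 p"] sc mod_hom_closed[OF fh] by (simp add: 0 s0)
    then show ?thesis
      using 0 mod_hom_closed[OF fh] by (auto simp: zero_V add_V intro!: restrict_ext)
  next
    case (Suc k)
    let ?h = "compose (carrier (P k)) f (s k)"
    have h: "?h \<in> mod_hom R (P k) N" using mod_hom_compose[OF s _ P_module] fh Suc by simp
    have "f (F m p) = ?h (d k p) \<oplus>\<^bsub>N\<^esub> f p" if p: "p \<in> carrier (P m)" for p
    proof -
      have "f (F m p \<ominus>\<^bsub>P m\<^esub> p) = f (d m (s m p)) \<oplus>\<^bsub>N\<^esub> f (s k (d k p))"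
        using p Suc sc dc by (simp add: sSuc mod_hom_add[OF fh[unfolded Suc]])
      also have "\<dots> = ?h (d k p)"
        using p Suc sc dc fd mod_hom_closed[OF fh[unfolded Suc]] by (simp add: compose_def)
      finally show ?thesis using diff[OF p] by simp
    qed
    then have "(\<lambda>p\<in>carrier (P m). f (F m p)) = compose (carrier (P m)) ?h (d k) \<oplus>\<^bsub>V m\<^esub> f"
      by (auto simp: add_V compose_eq intro!: restrict_ext)
    then show ?thesis using h Suc by auto
  qed
qed

text \<open>The section \<open>\<iota>\<close> of \<open>\<pi>\<close> makes the target a projective module over the source.\<close>

locale ring_retract = R: ring R + R': ring R' for R :: "'r ring" and R' :: "'s ring" +
  fixes \<pi> :: "'r \<Rightarrow> 's" and \<iota> :: "'s \<Rightarrow> 'r"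
  assumes pi_hom: "\<pi> \<in> ring_hom R R'"
    and iota_closed: "y \<in> carrier R' \<Longrightarrow> \<iota> y \<in> carrier R"
    and iota_add: "\<lbrakk>x \<in> carrier R'; y \<in> carrier R'\<rbrakk> \<Longrightarrow> \<iota> (x \<oplus>\<^bsub>R'\<^esub> y) = \<iota> x \<oplus>\<^bsub>R\<^esub> \<iota> y"
    and iota_mult: "\<lbrakk>r \<in> carrier R; y \<in> carrier R'\<rbrakk> \<Longrightarrow> \<iota> (\<pi> r \<otimes>\<^bsub>R'\<^esub> y) = r \<otimes>\<^bsub>R\<^esub> \<iota> y"
    and pi_iota: "y \<in> carrier R' \<Longrightarrow> \<pi> (\<iota> y) = y"
begin

lemma pi_closed: "r \<in> carrier R \<Longrightarrow> \<pi> r \<in> carrier R'"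
  using ring_hom_closed[OF pi_hom] .

lemma iota_zero: "\<iota> \<zero>\<^bsub>R'\<^esub> = \<zero>\<^bsub>R\<^esub>"
  using iota_add[OF R'.zero_closed R'.zero_closed] iota_closed[OF R'.zero_closed]
  by (metis R'.l_zero R'.zero_closed R.add.r_cancel_one')

lemma iota_eq_zero_iff: "y \<in> carrier R' \<Longrightarrow> \<iota> y = \<zero>\<^bsub>R\<^esub> \<longleftrightarrow> y = \<zero>\<^bsub>R'\<^esub>"
  using iota_zero pi_iota R'.zero_closed by metis

text \<open>Restriction of scalars along \<pi>. Carrier and addition are untouched, so the same maps
  serve as differentials and homomorphisms over both rings.\<close>

definition inflate :: "('s, 'm) module \<Rightarrow> ('r, 'm) module" where
  "inflate M = \<lparr>carrier = carrier M, mult = undefined, one = undefined, zero = \<zero>\<^bsub>M\<^esub>,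
     add = (\<oplus>\<^bsub>M\<^esub>), smult = (\<lambda>r x. \<pi> r \<odot>\<^bsub>M\<^esub> x)\<rparr>"

lemma inflate_simps [simp]:
  "carrier (inflate M) = carrier M" "\<zero>\<^bsub>inflate M\<^esub> = \<zero>\<^bsub>M\<^esub>"
  "x \<oplus>\<^bsub>inflate M\<^esub> y = x \<oplus>\<^bsub>M\<^esub> y" "r \<odot>\<^bsub>inflate M\<^esub> x = \<pi> r \<odot>\<^bsub>M\<^esub> x"
  by (simp_all add: inflate_def)

lemma a_inv_inflate: "\<ominus>\<^bsub>inflate M\<^esub> x = \<ominus>\<^bsub>M\<^esub> x"
  by (simp add: a_inv_def m_inv_def)

lemma minus_inflate [simp]: "x \<ominus>\<^bsub>inflate M\<^esub> y = x \<ominus>\<^bsub>M\<^esub> y"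
  by (simp add: a_minus_def a_inv_inflate)

lemma finsum_inflate: "finsum (inflate M) c X = finsum M c X"
  by (simp add: finsum_def finprod_def inflate_def)

lemma abelian_group_inflate:
  assumes "abelian_group M"
  shows "abelian_group (inflate M)"
proof -
  interpret abelian_group M by fact
  show ?thesis
    by (rule abelian_groupI) (auto simp: a_ac intro: add.l_inv_ex)
qed

lemma left_module_inflate:
  assumes "left_module R' M"
  shows "left_module R (inflate M)"
proof -
  interpret M: left_module R' M by fact
  interpret I: abelian_group "inflate M" by (rule abelian_group_inflate[OF M.abelian_group_axioms])
  show ?thesis
    using ring_hom_mult[OF pi_hom] ring_hom_add[OF pi_hom] ring_hom_one[OF pi_hom]
    by unfold_locales
      (auto simp: pi_closed M.smult_closed M.smult_l_distr M.smult_r_distr M.smult_assoc M.smult_one)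
qed

text \<open>Linearity over R implies linearity over R', as every element a of R' is \<pi> of \<iota>
  a.\<close>

lemma mod_hom_inflate: "mod_hom R (inflate M) (inflate N) = mod_hom R' M N"
proof
  show "mod_hom R' M N \<subseteq> mod_hom R (inflate M) (inflate N)"
    by (auto simp: mod_hom_def pi_closed)
  have "f (a \<odot>\<^bsub>M\<^esub> x) = a \<odot>\<^bsub>N\<^esub> f x"
    if "f \<in> mod_hom R (inflate M) (inflate N)" "a \<in> carrier R'" "x \<in> carrier M" for f a x
    using mod_hom_smult[OF that(1) iota_closed[OF that(2)], of x] that by (simp add: pi_iota)
  then show "mod_hom R (inflate M) (inflate N) \<subseteq> mod_hom R' M N"
    by (auto simp: mod_hom_def)
qed

text \<open>Apply \<iota> to the coordinates of a splitting over R'. As \<iota> is linear over R and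
  vanishes only at 0, supports are kept, and \<pi> \<iota> = id gives back the same expansion of
  p.\<close>

lemma projective_module_inflate:
  assumes "projective_module R' M"
  shows "projective_module R (inflate M)"
proof -
  interpret M: left_module R' M using assms by (simp add: projective_module_def)
  obtain s where s: "s \<in> mod_hom R' M (free_module R' (carrier M))"
    and sp: "\<And>p. p \<in> carrier M \<Longrightarrow>
       finsum M (\<lambda>x. s p x \<odot>\<^bsub>M\<^esub> x) {x \<in> carrier M. s p x \<noteq> \<zero>\<^bsub>R'\<^esub>} = p"
    using assms unfolding projective_module_def by blast
  have s_carr: "s p \<in> carrier (free_module R' (carrier M))" if "p \<in> carrier M" for p
    using mod_hom_closed[OF s that] .
  have s_in: "s p x \<in> carrier R'" if "p \<in> carrier M" "x \<in> carrier M" for p x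
    using s_carr[OF that(1)] that by (auto simp: free_module_def)
  have s_fin: "finite {x \<in> carrier M. s p x \<noteq> \<zero>\<^bsub>R'\<^esub>}" if "p \<in> carrier M" for p
    using s_carr[OF that] by (simp add: free_module_def)
  define t where "t = (\<lambda>p\<in>carrier M. \<lambda>x\<in>carrier M. \<iota> (s p x))"
  have supp: "{x \<in> carrier M. t p x \<noteq> \<zero>\<^bsub>R\<^esub>} = {x \<in> carrier M. s p x \<noteq> \<zero>\<^bsub>R'\<^esub>}" if "p \<in> carrier M" for p
    using that s_in by (auto simp: t_def iota_eq_zero_iff)
  have "t \<in> mod_hom R (inflate M) (free_module R (carrier M))"
  proof (rule mod_homI)
    show "t \<in> carrier (inflate M) \<rightarrow>\<^sub>E carrier (free_module R (carrier M))"
      using s_in s_fin supp by (auto simp: t_def free_module_def iota_closed)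
  next
    fix p q assume pq: "p \<in> carrier (inflate M)" "q \<in> carrier (inflate M)"
    have "s (p \<oplus>\<^bsub>M\<^esub> q) x = s p x \<oplus>\<^bsub>R'\<^esub> s q x" if "x \<in> carrier M" for x
      using mod_hom_add[OF s, of p q] pq that by (simp add: free_module_def)
    then show "t (p \<oplus>\<^bsub>inflate M\<^esub> q) = t p \<oplus>\<^bsub>free_module R (carrier M)\<^esub> t q"
      using pq s_in by (auto simp: t_def free_module_def iota_add intro!: restrict_ext)
  next
    fix a p assume ap: "a \<in> carrier R" "p \<in> carrier (inflate M)"
    have "s (\<pi> a \<odot>\<^bsub>M\<^esub> p) x = \<pi> a \<otimes>\<^bsub>R'\<^esub> s p x" if "x \<in> carrier M" for x
      using mod_hom_smult[OF s pi_closed[OF ap(1)], of p] ap that by (simp add: free_module_def)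
    then show "t (a \<odot>\<^bsub>inflate M\<^esub> p) = a \<odot>\<^bsub>free_module R (carrier M)\<^esub> t p"
      using ap s_in by (auto simp: t_def free_module_def iota_mult pi_closed M.smult_closed intro!: restrict_ext)
  qed
  moreover have "finsum (inflate M) (\<lambda>x. t p x \<odot>\<^bsub>inflate M\<^esub> x) {x \<in> carrier M. t p x \<noteq> \<zero>\<^bsub>R\<^esub>} = p"
    if p: "p \<in> carrier M" for p
  proof -
    have "finsum M (\<lambda>x. t p x \<odot>\<^bsub>inflate M\<^esub> x) {x \<in> carrier M. s p x \<noteq> \<zero>\<^bsub>R'\<^esub>} =
        finsum M (\<lambda>x. s p x \<odot>\<^bsub>M\<^esub> x) {x \<in> carrier M. s p x \<noteq> \<zero>\<^bsub>R'\<^esub>}"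
      using p s_in by (intro M.finsum_cong') (auto simp: t_def pi_iota M.smult_closed)
    then show ?thesis using sp[OF p] supp[OF p] by (simp add: finsum_inflate)
  qed
  ultimately show ?thesis
    using left_module_inflate[OF M.left_module_axioms] unfolding projective_module_def by auto
qed

text \<open>T and T' are modules over different rings and hence records of different types, so they
  are identified field by field. Differentials and augmentation stay literally the same.\<close>

lemma projective_resolution_inflate:
  assumes Q: "projective_resolution R' T' Q d \<epsilon>"
    and T: "carrier T = carrier T'" "\<And>x y. x \<oplus>\<^bsub>T\<^esub> y = x \<oplus>\<^bsub>T'\<^esub> y" "\<zero>\<^bsub>T\<^esub> = \<zero>\<^bsub>T'\<^esub>"
      "\<And>r x. \<lbrakk>r \<in> carrier R; x \<in> carrier T\<rbrakk> \<Longrightarrow> r \<odot>\<^bsub>T\<^esub> x = \<pi> r \<odot>\<^bsub>T'\<^esub> x"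
  shows "projective_resolution R T (\<lambda>n. inflate (Q n)) d \<epsilon>"
proof -
  have "\<epsilon> \<in> mod_hom R' (Q 0) T'" using Q by (simp add: projective_resolution_def)
  then have "\<epsilon> \<in> mod_hom R (inflate (Q 0)) T"
    using T pi_closed by (intro mod_homI) (auto simp: mod_hom_add mod_hom_smult mod_hom_closed dest: mod_hom_PiE)
  then show ?thesis
    using Q T by (simp add: projective_resolution_def mod_hom_inflate projective_module_inflate)
qed

end

text \<open>Every element of T is an \<epsilon>-image, and \<epsilon> carries the module identities
  over. In this way the resolved module inherits its axioms from the resolution.\<close>

lemma left_module_image:
  assumes "left_module R M" and T: "abelian_group T" and \<epsilon>: "\<epsilon> \<in> mod_hom R M T" "\<epsilon> ` carrier M = carrier T"
  shows "left_module R T"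
proof -
  interpret M: left_module R M by fact
  interpret T: abelian_group T by fact
  note h = mod_hom_add[OF \<epsilon>(1), symmetric] mod_hom_smult[OF \<epsilon>(1), symmetric]
  have cl: "\<epsilon> x \<in> carrier T" if "x \<in> carrier M" for x using mod_hom_closed[OF \<epsilon>(1) that] .
  show ?thesis
    by unfold_locales
      (unfold \<epsilon>(2)[symmetric], auto simp: h cl M.smult_closed M.smult_l_distr M.smult_r_distr M.smult_assoc M.smult_one)
qed

text \<open>The idempotent \<open>\<iota> 1\<close> acts as the identity on inflated modules, so that only the summand
  \<open>i ` carrier M\<close> of \<open>N\<close>, which is its image, contributes to the Ext groups of \<open>N\<close>.\<close>

lemma Ext_change_of_rings:
  fixes R :: "('b \<Rightarrow> 'k::field) ring" and R' :: "('b2 \<Rightarrow> 'k) ring"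
  assumes "ring_retract R R' \<pi> \<iota>"
    and P: "projective_resolution R T P d \<epsilon>" and Q: "projective_resolution R' T' Q d' \<epsilon>'"
    and T: "abelian_group T" "carrier T = carrier T'" "\<And>x y. x \<oplus>\<^bsub>T\<^esub> y = x \<oplus>\<^bsub>T'\<^esub> y" "\<zero>\<^bsub>T\<^esub> = \<zero>\<^bsub>T'\<^esub>"
      "\<And>r x. \<lbrakk>r \<in> carrier R; x \<in> carrier T\<rbrakk> \<Longrightarrow> r \<odot>\<^bsub>T\<^esub> x = \<pi> r \<odot>\<^bsub>T'\<^esub> x"
    and N: "ext_complex R P d N" and M: "ext_complex R' Q d' M"
    and i: "\<And>x. x \<in> carrier M \<Longrightarrow> i x \<in> carrier N"
      "\<And>x y. \<lbrakk>x \<in> carrier M; y \<in> carrier M\<rbrakk> \<Longrightarrow> i (x \<oplus>\<^bsub>M\<^esub> y) = i x \<oplus>\<^bsub>N\<^esub> i y"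
      "\<And>r x. \<lbrakk>r \<in> carrier R; x \<in> carrier M\<rbrakk> \<Longrightarrow> i (\<pi> r \<odot>\<^bsub>M\<^esub> x) = r \<odot>\<^bsub>N\<^esub> i x"
    and j: "\<And>x. x \<in> carrier N \<Longrightarrow> j x \<in> carrier M"
      "\<And>x y. \<lbrakk>x \<in> carrier N; y \<in> carrier N\<rbrakk> \<Longrightarrow> j (x \<oplus>\<^bsub>N\<^esub> y) = j x \<oplus>\<^bsub>M\<^esub> j y"
      "\<And>r x. \<lbrakk>r \<in> carrier R; x \<in> carrier N\<rbrakk> \<Longrightarrow> j (r \<odot>\<^bsub>N\<^esub> x) = \<pi> r \<odot>\<^bsub>M\<^esub> j x"
    and ji: "\<And>x. x \<in> carrier M \<Longrightarrow> j (i x) = x"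
    and ij: "\<And>x. x \<in> carrier N \<Longrightarrow> i (j x) = \<iota> \<one>\<^bsub>R'\<^esub> \<odot>\<^bsub>N\<^esub> x"
    and scalar: "\<And>c. \<pi> (\<lambda>b. c * \<one>\<^bsub>R\<^esub> b) = (\<lambda>b. c * \<one>\<^bsub>R'\<^esub> b)"
  shows "\<exists>\<phi>. linear_iso (Ext R P d N m) (Ext R' Q d' M m) \<phi> \<and>
    (\<forall>\<theta> \<eta>. restrict \<theta> (carrier N) \<in> mod_hom R N N \<longrightarrow> restrict \<eta> (carrier M) \<in> mod_hom R' M M \<longrightarrow>
       (\<forall>x\<in>carrier N. j (\<theta> x) = \<eta> (j x)) \<longrightarrow>
       (\<forall>X\<in>carrier (Ext R P d N m). \<phi> (Ext_map R P d N m \<theta> X) = Ext_map R' Q d' M m \<eta> (\<phi> X)))"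
proof -
  interpret ring_retract R R' \<pi> \<iota> by fact
  interpret N: ext_complex R P d N by fact
  interpret M: ext_complex R' Q d' M by fact
  interpret Nm: left_module R N by (rule N.N_module)
  interpret Mm: left_module R' M by (rule M.N_module)
  have T_mod: "left_module R T"
  proof (rule left_module_image[OF N.P_module T(1)])
    show "\<epsilon> \<in> mod_hom R (P 0) T" "\<epsilon> ` carrier (P 0) = carrier T"
      using P by (simp_all add: projective_resolution_def)
  qed
  \<comment> \<open>The resolution over R' thereby becomes a second projective resolution of T over
    R, to be compared with P.\<close>
  have QD: "projective_resolution R T (\<lambda>n. inflate (Q n)) d' \<epsilon>'"
    by (rule projective_resolution_inflate[OF Q T(2-5)])
  have QD_mod: "left_module R (inflate (Q n))" for n by (rule left_module_inflate[OF M.P_module])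
  have d'_hom: "d' n \<in> mod_hom R (inflate (Q (Suc n))) (inflate (Q n))" for n
    using M.d_hom by (simp add: mod_hom_inflate)
  obtain F where F: "\<And>n. F n \<in> mod_hom R (P n) (inflate (Q n))"
    and F0: "\<And>p. p \<in> carrier (P 0) \<Longrightarrow> \<epsilon>' (F 0 p) = \<epsilon> p"
    and Fd: "\<And>n p. p \<in> carrier (P (Suc n)) \<Longrightarrow> d' n (F (Suc n) p) = F n (d n p)"
    using chain_map_lift[OF P QD T_mod] by blast
  obtain H where H: "\<And>n. H n \<in> mod_hom R (inflate (Q n)) (P n)"
    and H0: "\<And>q. q \<in> carrier (Q 0) \<Longrightarrow> \<epsilon> (H 0 q) = \<epsilon>' q"
    and Hd: "\<And>n q. q \<in> carrier (Q (Suc n)) \<Longrightarrow> d n (H (Suc n) q) = H n (d' n q)"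
    using chain_map_lift[OF QD P T_mod] unfolding inflate_simps by blast
  have Fc: "F n p \<in> carrier (Q n)" if "p \<in> carrier (P n)" for n p using mod_hom_closed[OF F that] by simp
  have Hc: "H n q \<in> carrier (P n)" if "q \<in> carrier (Q n)" for n q using mod_hom_closed[OF H] that by simp
  have dc: "d n p \<in> carrier (P n)" if "p \<in> carrier (P (Suc n))" for n p using mod_hom_closed[OF N.d_hom that] .
  have d'c: "d' n p \<in> carrier (Q n)" if "p \<in> carrier (Q (Suc n))" for n p using mod_hom_closed[OF M.d_hom that] .
  let ?HF = "\<lambda>n. compose (carrier (P n)) (H n) (F n)" and ?FH = "\<lambda>n. compose (carrier (Q n)) (F n) (H n)"
  have HF: "?HF n \<in> mod_hom R (P n) (P n)" for n using mod_hom_compose[OF F H N.P_module] .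
  have FH: "?FH n \<in> mod_hom R (inflate (Q n)) (inflate (Q n))" for n
    using mod_hom_compose[OF H F QD_mod] by simp
  obtain s where s: "\<And>n. s n \<in> mod_hom R (P n) (P (Suc n))"
    "\<And>p. p \<in> carrier (P 0) \<Longrightarrow> ?HF 0 p \<ominus>\<^bsub>P 0\<^esub> p = d 0 (s 0 p)"
    "\<And>n p. p \<in> carrier (P (Suc n)) \<Longrightarrow>
      ?HF (Suc n) p \<ominus>\<^bsub>P (Suc n)\<^esub> p = d (Suc n) (s (Suc n) p) \<oplus>\<^bsub>P (Suc n)\<^esub> s n (d n p)"
  proof -
    have "\<exists>s. (\<forall>n. s n \<in> mod_hom R (P n) (P (Suc n))) \<and>
      (\<forall>p\<in>carrier (P 0). ?HF 0 p \<ominus>\<^bsub>P 0\<^esub> p = d 0 (s 0 p)) \<and>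
      (\<forall>n. \<forall>p\<in>carrier (P (Suc n)). ?HF (Suc n) p \<ominus>\<^bsub>P (Suc n)\<^esub> p =
        d (Suc n) (s (Suc n) p) \<oplus>\<^bsub>P (Suc n)\<^esub> s n (d n p))"
      by (rule chain_map_homotopic_id[OF P T_mod HF]) (simp_all add: compose_eq dc Fc Fd Hd F0 H0)
    then show ?thesis using that by blast
  qed
  obtain t where t: "\<And>n. t n \<in> mod_hom R (inflate (Q n)) (inflate (Q (Suc n)))"
    "\<And>p. p \<in> carrier (Q 0) \<Longrightarrow> ?FH 0 p \<ominus>\<^bsub>Q 0\<^esub> p = d' 0 (t 0 p)"
    "\<And>n p. p \<in> carrier (Q (Suc n)) \<Longrightarrow>
      ?FH (Suc n) p \<ominus>\<^bsub>Q (Suc n)\<^esub> p = d' (Suc n) (t (Suc n) p) \<oplus>\<^bsub>Q (Suc n)\<^esub> t n (d' n p)"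
  proof -
    have "\<exists>t. (\<forall>n. t n \<in> mod_hom R (inflate (Q n)) (inflate (Q (Suc n)))) \<and>
      (\<forall>p\<in>carrier (inflate (Q 0)). ?FH 0 p \<ominus>\<^bsub>inflate (Q 0)\<^esub> p = d' 0 (t 0 p)) \<and>
      (\<forall>n. \<forall>p\<in>carrier (inflate (Q (Suc n))). ?FH (Suc n) p \<ominus>\<^bsub>inflate (Q (Suc n))\<^esub> p =
        d' (Suc n) (t (Suc n) p) \<oplus>\<^bsub>inflate (Q (Suc n))\<^esub> t n (d' n p))"
      by (rule chain_map_homotopic_id[OF QD T_mod FH]) (simp_all add: compose_eq d'c Hc Fd Hd F0 H0)
    then show ?thesis using that by (simp only: inflate_simps minus_inflate) blast
  qed
  have t': "t n \<in> mod_hom R' (Q n) (Q (Suc n))" for n using t(1) by (simp add: mod_hom_inflate)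
  \<comment> \<open>On cochains the comparison combines the chain maps H and F with the projection j
    and the inclusion i.\<close>
  define u where "u = (\<lambda>n f. \<lambda>q\<in>carrier (Q n). j (f (H n q)))"
  define w where "w = (\<lambda>n h. \<lambda>p\<in>carrier (P n). i (h (F n p)))"
  have j0: "j \<zero>\<^bsub>N\<^esub> = \<zero>\<^bsub>M\<^esub>"
    using j(2)[of "\<zero>\<^bsub>N\<^esub>" "\<zero>\<^bsub>N\<^esub>"] j(1)[of "\<zero>\<^bsub>N\<^esub>"]
    by (metis Mm.M.add.r_cancel_one' Nm.M.l_zero Nm.M.zero_closed)
  have i0: "i \<zero>\<^bsub>M\<^esub> = \<zero>\<^bsub>N\<^esub>"
    using i(2)[of "\<zero>\<^bsub>M\<^esub>" "\<zero>\<^bsub>M\<^esub>"] i(1)[of "\<zero>\<^bsub>M\<^esub>"]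
    by (metis Nm.M.add.r_cancel_one' Mm.M.l_zero Mm.M.zero_closed)
  have Qadd: "x \<oplus>\<^bsub>Q n\<^esub> y \<in> carrier (Q n)" if "x \<in> carrier (Q n)" "y \<in> carrier (Q n)" for n x y
    using that abelian_groupE(1)[OF left_module_abelian_group[OF M.P_module]] by blast
  have Padd: "x \<oplus>\<^bsub>P n\<^esub> y \<in> carrier (P n)" if "x \<in> carrier (P n)" "y \<in> carrier (P n)" for n x y
    using that abelian_groupE(1)[OF left_module_abelian_group[OF N.P_module]] by blast
  have u_hom: "u n f \<in> mod_hom R' (Q n) M" if f: "f \<in> mod_hom R (P n) N" for n f
  proof (rule mod_homI)
    show "u n f \<in> carrier (Q n) \<rightarrow>\<^sub>E carrier M"
      using mod_hom_closed[OF f] Hc j(1) by (auto simp: u_def)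
  next
    fix x y assume "x \<in> carrier (Q n)" "y \<in> carrier (Q n)"
    then show "u n f (x \<oplus>\<^bsub>Q n\<^esub> y) = u n f x \<oplus>\<^bsub>M\<^esub> u n f y"
      using mod_hom_add[OF H, of x n y] Hc mod_hom_add[OF f] mod_hom_closed[OF f]
      by (simp add: u_def Qadd j(2))
  next
    fix a x assume ax: "a \<in> carrier R'" "x \<in> carrier (Q n)"
    \<comment> \<open>Linearity over R' is obtained by writing a as \<pi> of \<iota> a and using
      linearity of H over R.\<close>
    have "H n (a \<odot>\<^bsub>Q n\<^esub> x) = \<iota> a \<odot>\<^bsub>P n\<^esub> H n x"
      using mod_hom_smult[OF H iota_closed[OF ax(1)], of x n] ax by (simp add: pi_iota)
    then show "u n f (a \<odot>\<^bsub>Q n\<^esub> x) = a \<odot>\<^bsub>M\<^esub> u n f x"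
      using ax left_module.smult_closed[OF M.P_module ax] Hc mod_hom_closed[OF f]
      by (simp add: u_def mod_hom_smult[OF f] iota_closed j(3) pi_iota)
  qed
  have w_hom: "w n h \<in> mod_hom R (P n) N" if h: "h \<in> mod_hom R' (Q n) M" for n h
  proof (rule mod_homI)
    show "w n h \<in> carrier (P n) \<rightarrow>\<^sub>E carrier N"
      using mod_hom_closed[OF h] Fc i(1) by (auto simp: w_def)
  next
    fix x y assume "x \<in> carrier (P n)" "y \<in> carrier (P n)"
    then show "w n h (x \<oplus>\<^bsub>P n\<^esub> y) = w n h x \<oplus>\<^bsub>N\<^esub> w n h y"
      using mod_hom_add[OF F, of x n y] Fc mod_hom_add[OF h] mod_hom_closed[OF h]
      by (simp add: w_def Padd i(2))
  next
    fix a x assume ax: "a \<in> carrier R" "x \<in> carrier (P n)"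
    have "F n (a \<odot>\<^bsub>P n\<^esub> x) = \<pi> a \<odot>\<^bsub>Q n\<^esub> F n x"
      using mod_hom_smult[OF F ax] by simp
    then show "w n h (a \<odot>\<^bsub>P n\<^esub> x) = a \<odot>\<^bsub>N\<^esub> w n h x"
      using ax left_module.smult_closed[OF N.P_module ax] Fc mod_hom_closed[OF h]
      by (simp add: w_def mod_hom_smult[OF h] pi_closed i(3))
  qed
  have u_d: "u (Suc n) (compose (carrier (P (Suc n))) f (d n)) = compose (carrier (Q (Suc n))) (u n f) (d' n)" for n f
    using Hc d'c Hd by (auto simp: u_def compose_def intro!: restrict_ext)
  have w_d: "w (Suc n) (compose (carrier (Q (Suc n))) f (d' n)) = compose (carrier (P (Suc n))) (w n f) (d n)" for n f
    using Fc dc Fd by (auto simp: w_def compose_def intro!: restrict_ext)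
  \<comment> \<open>i j is the action of \<iota> 1. By linearity it moves through f and H onto the
    inflated module, where it acts as \<pi> (\<iota> 1) = 1.\<close>
  have wu: "w n (u n f) = (\<lambda>p\<in>carrier (P n). f (?HF n p))" if f: "f \<in> mod_hom R (P n) N" for n f
    unfolding w_def u_def
  proof (rule restrict_ext)
    fix p assume p: "p \<in> carrier (P n)"
    have Fp: "F n p \<in> carrier (Q n)" using Fc[OF p] .
    have one: "\<iota> \<one>\<^bsub>R'\<^esub> \<in> carrier R" by (rule iota_closed) simp
    have "\<iota> \<one>\<^bsub>R'\<^esub> \<odot>\<^bsub>N\<^esub> f (H n (F n p)) = f (H n (\<iota> \<one>\<^bsub>R'\<^esub> \<odot>\<^bsub>inflate (Q n)\<^esub> F n p))"
      using one Fp Hc mod_hom_smult[OF H one, of "F n p" n] mod_hom_smult[OF f one] by simp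
    also have "\<iota> \<one>\<^bsub>R'\<^esub> \<odot>\<^bsub>inflate (Q n)\<^esub> F n p = F n p"
      using Fp left_module.smult_one[OF M.P_module Fp] by (simp add: pi_iota)
    finally show "i ((\<lambda>q\<in>carrier (Q n). j (f (H n q))) (F n p)) = f (?HF n p)"
      using p Fp Hc mod_hom_closed[OF f] by (simp add: ij compose_eq)
  qed
  have uw: "u n (w n h) = (\<lambda>q\<in>carrier (Q n). h (?FH n q))" if h: "h \<in> mod_hom R' (Q n) M" for n h
    unfolding w_def u_def using Hc Fc mod_hom_closed[OF h]
    by (intro restrict_ext) (simp add: ji compose_eq)
  have "\<exists>\<phi>. linear_iso (Ext R P d N m) (Ext R' Q d' M m) \<phi> \<and>
    (\<forall>f\<in>cocycles R P d N m. \<phi> (Ext_class R P d N m f) = Ext_class R' Q d' M m (u m f))"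
  proof (rule Ext_iso[OF N M, where w = "w m"])
    show "u m (f \<oplus>\<^bsub>N.V m\<^esub> g) = u m f \<oplus>\<^bsub>M.V m\<^esub> u m g"
      if "f \<in> mod_hom R (P m) N" "g \<in> mod_hom R (P m) N" for f g
      using that Hc by (auto simp: u_def N.add_V M.add_V mod_hom_closed j(2) intro!: restrict_ext)
    show "w m (f \<oplus>\<^bsub>M.V m\<^esub> g) = w m f \<oplus>\<^bsub>N.V m\<^esub> w m g"
      if "f \<in> mod_hom R' (Q m) M" "g \<in> mod_hom R' (Q m) M" for f g
      using that Fc by (auto simp: w_def N.add_V M.add_V mod_hom_closed i(2) intro!: restrict_ext)
    show "u m (c \<odot>\<^bsub>N.V m\<^esub> f) = c \<odot>\<^bsub>M.V m\<^esub> u m f" if "f \<in> mod_hom R (P m) N" for f c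
      using that Hc N.scalar_closed
      by (auto simp: u_def N.smult_V M.smult_V mod_hom_closed j(3) scalar intro!: restrict_ext)
    show "u m f \<in> cocycles R' Q d' M m" if "f \<in> cocycles R P d N m" for f
      using that u_hom d'c Hc Hd[symmetric] by (auto simp: N.cocycles_iff M.cocycles_iff) (simp add: u_def j0)
    show "w m f \<in> cocycles R P d N m" if "f \<in> cocycles R' Q d' M m" for f
      using that w_hom dc Fc Fd[symmetric] by (auto simp: N.cocycles_iff M.cocycles_iff) (simp add: w_def i0)
    show "u m f \<in> coboundaries R' Q d' M m" if "f \<in> coboundaries R P d N m" for f
    proof (cases m)
      case 0
      then show ?thesis using that Hc by (auto simp: u_def N.zero_V M.zero_V j0 intro!: restrict_ext)
    next
      case (Suc k)
      then show ?thesis using that u_hom by (auto simp: u_d)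
    qed
    show "w m f \<in> coboundaries R P d N m" if "f \<in> coboundaries R' Q d' M m" for f
    proof (cases m)
      case 0
      then show ?thesis using that Fc by (auto simp: w_def N.zero_V M.zero_V i0 intro!: restrict_ext)
    next
      case (Suc k)
      then show ?thesis using that w_hom by (auto simp: w_d)
    qed
    show "\<exists>b\<in>coboundaries R P d N m. w m (u m f) = b \<oplus>\<^bsub>N.V m\<^esub> f" if f: "f \<in> cocycles R P d N m" for f
      unfolding wu[OF subsetD[OF N.cocycles_subset f]]
      by (rule N.chain_homotopy_cohomologous[OF mod_hom_closed[OF HF] s f])
    show "\<exists>b\<in>coboundaries R' Q d' M m. u m (w m h) = b \<oplus>\<^bsub>M.V m\<^esub> h" if h: "h \<in> cocycles R' Q d' M m" for h
      unfolding uw[OF subsetD[OF M.cocycles_subset h]]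
      using mod_hom_closed[OF FH] by (intro M.chain_homotopy_cohomologous[OF _ t' t(2,3) h]) auto
  qed (simp_all add: u_hom w_hom)
  then obtain \<phi> where \<phi>: "linear_iso (Ext R P d N m) (Ext R' Q d' M m) \<phi>"
    "\<And>f. f \<in> cocycles R P d N m \<Longrightarrow> \<phi> (N.cls m f) = M.cls m (u m f)" by blast
  have "\<phi> (Ext_map R P d N m \<theta> X) = Ext_map R' Q d' M m \<eta> (\<phi> X)"
    if th: "restrict \<theta> (carrier N) \<in> mod_hom R N N" and et: "restrict \<eta> (carrier M) \<in> mod_hom R' M M"
      and j\<theta>: "\<And>x. x \<in> carrier N \<Longrightarrow> j (\<theta> x) = \<eta> (j x)" and X: "X \<in> carrier (Ext R P d N m)" for \<theta> \<eta> X
  proof -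
    obtain f where f: "f \<in> cocycles R P d N m" "X = N.cls m f" using N.Ext_carrierE[OF X] by blast
    then have fh: "f \<in> mod_hom R (P m) N" using N.cocycles_subset by auto
    have "u m (compose (carrier (P m)) \<theta> f) = compose (carrier (Q m)) \<eta> (u m f)"
      using Hc mod_hom_closed[OF fh] j\<theta> by (auto simp: u_def compose_def intro!: restrict_ext)
    then show ?thesis
      using f fh th et by (simp add: N.Ext_map_cls M.Ext_map_cls \<phi> N.compose_cocycles u_hom)
  qed
  then show ?thesis using \<phi>(1) by blast
qed

section \<open>Based algebras and modules\<close>

lemma lin_space_finite: "finite X \<Longrightarrow> lin_space X = {v. \<forall>x. x \<notin> X \<longrightarrow> v x = 0}"
  by (auto simp: lin_space_def intro: finite_subset)

lemma lin_spaceI: "\<lbrakk>finite X; \<And>x. x \<notin> X \<Longrightarrow> v x = 0\<rbrakk> \<Longrightarrow> v \<in> lin_space X"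
  by (simp add: lin_space_finite)

lemma lin_space_outside: "\<lbrakk>v \<in> lin_space X; x \<notin> X\<rbrakk> \<Longrightarrow> v x = 0"
  by (auto simp: lin_space_def)

lemma bilin_ext_eq:
  assumes "finite Y" "finite X" "r \<in> lin_space Y" "v \<in> lin_space X"
  shows "bilin_ext \<beta> r v z = (\<Sum>y\<in>Y. \<Sum>x\<in>X. r y * v x * \<beta> y x z)"
proof -
  have "(\<Sum>x | v x \<noteq> 0. r y * v x * \<beta> y x z) = (\<Sum>x\<in>X. r y * v x * \<beta> y x z)" for y
    using assms by (intro sum.mono_neutral_left) (auto simp: lin_space_def)
  then have "bilin_ext \<beta> r v z = (\<Sum>y | r y \<noteq> 0. \<Sum>x\<in>X. r y * v x * \<beta> y x z)"
    by (simp add: bilin_ext_def)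
  also have "\<dots> = (\<Sum>y\<in>Y. \<Sum>x\<in>X. r y * v x * \<beta> y x z)"
    using assms by (intro sum.mono_neutral_left) (auto simp: lin_space_def)
  finally show ?thesis .
qed

lemma lin_ext_eq:
  assumes "finite X" "v \<in> lin_space X"
  shows "lin_ext \<phi> v z = (\<Sum>x\<in>X. v x * \<phi> x z)"
  unfolding lin_ext_def using assms by (intro sum.mono_neutral_left) (auto simp: lin_space_def)

lemma lin_ext_basis_apply:
  assumes "finite X" "v \<in> lin_space X" "inj_on t X" "x \<in> X"
  shows "lin_ext (\<lambda>x. basis_vec (t x)) v (t x) = v x"
proof -
  have "lin_ext (\<lambda>x. basis_vec (t x)) v (t x) = (\<Sum>y\<in>X. if y = x then v y else 0)"
    unfolding lin_ext_eq[OF assms(1,2)]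
    using assms(3,4) by (intro sum.cong) (auto simp: basis_vec_def inj_on_eq_iff)
  then show ?thesis using assms by simp
qed

lemma lin_ext_basis_in_lin_space:
  assumes "finite X" "v \<in> lin_space X" "t ` X \<subseteq> X"
  shows "lin_ext (\<lambda>x. basis_vec (t x)) v \<in> lin_space X"
proof (rule lin_spaceI)
  fix z assume "z \<notin> X"
  then show "lin_ext (\<lambda>x. basis_vec (t x)) v z = 0"
    using assms(3) unfolding lin_ext_eq[OF assms(1,2)]
    by (intro sum.neutral) (auto simp: basis_vec_def)
qed fact

lemma based_module_simps:
  "carrier (based_module X \<beta>) = lin_space X"
  "\<zero>\<^bsub>based_module X \<beta>\<^esub> = (\<lambda>_. 0)"
  "v \<oplus>\<^bsub>based_module X \<beta>\<^esub> w = (\<lambda>x. v x + w x)"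
  "r \<odot>\<^bsub>based_module X \<beta>\<^esub> v = bilin_ext \<beta> r v"
  by (simp_all add: based_module_def)

lemma based_algebra_simps:
  "carrier (based_algebra Y \<mu> u) = lin_space Y"
  "\<zero>\<^bsub>based_algebra Y \<mu> u\<^esub> = (\<lambda>_. 0)"
  "\<one>\<^bsub>based_algebra Y \<mu> u\<^esub> = u"
  "v \<oplus>\<^bsub>based_algebra Y \<mu> u\<^esub> w = (\<lambda>x. v x + w x)"
  "r \<otimes>\<^bsub>based_algebra Y \<mu> u\<^esub> v = bilin_ext \<mu> r v"
  by (simp_all add: based_algebra_def)

lemma abelian_group_based_module:
  assumes "finite X"
  shows "abelian_group (based_module X \<beta>)"
proof (rule abelian_groupI)
  fix v assume "v \<in> carrier (based_module X \<beta>)"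
  then show "\<exists>w\<in>carrier (based_module X \<beta>). w \<oplus>\<^bsub>based_module X \<beta>\<^esub> v = \<zero>\<^bsub>based_module X \<beta>\<^esub>"
    using assms by (intro bexI[of _ "\<lambda>x. - v x"]) (auto simp: based_module_simps lin_space_finite)
qed (use assms in \<open>auto simp: based_module_simps lin_space_finite ac_simps\<close>)

lemma bilin_ext_smult:
  fixes \<mu> :: "'y \<Rightarrow> 'x \<Rightarrow> 'z \<Rightarrow> 'k::field"
  shows "bilin_ext \<mu> (\<lambda>b. c * r b) v z = c * bilin_ext \<mu> r v z"
    and "bilin_ext \<mu> r (\<lambda>b. c * v b) z = c * bilin_ext \<mu> r v z"
  by (cases "c = 0"; simp add: bilin_ext_def sum_distrib_left mult_ac)+

lemma based_algebra_scalar_closed: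
  assumes "ring (based_algebra Y \<mu> u)"
  shows "(\<lambda>b. c * \<one>\<^bsub>based_algebra Y \<mu> u\<^esub> b) \<in> carrier (based_algebra Y \<mu> u)"
  using monoid.one_closed[OF ring.is_monoid[OF assms]]
  by (auto simp: based_algebra_simps lin_space_def intro: finite_subset)

lemma based_algebra_scalar_central:
  assumes "ring (based_algebra Y \<mu> u)" "a \<in> carrier (based_algebra Y \<mu> u)"
  shows "a \<otimes>\<^bsub>based_algebra Y \<mu> u\<^esub> (\<lambda>b. c * \<one>\<^bsub>based_algebra Y \<mu> u\<^esub> b) =
    (\<lambda>b. c * \<one>\<^bsub>based_algebra Y \<mu> u\<^esub> b) \<otimes>\<^bsub>based_algebra Y \<mu> u\<^esub> a"
  using monoid.r_one[OF ring.is_monoid[OF assms(1)] assms(2)] monoid.l_one[OF ring.is_monoid[OF assms(1)] assms(2)]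
  by (simp add: based_algebra_simps bilin_ext_smult fun_eq_iff)

text \<open>The ring axioms of the algebra are part of \<open>left_module\<close> and are taken from
  N; centrality of the scalars then follows from the unit laws and bilinearity.\<close>

lemma ext_complex_based_algebra:
  assumes "projective_resolution (based_algebra Y \<mu> u) T P d \<epsilon>" and "left_module (based_algebra Y \<mu> u) N"
  shows "ext_complex (based_algebra Y \<mu> u) P d N"
  using assms left_module_ring[OF assms(2)]
  by (intro ext_complex.intro based_algebra_scalar_closed based_algebra_scalar_central)
    (auto simp: projective_resolution_def projective_module_def)

lemma (in group) inv_mult_cancel: "\<lbrakk>a \<in> carrier G; b \<in> carrier G\<rbrakk> \<Longrightarrow> inv a \<otimes> (a \<otimes> b) = b"
  by (metis inv_closed l_inv l_one m_assoc)

section \<open>Finite sets with a group action\<close>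

locale finite_gset = group G for G :: "('g, 'c) monoid_scheme" (structure) +
  fixes X :: "'x set" and act :: "'g \<Rightarrow> 'x \<Rightarrow> 'x"
  assumes finite_G: "finite (carrier G)" and finite_X: "finite X"
    and act_closed: "\<lbrakk>a \<in> carrier G; x \<in> X\<rbrakk> \<Longrightarrow> act a x \<in> X"
    and act_mult: "\<lbrakk>a \<in> carrier G; b \<in> carrier G; x \<in> X\<rbrakk> \<Longrightarrow> act (a \<otimes> b) x = act a (act b x)"
    and act_one: "x \<in> X \<Longrightarrow> act \<one> x = x"
begin

lemma act_inv_act: "\<lbrakk>a \<in> carrier G; x \<in> X\<rbrakk> \<Longrightarrow> act (inv a) (act a x) = x"
  using act_mult[of "inv a" a x] by (simp add: act_one)

lemma act_act_inv: "\<lbrakk>a \<in> carrier G; x \<in> X\<rbrakk> \<Longrightarrow> act a (act (inv a) x) = x"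
  using act_mult[of a "inv a" x] by (simp add: act_one)

lemma act_eq_iff: "\<lbrakk>a \<in> carrier G; x \<in> X; z \<in> X\<rbrakk> \<Longrightarrow> z = act a x \<longleftrightarrow> x = act (inv a) z"
  using act_inv_act act_act_inv by auto

lemma sum_translate:
  fixes f :: "'g \<Rightarrow> 'k::comm_monoid_add"
  assumes "a \<in> carrier G"
  shows "(\<Sum>b\<in>carrier G. f (a \<otimes> b)) = (\<Sum>b\<in>carrier G. f b)"
  using assms by (intro sum.reindex_bij_witness[of _ "\<lambda>b. inv a \<otimes> b" "\<lambda>b. a \<otimes> b"]) (auto simp: m_assoc[symmetric])

text \<open>The coefficient at z collects from each a the single x with a x = z, namely a^-1
  z.\<close>

lemma bilin_ext_act:
  fixes r :: "'g \<Rightarrow> 'k::field"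
  assumes "r \<in> lin_space (carrier G)" "v \<in> lin_space X"
  shows "bilin_ext (\<lambda>a x. basis_vec (act a x)) r v z =
    (if z \<in> X then \<Sum>a\<in>carrier G. r a * v (act (inv a) z) else 0)"
proof (cases "z \<in> X")
  case True
  have "(\<Sum>x\<in>X. r a * v x * basis_vec (act a x) z) = r a * v (act (inv a) z)" if a: "a \<in> carrier G" for a
  proof -
    have "(\<Sum>x\<in>X. r a * v x * basis_vec (act a x) z) = (\<Sum>x\<in>X. if x = act (inv a) z then r a * v x else 0)"
      using True a by (intro sum.cong) (auto simp: basis_vec_def act_eq_iff[OF a _ True])
    then show ?thesis using finite_X True a act_closed by simp
  qed
  then show ?thesis using True by (simp add: bilin_ext_eq[OF finite_G finite_X assms])
next
  case False
  have "r a * v x * basis_vec (act a x) z = 0" if "a \<in> carrier G" "x \<in> X" for a x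
    using False act_closed[OF that] by (auto simp: basis_vec_def)
  then show ?thesis using False by (auto simp: bilin_ext_eq[OF finite_G finite_X assms] intro!: sum.neutral)
qed

end

text \<open>A crossed G-set. Its linearization is a Yetter-Drinfeld module, that is, a module over
  the double, with a homogeneous basis that the group permutes. The double itself, the tensor powers
  of its dual, and the representation variety with f \<mapsto> f c as degree are all of this
  form.\<close>

locale graded_gset = finite_gset +
  fixes deg :: "'x \<Rightarrow> 'g"
  assumes deg_closed: "x \<in> X \<Longrightarrow> deg x \<in> carrier G"
    and deg_act: "\<lbrakk>a \<in> carrier G; x \<in> X\<rbrakk> \<Longrightarrow> deg (act a x) = a \<otimes> deg x \<otimes> inv a"
begin

text \<open>The basis element (h, a) acts by a and then projects onto degree h, so at z the
  contributions come from h = deg z and x = a^-1 z. The shape of \<beta> is asked on the carriers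
  only, so that formulas of quite different form can be matched with it.\<close>

lemma bilin_ext_graded:
  fixes r :: "'g \<times> 'g \<Rightarrow> 'k::field"
  assumes "r \<in> lin_space (carrier G \<times> carrier G)" "v \<in> lin_space X"
    and \<beta>: "\<And>h a x. \<lbrakk>h \<in> carrier G; a \<in> carrier G; x \<in> X\<rbrakk> \<Longrightarrow>
      \<beta> (h, a) x = (if h = deg (act a x) then basis_vec (act a x) else (\<lambda>_. 0))"
  shows "bilin_ext \<beta> r v z = (if z \<in> X then \<Sum>a\<in>carrier G. r (deg z, a) * v (act (inv a) z) else 0)"
proof -
  have eq: "bilin_ext \<beta> r v z = (\<Sum>h\<in>carrier G. \<Sum>a\<in>carrier G. \<Sum>x\<in>X. r (h, a) * v x * \<beta> (h, a) x z)"
    by (simp add: bilin_ext_eq[OF finite_cartesian_product[OF finite_G finite_G] finite_X assms(1,2)]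
        sum.cartesian_product')
  show ?thesis
  proof (cases "z \<in> X")
    case True
    have "(\<Sum>x\<in>X. r (h, a) * v x * \<beta> (h, a) x z) = (if h = deg z then r (deg z, a) * v (act (inv a) z) else 0)"
      if a: "h \<in> carrier G" "a \<in> carrier G" for h a
    proof -
      have "(\<Sum>x\<in>X. r (h, a) * v x * \<beta> (h, a) x z) =
          (\<Sum>x\<in>X. if x = act (inv a) z then (if h = deg z then r (h, a) * v x else 0) else 0)"
        using True a act_act_inv by (intro sum.cong) (auto simp: \<beta> basis_vec_def act_eq_iff[OF a(2) _ True])
      then show ?thesis using finite_X True a act_closed by simp
    qed
    then have "bilin_ext \<beta> r v z =
        (\<Sum>h\<in>carrier G. \<Sum>a\<in>carrier G. if h = deg z then r (deg z, a) * v (act (inv a) z) else 0)"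
      using eq by simp
    also have "\<dots> = (\<Sum>a\<in>carrier G. \<Sum>h\<in>carrier G. if h = deg z then r (deg z, a) * v (act (inv a) z) else 0)"
      by (rule sum.swap)
    finally show ?thesis using finite_G True deg_closed by simp
  next
    case False
    have "r (h, a) * v x * \<beta> (h, a) x z = 0" if "h \<in> carrier G" "a \<in> carrier G" "x \<in> X" for h a x
      using False act_closed[OF that(2,3)] that by (auto simp: \<beta> basis_vec_def)
    then show ?thesis using False by (auto simp: eq intro!: sum.neutral)
  qed
qed

end

section \<open>The group algebra and its permutation modules\<close>

text \<open>With left multiplication as action, the product of the group algebra becomes an instance
  of \<open>bilin_ext_act\<close>, which yields the convolution formula.\<close>

lemma (in group) finite_gset_left_mult:
  "finite (carrier G) \<Longrightarrow> finite_gset G (carrier G) (\<lambda>a b. a \<otimes> b)"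
  by unfold_locales (auto simp: m_assoc)

lemma carrier_group_algebra [simp]: "carrier (group_algebra G) = lin_space (carrier G)"
  by (simp add: group_algebra_def based_algebra_simps)

lemma add_group_algebra [simp]: "r \<oplus>\<^bsub>group_algebra G\<^esub> s = (\<lambda>a. r a + s a)"
  by (simp add: group_algebra_def based_algebra_simps)

lemma one_group_algebra [simp]: "\<one>\<^bsub>group_algebra G\<^esub> = basis_vec \<one>\<^bsub>G\<^esub>"
  by (simp add: group_algebra_def based_algebra_simps)

lemma zero_group_algebra [simp]: "\<zero>\<^bsub>group_algebra G\<^esub> = (\<lambda>_. 0)"
  by (simp add: group_algebra_def based_algebra_simps)

lemma (in group) mult_group_algebra:
  fixes r s :: "'a \<Rightarrow> 'k::field"
  assumes "finite (carrier G)" "r \<in> lin_space (carrier G)" "s \<in> lin_space (carrier G)"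
  shows "(r \<otimes>\<^bsub>group_algebra G\<^esub> s) c = (if c \<in> carrier G then \<Sum>a\<in>carrier G. r a * s (inv a \<otimes> c) else 0)"
proof -
  interpret finite_gset G "carrier G" "\<lambda>a b. a \<otimes> b" using finite_gset_left_mult[OF assms(1)] .
  show ?thesis using bilin_ext_act[OF assms(2,3), of c] by (simp add: group_algebra_def based_algebra_simps)
qed

context finite_gset
begin

abbreviation perm_module :: "('g \<Rightarrow> 'k::field, 'x \<Rightarrow> 'k) module" where
  "perm_module \<equiv> based_module X (\<lambda>a x. basis_vec (act a x))"

lemma smult_perm_module:
  fixes r :: "'g \<Rightarrow> 'k::field"
  assumes "r \<in> lin_space (carrier G)" "v \<in> lin_space X"
  shows "(r \<odot>\<^bsub>perm_module\<^esub> v) z = (if z \<in> X then \<Sum>a\<in>carrier G. r a * v (act (inv a) z) else 0)"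
  using bilin_ext_act[OF assms] by (simp add: based_module_simps)

text \<open>The axiom with content is associativity, where the double sum over a and k becomes one
  over a and b by the substitution k = a b.\<close>

lemma left_module_perm_module:
  assumes "ring (group_algebra G :: ('g \<Rightarrow> 'k::field) ring)"
  shows "left_module (group_algebra G) (perm_module :: ('g \<Rightarrow> 'k, 'x \<Rightarrow> 'k) module)"
proof -
  let ?R = "group_algebra G :: ('g \<Rightarrow> 'k) ring" and ?M = "perm_module :: ('g \<Rightarrow> 'k, 'x \<Rightarrow> 'k) module"
  interpret R: ring ?R by fact
  interpret M: abelian_group ?M by (rule abelian_group_based_module[OF finite_X])
  have cM: "carrier ?M = lin_space X" by (simp add: based_module_simps)
  have aM: "v \<oplus>\<^bsub>?M\<^esub> w = (\<lambda>x. v x + w x)" for v w by (simp add: based_module_simps)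
  have cl: "r \<odot>\<^bsub>?M\<^esub> v \<in> lin_space X" if "r \<in> lin_space (carrier G)" "v \<in> lin_space X" for r v
    by (rule lin_spaceI[OF finite_X]) (simp add: smult_perm_module[OF that])
  note m = smult_perm_module
  {
    fix r s v w assume "r \<in> carrier ?R" "v \<in> carrier ?M" "s \<in> carrier ?R" "w \<in> carrier ?M"
    then have [simp]: "r \<in> lin_space (carrier G)" "v \<in> lin_space X" "s \<in> lin_space (carrier G)" "w \<in> lin_space X"
      by (simp_all add: cM)
    have [simp]: "(\<lambda>x. v x + w x) \<in> lin_space X"
      using M.a_closed[of v w] by (simp add: cM aM)
    have [simp]: "(\<lambda>x. r x + s x) \<in> lin_space (carrier G)"
      using R.a_closed[of r s] by simp
    have rs: "r \<otimes>\<^bsub>?R\<^esub> s \<in> lin_space (carrier G)" using R.m_closed[of r s] by simp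
    have closed: "r \<odot>\<^bsub>?M\<^esub> v \<in> carrier ?M" by (simp add: cM cl)
    have l_distr: "(r \<oplus>\<^bsub>?R\<^esub> s) \<odot>\<^bsub>?M\<^esub> v = r \<odot>\<^bsub>?M\<^esub> v \<oplus>\<^bsub>?M\<^esub> s \<odot>\<^bsub>?M\<^esub> v"
      by (auto simp: fun_eq_iff aM m sum.distrib distrib_right)
    have r_distr: "r \<odot>\<^bsub>?M\<^esub> (v \<oplus>\<^bsub>?M\<^esub> w) = r \<odot>\<^bsub>?M\<^esub> v \<oplus>\<^bsub>?M\<^esub> r \<odot>\<^bsub>?M\<^esub> w"
      by (auto simp: fun_eq_iff aM m sum.distrib distrib_left)
    have assoc: "(r \<otimes>\<^bsub>?R\<^esub> s) \<odot>\<^bsub>?M\<^esub> v = r \<odot>\<^bsub>?M\<^esub> (s \<odot>\<^bsub>?M\<^esub> v)"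
    proof
      fix z
      show "((r \<otimes>\<^bsub>?R\<^esub> s) \<odot>\<^bsub>?M\<^esub> v) z = (r \<odot>\<^bsub>?M\<^esub> (s \<odot>\<^bsub>?M\<^esub> v)) z"
      proof (cases "z \<in> X")
        case z: True
        have "((r \<otimes>\<^bsub>?R\<^esub> s) \<odot>\<^bsub>?M\<^esub> v) z =
            (\<Sum>k\<in>carrier G. \<Sum>a\<in>carrier G. r a * s (inv a \<otimes> k) * v (act (inv k) z))"
          using z by (simp add: m[OF rs] mult_group_algebra[OF finite_G] sum_distrib_right)
        also have "\<dots> = (\<Sum>a\<in>carrier G. \<Sum>k\<in>carrier G. r a * s (inv a \<otimes> k) * v (act (inv k) z))"
          by (rule sum.swap)
        also have "\<dots> = (\<Sum>a\<in>carrier G. \<Sum>b\<in>carrier G. r a * s b * v (act (inv (a \<otimes> b)) z))"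
        proof (rule sum.cong)
          fix a assume a: "a \<in> carrier G"
          show "(\<Sum>k\<in>carrier G. r a * s (inv a \<otimes> k) * v (act (inv k) z)) =
              (\<Sum>b\<in>carrier G. r a * s b * v (act (inv (a \<otimes> b)) z))"
            unfolding sum_translate[OF a, of "\<lambda>k. r a * s (inv a \<otimes> k) * v (act (inv k) z)", symmetric]
            by (rule sum.cong) (simp_all add: inv_mult_cancel a)
        qed simp
        also have "\<dots> = (\<Sum>a\<in>carrier G. r a * (s \<odot>\<^bsub>?M\<^esub> v) (act (inv a) z))"
          using z by (intro sum.cong) (simp_all add: m act_closed sum_distrib_left inv_mult_group act_mult mult_ac)
        also have "\<dots> = (r \<odot>\<^bsub>?M\<^esub> (s \<odot>\<^bsub>?M\<^esub> v)) z"
          using z by (simp add: m cl)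
        finally show ?thesis .
      qed (use rs cl in \<open>simp add: m\<close>)
    qed
    have one: "basis_vec \<one> \<in> lin_space (carrier G)" by (rule lin_spaceI[OF finite_G]) (auto simp: basis_vec_def)
    have one: "\<one>\<^bsub>?R\<^esub> \<odot>\<^bsub>?M\<^esub> v = v"
    proof
      fix z
      have "(\<Sum>a\<in>carrier G. basis_vec \<one> a * v (act (inv a) z)) = (\<Sum>a\<in>carrier G. if a = \<one> then v (act (inv a) z) else 0)"
        by (intro sum.cong) (auto simp: basis_vec_def)
      then show "(\<one>\<^bsub>?R\<^esub> \<odot>\<^bsub>?M\<^esub> v) z = v z"
        using finite_G lin_space_outside[of v X z] by (simp add: m[OF one] act_one)
    qed
    note closed l_distr r_distr assoc one
  }
  note block = this
  show ?thesis
  proof unfold_locales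
    fix a x assume ax: "a \<in> carrier ?R" "x \<in> carrier ?M"
    show "a \<odot>\<^bsub>?M\<^esub> x \<in> carrier ?M" by (rule block(1)[OF ax ax])
  next
    fix a b x assume abx: "a \<in> carrier ?R" "b \<in> carrier ?R" "x \<in> carrier ?M"
    show "(a \<oplus>\<^bsub>?R\<^esub> b) \<odot>\<^bsub>?M\<^esub> x = a \<odot>\<^bsub>?M\<^esub> x \<oplus>\<^bsub>?M\<^esub> b \<odot>\<^bsub>?M\<^esub> x"
      by (rule block(2)[OF abx(1,3,2,3)])
    show "(a \<otimes>\<^bsub>?R\<^esub> b) \<odot>\<^bsub>?M\<^esub> x = a \<odot>\<^bsub>?M\<^esub> (b \<odot>\<^bsub>?M\<^esub> x)"
      by (rule block(4)[OF abx(1,3,2,3)])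
  next
    fix a x y assume axy: "a \<in> carrier ?R" "x \<in> carrier ?M" "y \<in> carrier ?M"
    show "a \<odot>\<^bsub>?M\<^esub> (x \<oplus>\<^bsub>?M\<^esub> y) = a \<odot>\<^bsub>?M\<^esub> x \<oplus>\<^bsub>?M\<^esub> a \<odot>\<^bsub>?M\<^esub> y"
      by (rule block(3)[OF axy(1,2,1,3)])
  next
    fix x assume x: "x \<in> carrier ?M"
    show "\<one>\<^bsub>?R\<^esub> \<odot>\<^bsub>?M\<^esub> x = x" by (rule block(5)[OF R.zero_closed x R.zero_closed x])
  qed
qed

text \<open>On a finite set an injective self-map is a permutation, so a vector is determined by its
  values at the points t x, and there the linear extension of t has the coefficients of v.
  Equalities of permuted vectors are proved in this way below.\<close>

lemma lin_ext_basis_surj: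
  assumes t: "inj_on t X" "t ` X \<subseteq> X" and v: "v \<in> lin_space X"
    and w: "w \<in> lin_space X" and eq: "\<And>x. x \<in> X \<Longrightarrow> w (t x) = v x"
  shows "lin_ext (\<lambda>x. basis_vec (t x)) v = (w :: 'x \<Rightarrow> 'k::field)"
proof
  fix z
  show "lin_ext (\<lambda>x. basis_vec (t x)) v z = w z"
  proof (cases "z \<in> X")
    case True
    then obtain x where "x \<in> X" "z = t x" using endo_inj_surj[OF finite_X t(2,1)] by blast
    then show ?thesis using lin_ext_basis_apply[OF finite_X v t(1)] eq by simp
  next
    case False
    then show ?thesis
      using lin_space_outside[OF lin_ext_basis_in_lin_space[OF finite_X v t(2)]] lin_space_outside[OF w] by simp
  qed
qed

lemma lin_ext_basis_add:
  assumes t: "inj_on t X" "t ` X \<subseteq> X" and v: "v \<in> lin_space X" "w \<in> lin_space X"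
  shows "lin_ext (\<lambda>x. basis_vec (t x)) (\<lambda>x. v x + w x) =
    (\<lambda>z. lin_ext (\<lambda>x. basis_vec (t x)) v z + (lin_ext (\<lambda>x. basis_vec (t x)) w z :: 'k::field))"
proof (rule lin_ext_basis_surj[OF t])
  show "(\<lambda>x. v x + w x) \<in> lin_space X" using v finite_X by (simp add: lin_space_finite)
  show "(\<lambda>z. lin_ext (\<lambda>x. basis_vec (t x)) v z + lin_ext (\<lambda>x. basis_vec (t x)) w z) \<in> lin_space X"
    using lin_ext_basis_in_lin_space[OF finite_X v(1) t(2)] lin_ext_basis_in_lin_space[OF finite_X v(2) t(2)]
    by (intro lin_spaceI[OF finite_X]) (simp add: lin_space_outside)
qed (simp add: lin_ext_basis_apply[OF finite_X _ t(1)] v)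

text \<open>Both sides are compared at the points t x, where equivariance turns a^-1 (t x) into t
  (a^-1 x).\<close>

lemma perm_module_hom:
  assumes t: "inj_on t X" "t ` X \<subseteq> X"
    and eq: "\<And>a x. \<lbrakk>a \<in> carrier G; x \<in> X\<rbrakk> \<Longrightarrow> act a (t x) = t (act a x)"
    and R: "ring (group_algebra G :: ('g \<Rightarrow> 'k::field) ring)"
  shows "restrict (lin_ext (\<lambda>x. basis_vec (t x))) (carrier perm_module)
    \<in> mod_hom (group_algebra G) perm_module (perm_module :: ('g \<Rightarrow> 'k, 'x \<Rightarrow> 'k) module)"
proof -
  let ?M = "perm_module :: ('g \<Rightarrow> 'k, 'x \<Rightarrow> 'k) module" and ?L = "lin_ext (\<lambda>x. basis_vec (t x))"
  interpret M: left_module "group_algebra G" ?M by (rule left_module_perm_module[OF R])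
  have cM: "carrier ?M = lin_space X" by (simp add: based_module_simps)
  note Lc = lin_ext_basis_in_lin_space[OF finite_X _ t(2)]
  show ?thesis
  proof (rule mod_homI)
    fix r v assume rv: "r \<in> carrier (group_algebra G :: ('g \<Rightarrow> 'k) ring)" "v \<in> carrier ?M"
    then have rv': "r \<in> lin_space (carrier G)" "v \<in> lin_space X" by (simp_all add: cM)
    have rvc: "r \<odot>\<^bsub>?M\<^esub> v \<in> lin_space X" using M.smult_closed[OF rv] by (simp add: cM)
    have rLc: "r \<odot>\<^bsub>?M\<^esub> ?L v \<in> lin_space X" using M.smult_closed[OF rv(1), of "?L v"] Lc[OF rv'(2)] by (simp add: cM)
    have "?L (r \<odot>\<^bsub>?M\<^esub> v) = r \<odot>\<^bsub>?M\<^esub> ?L v"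
    proof (rule lin_ext_basis_surj[OF t rvc rLc])
      fix x assume x: "x \<in> X"
      then have "t x \<in> X" using t by auto
      then show "(r \<odot>\<^bsub>?M\<^esub> ?L v) (t x) = (r \<odot>\<^bsub>?M\<^esub> v) x"
        using x by (simp add: smult_perm_module rv' Lc eq act_closed lin_ext_basis_apply[OF finite_X _ t(1)])
    qed
    then show "restrict ?L (carrier ?M) (r \<odot>\<^bsub>?M\<^esub> v) = r \<odot>\<^bsub>?M\<^esub> restrict ?L (carrier ?M) v"
      using rvc rv' by (simp add: cM)
  next
    fix v w assume "v \<in> carrier ?M" "w \<in> carrier ?M"
    then show "restrict ?L (carrier ?M) (v \<oplus>\<^bsub>?M\<^esub> w) = restrict ?L (carrier ?M) v \<oplus>\<^bsub>?M\<^esub> restrict ?L (carrier ?M) w"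
      using M.M.a_closed[of v w] by (simp add: cM) (simp add: based_module_simps lin_ext_basis_add[OF t])
  qed (use Lc cM in auto)
qed

end

section \<open>The Drinfel'd double and its graded permutation modules\<close>

text \<open>The left regular module of the double is of the graded form: b sends \<delta>_c
  \<otimes> d to \<delta>_{bcb^-1} \<otimes> bd, and \<delta>_c \<otimes> d has degree c. This gives
  the convolution formula for its product.\<close>

lemma (in group) graded_gset_double:
  assumes "finite (carrier G)"
  shows "graded_gset G (carrier G \<times> carrier G) (\<lambda>b (c, d). (b \<otimes> c \<otimes> inv b, b \<otimes> d)) fst"
  using assms by unfold_locales (auto simp: m_assoc inv_mult_group)

lemma carrier_drinfeld_double [simp]: "carrier (drinfeld_double G) = lin_space (carrier G \<times> carrier G)"
  by (simp add: drinfeld_double_def based_algebra_simps)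

lemma add_drinfeld_double [simp]: "r \<oplus>\<^bsub>drinfeld_double G\<^esub> s = (\<lambda>a. r a + s a)"
  by (simp add: drinfeld_double_def based_algebra_simps)

lemma one_drinfeld_double [simp]:
  "\<one>\<^bsub>drinfeld_double G\<^esub> = (\<lambda>(a, b). if a \<in> carrier G \<and> b = \<one>\<^bsub>G\<^esub> then 1 else 0)"
  by (simp add: drinfeld_double_def based_algebra_simps)

lemma zero_drinfeld_double [simp]: "\<zero>\<^bsub>drinfeld_double G\<^esub> = (\<lambda>_. 0)"
  by (simp add: drinfeld_double_def based_algebra_simps)

lemma (in group) mult_drinfeld_double:
  fixes r s :: "'a \<times> 'a \<Rightarrow> 'k::field"
  assumes "finite (carrier G)" "r \<in> lin_space (carrier G \<times> carrier G)" "s \<in> lin_space (carrier G \<times> carrier G)"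
  shows "(r \<otimes>\<^bsub>drinfeld_double G\<^esub> s) (h, k) = (if h \<in> carrier G \<and> k \<in> carrier G
     then \<Sum>a\<in>carrier G. r (h, a) * s (inv a \<otimes> h \<otimes> a, inv a \<otimes> k) else 0)"
proof -
  interpret graded_gset G "carrier G \<times> carrier G" "\<lambda>b (c, d). (b \<otimes> c \<otimes> inv b, b \<otimes> d)" fst
    by (rule graded_gset_double[OF assms(1)])
  have "(r \<otimes>\<^bsub>drinfeld_double G\<^esub> s) (h, k) = bilin_ext (\<lambda>(a, b) (c, d). if a = b \<otimes> c \<otimes> inv b
      then basis_vec (a, b \<otimes> d) else (\<lambda>_. 0)) r s (h, k)"
    by (simp add: drinfeld_double_def based_algebra_simps)
  also have "\<dots> = (if (h, k) \<in> carrier G \<times> carrier G then \<Sum>a\<in>carrier G. r (fst (h, k), a) *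
      s (case (h, k) of (c, d) \<Rightarrow> (inv a \<otimes> c \<otimes> inv (inv a), inv a \<otimes> d)) else 0)"
    by (rule bilin_ext_graded[OF assms(2,3)]) auto
  finally show ?thesis by (simp cong: sum.cong)
qed

context graded_gset
begin

context
  fixes \<beta> :: "'g \<times> 'g \<Rightarrow> 'x \<Rightarrow> 'x \<Rightarrow> 'k::field"
  assumes \<beta>: "\<And>h a x. \<lbrakk>h \<in> carrier G; a \<in> carrier G; x \<in> X\<rbrakk> \<Longrightarrow>
      \<beta> (h, a) x = (if h = deg (act a x) then basis_vec (act a x) else (\<lambda>_. 0))"
    and R: "ring (drinfeld_double G :: ('g \<times> 'g \<Rightarrow> 'k) ring)"
begin

lemma smult_graded_module:
  assumes "r \<in> lin_space (carrier G \<times> carrier G)" "v \<in> lin_space X"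
  shows "(r \<odot>\<^bsub>based_module X \<beta>\<^esub> v) z =
    (if z \<in> X then \<Sum>a\<in>carrier G. r (deg z, a) * v (act (inv a) z) else 0)"
  unfolding based_module_simps by (rule bilin_ext_graded[OF assms \<beta>])

text \<open>As for the group algebra, associativity is the substitution k = a b. In addition, the
  degree of a^-1 z is a^-1 (deg z) a, which is the index that the convolution formula of the double
  has for its second factor.\<close>

lemma left_module_graded_module: "left_module (drinfeld_double G) (based_module X \<beta>)"
proof -
  let ?R = "drinfeld_double G :: ('g \<times> 'g \<Rightarrow> 'k) ring" and ?M = "based_module X \<beta>"
  let ?D = "carrier G \<times> carrier G"
  have finD: "finite ?D" using finite_G by simp
  interpret R: ring ?R by (rule R)
  interpret M: abelian_group ?M by (rule abelian_group_based_module[OF finite_X])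
  have cM: "carrier ?M = lin_space X" by (simp add: based_module_simps)
  have aM: "v \<oplus>\<^bsub>?M\<^esub> w = (\<lambda>x. v x + w x)" for v w by (simp add: based_module_simps)
  have cl: "r \<odot>\<^bsub>?M\<^esub> v \<in> lin_space X" if "r \<in> lin_space ?D" "v \<in> lin_space X" for r v
    by (rule lin_spaceI[OF finite_X]) (simp add: smult_graded_module[OF that])
  note m = smult_graded_module
  {
    fix r s v w assume "r \<in> carrier ?R" "v \<in> carrier ?M" "s \<in> carrier ?R" "w \<in> carrier ?M"
    then have [simp]: "r \<in> lin_space ?D" "v \<in> lin_space X" "s \<in> lin_space ?D" "w \<in> lin_space X"
      by (simp_all add: cM)
    have [simp]: "(\<lambda>x. v x + w x) \<in> lin_space X"
      using M.a_closed[of v w] by (simp add: cM aM)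
    have [simp]: "(\<lambda>x. r x + s x) \<in> lin_space ?D"
      using R.a_closed[of r s] by simp
    have rs: "r \<otimes>\<^bsub>?R\<^esub> s \<in> lin_space ?D" using R.m_closed[of r s] by simp
    have closed: "r \<odot>\<^bsub>?M\<^esub> v \<in> carrier ?M" by (simp add: cM cl)
    have l_distr: "(r \<oplus>\<^bsub>?R\<^esub> s) \<odot>\<^bsub>?M\<^esub> v = r \<odot>\<^bsub>?M\<^esub> v \<oplus>\<^bsub>?M\<^esub> s \<odot>\<^bsub>?M\<^esub> v"
      by (auto simp: fun_eq_iff aM m sum.distrib distrib_right)
    have r_distr: "r \<odot>\<^bsub>?M\<^esub> (v \<oplus>\<^bsub>?M\<^esub> w) = r \<odot>\<^bsub>?M\<^esub> v \<oplus>\<^bsub>?M\<^esub> r \<odot>\<^bsub>?M\<^esub> w"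
      by (auto simp: fun_eq_iff aM m sum.distrib distrib_left)
    have assoc: "(r \<otimes>\<^bsub>?R\<^esub> s) \<odot>\<^bsub>?M\<^esub> v = r \<odot>\<^bsub>?M\<^esub> (s \<odot>\<^bsub>?M\<^esub> v)"
    proof
      fix z
      show "((r \<otimes>\<^bsub>?R\<^esub> s) \<odot>\<^bsub>?M\<^esub> v) z = (r \<odot>\<^bsub>?M\<^esub> (s \<odot>\<^bsub>?M\<^esub> v)) z"
      proof (cases "z \<in> X")
        case z: True
        let ?h = "deg z"
        have h: "?h \<in> carrier G" using deg_closed[OF z] .
        have "((r \<otimes>\<^bsub>?R\<^esub> s) \<odot>\<^bsub>?M\<^esub> v) z =
            (\<Sum>k\<in>carrier G. \<Sum>a\<in>carrier G. r (?h, a) * s (inv a \<otimes> ?h \<otimes> a, inv a \<otimes> k) * v (act (inv k) z))"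
          using z h by (simp add: m[OF rs] mult_drinfeld_double[OF finite_G] sum_distrib_right)
        also have "\<dots> = (\<Sum>a\<in>carrier G. \<Sum>k\<in>carrier G.
            r (?h, a) * s (inv a \<otimes> ?h \<otimes> a, inv a \<otimes> k) * v (act (inv k) z))"
          by (rule sum.swap)
        also have "\<dots> = (\<Sum>a\<in>carrier G. \<Sum>b\<in>carrier G.
            r (?h, a) * s (inv a \<otimes> ?h \<otimes> a, b) * v (act (inv (a \<otimes> b)) z))"
        proof (rule sum.cong)
          fix a assume a: "a \<in> carrier G"
          show "(\<Sum>k\<in>carrier G. r (?h, a) * s (inv a \<otimes> ?h \<otimes> a, inv a \<otimes> k) * v (act (inv k) z)) =
              (\<Sum>b\<in>carrier G. r (?h, a) * s (inv a \<otimes> ?h \<otimes> a, b) * v (act (inv (a \<otimes> b)) z))"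
            unfolding sum_translate[OF a, of "\<lambda>k. r (?h, a) * s (inv a \<otimes> ?h \<otimes> a, inv a \<otimes> k) * v (act (inv k) z)", symmetric]
            by (rule sum.cong) (simp_all add: inv_mult_cancel a)
        qed simp
        also have "\<dots> = (\<Sum>a\<in>carrier G. r (?h, a) * (s \<odot>\<^bsub>?M\<^esub> v) (act (inv a) z))"
          using z by (intro sum.cong)
            (simp_all add: m act_closed sum_distrib_left inv_mult_group act_mult deg_act mult_ac)
        also have "\<dots> = (r \<odot>\<^bsub>?M\<^esub> (s \<odot>\<^bsub>?M\<^esub> v)) z"
          using z by (simp add: m cl)
        finally show ?thesis .
      qed (use rs cl in \<open>simp add: m\<close>)
    qed
    have one: "\<one>\<^bsub>?R\<^esub> \<in> lin_space ?D" using R.one_closed by simp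
    have one: "\<one>\<^bsub>?R\<^esub> \<odot>\<^bsub>?M\<^esub> v = v"
    proof
      fix z
      show "(\<one>\<^bsub>?R\<^esub> \<odot>\<^bsub>?M\<^esub> v) z = v z"
      proof (cases "z \<in> X")
        case True
        have "(\<Sum>a\<in>carrier G. \<one>\<^bsub>?R\<^esub> (deg z, a) * v (act (inv a) z)) =
            (\<Sum>a\<in>carrier G. if a = \<one> then v (act (inv a) z) else 0)"
          using deg_closed[OF True] by (intro sum.cong) auto
        then show ?thesis using True finite_G unfolding m[OF one \<open>v \<in> lin_space X\<close>] by (simp add: act_one)
      qed (use lin_space_outside m[OF one \<open>v \<in> lin_space X\<close>] in force)
    qed
    note closed l_distr r_distr assoc one
  }
  note block = this
  show ?thesis
  proof unfold_locales
    fix a x assume ax: "a \<in> carrier ?R" "x \<in> carrier ?M"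
    show "a \<odot>\<^bsub>?M\<^esub> x \<in> carrier ?M" by (rule block(1)[OF ax ax])
  next
    fix a b x assume abx: "a \<in> carrier ?R" "b \<in> carrier ?R" "x \<in> carrier ?M"
    show "(a \<oplus>\<^bsub>?R\<^esub> b) \<odot>\<^bsub>?M\<^esub> x = a \<odot>\<^bsub>?M\<^esub> x \<oplus>\<^bsub>?M\<^esub> b \<odot>\<^bsub>?M\<^esub> x"
      by (rule block(2)[OF abx(1,3,2,3)])
    show "(a \<otimes>\<^bsub>?R\<^esub> b) \<odot>\<^bsub>?M\<^esub> x = a \<odot>\<^bsub>?M\<^esub> (b \<odot>\<^bsub>?M\<^esub> x)"
      by (rule block(4)[OF abx(1,3,2,3)])
  next
    fix a x y assume axy: "a \<in> carrier ?R" "x \<in> carrier ?M" "y \<in> carrier ?M"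
    show "a \<odot>\<^bsub>?M\<^esub> (x \<oplus>\<^bsub>?M\<^esub> y) = a \<odot>\<^bsub>?M\<^esub> x \<oplus>\<^bsub>?M\<^esub> a \<odot>\<^bsub>?M\<^esub> y"
      by (rule block(3)[OF axy(1,2,1,3)])
  next
    fix x assume x: "x \<in> carrier ?M"
    show "\<one>\<^bsub>?R\<^esub> \<odot>\<^bsub>?M\<^esub> x = x" by (rule block(5)[OF R.zero_closed x R.zero_closed x])
  qed
qed

text \<open>Equivariance makes the map commute with the group part of the double, and preservation
  of degrees with the projections \<delta>_h.\<close>

lemma graded_module_hom:
  assumes t: "inj_on t X" "t ` X \<subseteq> X"
    and eq: "\<And>a x. \<lbrakk>a \<in> carrier G; x \<in> X\<rbrakk> \<Longrightarrow> act a (t x) = t (act a x)"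
    and deg_t: "\<And>x. x \<in> X \<Longrightarrow> deg (t x) = deg x"
  shows "restrict (lin_ext (\<lambda>x. basis_vec (t x))) (carrier (based_module X \<beta>))
    \<in> mod_hom (drinfeld_double G) (based_module X \<beta>) (based_module X \<beta>)"
proof -
  let ?M = "based_module X \<beta>" and ?L = "lin_ext (\<lambda>x. basis_vec (t x))"
  interpret M: left_module "drinfeld_double G" ?M by (rule left_module_graded_module)
  have cM: "carrier ?M = lin_space X" by (simp add: based_module_simps)
  note Lc = lin_ext_basis_in_lin_space[OF finite_X _ t(2)]
  show ?thesis
  proof (rule mod_homI)
    fix r v assume rv: "r \<in> carrier (drinfeld_double G :: ('g \<times> 'g \<Rightarrow> 'k) ring)" "v \<in> carrier ?M"
    then have rv': "r \<in> lin_space (carrier G \<times> carrier G)" "v \<in> lin_space X" by (simp_all add: cM)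
    have rvc: "r \<odot>\<^bsub>?M\<^esub> v \<in> lin_space X" using M.smult_closed[OF rv] by (simp add: cM)
    have rLc: "r \<odot>\<^bsub>?M\<^esub> ?L v \<in> lin_space X" using M.smult_closed[OF rv(1), of "?L v"] Lc[OF rv'(2)] by (simp add: cM)
    have "?L (r \<odot>\<^bsub>?M\<^esub> v) = r \<odot>\<^bsub>?M\<^esub> ?L v"
    proof (rule lin_ext_basis_surj[OF t rvc rLc])
      fix x assume x: "x \<in> X"
      then have "t x \<in> X" using t by auto
      then show "(r \<odot>\<^bsub>?M\<^esub> ?L v) (t x) = (r \<odot>\<^bsub>?M\<^esub> v) x"
        using x by (simp add: smult_graded_module rv' Lc eq deg_t act_closed lin_ext_basis_apply[OF finite_X _ t(1)])
    qed
    then show "restrict ?L (carrier ?M) (r \<odot>\<^bsub>?M\<^esub> v) = r \<odot>\<^bsub>?M\<^esub> restrict ?L (carrier ?M) v"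
      using rvc rv' by (simp add: cM)
  next
    fix v w assume "v \<in> carrier ?M" "w \<in> carrier ?M"
    then show "restrict ?L (carrier ?M) (v \<oplus>\<^bsub>?M\<^esub> w) = restrict ?L (carrier ?M) v \<oplus>\<^bsub>?M\<^esub> restrict ?L (carrier ?M) w"
      using M.M.a_closed[of v w] by (simp add: cM) (simp add: based_module_simps lin_ext_basis_add[OF t])
  qed (use Lc cM in auto)
qed

end

end

subsection \<open>The group algebra as a direct factor of the double\<close>

text \<open>\<pi> keeps the coefficients at \<delta>_1, and \<iota> extends by zero. In a product
  the index 1 of the first factor meets the index a^-1 1 a = 1 of the second, so on degree 1 the
  double multiplies like the group algebra.\<close>

lemma (in group) ring_retract_double:
  assumes fin: "finite (carrier G)"
    and D: "ring (drinfeld_double G :: ('a \<times> 'a \<Rightarrow> 'k::field) ring)"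
    and A: "ring (group_algebra G :: ('a \<Rightarrow> 'k) ring)"
  shows "ring_retract (drinfeld_double G) (group_algebra G :: ('a \<Rightarrow> 'k) ring)
    (\<lambda>r a. r (\<one>, a)) (\<lambda>s (h, a). if h = \<one> then s a else 0)"
proof -
  let ?D = "drinfeld_double G :: ('a \<times> 'a \<Rightarrow> 'k) ring" and ?A = "group_algebra G :: ('a \<Rightarrow> 'k) ring"
  have fin2: "finite (carrier G \<times> carrier G)" using fin by simp
  interpret D: ring ?D by fact
  interpret A: ring ?A by fact
  have pi: "(\<lambda>a. r (\<one>, a)) \<in> lin_space (carrier G)" if "r \<in> lin_space (carrier G \<times> carrier G)" for r :: "'a \<times> 'a \<Rightarrow> 'k"
    using that fin fin2 by (simp add: lin_space_finite)
  have iota: "(\<lambda>(h, a). if h = \<one> then s a else 0) \<in> lin_space (carrier G \<times> carrier G)"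
    if "s \<in> lin_space (carrier G)" for s :: "'a \<Rightarrow> 'k"
    using that fin fin2 by (auto simp: lin_space_finite)
  show ?thesis
  proof (intro ring_retract.intro ring_retract_axioms.intro D A)
    show "(\<lambda>r a. r (\<one>, a)) \<in> ring_hom ?D ?A"
    proof (rule ring_hom_memI)
      fix r s assume "r \<in> carrier ?D" "s \<in> carrier ?D"
      then have rs: "r \<in> lin_space (carrier G \<times> carrier G)" "s \<in> lin_space (carrier G \<times> carrier G)" by simp_all
      show "(\<lambda>a. (r \<otimes>\<^bsub>?D\<^esub> s) (\<one>, a)) = (\<lambda>a. r (\<one>, a)) \<otimes>\<^bsub>?A\<^esub> (\<lambda>a. s (\<one>, a))"
        by (simp add: fun_eq_iff mult_drinfeld_double[OF fin rs] mult_group_algebra[OF fin pi pi] rs cong: sum.cong)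
    qed (use pi in \<open>auto simp: basis_vec_def\<close>)
    fix r s assume "r \<in> carrier ?D" "s \<in> carrier ?A"
    then have rs: "r \<in> lin_space (carrier G \<times> carrier G)" "s \<in> lin_space (carrier G)" by simp_all
    show "(\<lambda>(h, a). if h = \<one> then ((\<lambda>a. r (\<one>, a)) \<otimes>\<^bsub>?A\<^esub> s) a else 0) = r \<otimes>\<^bsub>?D\<^esub> (\<lambda>(h, a). if h = \<one> then s a else 0)"
    proof
      fix p :: "'a \<times> 'a"
      obtain h k where p: "p = (h, k)" by (cases p)
      \<comment> \<open>The unit element is alone in its conjugacy class; hence multiplication by r
        does not mix degree 1 with other degrees.\<close>
      have conj: "inv a \<otimes> h \<otimes> a = \<one> \<longleftrightarrow> h = \<one>" if "a \<in> carrier G" "h \<in> carrier G" for a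
        using that by (metis inv_closed inv_solve_right l_one m_closed inv_solve_left' l_inv r_one)
      show "(\<lambda>(h, a). if h = \<one> then ((\<lambda>a. r (\<one>, a)) \<otimes>\<^bsub>?A\<^esub> s) a else 0) p = (r \<otimes>\<^bsub>?D\<^esub> (\<lambda>(h, a). if h = \<one> then s a else 0)) p"
        by (auto simp: p mult_drinfeld_double[OF fin rs(1) iota[OF rs(2)]] mult_group_algebra[OF fin pi[OF rs(1)] rs(2)]
            conj cong: sum.cong intro!: sum.neutral)
    qed
  qed (use iota in \<open>auto simp: fun_eq_iff\<close>)
qed

section \<open>The twist acts trivially on group cohomology\<close>

lemma (in abelian_monoid) finsum_swap:
  assumes "finite A" "finite B" "\<And>x y. \<lbrakk>x \<in> A; y \<in> B\<rbrakk> \<Longrightarrow> f x y \<in> carrier G"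
  shows "finsum G (\<lambda>x. finsum G (f x) B) A = finsum G (\<lambda>y. finsum G (\<lambda>x. f x y) A) B"
  using assms(1,3)
proof (induction A rule: finite_induct)
  case (insert a A)
  have "finsum G (\<lambda>x. finsum G (f x) B) (insert a A) = finsum G (f a) B \<oplus> finsum G (\<lambda>x. finsum G (f x) B) A"
    using insert by (intro finsum_insert) auto
  also have "\<dots> = finsum G (f a) B \<oplus> finsum G (\<lambda>y. finsum G (\<lambda>x. f x y) A) B"
    using insert by simp
  also have "\<dots> = finsum G (\<lambda>y. f a y \<oplus> finsum G (\<lambda>x. f x y) A) B"
    using insert by (intro finsum_addf[symmetric]) auto
  also have "\<dots> = finsum G (\<lambda>y. finsum G (\<lambda>x. f x y) (insert a A)) B"
    using insert by (intro finsum_cong') (auto intro!: finsum_insert[symmetric])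
  finally show ?case .
qed simp

lemma (in abelian_group) minus_eqI:
  assumes "a \<oplus> b = c" "a \<in> carrier G" "b \<in> carrier G"
  shows "c \<ominus> b = a"
  using assms(2,3) unfolding assms(1)[symmetric] by (simp add: a_minus_def a_assoc r_neg)

text \<open>The summand of r at g, kept as an element of the group algebra because the module
  records carry scalars only through the algebra.\<close>

definition homogeneous_part :: "('y \<Rightarrow> 'k::field) \<Rightarrow> 'y \<Rightarrow> 'y \<Rightarrow> 'k" where
  "homogeneous_part r g = (\<lambda>b. if b = g then r g else 0)"

lemma homogeneous_part_closed: "g \<in> Y \<Longrightarrow> homogeneous_part r g \<in> lin_space Y"
  by (auto simp: homogeneous_part_def lin_space_def intro: finite_subset[of _ "{g}"])

lemma basis_vec_closed: "g \<in> Y \<Longrightarrow> basis_vec g \<in> lin_space Y"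
  by (auto simp: basis_vec_def lin_space_def intro: finite_subset[of _ "{g}"])

lemma sum_homogeneous_part:
  assumes "finite Y" "r \<in> lin_space Y"
  shows "(\<lambda>z. \<Sum>g\<in>Y. homogeneous_part r g z) = r"
  using assms by (auto simp: homogeneous_part_def fun_eq_iff lin_space_outside)

lemma left_module_sum_smult:
  assumes M: "left_module (group_algebra G) M" and "finite X" "\<And>y. y \<in> X \<Longrightarrow> c y \<in> lin_space (carrier G)"
    and x: "x \<in> carrier M"
  shows "(\<lambda>z. \<Sum>y\<in>X. c y z) \<odot>\<^bsub>M\<^esub> x = finsum M (\<lambda>y. c y \<odot>\<^bsub>M\<^esub> x) X \<and>
    (\<lambda>z. \<Sum>y\<in>X. c y z) \<in> lin_space (carrier G)"
  using assms(2,3)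
proof (induction X rule: finite_induct)
  case empty
  interpret M: left_module "group_algebra G" M by fact
  show ?case using M.smult_zero_left[OF x] M.R.zero_closed by simp
next
  case (insert y X)
  interpret M: left_module "group_algebra G" M by fact
  have c: "(\<lambda>y. c y \<odot>\<^bsub>M\<^esub> x) \<in> X \<rightarrow> carrier M" "c y \<odot>\<^bsub>M\<^esub> x \<in> carrier M"
    using insert.prems x by (auto simp: M.smult_closed)
  have eq: "(\<lambda>z. \<Sum>y\<in>insert y X. c y z) = c y \<oplus>\<^bsub>group_algebra G\<^esub> (\<lambda>z. \<Sum>y\<in>X. c y z)"
    using insert by simp
  have cl: "c y \<in> carrier (group_algebra G)" "(\<lambda>z. \<Sum>y\<in>X. c y z) \<in> carrier (group_algebra G)"
    using insert by auto
  show ?case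
    unfolding eq M.smult_l_distr[OF cl x] using insert c M.R.a_closed[OF cl] by simp
qed

text \<open>Maps from G to M with (g . w)(h) = g . w(g^-1 h g). A linear map s from Q into this
  module is a family of additive maps s_h with s_h(g q) = g . s_{g^-1 h g}(q), which is the
  compatibility required of the homotopies for the twist.\<close>

definition conj_maps ::
    "('g, 'c) monoid_scheme \<Rightarrow> ('g \<Rightarrow> 'k::field, 'm) module \<Rightarrow> ('g \<Rightarrow> 'k, 'g \<Rightarrow> 'm) module" where
  "conj_maps G M = \<lparr>carrier = carrier G \<rightarrow>\<^sub>E carrier M, mult = undefined, one = undefined,
     zero = (\<lambda>h\<in>carrier G. \<zero>\<^bsub>M\<^esub>), add = (\<lambda>v w. \<lambda>h\<in>carrier G. v h \<oplus>\<^bsub>M\<^esub> w h),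
     smult = (\<lambda>r w. \<lambda>h\<in>carrier G. finsum M
       (\<lambda>g. homogeneous_part r g \<odot>\<^bsub>M\<^esub> w (inv\<^bsub>G\<^esub> g \<otimes>\<^bsub>G\<^esub> h \<otimes>\<^bsub>G\<^esub> g)) (carrier G))\<rparr>"

lemma conj_maps_simps:
  "carrier (conj_maps G M) = carrier G \<rightarrow>\<^sub>E carrier M"
  "\<zero>\<^bsub>conj_maps G M\<^esub> = (\<lambda>h\<in>carrier G. \<zero>\<^bsub>M\<^esub>)"
  "v \<oplus>\<^bsub>conj_maps G M\<^esub> w = (\<lambda>h\<in>carrier G. v h \<oplus>\<^bsub>M\<^esub> w h)"
  "r \<odot>\<^bsub>conj_maps G M\<^esub> w = (\<lambda>h\<in>carrier G. finsum M
       (\<lambda>g. homogeneous_part r g \<odot>\<^bsub>M\<^esub> w (inv\<^bsub>G\<^esub> g \<otimes>\<^bsub>G\<^esub> h \<otimes>\<^bsub>G\<^esub> g)) (carrier G))"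
  by (simp_all add: conj_maps_def)

text \<open>The factorizations of k are k = a (a^-1 k), one for each a.\<close>

lemma (in group) homogeneous_part_mult:
  fixes r s :: "'a \<Rightarrow> 'k::field"
  assumes "finite (carrier G)" "r \<in> lin_space (carrier G)" "s \<in> lin_space (carrier G)" "k \<in> carrier G"
  shows "homogeneous_part (r \<otimes>\<^bsub>group_algebra G\<^esub> s) k =
    (\<lambda>z. \<Sum>a\<in>carrier G. (homogeneous_part r a \<otimes>\<^bsub>group_algebra G\<^esub> homogeneous_part s (inv a \<otimes> k)) z)"
proof
  fix z
  have *: "(homogeneous_part r a \<otimes>\<^bsub>group_algebra G\<^esub> homogeneous_part s (inv a \<otimes> k)) z =
      (if z = k then r a * s (inv a \<otimes> k) else 0)" if a: "a \<in> carrier G" for a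
  proof -
    have ak: "inv a \<otimes> k \<in> carrier G" using a assms by simp
    have "(homogeneous_part r a \<otimes>\<^bsub>group_algebra G\<^esub> homogeneous_part s (inv a \<otimes> k)) z =
        (if z \<in> carrier G then \<Sum>b\<in>carrier G. if b = a then r a * homogeneous_part s (inv a \<otimes> k) (inv b \<otimes> z) else 0 else 0)"
      unfolding mult_group_algebra[OF assms(1) homogeneous_part_closed[OF a] homogeneous_part_closed[OF ak]]
      by (auto simp: homogeneous_part_def[of r] intro!: sum.cong)
    also have "\<dots> = (if z = k then r a * s (inv a \<otimes> k) else 0)"
      using assms a by (auto simp: homogeneous_part_def)
    finally show ?thesis .
  qed
  show "homogeneous_part (r \<otimes>\<^bsub>group_algebra G\<^esub> s) k z =
    (\<Sum>a\<in>carrier G. (homogeneous_part r a \<otimes>\<^bsub>group_algebra G\<^esub> homogeneous_part s (inv a \<otimes> k)) z)"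
    using assms by (simp add: * homogeneous_part_def[of "r \<otimes>\<^bsub>group_algebra G\<^esub> s"]
        mult_group_algebra[OF assms(1-3)] cong: sum.cong)
qed

lemma (in group) conj_closed: "\<lbrakk>g \<in> carrier G; h \<in> carrier G\<rbrakk> \<Longrightarrow> inv g \<otimes> h \<otimes> g \<in> carrier G"
  by simp

text \<open>Associativity is again the substitution k = a b, now with sums in M; conjugating h by
  a^-1 and then by b^-1 is conjugating it by (a b)^-1.\<close>

lemma (in group) left_module_conj_maps:
  fixes M :: "('a \<Rightarrow> 'k::field, 'm) module"
  assumes fin: "finite (carrier G)" and M: "left_module (group_algebra G) M"
  shows "left_module (group_algebra G) (conj_maps G M)"
proof -
  let ?R = "group_algebra G :: ('a \<Rightarrow> 'k) ring" and ?W = "conj_maps G M"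
  let ?p = homogeneous_part
  interpret M: left_module ?R M by fact
  have W: "abelian_group ?W"
  proof (rule abelian_groupI)
    fix x assume x: "x \<in> carrier ?W"
    show "\<exists>y\<in>carrier ?W. y \<oplus>\<^bsub>?W\<^esub> x = \<zero>\<^bsub>?W\<^esub>"
      using x by (intro bexI[of _ "\<lambda>h\<in>carrier G. \<ominus>\<^bsub>M\<^esub> x h"])
        (auto simp: conj_maps_simps M.M.l_neg PiE_iff intro!: restrict_ext)
    show "\<zero>\<^bsub>?W\<^esub> \<oplus>\<^bsub>?W\<^esub> x = x"
      using x by (auto simp: conj_maps_simps fun_eq_iff PiE_iff extensional_def)
  qed (auto simp: conj_maps_simps M.M.a_ac PiE_iff intro!: restrict_ext)
  interpret W: abelian_group ?W by (rule W)
  have p: "?p r g \<in> carrier ?R" if "g \<in> carrier G" for r g using homogeneous_part_closed[OF that] by simp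
  have wc: "w h \<in> carrier M" if "w \<in> carrier ?W" "h \<in> carrier G" for w h using that by (auto simp: conj_maps_simps)
  have t: "?p r g \<odot>\<^bsub>M\<^esub> w (inv g \<otimes> h \<otimes> g) \<in> carrier M" if "w \<in> carrier ?W" "h \<in> carrier G" "g \<in> carrier G" for r w h g
    using that by (intro M.smult_closed p wc) auto
  have cl: "r \<odot>\<^bsub>?W\<^esub> w \<in> carrier ?W" if "w \<in> carrier ?W" for r w
    using t that by (auto simp: conj_maps_simps(1) conj_maps_simps(4)[of _ _ r w] intro!: M.finsum_closed)
  have p_add: "?p (\<lambda>a. r a + s a) g = ?p r g \<oplus>\<^bsub>?R\<^esub> ?p s g" for r s :: "'a \<Rightarrow> 'k" and g
    by (auto simp: homogeneous_part_def)
  show ?thesis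
  proof unfold_locales
    fix a x assume "a \<in> carrier ?R" "x \<in> carrier ?W"
    then show "a \<odot>\<^bsub>?W\<^esub> x \<in> carrier ?W" by (intro cl)
  next
    fix r s w assume r: "r \<in> carrier ?R" and s: "s \<in> carrier ?R" and w: "w \<in> carrier ?W"
    show "(r \<oplus>\<^bsub>?R\<^esub> s) \<odot>\<^bsub>?W\<^esub> w = r \<odot>\<^bsub>?W\<^esub> w \<oplus>\<^bsub>?W\<^esub> s \<odot>\<^bsub>?W\<^esub> w"
      unfolding conj_maps_simps(3,4)
    proof (rule restrict_ext)
      fix h assume h: "h \<in> carrier G"
      have "finsum M (\<lambda>g. ?p (r \<oplus>\<^bsub>?R\<^esub> s) g \<odot>\<^bsub>M\<^esub> w (inv g \<otimes> h \<otimes> g)) (carrier G) =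
          finsum M (\<lambda>g. ?p r g \<odot>\<^bsub>M\<^esub> w (inv g \<otimes> h \<otimes> g) \<oplus>\<^bsub>M\<^esub> ?p s g \<odot>\<^bsub>M\<^esub> w (inv g \<otimes> h \<otimes> g)) (carrier G)"
      proof (rule M.M.finsum_cong')
        fix g assume g: "g \<in> carrier G"
        show "?p (r \<oplus>\<^bsub>?R\<^esub> s) g \<odot>\<^bsub>M\<^esub> w (inv g \<otimes> h \<otimes> g) =
          ?p r g \<odot>\<^bsub>M\<^esub> w (inv g \<otimes> h \<otimes> g) \<oplus>\<^bsub>M\<^esub> ?p s g \<odot>\<^bsub>M\<^esub> w (inv g \<otimes> h \<otimes> g)"
          unfolding add_group_algebra p_add[unfolded add_group_algebra]
          using M.smult_l_distr[OF p p wc, of g g w _ r s] g h w by simp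
      qed (use t[OF w h] in auto)
      also have "\<dots> = finsum M (\<lambda>g. ?p r g \<odot>\<^bsub>M\<^esub> w (inv g \<otimes> h \<otimes> g)) (carrier G) \<oplus>\<^bsub>M\<^esub>
          finsum M (\<lambda>g. ?p s g \<odot>\<^bsub>M\<^esub> w (inv g \<otimes> h \<otimes> g)) (carrier G)"
        using t[OF w h] by (intro M.M.finsum_addf) auto
      finally show "finsum M (\<lambda>g. ?p (r \<oplus>\<^bsub>?R\<^esub> s) g \<odot>\<^bsub>M\<^esub> w (inv g \<otimes> h \<otimes> g)) (carrier G) =
          (\<lambda>h\<in>carrier G. finsum M (\<lambda>g. ?p r g \<odot>\<^bsub>M\<^esub> w (inv g \<otimes> h \<otimes> g)) (carrier G)) h \<oplus>\<^bsub>M\<^esub>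
          (\<lambda>h\<in>carrier G. finsum M (\<lambda>g. ?p s g \<odot>\<^bsub>M\<^esub> w (inv g \<otimes> h \<otimes> g)) (carrier G)) h"
        using h by simp
    qed
    show "(r \<otimes>\<^bsub>?R\<^esub> s) \<odot>\<^bsub>?W\<^esub> w = r \<odot>\<^bsub>?W\<^esub> (s \<odot>\<^bsub>?W\<^esub> w)"
      unfolding conj_maps_simps(4)
    proof (rule restrict_ext)
      fix h assume h: "h \<in> carrier G"
      define f where "f a b = ?p r a \<odot>\<^bsub>M\<^esub> (?p s b \<odot>\<^bsub>M\<^esub> w (inv b \<otimes> (inv a \<otimes> h \<otimes> a) \<otimes> b))" for a b
      have f: "f a b \<in> carrier M" if "a \<in> carrier G" "b \<in> carrier G" for a b
        unfolding f_def using that h w by (intro M.smult_closed p t conj_closed) auto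
      have cl': "?p r a \<odot>\<^bsub>M\<^esub>
          (\<lambda>h\<in>carrier G. finsum M (\<lambda>g. ?p s g \<odot>\<^bsub>M\<^esub> w (inv g \<otimes> h \<otimes> g)) (carrier G)) (inv a \<otimes> h \<otimes> a) \<in> carrier M"
          if "a \<in> carrier G" for a
          using that h w cl[OF w, of s] by (intro M.smult_closed p) (auto simp: conj_maps_simps)
      have "finsum M (\<lambda>k. ?p (r \<otimes>\<^bsub>?R\<^esub> s) k \<odot>\<^bsub>M\<^esub> w (inv k \<otimes> h \<otimes> k)) (carrier G) =
          finsum M (\<lambda>k. finsum M (\<lambda>a. f a (inv a \<otimes> k)) (carrier G)) (carrier G)"
      proof (rule M.M.finsum_cong')
        fix k assume k: "k \<in> carrier G"
        have wk: "w (inv k \<otimes> h \<otimes> k) \<in> carrier M" using k h w by (intro wc) auto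
        have "?p (r \<otimes>\<^bsub>?R\<^esub> s) k \<odot>\<^bsub>M\<^esub> w (inv k \<otimes> h \<otimes> k) =
            finsum M (\<lambda>a. (?p r a \<otimes>\<^bsub>?R\<^esub> ?p s (inv a \<otimes> k)) \<odot>\<^bsub>M\<^esub> w (inv k \<otimes> h \<otimes> k)) (carrier G)"
          using r s k unfolding homogeneous_part_mult[OF fin _ _ k, of r s, OF r[simplified] s[simplified]]
          by (intro left_module_sum_smult[OF M fin _ wk, THEN conjunct1]) (metis carrier_group_algebra M.R.m_closed p inv_closed m_closed)
        also have "\<dots> = finsum M (\<lambda>a. f a (inv a \<otimes> k)) (carrier G)"
        proof (rule M.M.finsum_cong')
          fix a assume a: "a \<in> carrier G"
          have "inv (inv a \<otimes> k) \<otimes> (inv a \<otimes> h \<otimes> a) \<otimes> (inv a \<otimes> k) = inv k \<otimes> h \<otimes> k"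
          proof -
            have "inv (inv a \<otimes> k) \<otimes> (inv a \<otimes> h \<otimes> a) \<otimes> (inv a \<otimes> k) = inv k \<otimes> (a \<otimes> (inv a \<otimes> (h \<otimes> (a \<otimes> (inv a \<otimes> k)))))"
              using a h k by (simp add: inv_mult_group m_assoc)
            then show ?thesis using a h k inv_mult_cancel[of "inv a"] by (simp add: m_assoc)
          qed
          then show "(?p r a \<otimes>\<^bsub>?R\<^esub> ?p s (inv a \<otimes> k)) \<odot>\<^bsub>M\<^esub> w (inv k \<otimes> h \<otimes> k) = f a (inv a \<otimes> k)"
            unfolding f_def using a k wk by (simp add: M.smult_assoc[OF p p])
        qed (use f k in auto)
        finally show "?p (r \<otimes>\<^bsub>?R\<^esub> s) k \<odot>\<^bsub>M\<^esub> w (inv k \<otimes> h \<otimes> k) = finsum M (\<lambda>a. f a (inv a \<otimes> k)) (carrier G)" .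
      qed (use f in \<open>auto intro!: M.M.finsum_closed\<close>)
      also have "\<dots> = finsum M (\<lambda>a. finsum M (\<lambda>k. f a (inv a \<otimes> k)) (carrier G)) (carrier G)"
        using f by (intro M.M.finsum_swap fin) auto
      also have "\<dots> = finsum M (\<lambda>a. ?p r a \<odot>\<^bsub>M\<^esub>
          (\<lambda>h\<in>carrier G. finsum M (\<lambda>g. ?p s g \<odot>\<^bsub>M\<^esub> w (inv g \<otimes> h \<otimes> g)) (carrier G)) (inv a \<otimes> h \<otimes> a)) (carrier G)"
      proof (rule M.M.finsum_cong')
        fix a assume a: "a \<in> carrier G"
        have bij: "(\<lambda>k. inv a \<otimes> k) ` carrier G = carrier G" "inj_on (\<lambda>k. inv a \<otimes> k) (carrier G)"
          using a inj_on_cmult surj_const_mult by auto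
        have "finsum M (\<lambda>k. f a (inv a \<otimes> k)) (carrier G) = finsum M (f a) (carrier G)"
          using M.M.finsum_reindex[of "f a" "\<lambda>k. inv a \<otimes> k" "carrier G"] bij f a by auto
        also have "\<dots> = ?p r a \<odot>\<^bsub>M\<^esub> finsum M (\<lambda>b. ?p s b \<odot>\<^bsub>M\<^esub> w (inv b \<otimes> (inv a \<otimes> h \<otimes> a) \<otimes> b)) (carrier G)"
          unfolding f_def using a h w t[OF w conj_closed[OF a h]]
          by (intro M.smult_finsum[symmetric] p fin) auto
        finally show "finsum M (\<lambda>k. f a (inv a \<otimes> k)) (carrier G) = ?p r a \<odot>\<^bsub>M\<^esub>
          (\<lambda>h\<in>carrier G. finsum M (\<lambda>g. ?p s g \<odot>\<^bsub>M\<^esub> w (inv g \<otimes> h \<otimes> g)) (carrier G)) (inv a \<otimes> h \<otimes> a)"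
          using a h by simp
      qed (use cl' in auto)
      finally show "finsum M (\<lambda>k. ?p (r \<otimes>\<^bsub>?R\<^esub> s) k \<odot>\<^bsub>M\<^esub> w (inv k \<otimes> h \<otimes> k)) (carrier G) =
         finsum M (\<lambda>a. ?p r a \<odot>\<^bsub>M\<^esub>
          (\<lambda>h\<in>carrier G. finsum M (\<lambda>g. ?p s g \<odot>\<^bsub>M\<^esub> w (inv g \<otimes> h \<otimes> g)) (carrier G)) (inv a \<otimes> h \<otimes> a)) (carrier G)" .
    qed
  next
    fix r v w assume r: "r \<in> carrier ?R" and v: "v \<in> carrier ?W" and w: "w \<in> carrier ?W"
    show "r \<odot>\<^bsub>?W\<^esub> (v \<oplus>\<^bsub>?W\<^esub> w) = r \<odot>\<^bsub>?W\<^esub> v \<oplus>\<^bsub>?W\<^esub> r \<odot>\<^bsub>?W\<^esub> w"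
      unfolding conj_maps_simps(3,4)
    proof (rule restrict_ext)
      fix h assume h: "h \<in> carrier G"
      have "finsum M (\<lambda>g. ?p r g \<odot>\<^bsub>M\<^esub> (\<lambda>h\<in>carrier G. v h \<oplus>\<^bsub>M\<^esub> w h) (inv g \<otimes> h \<otimes> g)) (carrier G) =
          finsum M (\<lambda>g. ?p r g \<odot>\<^bsub>M\<^esub> v (inv g \<otimes> h \<otimes> g) \<oplus>\<^bsub>M\<^esub> ?p r g \<odot>\<^bsub>M\<^esub> w (inv g \<otimes> h \<otimes> g)) (carrier G)"
      proof (rule M.M.finsum_cong')
        fix g assume g: "g \<in> carrier G"
        show "?p r g \<odot>\<^bsub>M\<^esub> (\<lambda>h\<in>carrier G. v h \<oplus>\<^bsub>M\<^esub> w h) (inv g \<otimes> h \<otimes> g) =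
          ?p r g \<odot>\<^bsub>M\<^esub> v (inv g \<otimes> h \<otimes> g) \<oplus>\<^bsub>M\<^esub> ?p r g \<odot>\<^bsub>M\<^esub> w (inv g \<otimes> h \<otimes> g)"
          using M.smult_r_distr[OF p wc wc, of g v _ w _ r] g h v w by simp
      qed (use t h v w in auto)
      also have "\<dots> = finsum M (\<lambda>g. ?p r g \<odot>\<^bsub>M\<^esub> v (inv g \<otimes> h \<otimes> g)) (carrier G) \<oplus>\<^bsub>M\<^esub>
          finsum M (\<lambda>g. ?p r g \<odot>\<^bsub>M\<^esub> w (inv g \<otimes> h \<otimes> g)) (carrier G)"
        using t h v w by (intro M.M.finsum_addf) auto
      finally show "finsum M (\<lambda>g. ?p r g \<odot>\<^bsub>M\<^esub> (\<lambda>h\<in>carrier G. v h \<oplus>\<^bsub>M\<^esub> w h) (inv g \<otimes> h \<otimes> g)) (carrier G) =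
          (\<lambda>h\<in>carrier G. finsum M (\<lambda>g. ?p r g \<odot>\<^bsub>M\<^esub> v (inv g \<otimes> h \<otimes> g)) (carrier G)) h \<oplus>\<^bsub>M\<^esub>
          (\<lambda>h\<in>carrier G. finsum M (\<lambda>g. ?p r g \<odot>\<^bsub>M\<^esub> w (inv g \<otimes> h \<otimes> g)) (carrier G)) h"
        using h by simp
    qed
  next
    fix w assume w: "w \<in> carrier ?W"
    show "\<one>\<^bsub>?R\<^esub> \<odot>\<^bsub>?W\<^esub> w = w"
    proof
      fix h
      show "(\<one>\<^bsub>?R\<^esub> \<odot>\<^bsub>?W\<^esub> w) h = w h"
      proof (cases "h \<in> carrier G")
        case h: True
        have p1: "?p \<one>\<^bsub>?R\<^esub> g = (if g = \<one> then \<one>\<^bsub>?R\<^esub> else \<zero>\<^bsub>?R\<^esub>)" for g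
          by (auto simp: homogeneous_part_def basis_vec_def)
        have "finsum M (\<lambda>g. ?p \<one>\<^bsub>?R\<^esub> g \<odot>\<^bsub>M\<^esub> w (inv g \<otimes> h \<otimes> g)) (carrier G) =
            finsum M (\<lambda>g. if \<one> = g then w h else \<zero>\<^bsub>M\<^esub>) (carrier G)"
        proof (rule M.M.finsum_cong')
          fix g assume g: "g \<in> carrier G"
          show "?p \<one>\<^bsub>?R\<^esub> g \<odot>\<^bsub>M\<^esub> w (inv g \<otimes> h \<otimes> g) = (if \<one> = g then w h else \<zero>\<^bsub>M\<^esub>)"
            unfolding p1 using M.smult_one[OF wc[OF w h]] M.smult_zero_left[OF wc[OF w conj_closed[OF g h]]] h
            by auto
        qed (use wc[OF w h] in auto)
        also have "\<dots> = w h"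
          using M.M.add.finprod_singleton[OF one_closed fin, of "\<lambda>_. w h"] wc[OF w h] by (simp add: finsum_def)
        finally show ?thesis using h by (simp add: conj_maps_simps(4))
      next
        case False
        then show ?thesis using w by (auto simp: conj_maps_simps PiE_iff extensional_def)
      qed
    qed
  qed
qed

text \<open>Applied to the differentials, it turns a resolution Q into the complex of the
  \<open>conj_maps G (Q n)\<close>.\<close>

lemma compose_pointwise_conj_maps_hom:
  fixes G :: "('g, 'c) monoid_scheme" (structure) and M :: "('g \<Rightarrow> 'k::field, 'm) module" and N :: "('g \<Rightarrow> 'k, 'n) module"
  assumes "group G" "finite (carrier G)" and M: "left_module (group_algebra G) M" and N: "left_module (group_algebra G) N"
    and f: "f \<in> mod_hom (group_algebra G) M N"
  shows "(\<lambda>w\<in>carrier (conj_maps G M). \<lambda>h\<in>carrier G. f (w h))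
    \<in> mod_hom (group_algebra G) (conj_maps G M) (conj_maps G N)"
proof -
  interpret group G by fact
  interpret M: left_module "group_algebra G" M by fact
  interpret N: left_module "group_algebra G" N by fact
  interpret W: left_module "group_algebra G" "conj_maps G M" by (rule left_module_conj_maps[OF assms(2) M])
  have fc: "f x \<in> carrier N" if "x \<in> carrier M" for x using mod_hom_closed[OF f that] .
  show ?thesis
  proof (rule mod_homI)
    show "(\<lambda>w\<in>carrier (conj_maps G M). \<lambda>h\<in>carrier G. f (w h)) \<in> carrier (conj_maps G M) \<rightarrow>\<^sub>E carrier (conj_maps G N)"
      using fc by (auto simp: conj_maps_simps(1) PiE_iff)
  next
    fix v w assume vw: "v \<in> carrier (conj_maps G M)" "w \<in> carrier (conj_maps G M)"
    have "f (v h \<oplus>\<^bsub>M\<^esub> w h) = f (v h) \<oplus>\<^bsub>N\<^esub> f (w h)" if "h \<in> carrier G" for h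
      using mod_hom_add[OF f] vw that by (auto simp: conj_maps_simps(1))
    then show "(\<lambda>w\<in>carrier (conj_maps G M). \<lambda>h\<in>carrier G. f (w h)) (v \<oplus>\<^bsub>conj_maps G M\<^esub> w) =
      (\<lambda>w\<in>carrier (conj_maps G M). \<lambda>h\<in>carrier G. f (w h)) v \<oplus>\<^bsub>conj_maps G N\<^esub>
      (\<lambda>w\<in>carrier (conj_maps G M). \<lambda>h\<in>carrier G. f (w h)) w"
      using vw W.M.a_closed[OF vw] by (auto simp: conj_maps_simps(3) intro!: restrict_ext)
  next
    fix r w assume rw: "r \<in> carrier (group_algebra G :: ('g \<Rightarrow> 'k) ring)" "w \<in> carrier (conj_maps G M)"
    have "f (finsum M (\<lambda>g. homogeneous_part r g \<odot>\<^bsub>M\<^esub> w (inv g \<otimes> h \<otimes> g)) (carrier G)) =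
        finsum N (\<lambda>g. homogeneous_part r g \<odot>\<^bsub>N\<^esub> f (w (inv g \<otimes> h \<otimes> g))) (carrier G)" if h: "h \<in> carrier G" for h
    proof -
      have wc: "w (inv g \<otimes> h \<otimes> g) \<in> carrier M" if "g \<in> carrier G" for g
        using rw h that by (auto simp: conj_maps_simps(1))
      have "f (finsum M (\<lambda>g. homogeneous_part r g \<odot>\<^bsub>M\<^esub> w (inv g \<otimes> h \<otimes> g)) (carrier G)) =
          finsum N (\<lambda>g. f (homogeneous_part r g \<odot>\<^bsub>M\<^esub> w (inv g \<otimes> h \<otimes> g))) (carrier G)"
        using wc homogeneous_part_closed
        by (intro mod_hom_finsum[OF f M.abelian_group_axioms N.abelian_group_axioms assms(2)])
          (auto intro!: M.smult_closed)
      also have "\<dots> = finsum N (\<lambda>g. homogeneous_part r g \<odot>\<^bsub>N\<^esub> f (w (inv g \<otimes> h \<otimes> g))) (carrier G)"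
        using wc homogeneous_part_closed fc
        by (intro N.M.finsum_cong') (auto intro!: N.smult_closed mod_hom_smult[OF f])
      finally show ?thesis .
    qed
    then show "(\<lambda>w\<in>carrier (conj_maps G M). \<lambda>h\<in>carrier G. f (w h)) (r \<odot>\<^bsub>conj_maps G M\<^esub> w) =
      r \<odot>\<^bsub>conj_maps G N\<^esub> (\<lambda>w\<in>carrier (conj_maps G M). \<lambda>h\<in>carrier G. f (w h)) w"
      using rw W.smult_closed[OF rw]
      by (simp only: restrict_apply' if_True conj_maps_simps(4))
        (auto intro!: restrict_ext N.M.finsum_cong' N.smult_closed homogeneous_part_closed fc simp: conj_maps_simps(1) PiE_iff)
  qed
qed

text \<open>Equivariance is the identity h (g x) - g x = g ((g^-1 h g) x - x). A single translation
  by h commutes with the action of g only if g^-1 h g acts as h does, but all translations together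
  form a module map into \<open>conj_maps\<close>.\<close>

lemma (in group) conj_translation_hom:
  fixes M :: "('a \<Rightarrow> 'k::field, 'm) module"
  assumes fin: "finite (carrier G)" and M: "left_module (group_algebra G) M"
  shows "(\<lambda>x\<in>carrier M. \<lambda>h\<in>carrier G. basis_vec h \<odot>\<^bsub>M\<^esub> x \<ominus>\<^bsub>M\<^esub> x)
    \<in> mod_hom (group_algebra G) M (conj_maps G M)"
proof -
  let ?R = "group_algebra G :: ('a \<Rightarrow> 'k) ring" and ?p = homogeneous_part
  interpret M: left_module ?R M by fact
  have b: "basis_vec h \<in> carrier ?R" if "h \<in> carrier G" for h using basis_vec_closed[OF that] by simp
  have p: "?p r g \<in> carrier ?R" if "g \<in> carrier G" for r g using homogeneous_part_closed[OF that] by simp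
  have cl: "basis_vec h \<odot>\<^bsub>M\<^esub> x \<ominus>\<^bsub>M\<^esub> x \<in> carrier M" if "h \<in> carrier G" "x \<in> carrier M" for h x
    using that b by (intro M.M.minus_closed M.smult_closed)
  show ?thesis
  proof (rule mod_homI)
    show "(\<lambda>x\<in>carrier M. \<lambda>h\<in>carrier G. basis_vec h \<odot>\<^bsub>M\<^esub> x \<ominus>\<^bsub>M\<^esub> x) \<in> carrier M \<rightarrow>\<^sub>E carrier (conj_maps G M)"
      using cl by (auto simp: conj_maps_simps(1))
  next
    fix x y assume xy: "x \<in> carrier M" "y \<in> carrier M"
    then show "(\<lambda>x\<in>carrier M. \<lambda>h\<in>carrier G. basis_vec h \<odot>\<^bsub>M\<^esub> x \<ominus>\<^bsub>M\<^esub> x) (x \<oplus>\<^bsub>M\<^esub> y) =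
      (\<lambda>x\<in>carrier M. \<lambda>h\<in>carrier G. basis_vec h \<odot>\<^bsub>M\<^esub> x \<ominus>\<^bsub>M\<^esub> x) x \<oplus>\<^bsub>conj_maps G M\<^esub>
      (\<lambda>x\<in>carrier M. \<lambda>h\<in>carrier G. basis_vec h \<odot>\<^bsub>M\<^esub> x \<ominus>\<^bsub>M\<^esub> x) y"
      using M.smult_r_distr[OF b] M.smult_closed[OF b] M.M.minus_interchange
      by (auto simp: conj_maps_simps(3) intro!: restrict_ext)
  next
    fix r x assume r: "r \<in> carrier ?R" and x: "x \<in> carrier M"
    have "basis_vec h \<odot>\<^bsub>M\<^esub> (r \<odot>\<^bsub>M\<^esub> x) \<ominus>\<^bsub>M\<^esub> r \<odot>\<^bsub>M\<^esub> x =
        finsum M (\<lambda>g. ?p r g \<odot>\<^bsub>M\<^esub> (basis_vec (inv g \<otimes> h \<otimes> g) \<odot>\<^bsub>M\<^esub> x \<ominus>\<^bsub>M\<^esub> x)) (carrier G)"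
      if h: "h \<in> carrier G" for h
    proof -
      have c1: "?p r g \<otimes>\<^bsub>?R\<^esub> basis_vec (inv g \<otimes> h \<otimes> g) \<in> carrier ?R" if "g \<in> carrier G" for g
        using that h p b by (intro M.R.m_closed) auto
      \<comment> \<open>The summand at g is r_g g (g^-1 h g) = r_g h g, and these add up to h
        r.\<close>
      have coeff: "(\<lambda>z. \<Sum>g\<in>carrier G. (?p r g \<otimes>\<^bsub>?R\<^esub> basis_vec (inv g \<otimes> h \<otimes> g)) z) = basis_vec h \<otimes>\<^bsub>?R\<^esub> r"
      proof
        fix z
        show "(\<Sum>g\<in>carrier G. (?p r g \<otimes>\<^bsub>?R\<^esub> basis_vec (inv g \<otimes> h \<otimes> g)) z) = (basis_vec h \<otimes>\<^bsub>?R\<^esub> r) z"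
        proof (cases "z \<in> carrier G")
          case z: True
          have eq: "inv g \<otimes> z = inv g \<otimes> h \<otimes> g \<longleftrightarrow> g = inv h \<otimes> z" if "g \<in> carrier G" for g
          proof -
            have "inv g \<otimes> z = inv g \<otimes> (h \<otimes> g) \<longleftrightarrow> z = h \<otimes> g" using that h z by simp
            then show ?thesis using that h z by (simp add: m_assoc inv_solve_left[of g h z])
          qed
          have "(?p r g \<otimes>\<^bsub>?R\<^esub> basis_vec (inv g \<otimes> h \<otimes> g)) z = (if g = inv h \<otimes> z then r g else 0)"
            if g: "g \<in> carrier G" for g
          proof -
            have "(?p r g \<otimes>\<^bsub>?R\<^esub> basis_vec (inv g \<otimes> h \<otimes> g)) z =
                (\<Sum>a\<in>carrier G. if a = g then r g * basis_vec (inv g \<otimes> h \<otimes> g) (inv g \<otimes> z) else 0)"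
              using z unfolding mult_group_algebra[OF fin homogeneous_part_closed[OF g] basis_vec_closed[OF conj_closed[OF g h]]]
              by (auto simp: homogeneous_part_def intro!: sum.cong)
            then show ?thesis using fin g eq[OF g] by (simp add: basis_vec_def)
          qed
          then have "(\<Sum>g\<in>carrier G. (?p r g \<otimes>\<^bsub>?R\<^esub> basis_vec (inv g \<otimes> h \<otimes> g)) z) = r (inv h \<otimes> z)"
            using fin h z by simp
          also have "\<dots> = (\<Sum>a\<in>carrier G. if a = h then r (inv a \<otimes> z) else 0)"
            using fin h by simp
          also have "\<dots> = (basis_vec h \<otimes>\<^bsub>?R\<^esub> r) z"
            using r z by (subst mult_group_algebra[OF fin basis_vec_closed[OF h]])
              (auto simp: basis_vec_def intro!: sum.cong)
          finally show ?thesis .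
        next
          case False
          then have "(?p r g \<otimes>\<^bsub>?R\<^esub> basis_vec (inv g \<otimes> h \<otimes> g)) z = 0" if "g \<in> carrier G" for g
            using c1[OF that] by (simp add: lin_space_outside)
          moreover have "(basis_vec h \<otimes>\<^bsub>?R\<^esub> r) z = 0"
            using M.R.m_closed[OF b[OF h] r] False by (simp add: lin_space_outside)
          ultimately show ?thesis by simp
        qed
      qed
      have bx: "basis_vec (inv g \<otimes> h \<otimes> g) \<odot>\<^bsub>M\<^esub> x \<in> carrier M" if "g \<in> carrier G" for g
        using that h x b by (intro M.smult_closed) auto
      \<comment> \<open>The term r x is added so that the sums recombine without negatives;
        \<open>minus_eqI\<close> takes it back to the other side at the end.\<close>
      have "finsum M (\<lambda>g. ?p r g \<odot>\<^bsub>M\<^esub> (basis_vec (inv g \<otimes> h \<otimes> g) \<odot>\<^bsub>M\<^esub> x \<ominus>\<^bsub>M\<^esub> x)) (carrier G) \<oplus>\<^bsub>M\<^esub> r \<odot>\<^bsub>M\<^esub> x =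
          finsum M (\<lambda>g. ?p r g \<odot>\<^bsub>M\<^esub> (basis_vec (inv g \<otimes> h \<otimes> g) \<odot>\<^bsub>M\<^esub> x \<ominus>\<^bsub>M\<^esub> x)) (carrier G) \<oplus>\<^bsub>M\<^esub>
          finsum M (\<lambda>g. ?p r g \<odot>\<^bsub>M\<^esub> x) (carrier G)"
        using left_module_sum_smult[where c = "?p r", OF M fin homogeneous_part_closed x] sum_homogeneous_part[OF fin, of r] r by simp
      also have "\<dots> = finsum M (\<lambda>g. ?p r g \<odot>\<^bsub>M\<^esub> (basis_vec (inv g \<otimes> h \<otimes> g) \<odot>\<^bsub>M\<^esub> x \<ominus>\<^bsub>M\<^esub> x) \<oplus>\<^bsub>M\<^esub> ?p r g \<odot>\<^bsub>M\<^esub> x) (carrier G)"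
        using bx x p by (intro M.M.finsum_addf[symmetric]) (auto intro!: M.smult_closed)
      also have "\<dots> = finsum M (\<lambda>g. (?p r g \<otimes>\<^bsub>?R\<^esub> basis_vec (inv g \<otimes> h \<otimes> g)) \<odot>\<^bsub>M\<^esub> x) (carrier G)"
      proof (rule M.M.finsum_cong')
        fix g assume g: "g \<in> carrier G"
        have "?p r g \<odot>\<^bsub>M\<^esub> (basis_vec (inv g \<otimes> h \<otimes> g) \<odot>\<^bsub>M\<^esub> x \<ominus>\<^bsub>M\<^esub> x) \<oplus>\<^bsub>M\<^esub> ?p r g \<odot>\<^bsub>M\<^esub> x =
            ?p r g \<odot>\<^bsub>M\<^esub> (basis_vec (inv g \<otimes> h \<otimes> g) \<odot>\<^bsub>M\<^esub> x)"
          using bx[OF g] x p[OF g] by (simp add: M.smult_r_distr[symmetric] M.M.add_minus_cancel del: carrier_group_algebra)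
        then show "?p r g \<odot>\<^bsub>M\<^esub> (basis_vec (inv g \<otimes> h \<otimes> g) \<odot>\<^bsub>M\<^esub> x \<ominus>\<^bsub>M\<^esub> x) \<oplus>\<^bsub>M\<^esub> ?p r g \<odot>\<^bsub>M\<^esub> x =
            (?p r g \<otimes>\<^bsub>?R\<^esub> basis_vec (inv g \<otimes> h \<otimes> g)) \<odot>\<^bsub>M\<^esub> x"
          using M.smult_assoc[OF p[OF g] b x, of "inv g \<otimes> h \<otimes> g" r] g h by simp
      qed (use c1 x in \<open>auto intro!: M.smult_closed\<close>)
      also have "\<dots> = (basis_vec h \<otimes>\<^bsub>?R\<^esub> r) \<odot>\<^bsub>M\<^esub> x"
        using left_module_sum_smult[OF M fin _ x, of "\<lambda>g. ?p r g \<otimes>\<^bsub>?R\<^esub> basis_vec (inv g \<otimes> h \<otimes> g)"] c1 coeff by simp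
      also have "\<dots> = basis_vec h \<odot>\<^bsub>M\<^esub> (r \<odot>\<^bsub>M\<^esub> x)"
        by (rule M.smult_assoc[OF b[OF h] r x])
      finally have "finsum M (\<lambda>g. ?p r g \<odot>\<^bsub>M\<^esub> (basis_vec (inv g \<otimes> h \<otimes> g) \<odot>\<^bsub>M\<^esub> x \<ominus>\<^bsub>M\<^esub> x)) (carrier G)
          \<oplus>\<^bsub>M\<^esub> r \<odot>\<^bsub>M\<^esub> x = basis_vec h \<odot>\<^bsub>M\<^esub> (r \<odot>\<^bsub>M\<^esub> x)" .
      moreover have "finsum M (\<lambda>g. ?p r g \<odot>\<^bsub>M\<^esub> (basis_vec (inv g \<otimes> h \<otimes> g) \<odot>\<^bsub>M\<^esub> x \<ominus>\<^bsub>M\<^esub> x)) (carrier G) \<in> carrier M"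
        using M.smult_closed[OF p M.M.minus_closed[OF bx x]] by (intro M.M.finsum_closed) blast
      ultimately show ?thesis
        using M.smult_closed[OF r x] by (intro M.M.minus_eqI)
    qed
    then show "(\<lambda>x\<in>carrier M. \<lambda>h\<in>carrier G. basis_vec h \<odot>\<^bsub>M\<^esub> x \<ominus>\<^bsub>M\<^esub> x) (r \<odot>\<^bsub>M\<^esub> x) =
        r \<odot>\<^bsub>conj_maps G M\<^esub> (\<lambda>x\<in>carrier M. \<lambda>h\<in>carrier G. basis_vec h \<odot>\<^bsub>M\<^esub> x \<ominus>\<^bsub>M\<^esub> x) x"
      using M.smult_closed[OF r x] x
      by (auto simp: conj_maps_simps(4) intro!: restrict_ext M.M.finsum_cong' M.smult_closed homogeneous_part_closed cl)
  qed
qed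

section \<open>Null-homotopy of the translations of a resolution\<close>

lemma abelian_group_character_module: "abelian_group (character_module \<kappa>)"
  by (rule abelian_groupI) (auto simp: character_module_def intro: exI[of _ "- x" for x])

lemma finsum_based_module:
  fixes c :: "'i \<Rightarrow> 'x \<Rightarrow> 'k::field"
  assumes "finite X" "finite I" "\<And>i. i \<in> I \<Longrightarrow> c i \<in> lin_space X"
  shows "finsum (based_module X \<beta>) c I z = (\<Sum>i\<in>I. c i z)"
  using assms(2,3)
proof (induction I rule: finite_induct)
  case empty
  interpret abelian_group "based_module X \<beta>" by (rule abelian_group_based_module[OF assms(1)])
  show ?case by (simp add: based_module_simps(2))
next
  case (insert i I)
  interpret abelian_group "based_module X \<beta>" by (rule abelian_group_based_module[OF assms(1)])
  show ?case
    using insert by (subst finsum_insert) (auto simp: based_module_simps)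
qed

text \<open>The complex of the \<open>conj_maps G (Q n)\<close> is exact in positive degrees because
  it is so at each h, and h q - q is killed by the augmentation because G acts trivially on K. Hence
  the chain map q \<mapsto> (h \<mapsto> h q - q) is null-homotopic, and a homotopy with values in
  \<open>conj_maps\<close> is automatically compatible with conjugation.\<close>

lemma (in group) conj_translation_null_homotopic:
  fixes Q :: "nat \<Rightarrow> ('a \<Rightarrow> 'k::field, 'q) module"
  assumes fin: "finite (carrier G)"
    and Q: "projective_resolution (group_algebra G) trivial_group_module Q d \<epsilon>"
  shows "\<exists>s. (\<forall>n. s n \<in> mod_hom (group_algebra G) (Q n) (conj_maps G (Q (Suc n)))) \<and>
    (\<forall>q\<in>carrier (Q 0). \<forall>h\<in>carrier G. basis_vec h \<odot>\<^bsub>Q 0\<^esub> q \<ominus>\<^bsub>Q 0\<^esub> q = d 0 (s 0 q h)) \<and>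
    (\<forall>n. \<forall>q\<in>carrier (Q (Suc n)). \<forall>h\<in>carrier G. basis_vec h \<odot>\<^bsub>Q (Suc n)\<^esub> q \<ominus>\<^bsub>Q (Suc n)\<^esub> q =
       d (Suc n) (s (Suc n) q h) \<oplus>\<^bsub>Q (Suc n)\<^esub> s n (d n q) h)"
proof -
  let ?R = "group_algebra G :: ('a \<Rightarrow> 'k) ring"
  let ?W = "\<lambda>n. conj_maps G (Q n)"
  define e where "e n = (\<lambda>w\<in>carrier (?W (Suc n)). \<lambda>h\<in>carrier G. d n (w h))" for n
  define E where "E n = (\<lambda>q\<in>carrier (Q n). \<lambda>h\<in>carrier G. basis_vec h \<odot>\<^bsub>Q n\<^esub> q \<ominus>\<^bsub>Q n\<^esub> q)" for n
  have Qp: "projective_module ?R (Q n)" "left_module ?R (Q n)" and d: "d n \<in> mod_hom ?R (Q (Suc n)) (Q n)" for n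
    using Q by (auto simp: projective_resolution_def projective_module_def)
  have eps: "\<epsilon> \<in> mod_hom ?R (Q 0) trivial_group_module"
    and ex0: "{p \<in> carrier (Q 0). \<epsilon> p = \<zero>\<^bsub>trivial_group_module :: ('a \<Rightarrow> 'k, 'k) module\<^esub>} = d 0 ` carrier (Q 1)"
    and ex: "\<And>n. {p \<in> carrier (Q (Suc n)). d n p = \<zero>\<^bsub>Q n\<^esub>} = d (Suc n) ` carrier (Q (Suc (Suc n)))"
    using Q by (auto simp: projective_resolution_def)
  note ag = left_module_abelian_group[OF Qp(2)]
  have W: "left_module ?R (?W n)" for n by (rule left_module_conj_maps[OF fin Qp(2)])
  have e: "e n \<in> mod_hom ?R (?W (Suc n)) (?W n)" for n
    unfolding e_def by (rule compose_pointwise_conj_maps_hom[OF group_axioms fin Qp(2) Qp(2) d])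
  have E: "E n \<in> mod_hom ?R (Q n) (?W n)" for n
    unfolding E_def by (rule conj_translation_hom[OF fin Qp(2)])
  have b: "basis_vec h \<in> carrier ?R" if "h \<in> carrier G" for h using basis_vec_closed[OF that] by simp
  have bq: "basis_vec h \<odot>\<^bsub>Q n\<^esub> q \<in> carrier (Q n)" if "h \<in> carrier G" "q \<in> carrier (Q n)" for h q n
    using left_module.smult_closed[OF Qp(2) b[OF that(1)] that(2)] .
  have dq: "d n q \<in> carrier (Q n)" if "q \<in> carrier (Q (Suc n))" for n q using mod_hom_closed[OF d that] .
  \<comment> \<open>Preimages are chosen for each h separately. Exactness concerns images as sets;
    the equivariance of the homotopy is supplied later by projectivity of the Q n.\<close>
  have lift: "\<exists>w\<in>carrier (?W (Suc n)). \<forall>h\<in>carrier G. y h = d n (w h)"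
    if "\<And>h. h \<in> carrier G \<Longrightarrow> y h \<in> d n ` carrier (Q (Suc n))" for y n
  proof -
    have "\<forall>h\<in>carrier G. \<exists>w. w \<in> carrier (Q (Suc n)) \<and> y h = d n w" using that by blast
    then obtain w where "\<And>h. h \<in> carrier G \<Longrightarrow> w h \<in> carrier (Q (Suc n)) \<and> y h = d n (w h)" by metis
    then show ?thesis by (intro bexI[of _ "restrict w (carrier G)"]) (auto simp: conj_maps_simps(1))
  qed
  have "\<exists>s. (\<forall>n. s n \<in> mod_hom ?R (Q n) (?W (Suc n))) \<and> (\<forall>q\<in>carrier (Q 0). E 0 q = e 0 (s 0 q)) \<and>
    (\<forall>n. \<forall>q\<in>carrier (Q (Suc n)). E (Suc n) q = e (Suc n) (s (Suc n) q) \<oplus>\<^bsub>?W (Suc n)\<^esub> s n (d n q))"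
  proof (rule null_homotopy[where P = Q and d = d and C = ?W and e = e and E = E and R = ?R])
    show "d n (d (Suc n) p) = \<zero>\<^bsub>Q n\<^esub>" if "p \<in> carrier (Q (Suc (Suc n)))" for n p
      using ex that by auto
    show "y \<in> e (Suc n) ` carrier (?W (Suc (Suc n)))" if y: "y \<in> carrier (?W (Suc n))" "e n y = \<zero>\<^bsub>?W n\<^esub>" for n y
    proof -
      have yh: "y h \<in> d (Suc n) ` carrier (Q (Suc (Suc n)))" if h: "h \<in> carrier G" for h
      proof -
        have "y h \<in> carrier (Q (Suc n))" using y h by (auto simp: conj_maps_simps(1))
        moreover have "d n (y h) = \<zero>\<^bsub>Q n\<^esub>"
          using fun_cong[OF y(2), of h] y(1) h by (simp add: e_def conj_maps_simps(2))
        ultimately show ?thesis using ex by blast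
      qed
      have "\<exists>w\<in>carrier (?W (Suc (Suc n))). \<forall>h\<in>carrier G. y h = d (Suc n) (w h)"
        by (rule lift) (rule yh)
      then obtain w where w: "w \<in> carrier (?W (Suc (Suc n)))" "\<forall>h\<in>carrier G. y h = d (Suc n) (w h)"
        by (rule bexE)
      then have "y = e (Suc n) w"
        using y(1) by (auto simp: e_def conj_maps_simps(1) fun_eq_iff PiE_iff extensional_def)
      then show ?thesis using w by blast
    qed
    show "e n (E (Suc n) p) = E n (d n p)" if p: "p \<in> carrier (Q (Suc n))" for n p
    proof -
      have "d n (basis_vec h \<odot>\<^bsub>Q (Suc n)\<^esub> p \<ominus>\<^bsub>Q (Suc n)\<^esub> p) = basis_vec h \<odot>\<^bsub>Q n\<^esub> d n p \<ominus>\<^bsub>Q n\<^esub> d n p"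
        if h: "h \<in> carrier G" for h
        by (simp only: mod_hom_minus[OF d ag ag bq[OF h p] p] mod_hom_smult[OF d b[OF h] p])
      moreover have "E (Suc n) p \<in> carrier (?W (Suc n))" using mod_hom_closed[OF E p] .
      ultimately show ?thesis using p dq by (auto simp: e_def) (auto simp: E_def intro!: restrict_ext)
    qed
    show "E 0 ` carrier (Q 0) \<subseteq> e 0 ` carrier (?W (Suc 0))"
    proof (rule image_subsetI)
      fix q assume q: "q \<in> carrier (Q 0)"
      have Eh: "E 0 q h \<in> d 0 ` carrier (Q (Suc 0))" if h: "h \<in> carrier G" for h
      proof -
        let ?T = "trivial_group_module :: ('a \<Rightarrow> 'k, 'k) module"
        have T: "abelian_group ?T" by (simp add: trivial_group_module_def abelian_group_character_module)
        have supp: "{y. (basis_vec h y :: 'k) \<noteq> 0} = {h}" by (auto simp: basis_vec_def)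
        have "\<epsilon> (basis_vec h \<odot>\<^bsub>Q 0\<^esub> q) = basis_vec h \<odot>\<^bsub>?T\<^esub> \<epsilon> q"
          by (rule mod_hom_smult[OF eps b[OF h] q])
        also have "\<dots> = \<epsilon> q"
          by (simp add: trivial_group_module_def character_module_def supp) (simp add: basis_vec_def)
        finally have "\<epsilon> (basis_vec h \<odot>\<^bsub>Q 0\<^esub> q \<ominus>\<^bsub>Q 0\<^esub> q) = \<zero>\<^bsub>?T\<^esub>"
          using abelian_group.minus_zero_iff[OF T] mod_hom_closed[OF eps q]
          by (simp add: mod_hom_minus[OF eps ag T bq[OF h q] q])
        moreover have "basis_vec h \<odot>\<^bsub>Q 0\<^esub> q \<ominus>\<^bsub>Q 0\<^esub> q \<in> carrier (Q 0)"
          using abelian_group.minus_closed[OF ag bq[OF h q] q] .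
        ultimately show ?thesis using ex0 q h by (auto simp: E_def)
      qed
      have "\<exists>w\<in>carrier (?W (Suc 0)). \<forall>h\<in>carrier G. E 0 q h = d 0 (w h)"
        by (rule lift) (rule Eh)
      then obtain w where w: "w \<in> carrier (?W (Suc 0))" "\<forall>h\<in>carrier G. E 0 q h = d 0 (w h)"
        by (rule bexE)
      then have "E 0 q = e 0 w"
        using mod_hom_closed[OF E q] by (auto simp: e_def conj_maps_simps(1) fun_eq_iff PiE_iff extensional_def)
      then show "E 0 q \<in> e 0 ` carrier (?W (Suc 0))" using w by blast
    qed
  qed (rule Qp(1) d W e E)+
  then obtain s where s: "\<And>n. s n \<in> mod_hom ?R (Q n) (?W (Suc n))" "\<And>q. q \<in> carrier (Q 0) \<Longrightarrow> E 0 q = e 0 (s 0 q)"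
    "\<And>n q. q \<in> carrier (Q (Suc n)) \<Longrightarrow> E (Suc n) q = e (Suc n) (s (Suc n) q) \<oplus>\<^bsub>?W (Suc n)\<^esub> s n (d n q)" by blast
  have sc: "s n q \<in> carrier (?W (Suc n))" if "q \<in> carrier (Q n)" for n q using mod_hom_closed[OF s(1) that] .
  show ?thesis
  proof (intro exI[of _ s] conjI allI ballI s(1))
    fix q h assume "q \<in> carrier (Q 0)" "h \<in> carrier G"
    then show "basis_vec h \<odot>\<^bsub>Q 0\<^esub> q \<ominus>\<^bsub>Q 0\<^esub> q = d 0 (s 0 q h)"
      using fun_cong[OF s(2), of q h] sc by (simp add: E_def e_def)
  next
    fix n q h assume "q \<in> carrier (Q (Suc n))" "h \<in> carrier G"
    then show "basis_vec h \<odot>\<^bsub>Q (Suc n)\<^esub> q \<ominus>\<^bsub>Q (Suc n)\<^esub> q = d (Suc n) (s (Suc n) q h) \<oplus>\<^bsub>Q (Suc n)\<^esub> s n (d n q) h"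
      using fun_cong[OF s(3), of q n h] sc by (simp add: E_def e_def conj_maps_simps(3))
  qed
qed

text \<open>The element deg x commutes with itself, so moving x by it keeps the degree, and the
  twist is undone by the inverse of deg x. Equivariance is a (deg x) x = (a (deg x) a^-1) (a
  x).\<close>

lemma (in graded_gset) twist_props:
  shows "inj_on (\<lambda>x. act (deg x) x) X" and "(\<lambda>x. act (deg x) x) ` X \<subseteq> X"
    and "\<lbrakk>a \<in> carrier G; x \<in> X\<rbrakk> \<Longrightarrow> act a (act (deg x) x) = act (deg (act a x)) (act a x)"
    and "x \<in> X \<Longrightarrow> deg (act (deg x) x) = deg x"
proof -
  show d: "deg (act (deg x) x) = deg x" if "x \<in> X" for x
    using that by (simp add: deg_act deg_closed m_assoc)
  show "inj_on (\<lambda>x. act (deg x) x) X"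
    by (rule inj_onI) (metis d act_inv_act deg_closed)
  show "(\<lambda>x. act (deg x) x) ` X \<subseteq> X" by (auto simp: act_closed deg_closed)
  show "act a (act (deg x) x) = act (deg (act a x)) (act a x)" if "a \<in> carrier G" "x \<in> X"
    using that by (simp add: deg_act deg_closed act_mult[symmetric] act_closed m_assoc)
qed

text \<open>On the component of degree \<open>h\<close> the twist is translation by \<open>h\<close>. As a chain map of the
  resolution translation by \<open>h\<close> is homotopic to the identity, and the homotopies can be chosen
  compatibly with conjugation.\<close>

lemma (in graded_gset) Ext_map_twist:
  fixes Q :: "nat \<Rightarrow> ('g \<Rightarrow> 'k::field, 'q) module"
  assumes Q: "projective_resolution (group_algebra G) trivial_group_module Q d \<epsilon>"
    and Y: "Y \<in> carrier (Ext (group_algebra G) Q d perm_module m)"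
  shows "Ext_map (group_algebra G) Q d perm_module m (lin_ext (\<lambda>x. basis_vec (act (deg x) x))) Y = Y"
proof -
  let ?R = "group_algebra G :: ('g \<Rightarrow> 'k) ring" and ?M = "perm_module :: ('g \<Rightarrow> 'k, 'x \<Rightarrow> 'k) module"
  let ?t = "\<lambda>x. act (deg x) x" and ?p = homogeneous_part
  have Qm: "left_module ?R (Q n)" and d: "d n \<in> mod_hom ?R (Q (Suc n)) (Q n)" for n
    using Q by (auto simp: projective_resolution_def projective_module_def)
  have R: "ring ?R" using left_module_ring[OF Qm] .
  have M: "left_module ?R ?M" by (rule left_module_perm_module[OF R])
  interpret M: left_module ?R ?M by (rule M)
  interpret E: ext_complex ?R Q d ?M
    using ext_complex_based_algebra[of _ _ _ trivial_group_module Q d \<epsilon> ?M] Q M by (simp add: group_algebra_def)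
  have cM: "carrier ?M = lin_space X" and aM: "\<And>v w. v \<oplus>\<^bsub>?M\<^esub> w = (\<lambda>x. v x + w x)"
    and zM: "\<zero>\<^bsub>?M\<^esub> = (\<lambda>_. 0)" by (simp_all add: based_module_simps)
  note tw = twist_props
  have th: "restrict (lin_ext (\<lambda>x. basis_vec (?t x))) (carrier ?M) \<in> mod_hom ?R ?M ?M"
    by (rule perm_module_hom[OF tw(1,2) _ R]) (simp add: tw(3))
  have b: "basis_vec h \<in> carrier ?R" if "h \<in> carrier G" for h using basis_vec_closed[OF that] by simp
  obtain f where f: "f \<in> cocycles ?R Q d ?M m" "Y = E.cls m f" using E.Ext_carrierE[OF Y] by blast
  have fh: "f \<in> mod_hom ?R (Q m) ?M" and fd: "\<And>q. q \<in> carrier (Q (Suc m)) \<Longrightarrow> f (d m q) = (\<lambda>_. 0)"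
    using f(1) by (auto simp: E.cocycles_iff zM)
  have fc: "f q \<in> lin_space X" if "q \<in> carrier (Q m)" for q using mod_hom_closed[OF fh that] cM by simp
  obtain s where s: "\<And>n. s n \<in> mod_hom ?R (Q n) (conj_maps G (Q (Suc n)))"
    and s0: "\<And>q h. \<lbrakk>q \<in> carrier (Q 0); h \<in> carrier G\<rbrakk> \<Longrightarrow> basis_vec h \<odot>\<^bsub>Q 0\<^esub> q \<ominus>\<^bsub>Q 0\<^esub> q = d 0 (s 0 q h)"
    and sSuc: "\<And>n q h. \<lbrakk>q \<in> carrier (Q (Suc n)); h \<in> carrier G\<rbrakk> \<Longrightarrow>
       basis_vec h \<odot>\<^bsub>Q (Suc n)\<^esub> q \<ominus>\<^bsub>Q (Suc n)\<^esub> q = d (Suc n) (s (Suc n) q h) \<oplus>\<^bsub>Q (Suc n)\<^esub> s n (d n q) h"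
    using conj_translation_null_homotopic[OF finite_G Q] by blast
  have sc: "s n q h \<in> carrier (Q (Suc n))" if "q \<in> carrier (Q n)" "h \<in> carrier G" for n q h
    using mod_hom_closed[OF s that(1)] that(2) by (auto simp: conj_maps_simps(1))
  have dc: "d n q \<in> carrier (Q n)" if "q \<in> carrier (Q (Suc n))" for n q using mod_hom_closed[OF d that] .
  \<comment> \<open>At z the twisted vector has the coefficient of f q at (deg z)^-1 z, which is the
    coefficient of (deg z) . f q at z; linearity of f then moves deg z to the resolution.\<close>
  have key: "lin_ext (\<lambda>x. basis_vec (?t x)) (f q) z = f (basis_vec (deg z) \<odot>\<^bsub>Q m\<^esub> q \<ominus>\<^bsub>Q m\<^esub> q) z + f q z"
    if q: "q \<in> carrier (Q m)" and z: "z \<in> X" for q z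
  proof -
    let ?x = "act (inv (deg z)) z"
    have dz: "deg z \<in> carrier G" using deg_closed[OF z] .
    have x: "?x \<in> X" "deg ?x = deg z" using z dz by (simp_all add: act_closed deg_act m_assoc)
    then have tx: "?t ?x = z" using z dz by (simp add: act_act_inv)
    have "lin_ext (\<lambda>x. basis_vec (?t x)) (f q) z = f q ?x"
      using lin_ext_basis_apply[OF finite_X fc[OF q] tw(1) x(1)] tx by simp
    also have "\<dots> = (\<Sum>a\<in>carrier G. if a = deg z then f q (act (inv a) z) else 0)"
      using finite_G dz by simp
    also have "\<dots> = (basis_vec (deg z) \<odot>\<^bsub>?M\<^esub> f q) z"
      using z by (simp add: smult_perm_module[OF basis_vec_closed[OF dz] fc[OF q]])
        (auto simp: basis_vec_def intro!: sum.cong)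
    also have "basis_vec (deg z) \<odot>\<^bsub>?M\<^esub> f q = f (basis_vec (deg z) \<odot>\<^bsub>Q m\<^esub> q)"
      using mod_hom_smult[OF fh b[OF dz] q] by simp
    also have "basis_vec (deg z) \<odot>\<^bsub>Q m\<^esub> q = (basis_vec (deg z) \<odot>\<^bsub>Q m\<^esub> q \<ominus>\<^bsub>Q m\<^esub> q) \<oplus>\<^bsub>Q m\<^esub> q"
      using abelian_group.add_minus_cancel[OF left_module_abelian_group[OF Qm] left_module.smult_closed[OF Qm b[OF dz] q] q] by simp
    also have "f \<dots> = (\<lambda>z'. f (basis_vec (deg z) \<odot>\<^bsub>Q m\<^esub> q \<ominus>\<^bsub>Q m\<^esub> q) z' + f q z')"
      using mod_hom_add[OF fh abelian_group.minus_closed[OF left_module_abelian_group[OF Qm] left_module.smult_closed[OF Qm b[OF dz] q] q] q]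
      by (simp add: aM)
    finally show ?thesis .
  qed
  have Lc: "lin_ext (\<lambda>x. basis_vec (?t x)) (f q) \<in> lin_space X" if "q \<in> carrier (Q m)" for q
    by (rule lin_ext_basis_in_lin_space[OF finite_X fc[OF that] tw(2)])
  have "\<exists>b\<in>coboundaries ?R Q d ?M m.
      compose (carrier (Q m)) (lin_ext (\<lambda>x. basis_vec (?t x))) f = b \<oplus>\<^bsub>E.V m\<^esub> f"
  proof (cases m)
    case 0
    have "lin_ext (\<lambda>x. basis_vec (?t x)) (f q) = f q" if q: "q \<in> carrier (Q 0)" for q
    proof
      fix z
      show "lin_ext (\<lambda>x. basis_vec (?t x)) (f q) z = f q z"
      proof (cases "z \<in> X")
        case True
        have "f (d 0 (s 0 q (deg z))) = (\<lambda>_. 0)" using fd sc q deg_closed[OF True] 0 by simp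
        then show ?thesis using key[of q z] q True s0[OF q deg_closed[OF True]] 0 by simp
      next
        case False
        then show ?thesis using lin_space_outside[OF Lc, of q z] lin_space_outside[OF fc, of q z] q 0 by simp
      qed
    qed
    then show ?thesis
      using 0 by (auto simp: E.zero_V E.add_V aM zM compose_def intro!: restrict_ext)
  next
    case (Suc k)
    note fh' = fh[unfolded Suc] and fc' = fc[unfolded Suc]
    \<comment> \<open>At the coordinate z the homotopy for the group element deg z is used. The
      element thus varies with the coordinate, and compatibility of the homotopies with conjugation
      is what makes H linear over the group algebra.\<close>
    define H where "H = (\<lambda>q\<in>carrier (Q k). \<lambda>z. if z \<in> X then f (s k q (deg z)) z else 0)"
    have "H \<in> mod_hom ?R (Q k) ?M"
    proof (rule mod_homI)
      show "H \<in> carrier (Q k) \<rightarrow>\<^sub>E carrier ?M"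
        by (auto simp: H_def cM intro!: lin_spaceI[OF finite_X])
    next
      fix p q assume pq: "p \<in> carrier (Q k)" "q \<in> carrier (Q k)"
      have "p \<oplus>\<^bsub>Q k\<^esub> q \<in> carrier (Q k)" using pq abelian_groupE(1)[OF left_module_abelian_group[OF Qm]] by blast
      moreover have "f (s k (p \<oplus>\<^bsub>Q k\<^esub> q) h) = (\<lambda>z. f (s k p h) z + f (s k q h) z)" if h: "h \<in> carrier G" for h
        using mod_hom_add[OF s pq] mod_hom_add[OF fh' sc[OF pq(1) h] sc[OF pq(2) h]] h
        by (simp add: conj_maps_simps(3) aM)
      ultimately show "H (p \<oplus>\<^bsub>Q k\<^esub> q) = H p \<oplus>\<^bsub>?M\<^esub> H q"
        using pq deg_closed by (auto simp: H_def aM fun_eq_iff)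
    next
      fix r q assume r: "r \<in> carrier ?R" and q: "q \<in> carrier (Q k)"
      have rq: "r \<odot>\<^bsub>Q k\<^esub> q \<in> carrier (Q k)" using left_module.smult_closed[OF Qm r q] .
      have Hq: "H q \<in> lin_space X" using q by (auto simp: H_def intro!: lin_spaceI[OF finite_X])
      show "H (r \<odot>\<^bsub>Q k\<^esub> q) = r \<odot>\<^bsub>?M\<^esub> H q"
      proof
        fix z
        show "H (r \<odot>\<^bsub>Q k\<^esub> q) z = (r \<odot>\<^bsub>?M\<^esub> H q) z"
        proof (cases "z \<in> X")
          case z: True
          let ?h = "deg z"
          have h: "?h \<in> carrier G" using deg_closed[OF z] .
          have sg: "s k q (inv g \<otimes> ?h \<otimes> g) \<in> carrier (Q (Suc k))" if "g \<in> carrier G" for g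
            using sc[OF q conj_closed[OF that h]] .
          have p: "?p r g \<in> carrier ?R" if "g \<in> carrier G" for g using homogeneous_part_closed[OF that] by simp
          have "H (r \<odot>\<^bsub>Q k\<^esub> q) z = f (s k (r \<odot>\<^bsub>Q k\<^esub> q) ?h) z" using rq z by (simp add: H_def)
          also have "s k (r \<odot>\<^bsub>Q k\<^esub> q) ?h =
              finsum (Q (Suc k)) (\<lambda>g. ?p r g \<odot>\<^bsub>Q (Suc k)\<^esub> s k q (inv g \<otimes> ?h \<otimes> g)) (carrier G)"
            using mod_hom_smult[OF s r q] h by (simp add: conj_maps_simps(4))
          also have "f \<dots> = finsum ?M (\<lambda>g. f (?p r g \<odot>\<^bsub>Q (Suc k)\<^esub> s k q (inv g \<otimes> ?h \<otimes> g))) (carrier G)"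
            using sg p by (intro mod_hom_finsum[OF fh' left_module_abelian_group[OF Qm] M.abelian_group_axioms finite_G])
              (auto intro!: left_module.smult_closed[OF Qm])
          also have "\<dots> = finsum ?M (\<lambda>g. ?p r g \<odot>\<^bsub>?M\<^esub> f (s k q (inv g \<otimes> ?h \<otimes> g))) (carrier G)"
            using sg p mod_hom_closed[OF fh'] by (intro M.M.finsum_cong') (auto intro!: mod_hom_smult[OF fh'] M.smult_closed)
          also have "\<dots> z = (\<Sum>g\<in>carrier G. (?p r g \<odot>\<^bsub>?M\<^esub> f (s k q (inv g \<otimes> ?h \<otimes> g))) z)"
          proof (rule finsum_based_module[OF finite_X finite_G])
            fix g assume g: "g \<in> carrier G"
            show "?p r g \<odot>\<^bsub>?M\<^esub> f (s k q (inv g \<otimes> ?h \<otimes> g)) \<in> lin_space X"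
              using M.smult_closed[OF p[OF g] mod_hom_closed[OF fh' sg[OF g]]] by (simp add: cM)
          qed
          also have "\<dots> = (\<Sum>g\<in>carrier G. r g * H q (act (inv g) z))"
          proof (rule sum.cong)
            fix g assume g: "g \<in> carrier G"
            have "(?p r g \<odot>\<^bsub>?M\<^esub> f (s k q (inv g \<otimes> ?h \<otimes> g))) z =
                (\<Sum>a\<in>carrier G. if a = g then r g * f (s k q (inv g \<otimes> ?h \<otimes> g)) (act (inv g) z) else 0)"
              using z unfolding smult_perm_module[OF homogeneous_part_closed[OF g] fc'[OF sg[OF g]]]
              by (auto simp: homogeneous_part_def intro!: sum.cong)
            then show "(?p r g \<odot>\<^bsub>?M\<^esub> f (s k q (inv g \<otimes> ?h \<otimes> g))) z = r g * H q (act (inv g) z)"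
              using finite_G g q z by (simp add: H_def act_closed deg_act)
          qed simp
          also have "\<dots> = (r \<odot>\<^bsub>?M\<^esub> H q) z"
            using z r Hq by (simp add: smult_perm_module)
          finally show ?thesis .
        next
          case False
          then show ?thesis using rq r Hq by (simp add: H_def smult_perm_module)
        qed
      qed
    qed
    moreover have "lin_ext (\<lambda>x. basis_vec (?t x)) (f q) = (\<lambda>z. H (d k q) z + f q z)" if q: "q \<in> carrier (Q m)" for q
    proof
      fix z
      show "lin_ext (\<lambda>x. basis_vec (?t x)) (f q) z = H (d k q) z + f q z"
      proof (cases "z \<in> X")
        case True
        have h: "deg z \<in> carrier G" using deg_closed[OF True] .
        have q': "q \<in> carrier (Q (Suc k))" using q Suc by simp
        have "f (basis_vec (deg z) \<odot>\<^bsub>Q m\<^esub> q \<ominus>\<^bsub>Q m\<^esub> q) =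
            (\<lambda>z'. f (d m (s m q (deg z))) z' + f (s k (d k q) (deg z)) z')"
          using sSuc[OF q' h] mod_hom_add[OF fh' dc[OF sc[OF q' h]] sc[OF dc[OF q'] h]] Suc by (simp add: aM)
        moreover have "f (d m (s m q (deg z))) = (\<lambda>_. 0)" using fd sc[OF q h] by simp
        ultimately show ?thesis using key[OF q True] dc[OF q'] True by (simp add: H_def)
      next
        case False
        then show ?thesis
          using lin_space_outside[OF Lc[OF q], of z] lin_space_outside[OF fc[OF q], of z] dc[of q k] q Suc by (simp add: H_def)
      qed
    qed
    then have "compose (carrier (Q m)) (lin_ext (\<lambda>x. basis_vec (?t x))) f = compose (carrier (Q m)) H (d k) \<oplus>\<^bsub>E.V m\<^esub> f"
      by (auto simp: E.add_V aM compose_def intro!: restrict_ext)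
    ultimately show ?thesis using Suc by auto
  qed
  then have "E.cls m (compose (carrier (Q m)) (lin_ext (\<lambda>x. basis_vec (?t x))) f) = E.cls m f"
    using E.cls_eqI fh by blast
  then show ?thesis using E.Ext_map_cls[OF th fh] f(2) by simp
qed

section \<open>The fundamental groupoid\<close>

text \<open>Paths with the same ends in a convex set are homotopic there, and \<open>h\<close>
  carries the homotopy to S. The unit and inverse laws arise with [0, 1] as the convex set, and the
  effect of a free homotopy with the unit square.\<close>

lemma homotopic_paths_via_convex:
  fixes C :: "'b::real_normed_vector set" and h :: "'b \<Rightarrow> 'a::topological_space"
  assumes "convex C" "continuous_on C h" "h ` C \<subseteq> S"
    and "path u" "path_image u \<subseteq> C" "path v" "path_image v \<subseteq> C"
    and "pathstart u = pathstart v" "pathfinish u = pathfinish v"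
  shows "homotopic_paths S (h \<circ> u) (h \<circ> v)"
proof -
  have "homotopic_paths C u v"
    using convex_imp_simply_connected[OF assms(1)] assms(4-) unfolding simply_connected_eq_homotopic_paths by simp
  then show ?thesis using assms(2,3) by (intro homotopic_paths_continuous_image) auto
qed

lemma homotopic_paths_reparam:
  fixes p :: "real \<Rightarrow> 'a::topological_space"
  assumes "path p" "path_image p \<subseteq> S" "path u" "path_image u \<subseteq> {0..1}" "path v" "path_image v \<subseteq> {0..1}"
    and "pathstart u = pathstart v" "pathfinish u = pathfinish v"
  shows "homotopic_paths S (p \<circ> u) (p \<circ> v)"
proof (rule homotopic_paths_via_convex)
  show "convex {0..1::real}" by simp
  show "continuous_on {0..1} p" using assms(1) by (simp add: path_def)
  show "p ` {0..1} \<subseteq> S" using assms(2) by (simp add: path_image_def)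
qed (use assms in simp_all)

lemma path_id_01: "path (\<lambda>t::real. t)" "path_image (\<lambda>t::real. t) = {0..1}"
  "pathstart (\<lambda>t::real. t) = 0" "pathfinish (\<lambda>t::real. t) = 1"
  by (auto simp: path_def path_image_def pathstart_def pathfinish_def intro!: continuous_intros)

lemma path_const [simp]: "path (\<lambda>_. a)" "path_image (\<lambda>_. a) = {a}" "pathstart (\<lambda>_. a) = a" "pathfinish (\<lambda>_. a) = a"
  by (auto simp: path_def path_image_def pathstart_def pathfinish_def)

lemma homotopic_paths_const_right:
  assumes "path p" "path_image p \<subseteq> S"
  shows "homotopic_paths S (p +++ (\<lambda>_. pathfinish p)) p"
proof -
  have "homotopic_paths S (p \<circ> ((\<lambda>t. t) +++ (\<lambda>_. 1))) (p \<circ> (\<lambda>t. t))"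
    by (rule homotopic_paths_reparam[OF assms]) (simp_all add: path_id_01 path_image_join)
  then show ?thesis unfolding path_compose_join by (simp add: o_def pathfinish_def)
qed

lemma homotopic_paths_const_left:
  assumes "path p" "path_image p \<subseteq> S"
  shows "homotopic_paths S ((\<lambda>_. pathstart p) +++ p) p"
proof -
  have "homotopic_paths S (p \<circ> ((\<lambda>_. 0) +++ (\<lambda>t. t))) (p \<circ> (\<lambda>t. t))"
    by (rule homotopic_paths_reparam[OF assms]) (simp_all add: path_id_01 path_image_join)
  then show ?thesis unfolding path_compose_join by (simp add: o_def pathstart_def)
qed

lemma homotopic_paths_reverse_right:
  assumes "path p" "path_image p \<subseteq> S"
  shows "homotopic_paths S (p +++ reversepath p) (\<lambda>_. pathstart p)"
proof -
  have "homotopic_paths S (p \<circ> ((\<lambda>t. t) +++ reversepath (\<lambda>t. t))) (p \<circ> (\<lambda>_. 0))"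
    by (rule homotopic_paths_reparam[OF assms]) (simp_all add: path_id_01 path_image_join)
  then show ?thesis unfolding path_compose_join by (simp add: o_def pathstart_def reversepath_def)
qed

text \<open>The sets of morphisms of the fundamental groupoid of S. A map that moves the base point
  sends loops at x to loops elsewhere, so classes of paths with arbitrary ends are required.\<close>

definition path_classes :: "'a::topological_space set \<Rightarrow> 'a \<Rightarrow> 'a \<Rightarrow> (real \<Rightarrow> 'a) set set" where
  "path_classes S a b = path_class S ` {p. path p \<and> path_image p \<subseteq> S \<and> pathstart p = a \<and> pathfinish p = b}"

text \<open>The formula of the product in \<open>fundamental_group\<close>, so that the two agree
  for loops by unfolding.\<close>

definition class_mult :: "'a::topological_space set \<Rightarrow> (real \<Rightarrow> 'a) set \<Rightarrow> (real \<Rightarrow> 'a) set \<Rightarrow> (real \<Rightarrow> 'a) set" where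
  "class_mult S X Y = (\<Union>p\<in>X. \<Union>q\<in>Y. path_class S (p +++ q))"

definition class_inv :: "'a::topological_space set \<Rightarrow> (real \<Rightarrow> 'a) set \<Rightarrow> (real \<Rightarrow> 'a) set" where
  "class_inv S X = (\<Union>p\<in>X. path_class S (reversepath p))"

section \<open>Evaluation on representatives\<close>

lemma path_class_eqI: "homotopic_paths S p q \<Longrightarrow> path_class S p = path_class S q"
  unfolding path_class_def using homotopic_paths_sym homotopic_paths_trans by blast

lemma path_class_self: "\<lbrakk>path p; path_image p \<subseteq> S\<rbrakk> \<Longrightarrow> p \<in> path_class S p"
  by (simp add: path_class_def)

lemma path_classesE:
  assumes "X \<in> path_classes S a b"
  obtains p where "path p" "path_image p \<subseteq> S" "pathstart p = a" "pathfinish p = b" "X = path_class S p"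
  using assms by (auto simp: path_classes_def)

lemma path_classesI:
  "\<lbrakk>path p; path_image p \<subseteq> S; pathstart p = a; pathfinish p = b\<rbrakk> \<Longrightarrow> path_class S p \<in> path_classes S a b"
  by (auto simp: path_classes_def)

text \<open>Products, inverses and images of classes are unions over representatives. Homotopy
  invariance makes all members of the union equal, and p itself is one of the
  representatives.\<close>

lemma UN_path_class:
  assumes "path p" "path_image p \<subseteq> S" "\<And>q. homotopic_paths S p q \<Longrightarrow> F q = F p"
  shows "(\<Union>q\<in>path_class S p. F q) = F p"
proof -
  have "F q = F p" if "q \<in> path_class S p" for q using that assms(3) by (simp only: path_class_def mem_Collect_eq)
  then show ?thesis using path_class_self[OF assms(1,2)] by blast
qed

lemma class_mult_path_class:
  assumes "path p" "path_image p \<subseteq> S" "path q" "path_image q \<subseteq> S" "pathfinish p = pathstart q"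
  shows "class_mult S (path_class S p) (path_class S q) = path_class S (p +++ q)"
proof -
  have 1: "(\<Union>q'\<in>path_class S q. path_class S (p' +++ q')) = path_class S (p' +++ q)"
    if "homotopic_paths S p p'" for p'
  proof (rule UN_path_class[OF assms(3,4)])
    fix q' assume "homotopic_paths S q q'"
    moreover have "homotopic_paths S p' p'" using that homotopic_paths_imp_path[OF that] homotopic_paths_imp_subset[OF that] by simp
    moreover have "pathfinish p' = pathstart q" using that assms(5) homotopic_paths_imp_pathfinish by metis
    ultimately show "path_class S (p' +++ q') = path_class S (p' +++ q)"
      using homotopic_paths_join path_class_eqI by metis
  qed
  have 2: "path_class S (p' +++ q) = path_class S (p +++ q)" if "homotopic_paths S p p'" for p'
    using homotopic_paths_join[OF that, of q q] assms by (intro path_class_eqI[symmetric]) simp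
  have F: "(\<Union>q'\<in>path_class S q. path_class S (p' +++ q')) = path_class S (p +++ q)"
    if "homotopic_paths S p p'" for p'
    using 1[OF that] 2[OF that] by simp
  have pp: "homotopic_paths S p p" using assms by simp
  have "(\<Union>p'\<in>path_class S p. \<Union>q'\<in>path_class S q. path_class S (p' +++ q')) =
      (\<Union>q'\<in>path_class S q. path_class S (p +++ q'))"
    by (rule UN_path_class[OF assms(1,2)]) (simp only: F F[OF pp])
  then show ?thesis unfolding class_mult_def F[OF pp] .
qed

lemma class_inv_path_class:
  assumes "path p" "path_image p \<subseteq> S"
  shows "class_inv S (path_class S p) = path_class S (reversepath p)"
  unfolding class_inv_def using assms
  by (rule UN_path_class) (auto intro!: path_class_eqI simp: homotopic_paths_reversepath homotopic_paths_sym)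

lemma path_continuous_image_in:
  assumes "path p" "path_image p \<subseteq> S" "continuous_on S \<psi>" "\<psi> ` S \<subseteq> S"
  shows "path (\<psi> \<circ> p)" "path_image (\<psi> \<circ> p) \<subseteq> S"
proof -
  show "path (\<psi> \<circ> p)"
    using assms by (intro path_continuous_image) (auto intro: continuous_on_subset)
  show "path_image (\<psi> \<circ> p) \<subseteq> S"
    using assms(2,4) unfolding path_image_compose by blast
qed

lemma pi1_map_path_class:
  assumes "path p" "path_image p \<subseteq> S" "continuous_on S \<psi>" "\<psi> ` S \<subseteq> S"
  shows "pi1_map S \<psi> (path_class S p) = path_class S (\<psi> \<circ> p)"
  unfolding pi1_map_def using assms(1,2)
proof (rule UN_path_class)
  fix q assume "homotopic_paths S p q"
  then have "homotopic_paths S (\<psi> \<circ> q) (\<psi> \<circ> p)"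
    using assms(3,4) by (intro homotopic_paths_continuous_image[OF homotopic_paths_sym]) auto
  then show "path_class S (\<psi> \<circ> q) = path_class S (\<psi> \<circ> p)" by (rule path_class_eqI)
qed

section \<open>Groupoid laws for classes of paths\<close>

lemma class_mult_closed:
  "\<lbrakk>X \<in> path_classes S a b; Y \<in> path_classes S b c\<rbrakk> \<Longrightarrow> class_mult S X Y \<in> path_classes S a c"
  by (elim path_classesE) (auto simp: class_mult_path_class path_image_join intro!: path_classesI)

lemma class_mult_assoc:
  "\<lbrakk>X \<in> path_classes S a b; Y \<in> path_classes S b c; Z \<in> path_classes S c e\<rbrakk> \<Longrightarrow>
    class_mult S (class_mult S X Y) Z = class_mult S X (class_mult S Y Z)"
  by (elim path_classesE)
    (auto simp: class_mult_path_class path_image_join intro!: path_class_eqI[symmetric] homotopic_paths_assoc)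

lemma class_one_closed: "a \<in> S \<Longrightarrow> path_class S (\<lambda>_. a) \<in> path_classes S a a"
  by (intro path_classesI) simp_all

lemma class_mult_one_left: "X \<in> path_classes S a b \<Longrightarrow> class_mult S (path_class S (\<lambda>_. a)) X = X"
proof (elim path_classesE)
  fix p assume p: "path p" "path_image p \<subseteq> S" "pathstart p = a" "pathfinish p = b" "X = path_class S p"
  then have "a \<in> S" using pathstart_in_path_image by blast
  then show ?thesis
    using p homotopic_paths_const_left[OF p(1,2)] by (auto simp: class_mult_path_class intro!: path_class_eqI)
qed

lemma class_mult_one_right: "X \<in> path_classes S a b \<Longrightarrow> class_mult S X (path_class S (\<lambda>_. b)) = X"
proof (elim path_classesE)
  fix p assume p: "path p" "path_image p \<subseteq> S" "pathstart p = a" "pathfinish p = b" "X = path_class S p"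
  then have "b \<in> S" using pathfinish_in_path_image by blast
  then show ?thesis
    using p homotopic_paths_const_right[OF p(1,2)] by (auto simp: class_mult_path_class intro!: path_class_eqI)
qed

lemma class_inv_closed: "X \<in> path_classes S a b \<Longrightarrow> class_inv S X \<in> path_classes S b a"
  by (elim path_classesE) (auto simp: class_inv_path_class intro!: path_classesI)

lemma class_inv_inv: "X \<in> path_classes S a b \<Longrightarrow> class_inv S (class_inv S X) = X"
  by (elim path_classesE) (simp add: class_inv_path_class)

lemma class_mult_inv_right: "X \<in> path_classes S a b \<Longrightarrow> class_mult S X (class_inv S X) = path_class S (\<lambda>_. a)"
proof (elim path_classesE)
  fix p assume p: "path p" "path_image p \<subseteq> S" "pathstart p = a" "pathfinish p = b" "X = path_class S p"
  then show ?thesis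
    using homotopic_paths_reverse_right[OF p(1,2)]
    by (auto simp: class_mult_path_class class_inv_path_class intro!: path_class_eqI)
qed

lemma class_mult_inv_left: "X \<in> path_classes S a b \<Longrightarrow> class_mult S (class_inv S X) X = path_class S (\<lambda>_. b)"
  using class_mult_inv_right[OF class_inv_closed] by (metis class_inv_inv)

lemma class_mult_inv_cancel_left:
  assumes "X \<in> path_classes S a b" "Y \<in> path_classes S b c"
  shows "class_mult S (class_inv S X) (class_mult S X Y) = Y"
  using assms class_mult_assoc[OF class_inv_closed[OF assms(1)] assms]
  by (simp add: class_mult_inv_left class_mult_one_left)

lemma class_inv_mult:
  "\<lbrakk>X \<in> path_classes S a b; Y \<in> path_classes S b c\<rbrakk> \<Longrightarrow>
    class_inv S (class_mult S X Y) = class_mult S (class_inv S Y) (class_inv S X)"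
  by (elim path_classesE)
    (simp add: class_mult_path_class class_inv_path_class path_image_join reversepath_joinpaths)

section \<open>Functoriality of the induced maps on classes of paths\<close>

lemma pi1_map_closed:
  assumes "continuous_on S \<psi>" "\<psi> ` S \<subseteq> S" "X \<in> path_classes S a b"
  shows "pi1_map S \<psi> X \<in> path_classes S (\<psi> a) (\<psi> b)"
  using assms(3)
proof (rule path_classesE)
  fix p assume p: "path p" "path_image p \<subseteq> S" "pathstart p = a" "pathfinish p = b" "X = path_class S p"
  then show ?thesis
    using p path_continuous_image_in[OF p(1,2) assms(1,2)] assms(1,2)
    by (auto simp: pi1_map_path_class pathstart_compose pathfinish_compose intro!: path_classesI)
qed

lemma pi1_map_mult:
  assumes "continuous_on S \<psi>" "\<psi> ` S \<subseteq> S" "X \<in> path_classes S a b" "Y \<in> path_classes S b c"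
  shows "pi1_map S \<psi> (class_mult S X Y) = class_mult S (pi1_map S \<psi> X) (pi1_map S \<psi> Y)"
proof -
  obtain p q where p: "path p" "path_image p \<subseteq> S" "pathstart p = a" "pathfinish p = b" "X = path_class S p"
    and q: "path q" "path_image q \<subseteq> S" "pathstart q = b" "pathfinish q = c" "Y = path_class S q"
    using assms(3,4) by (elim path_classesE) blast
  note path_continuous_image_in[OF p(1,2) assms(1,2)] path_continuous_image_in[OF q(1,2) assms(1,2)]
  then show ?thesis
    using p q assms(1,2)
    by (simp add: class_mult_path_class pi1_map_path_class path_image_join path_compose_join
        pathstart_compose pathfinish_compose)
qed

lemma pi1_map_inv:
  assumes "continuous_on S \<psi>" "\<psi> ` S \<subseteq> S" "X \<in> path_classes S a b"
  shows "pi1_map S \<psi> (class_inv S X) = class_inv S (pi1_map S \<psi> X)"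
  using assms(3)
proof (rule path_classesE)
  fix p assume p: "path p" "path_image p \<subseteq> S" "pathstart p = a" "pathfinish p = b" "X = path_class S p"
  then show ?thesis
    using p assms path_continuous_image_in[OF p(1,2) assms(1,2)] by (simp add: class_inv_path_class pi1_map_path_class) (simp add: o_def reversepath_def)
qed

text \<open>The composite \<xi> is prescribed on S only, because functions such as
  \<open>inv_into S \<psi>\<close> and \<open>compose S \<psi> \<phi>\<close> are meaningful there
  only.\<close>

lemma pi1_map_compose:
  assumes "continuous_on S \<psi>" "\<psi> ` S \<subseteq> S" "continuous_on S \<phi>" "\<phi> ` S \<subseteq> S" "X \<in> path_classes S a b"
    and "\<And>y. y \<in> S \<Longrightarrow> \<xi> y = \<phi> (\<psi> y)"
  shows "pi1_map S \<xi> X = pi1_map S \<phi> (pi1_map S \<psi> X)"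
  using assms(5)
proof (rule path_classesE)
  fix p assume p: "path p" "path_image p \<subseteq> S" "pathstart p = a" "pathfinish p = b" "X = path_class S p"
  note \<psi>p = path_continuous_image_in[OF p(1,2) assms(1,2)]
  note \<phi>p = path_continuous_image_in[OF \<psi>p assms(3,4)]
  have "(\<phi> \<circ> (\<psi> \<circ> p)) t = (\<xi> \<circ> p) t" if "t \<in> {0..1}" for t
    using p(2) that assms(6) by (auto simp: path_image_def image_subset_iff)
  then have "homotopic_paths S (\<phi> \<circ> (\<psi> \<circ> p)) (\<xi> \<circ> p)" using \<phi>p by (intro homotopic_paths_eq) auto
  moreover have "continuous_on S \<xi>" "\<xi> ` S \<subseteq> S"
    using continuous_on_compose2[OF assms(3,1,2)] continuous_on_cong[of S S \<xi> "\<lambda>y. \<phi> (\<psi> y)"] assms by auto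
  ultimately show ?thesis
    using p assms \<psi>p by (simp add: pi1_map_path_class path_class_eqI)
qed

lemma pi1_map_id:
  assumes "X \<in> path_classes S a b" "\<And>y. y \<in> S \<Longrightarrow> \<psi> y = y"
  shows "pi1_map S \<psi> X = X"
  using assms(1)
proof (rule path_classesE)
  fix p assume p: "path p" "path_image p \<subseteq> S" "pathstart p = a" "pathfinish p = b" "X = path_class S p"
  have "continuous_on S \<psi>" using assms(2) continuous_on_cong[of S S \<psi> "\<lambda>y. y"] by auto
  moreover have "\<psi> ` S \<subseteq> S" using assms(2) by auto
  ultimately have "pi1_map S \<psi> X = path_class S (\<psi> \<circ> p)"
    unfolding p(5) by (rule pi1_map_path_class[OF p(1,2)])
  also have "\<dots> = X"
    unfolding p(5) using p assms(2)
    by (intro path_class_eqI[symmetric] homotopic_paths_eq) (auto simp: path_image_def image_subset_iff)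
  finally show ?thesis .
qed

section \<open>Automorphisms induced by homeomorphisms that move the base point\<close>

lemma carrier_fundamental_group: "carrier (fundamental_group S x) = path_classes S x x"
  by (auto simp: fundamental_group_def path_classes_def loops_at_def)

lemma mult_fundamental_group: "X \<otimes>\<^bsub>fundamental_group S x\<^esub> Y = class_mult S X Y"
  by (simp add: fundamental_group_def class_mult_def)

lemma one_fundamental_group: "\<one>\<^bsub>fundamental_group S x\<^esub> = path_class S (\<lambda>_. x)"
  by (simp add: fundamental_group_def)

lemma group_fundamental_group:
  assumes "x \<in> S"
  shows "group (fundamental_group S x)"
proof (rule groupI)
  fix X assume "X \<in> carrier (fundamental_group S x)"
  then have X: "X \<in> path_classes S x x" by (simp add: carrier_fundamental_group)
  show "\<exists>Y\<in>carrier (fundamental_group S x). Y \<otimes>\<^bsub>fundamental_group S x\<^esub> X = \<one>\<^bsub>fundamental_group S x\<^esub>"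
    unfolding carrier_fundamental_group mult_fundamental_group one_fundamental_group
    using class_inv_closed[OF X] class_mult_inv_left[OF X] by blast
qed (auto simp: carrier_fundamental_group mult_fundamental_group one_fundamental_group class_one_closed assms
      class_mult_assoc class_mult_one_left intro: class_mult_closed)

lemma inv_fundamental_group:
  assumes "x \<in> S" "X \<in> path_classes S x x"
  shows "inv\<^bsub>fundamental_group S x\<^esub> X = class_inv S X"
  using group.inv_equality[OF group_fundamental_group[OF assms(1)]] assms
  by (simp add: carrier_fundamental_group mult_fundamental_group one_fundamental_group class_mult_inv_left class_inv_closed)

text \<open>Change of base point: go along c from x to its image, around the image of X, and back
  along c.\<close>

definition based_map ::
    "'a::topological_space set \<Rightarrow> (real \<Rightarrow> 'a) set \<Rightarrow> ('a \<Rightarrow> 'a) \<Rightarrow> (real \<Rightarrow> 'a) set \<Rightarrow> (real \<Rightarrow> 'a) set" where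
  "based_map S c \<psi> X = class_mult S c (class_mult S (pi1_map S \<psi> X) (class_inv S c))"

text \<open>The automorphisms of the fundamental group at \<open>x\<close> induced by \<open>\<psi>\<close>, one for each class of paths
  from \<open>x\<close> to \<open>\<psi> x\<close>.\<close>

definition based_maps ::
    "'a::topological_space set \<Rightarrow> 'a \<Rightarrow> ('a \<Rightarrow> 'a) \<Rightarrow> ((real \<Rightarrow> 'a) set \<Rightarrow> (real \<Rightarrow> 'a) set) set" where
  "based_maps S x \<psi> = (\<lambda>c. based_map S c \<psi>) ` path_classes S x (\<psi> x)"

context
  fixes S :: "'a::topological_space set" and x :: 'a
  assumes x: "x \<in> S"
begin

lemma based_map_closed:
  assumes "continuous_on S \<psi>" "\<psi> ` S \<subseteq> S" "c \<in> path_classes S x (\<psi> x)" "X \<in> path_classes S x x"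
  shows "based_map S c \<psi> X \<in> path_classes S x x"
  unfolding based_map_def using assms
  by (auto intro!: class_mult_closed class_inv_closed pi1_map_closed)

lemma based_map_mult:
  assumes "continuous_on S \<psi>" "\<psi> ` S \<subseteq> S" "c \<in> path_classes S x (\<psi> x)"
    and X: "X \<in> path_classes S x x" and Y: "Y \<in> path_classes S x x"
  shows "based_map S c \<psi> (class_mult S X Y) = class_mult S (based_map S c \<psi> X) (based_map S c \<psi> Y)"
proof -
  note c = assms(3)
  note c' = class_inv_closed[OF c]
  define U where "U = pi1_map S \<psi> X"
  define V where "V = pi1_map S \<psi> Y"
  have U: "U \<in> path_classes S (\<psi> x) (\<psi> x)" and V: "V \<in> path_classes S (\<psi> x) (\<psi> x)"
    unfolding U_def V_def using assms by (auto intro: pi1_map_closed)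
  note cl = class_mult_closed
  have "class_mult S (class_mult S c (class_mult S U (class_inv S c))) (class_mult S c (class_mult S V (class_inv S c))) =
      class_mult S c (class_mult S (class_mult S U (class_inv S c)) (class_mult S c (class_mult S V (class_inv S c))))"
    by (rule class_mult_assoc[OF c cl[OF U c'] cl[OF c cl[OF V c']]])
  also have "\<dots> = class_mult S c (class_mult S U (class_mult S (class_inv S c) (class_mult S c (class_mult S V (class_inv S c)))))"
    by (simp only: class_mult_assoc[OF U c' cl[OF c cl[OF V c']]])
  also have "\<dots> = class_mult S c (class_mult S U (class_mult S V (class_inv S c)))"
    by (simp only: class_mult_inv_cancel_left[OF c cl[OF V c']])
  also have "\<dots> = class_mult S c (class_mult S (class_mult S U V) (class_inv S c))"
    by (simp only: class_mult_assoc[OF U V c'])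
  finally show ?thesis
    unfolding based_map_def pi1_map_mult[OF assms(1,2) X Y] U_def V_def by simp
qed

lemma based_maps_hom:
  assumes "continuous_on S \<psi>" "\<psi> ` S \<subseteq> S" "a \<in> based_maps S x \<psi>"
  shows "a \<in> hom (fundamental_group S x) (fundamental_group S x)"
  using assms unfolding based_maps_def hom_def
  by (auto simp: carrier_fundamental_group mult_fundamental_group based_map_closed based_map_mult)

text \<open>The path that belongs to the composite runs along b to \<phi> x and then along the
  \<phi>-image of c.\<close>

lemma based_map_based_map:
  assumes \<psi>: "continuous_on S \<psi>" "\<psi> ` S \<subseteq> S" and \<phi>: "continuous_on S \<phi>" "\<phi> ` S \<subseteq> S"
    and \<xi>: "\<And>y. y \<in> S \<Longrightarrow> \<xi> y = \<phi> (\<psi> y)"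
    and b: "b \<in> path_classes S x (\<phi> x)" and c: "c \<in> path_classes S x (\<psi> x)" and X: "X \<in> path_classes S x x"
  shows "based_map S b \<phi> (based_map S c \<psi> X) = based_map S (class_mult S b (pi1_map S \<phi> c)) \<xi> X"
proof -
  define e where "e = pi1_map S \<phi> c"
  define U where "U = pi1_map S \<phi> (pi1_map S \<psi> X)"
  have e: "e \<in> path_classes S (\<phi> x) (\<phi> (\<psi> x))" unfolding e_def by (rule pi1_map_closed[OF \<phi> c])
  have pX: "pi1_map S \<psi> X \<in> path_classes S (\<psi> x) (\<psi> x)" by (rule pi1_map_closed[OF \<psi> X])
  have U: "U \<in> path_classes S (\<phi> (\<psi> x)) (\<phi> (\<psi> x))" unfolding U_def by (rule pi1_map_closed[OF \<phi> pX])
  have \<xi>X: "pi1_map S \<xi> X = U" unfolding U_def by (rule pi1_map_compose[OF \<psi> \<phi> X]) (rule \<xi>)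
  note e' = class_inv_closed[OF e] and b' = class_inv_closed[OF b] and cl = class_mult_closed
  have "pi1_map S \<phi> (based_map S c \<psi> X) = class_mult S e (class_mult S U (class_inv S e))"
    unfolding based_map_def
    by (simp only: pi1_map_mult[OF \<phi> c cl[OF pX class_inv_closed[OF c]]]
        pi1_map_mult[OF \<phi> pX class_inv_closed[OF c]] pi1_map_inv[OF \<phi> c] e_def U_def)
  then have "based_map S b \<phi> (based_map S c \<psi> X) =
      class_mult S b (class_mult S (class_mult S e (class_mult S U (class_inv S e))) (class_inv S b))"
    by (simp add: based_map_def)
  also have "\<dots> = class_mult S b (class_mult S e (class_mult S U (class_mult S (class_inv S e) (class_inv S b))))"
    by (simp only: class_mult_assoc[OF e cl[OF U e'] b'] class_mult_assoc[OF U e' b'])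
  also have "\<dots> = class_mult S (class_mult S b e) (class_mult S U (class_inv S (class_mult S b e)))"
    by (simp only: class_inv_mult[OF b e] class_mult_assoc[OF b e cl[OF U cl[OF e' b']]])
  also have "\<dots> = based_map S (class_mult S b e) \<xi> X"
    unfolding based_map_def[of S "class_mult S b e"] \<xi>X ..
  finally show ?thesis unfolding e_def .
qed

lemma based_maps_compose:
  assumes \<psi>: "continuous_on S \<psi>" "\<psi> ` S \<subseteq> S" and \<phi>: "continuous_on S \<phi>" "\<phi> ` S \<subseteq> S"
    and \<xi>: "\<And>y. y \<in> S \<Longrightarrow> \<xi> y = \<phi> (\<psi> y)"
    and "b \<in> based_maps S x \<phi>" "a \<in> based_maps S x \<psi>"
  shows "\<exists>e\<in>based_maps S x \<xi>. \<forall>X\<in>path_classes S x x. b (a X) = e X"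
proof -
  obtain b' a' where b': "b' \<in> path_classes S x (\<phi> x)" "b = based_map S b' \<phi>"
    and a': "a' \<in> path_classes S x (\<psi> x)" "a = based_map S a' \<psi>"
    using assms(6,7) by (auto simp: based_maps_def)
  have "class_mult S b' (pi1_map S \<phi> a') \<in> path_classes S x (\<xi> x)"
    using class_mult_closed[OF b'(1) pi1_map_closed[OF \<phi> a'(1)]] \<xi>[OF x] by simp
  then show ?thesis
    using based_map_based_map[where \<xi> = \<xi>, OF \<psi> \<phi> _ b'(1) a'(1)] \<xi> b'(2) a'(2)
    unfolding based_maps_def by (intro bexI[of _ "based_map S (class_mult S b' (pi1_map S \<phi> a')) \<xi>"]) auto
qed

text \<open>Two connecting classes a' and b' differ by the loop b' a'^-1 at x, and this loop is the
  conjugating element.\<close>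

lemma based_maps_inner:
  assumes \<psi>: "continuous_on S \<psi>" "\<psi> ` S \<subseteq> S" and "a \<in> based_maps S x \<psi>" "b \<in> based_maps S x \<psi>"
  shows "\<exists>c\<in>path_classes S x x. \<forall>X\<in>path_classes S x x. b X = class_mult S c (class_mult S (a X) (class_inv S c))"
proof -
  obtain a' b' where a': "a' \<in> path_classes S x (\<psi> x)" "a = based_map S a' \<psi>"
    and b': "b' \<in> path_classes S x (\<psi> x)" "b = based_map S b' \<psi>"
    using assms(3,4) by (auto simp: based_maps_def)
  define c where "c = class_mult S b' (class_inv S a')"
  note cl = class_mult_closed and ai = class_inv_closed[OF a'(1)] and bi = class_inv_closed[OF b'(1)]
  have c: "c \<in> path_classes S x x" unfolding c_def by (rule cl[OF b'(1) ai])
  have ci: "class_inv S c = class_mult S a' (class_inv S b')"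
    unfolding c_def by (simp only: class_inv_mult[OF b'(1) ai] class_inv_inv[OF a'(1)])
  have "b X = class_mult S c (class_mult S (a X) (class_inv S c))" if X: "X \<in> path_classes S x x" for X
  proof -
    define U where "U = pi1_map S \<psi> X"
    have U: "U \<in> path_classes S (\<psi> x) (\<psi> x)" unfolding U_def by (rule pi1_map_closed[OF \<psi> X])
    have "class_mult S (a X) (class_inv S c) =
        class_mult S a' (class_mult S (class_mult S U (class_inv S a')) (class_mult S a' (class_inv S b')))"
      unfolding a'(2) based_map_def ci U_def[symmetric] by (rule class_mult_assoc[OF a'(1) cl[OF U ai] cl[OF a'(1) bi]])
    also have "\<dots> = class_mult S a' (class_mult S U (class_inv S b'))"
      by (simp only: class_mult_assoc[OF U ai cl[OF a'(1) bi]] class_mult_inv_cancel_left[OF a'(1) bi])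
    finally have "class_mult S c (class_mult S (a X) (class_inv S c)) =
        class_mult S c (class_mult S a' (class_mult S U (class_inv S b')))" by simp
    also have "\<dots> = class_mult S b' (class_mult S U (class_inv S b'))"
      unfolding c_def
      by (simp only: class_mult_assoc[OF b'(1) ai cl[OF a'(1) cl[OF U bi]]] class_mult_inv_cancel_left[OF a'(1) cl[OF U bi]])
    finally show ?thesis unfolding b'(2) based_map_def U_def by simp
  qed
  then show ?thesis using c by blast
qed

text \<open>For \<psi> x = x the constant path is a connecting path.\<close>

lemma pi1_map_based_maps:
  assumes \<psi>: "continuous_on S \<psi>" "\<psi> ` S \<subseteq> S" "\<psi> x = x"
  shows "\<exists>a\<in>based_maps S x \<psi>. \<forall>X\<in>path_classes S x x. a X = pi1_map S \<psi> X"
proof -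
  let ?o = "path_class S (\<lambda>_. x)"
  have o: "?o \<in> path_classes S x x" by (rule class_one_closed[OF x])
  have "class_inv S ?o = ?o"
    using class_mult_inv_right[OF o] class_mult_one_left[OF class_inv_closed[OF o]] by simp
  then have "based_map S ?o \<psi> X = pi1_map S \<psi> X" if "X \<in> path_classes S x x" for X
    using pi1_map_closed[OF \<psi>(1,2) that] \<psi>(3)
    by (simp add: based_map_def class_mult_one_right class_mult_one_left)
  moreover have "based_map S ?o \<psi> \<in> based_maps S x \<psi>" using o \<psi>(3) by (simp add: based_maps_def)
  ultimately show ?thesis by blast
qed

text \<open>The track of the base point under a homotopy from the identity to \<open>\<psi>\<close>.\<close>

lemma homotopic_id_based_maps:
  assumes H: "continuous_on ({0..1} \<times> S) H" "\<And>t y. \<lbrakk>t \<in> {0..1::real}; y \<in> S\<rbrakk> \<Longrightarrow> H (t, y) \<in> S"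
    and H0: "\<And>y. y \<in> S \<Longrightarrow> H (0, y) = y" and H1: "\<And>y. y \<in> S \<Longrightarrow> H (1, y) = \<psi> y"
  shows "\<exists>a\<in>based_maps S x \<psi>. \<forall>X\<in>path_classes S x x. a X = X"
proof -
  define \<gamma> where "\<gamma> = (\<lambda>t. H (t, x))"
  have \<gamma>: "path \<gamma>" unfolding path_def \<gamma>_def
    by (rule continuous_on_compose2[OF H(1)]) (auto intro!: continuous_intros simp: x)
  have \<gamma>S: "path_image \<gamma> \<subseteq> S" using H(2) x by (auto simp: path_image_def \<gamma>_def)
  have \<gamma>01: "pathstart \<gamma> = x" "pathfinish \<gamma> = \<psi> x" using H0 H1 x by (auto simp: pathstart_def pathfinish_def \<gamma>_def)
  define c where "c = path_class S \<gamma>"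
  have c: "c \<in> path_classes S x (\<psi> x)" unfolding c_def using \<gamma> \<gamma>S \<gamma>01 by (rule path_classesI)
  have \<psi>: "continuous_on S \<psi>"
  proof -
    have "continuous_on S (\<lambda>y. H (1, y))"
      by (rule continuous_on_compose2[OF H(1)]) (auto intro!: continuous_intros)
    then show ?thesis by (rule continuous_on_eq) (rule H1)
  qed
  have \<psi>S: "\<psi> ` S \<subseteq> S" using H(2)[of 1] H1 by auto
  have "based_map S c \<psi> X = X" if "X \<in> path_classes S x x" for X
    using that
  proof (rule path_classesE)
    fix p assume p: "path p" "path_image p \<subseteq> S" "pathstart p = x" "pathfinish p = x" "X = path_class S p"
    \<comment> \<open>A map from the unit square to S: the first coordinate is the time of the
      homotopy, the second the parameter of the loop.\<close>
    define K where "K = (\<lambda>(t, s). H (t, p s))"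
    have pS: "p s \<in> S" if "s \<in> {0..1}" for s using p(2) that by (auto simp: path_image_def image_subset_iff)
    have "continuous_on {0..1} p" using p(1) by (simp add: path_def)
    then have "continuous_on ({0..1} \<times> {0..1}) (\<lambda>z. p (snd z))"
      by (rule continuous_on_compose2) (auto intro!: continuous_intros)
    then have K: "continuous_on ({0..1} \<times> {0..1}) K"
      unfolding K_def case_prod_unfold using pS
      by (intro continuous_on_compose2[OF H(1)] continuous_intros) auto
    \<comment> \<open>The two ways along the boundary of the square from (0, 0) to (1, 1): the loop
      followed by the track of x, and the track followed by the moved loop.\<close>
    have "homotopic_paths S (K \<circ> ((\<lambda>t. (0, t)) +++ (\<lambda>t. (t, 1)))) (K \<circ> ((\<lambda>t. (t, 0)) +++ (\<lambda>t. (1, t))))"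
    proof (rule homotopic_paths_via_convex[OF _ K])
      show "convex ({0..1::real} \<times> {0..1::real})" by (intro convex_Times) auto
      show "K ` ({0..1} \<times> {0..1}) \<subseteq> S" using H(2) pS by (auto simp: K_def)
      have edges: "path (\<lambda>t::real. (0::real, t))" "path (\<lambda>t::real. (t, 1::real))"
        "path (\<lambda>t::real. (t, 0::real))" "path (\<lambda>t::real. (1::real, t))"
        by (auto simp: path_def intro!: continuous_intros)
      then show "path ((\<lambda>t::real. (0::real, t)) +++ (\<lambda>t. (t, 1)))" "path ((\<lambda>t::real. (t, 0::real)) +++ (\<lambda>t. (1, t)))"
        by (simp_all add: path_join_eq pathstart_def pathfinish_def)
      show "path_image ((\<lambda>t::real. (0::real, t)) +++ (\<lambda>t. (t, 1))) \<subseteq> {0..1} \<times> {0..1}"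
        "path_image ((\<lambda>t::real. (t, 0::real)) +++ (\<lambda>t. (1, t))) \<subseteq> {0..1} \<times> {0..1}"
        by (rule subset_path_image_join; auto simp: path_image_def)+
    qed (auto simp: pathstart_def pathfinish_def joinpaths_def)
    then have "homotopic_paths S ((\<lambda>t. H (0, p t)) +++ \<gamma>) (\<gamma> +++ (\<lambda>t. H (1, p t)))"
      using p(3,4) unfolding path_compose_join by (simp add: o_def K_def \<gamma>_def pathstart_def pathfinish_def)
    moreover have "homotopic_paths S (p +++ \<gamma>) ((\<lambda>t. H (0, p t)) +++ \<gamma>)"
    proof (rule homotopic_paths_join)
      show "homotopic_paths S p (\<lambda>t. H (0, p t))" using p H0 pS by (intro homotopic_paths_eq) auto
    qed (use \<gamma> \<gamma>S \<gamma>01 p in auto)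
    moreover note \<psi>p = path_continuous_image_in[OF p(1,2) \<psi> \<psi>S]
    then have "homotopic_paths S (\<gamma> +++ (\<psi> \<circ> p)) (\<gamma> +++ (\<lambda>t. H (1, p t)))"
      using \<gamma> \<gamma>S \<gamma>01 p H1 pS
      by (intro homotopic_paths_join homotopic_paths_eq) (auto simp: pathstart_compose)
    ultimately have "homotopic_paths S (p +++ \<gamma>) (\<gamma> +++ (\<psi> \<circ> p))"
      using homotopic_paths_trans homotopic_paths_sym by blast
    \<comment> \<open>The track c intertwines the identity with the map induced by \<psi>;
      multiplying by the inverse of c on the right gives the claim.\<close>
    then have eq: "class_mult S X c = class_mult S c (pi1_map S \<psi> X)"
      using p \<gamma> \<gamma>S \<gamma>01 \<psi> \<psi>S \<psi>p
      by (simp add: c_def class_mult_path_class pi1_map_path_class pathstart_compose path_class_eqI)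
    have X: "X \<in> path_classes S x x" by fact
    have "based_map S c \<psi> X = class_mult S (class_mult S c (pi1_map S \<psi> X)) (class_inv S c)"
      unfolding based_map_def
      using class_mult_assoc[OF c pi1_map_closed[OF \<psi> \<psi>S X] class_inv_closed[OF c]] by simp
    also have "\<dots> = X"
      unfolding eq[symmetric] class_mult_assoc[OF X c class_inv_closed[OF c]]
        class_mult_inv_right[OF c] by (rule class_mult_one_right[OF X])
    finally show ?thesis .
  qed
  then show ?thesis using c by (auto simp: based_maps_def)
qed

end

section \<open>Surfaces and their diffeomorphisms\<close>

text \<open>Balls in coordinates make S locally path connected, and for a connected space this
  suffices. Path connectedness is what provides a path from x to \<psi> x, hence an automorphism for
  every homeomorphism.\<close>

lemma path_connected_closed_oriented_surface:
  fixes S :: "'a::t2_space set"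
  assumes "closed_oriented_surface S \<A>"
  shows "path_connected S"
proof -
  have "locally path_connected S"
    unfolding locally_def
  proof (intro allI impI, elim conjE)
    fix w y assume w: "openin (top_of_set S) w" "y \<in> w"
    have "y \<in> S" using w openin_imp_subset by blast
    then obtain U \<phi> where c: "(U, \<phi>) \<in> \<A>" "y \<in> U"
      using assms by (force simp: closed_oriented_surface_def)
    define h where "h = inv_into U \<phi>"
    have U: "openin (top_of_set S) U" and op: "open (\<phi> ` U)" and hom: "homeomorphism U (\<phi> ` U) \<phi> h"
      using assms c(1) unfolding closed_oriented_surface_def h_def by blast+
    have wU: "openin (top_of_set U) (w \<inter> U)"
      using w(1) U by (metis inf_le2 openin_Int openin_imp_subset openin_subset_trans)
    have "openin (top_of_set (\<phi> ` U)) (\<phi> ` (w \<inter> U))"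
      using homeomorphism_imp_open_map[OF hom wU] .
    then have "open (\<phi> ` (w \<inter> U))" using op openin_open_eq by blast
    moreover have "\<phi> y \<in> \<phi> ` (w \<inter> U)" using w c by blast
    ultimately obtain e where e: "e > 0" "ball (\<phi> y) e \<subseteq> \<phi> ` (w \<inter> U)" using open_contains_ball by blast
    define V where "V = h ` ball (\<phi> y) e"
    have BU: "ball (\<phi> y) e \<subseteq> \<phi> ` U" using e by blast
    have "continuous_on (ball (\<phi> y) e) h"
      using hom BU by (auto simp: homeomorphism_def intro: continuous_on_subset)
    then have pc: "path_connected V"
      unfolding V_def by (intro path_connected_continuous_image convex_imp_path_connected convex_ball)
    have "openin (top_of_set U) V"
      unfolding V_def using homeomorphism_imp_open_map[OF homeomorphism_symD[OF hom]] BU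
      by (simp add: open_subset)
    then have opV: "openin (top_of_set S) V" using U openin_trans by blast
    have "h z \<in> w" if "z \<in> ball (\<phi> y) e" for z
    proof -
      from that e(2) obtain u where "u \<in> w \<inter> U" "z = \<phi> u" by blast
      then show ?thesis using hom by (auto simp: homeomorphism_def)
    qed
    then have Vw: "V \<subseteq> w" unfolding V_def by blast
    have "h (\<phi> y) = y" using hom c(2) by (auto simp: homeomorphism_def)
    then have "y \<in> V" unfolding V_def using e(1) by (metis centre_in_ball imageI)
    then show "\<exists>u v. openin (top_of_set S) u \<and> path_connected v \<and> y \<in> u \<and> u \<subseteq> v \<and> v \<subseteq> w"
      using opV pc Vw by blast
  qed
  then have "openin (top_of_set S) (path_component_set S y)" "closedin (top_of_set S) (path_component_set S y)" for y
    by (simp_all add: openin_path_component_locally_path_connected closedin_path_component_locally_path_connected)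
  moreover have "connected S" using assms unfolding closed_oriented_surface_def by blast
  ultimately have "path_component_set S y = {} \<or> path_component_set S y = S" for y
    unfolding connected_clopen by blast
  then show ?thesis
    unfolding path_connected_component_set by (metis path_component_eq_empty)
qed

lemma path_classes_nonempty: "\<lbrakk>path_connected S; a \<in> S; b \<in> S\<rbrakk> \<Longrightarrow> path_classes S a b \<noteq> {}"
  unfolding path_connected_def path_classes_def by blast

lemma frechet_derivative_cong_ev:
  assumes "open U" "z \<in> U" "\<And>y. y \<in> U \<Longrightarrow> f y = g y"
  shows "frechet_derivative f (at z) = frechet_derivative g (at z)"
    and "f differentiable (at z) \<longleftrightarrow> g differentiable (at z)"
proof -
  have "(f has_derivative D) (at z) \<longleftrightarrow> (g has_derivative D) (at z)" for D
    using has_derivative_transform_within_open[OF _ assms(1,2)] assms(3) by metis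
  then show "frechet_derivative f (at z) = frechet_derivative g (at z)"
    and "f differentiable (at z) \<longleftrightarrow> g differentiable (at z)"
    by (simp_all add: frechet_derivative_def differentiable_def)
qed

lemma Ck_on_cong:
  assumes "open U" "\<And>y. y \<in> U \<Longrightarrow> f y = g y" "Ck_on k U f"
  shows "Ck_on k U g"
  using assms(2,3)
proof (induction k arbitrary: f g)
  case 0
  then show ?case using continuous_on_cong by fastforce
next
  case (Suc k)
  have "g differentiable (at z)" if "z \<in> U" for z
    using frechet_derivative_cong_ev(2)[OF assms(1) that, of f g] Suc.prems that by simp
  moreover have "Ck_on k U (\<lambda>z. frechet_derivative g (at z) v)" for v
  proof (rule Suc.IH)
    show "frechet_derivative f (at y) v = frechet_derivative g (at y) v" if "y \<in> U" for y
      using frechet_derivative_cong_ev(1)[OF assms(1) that, of f g] Suc.prems by simp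
  qed (use Suc.prems in simp)
  ultimately show ?case by simp
qed

text \<open>In coordinates the constant isotopy is a transition map that ignores the time. The
  derivative of a function of the second variable is again one, taken in the direction
  \<open>snd v\<close>, and this drives the induction.\<close>

lemma Ck_on_snd:
  fixes F :: "'a::real_normed_vector \<Rightarrow> 'b::real_normed_vector"
  assumes "open U" "Ck_on k U F"
  shows "Ck_on k (UNIV \<times> U) (\<lambda>z :: 'c::real_normed_vector \<times> 'a. F (snd z))"
  using assms(2)
proof (induction k arbitrary: F)
  case 0
  then show ?case by (auto intro!: continuous_on_compose2[of U F] continuous_intros)
next
  case (Suc k)
  have der: "((\<lambda>z :: 'c \<times> 'a. F (snd z)) has_derivative (\<lambda>v. frechet_derivative F (at (snd z)) (snd v))) (at z)"
    if "snd z \<in> U" for z :: "'c \<times> 'a"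
  proof -
    have "(F has_derivative frechet_derivative F (at (snd z))) (at (snd z))"
      using Suc.prems that frechet_derivative_works by auto
    then show ?thesis
      using has_derivative_compose[OF has_derivative_snd[OF has_derivative_ident]] by fastforce
  qed
  have "(\<lambda>z :: 'c \<times> 'a. F (snd z)) differentiable (at z)" if "snd z \<in> U" for z
    using der[OF that] by (auto simp: differentiable_def)
  moreover have "Ck_on k (UNIV \<times> U) (\<lambda>z :: 'c \<times> 'a. frechet_derivative (\<lambda>z. F (snd z)) (at z) v)" for v
  proof (rule Ck_on_cong)
    show "open (UNIV \<times> U :: ('c \<times> 'a) set)" using assms(1) by (simp add: open_Times)
    show "frechet_derivative F (at (snd z)) (snd v) = frechet_derivative (\<lambda>z. F (snd z)) (at z) v"
      if "z \<in> UNIV \<times> U" for z :: "'c \<times> 'a"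
      using frechet_derivative_at[OF der, of z] that by (metis mem_Times_iff)
    show "Ck_on k (UNIV \<times> U) (\<lambda>z :: 'c \<times> 'a. frechet_derivative F (at (snd z)) (snd v))"
      using Suc.IH[of "\<lambda>y. frechet_derivative F (at y) (snd v)"] Suc.prems by simp
  qed
  ultimately show ?case by (auto simp: mem_Times_iff)
qed

context
  fixes S :: "'a::t2_space set" and \<A> :: "'a chart set"
  assumes surface: "closed_oriented_surface S \<A>"
begin

lemma chart_point_in_surface:
  assumes "c \<in> \<A>" "p \<in> snd c ` fst c"
  shows "inv_into (fst c) (snd c) p \<in> S"
proof -
  have "inv_into (fst c) (snd c) p \<in> fst c" using assms(2) by (rule inv_into_into)
  then show ?thesis using surface assms(1) by (auto simp: closed_oriented_surface_def)
qed

text \<open>Charts take their points from S, so smoothness and orientation depend on the values on S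
  alone. This is needed because the conditions on a surface concern \<open>\<lambda>y. y\<close>,
  whereas the unit among the diffeomorphisms is \<open>\<lambda>y\<in>S. y\<close>.\<close>

lemma coord_dom_cong:
  assumes "\<And>y. y \<in> S \<Longrightarrow> f y = g y" "c \<in> \<A>"
  shows "coord_dom c c' f = coord_dom c c' g"
  using chart_point_in_surface[OF assms(2)] assms(1) by (auto simp: coord_dom_def)

lemma coord_map_cong:
  assumes "\<And>y. y \<in> S \<Longrightarrow> f y = g y" "c \<in> \<A>" "p \<in> snd c ` fst c"
  shows "coord_map c c' f p = coord_map c c' g p"
  using chart_point_in_surface[OF assms(2,3)] assms(1) by (simp add: coord_map_def)

lemma smooth_in_charts_cong:
  assumes "\<And>y. y \<in> S \<Longrightarrow> f y = g y" "smooth_in_charts \<A> f"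
  shows "smooth_in_charts \<A> g"
  unfolding smooth_in_charts_def
proof (intro ballI)
  fix c c' assume c: "c \<in> \<A>" "c' \<in> \<A>"
  have "smooth_on (coord_dom c c' f) (coord_map c c' f)" using assms(2) c by (simp add: smooth_in_charts_def)
  moreover have "coord_map c c' f p = coord_map c c' g p" if "p \<in> coord_dom c c' f" for p
    using coord_map_cong[of f g c p c'] assms(1) c(1) that by (simp add: coord_dom_def)
  moreover have "coord_dom c c' f = coord_dom c c' g" using coord_dom_cong[of f g c c'] assms(1) c(1) by simp
  ultimately show "smooth_on (coord_dom c c' g) (coord_map c c' g)"
    unfolding smooth_on_def by (metis IntD2)
qed

lemma orientation_preserving_cong:
  assumes "\<And>y. y \<in> S \<Longrightarrow> f y = g y" "orientation_preserving \<A> f"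
  shows "orientation_preserving \<A> g"
  unfolding orientation_preserving_def
proof (intro ballI)
  fix c c' p assume c: "c \<in> \<A>" "c' \<in> \<A>" and p: "p \<in> coord_dom c c' g"
  have p': "p \<in> coord_dom c c' f" using coord_dom_cong[of f g c c'] assms(1) c(1) p by simp
  have "open (snd c ` fst c)" using surface c(1) by (auto simp: closed_oriented_surface_def)
  moreover have "p \<in> snd c ` fst c" using p by (simp add: coord_dom_def)
  ultimately have "frechet_derivative (coord_map c c' f) (at p) = frechet_derivative (coord_map c c' g) (at p)"
    by (rule frechet_derivative_cong_ev(1)) (rule coord_map_cong[OF assms(1) c(1)])
  moreover have "0 < det (matrix (frechet_derivative (coord_map c c' f) (at p)))"
    using assms(2) c p' unfolding orientation_preserving_def by blast
  ultimately show "0 < det (matrix (frechet_derivative (coord_map c c' g) (at p)))" by simp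
qed

lemma id_in_diffeo_group: "(\<lambda>y\<in>S. y) \<in> carrier (diffeo_group S \<A>)"
proof -
  have inv: "inv_into S (\<lambda>y\<in>S. y) y = y" if "y \<in> S" for y
  proof -
    have "inj_on (\<lambda>y\<in>S. y) S" by (simp add: inj_on_def)
    from inv_into_f_f[OF this that] that show ?thesis by simp
  qed
  have id: "smooth_in_charts \<A> (\<lambda>y. y)" "orientation_preserving \<A> (\<lambda>y. y)"
    using surface unfolding closed_oriented_surface_def by blast+
  have "smooth_in_charts \<A> (\<lambda>y\<in>S. y)" by (rule smooth_in_charts_cong[OF _ id(1)]) simp
  moreover have "smooth_in_charts \<A> (inv_into S (\<lambda>y\<in>S. y))"
    by (rule smooth_in_charts_cong[OF _ id(1)]) (simp add: inv)
  moreover have "orientation_preserving \<A> (\<lambda>y\<in>S. y)"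
    by (rule orientation_preserving_cong[OF _ id(2)]) simp
  moreover have "continuous_on S (\<lambda>y\<in>S. y)" "continuous_on S (inv_into S (\<lambda>y\<in>S. y))"
    using inv by (auto intro: continuous_on_eq[OF continuous_on_id])
  ultimately show ?thesis by (simp add: diffeo_group_def id_Bij)
qed

text \<open>It makes every mapping class nonempty and provides a member of the unit class.\<close>

lemma id_isotopic_to_id: "(\<lambda>y\<in>S. y) \<in> diffeos_isotopic_to_id S \<A>"
proof -
  have "isotopic S \<A> (\<lambda>y\<in>S. y) (\<lambda>y\<in>S. y)"
    unfolding isotopic_def
  proof (intro exI[of _ "snd :: real \<times> 'a \<Rightarrow> 'a"] conjI ballI)
    show "continuous_on ({0..1} \<times> S) (snd :: real \<times> 'a \<Rightarrow> 'a)" by (intro continuous_intros)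
    show "(\<lambda>y\<in>S. snd (t :: real, y)) \<in> carrier (diffeo_group S \<A>)" for t
      using id_in_diffeo_group by simp
    fix c c' assume c: "c \<in> \<A>" "c' \<in> \<A>"
    show "smooth_on {(t, p). t \<in> {0..1::real} \<and> p \<in> coord_dom c c' (\<lambda>y. snd (t, y))}
        (\<lambda>(t, p). coord_map c c' (\<lambda>y. snd (t, y)) p)"
      unfolding smooth_on_def
    proof
      fix z assume "z \<in> {(t, p). t \<in> {0..1::real} \<and> p \<in> coord_dom c c' (\<lambda>y. snd (t, y))}"
      then have "snd z \<in> coord_dom c c' (\<lambda>y. y)" by auto
      moreover have "smooth_on (coord_dom c c' (\<lambda>y. y)) (coord_map c c' (\<lambda>y. y))"
        using surface c by (simp add: closed_oriented_surface_def smooth_in_charts_def)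
      ultimately obtain U F where U: "open U" "snd z \<in> U" "\<forall>k. Ck_on k U F"
        "\<forall>y\<in>U \<inter> coord_dom c c' (\<lambda>y. y). F y = coord_map c c' (\<lambda>y. y) y"
        unfolding smooth_on_def by meson
      show "\<exists>U F. open U \<and> z \<in> U \<and> (\<forall>k. Ck_on k U F) \<and>
        (\<forall>y\<in>U \<inter> {(t, p). t \<in> {0..1::real} \<and> p \<in> coord_dom c c' (\<lambda>y. snd (t, y))}.
          F y = (case y of (t, p) \<Rightarrow> coord_map c c' (\<lambda>y. snd (t, y)) p))"
        using U Ck_on_snd[OF U(1)]
        by (intro exI[of _ "UNIV \<times> U"] exI[of _ "\<lambda>z. F (snd z)"]) (auto simp: open_Times mem_Times_iff)
    qed
  qed auto
  moreover have "\<one>\<^bsub>diffeo_group S \<A>\<^esub> = (\<lambda>y\<in>S. y)" by (simp add: diffeo_group_def BijGroup_def)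
  ultimately show ?thesis using id_in_diffeo_group by (simp add: diffeos_isotopic_to_id_def)
qed

lemma diffeo_groupD:
  assumes "f \<in> carrier (diffeo_group S \<A>)"
  shows "bij_betw f S S" "continuous_on S f" "continuous_on S (inv_into S f)" "f \<in> Bij S"
  using assms by (auto simp: diffeo_group_def Bij_def)

end

section \<open>Homomorphisms from a surface group\<close>

lemma (in group) gen_value_closed:
  "\<lbrakk>\<And>i. i < n \<Longrightarrow> A i \<in> carrier G; \<And>i. i < n \<Longrightarrow> B i \<in> carrier G; gen_index s < n\<rbrakk> \<Longrightarrow> gen_value A B s \<in> carrier G"
  by (cases s) auto

lemma word_value_Nil [simp]: "word_value P A B [] = \<one>\<^bsub>P\<^esub>"
  by (simp add: word_value_def)

lemma word_value_Cons:
  "word_value P A B ((s, b) # w) =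
    (if b then gen_value A B s else inv\<^bsub>P\<^esub> gen_value A B s) \<otimes>\<^bsub>P\<^esub> word_value P A B w"
  by (simp add: word_value_def)

lemma surface_words_Cons: "(s, b) # w \<in> surface_words g \<longleftrightarrow> gen_index s < g \<and> w \<in> surface_words g"
  by (auto simp: surface_words_def)

lemma surface_words_append: "v @ w \<in> surface_words g \<longleftrightarrow> v \<in> surface_words g \<and> w \<in> surface_words g"
  by (auto simp: surface_words_def)

definition inverse_word :: "surface_word \<Rightarrow> surface_word" where
  "inverse_word w = rev (map (\<lambda>(s, b). (s, \<not> b)) w)"

lemma inverse_word_closed: "w \<in> surface_words g \<Longrightarrow> inverse_word w \<in> surface_words g"
  by (auto simp: surface_words_def inverse_word_def)

context group
begin

context
  fixes A B :: "nat \<Rightarrow> 'a" and g :: nat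
  assumes A: "\<And>i. i < g \<Longrightarrow> A i \<in> carrier G" and B: "\<And>i. i < g \<Longrightarrow> B i \<in> carrier G"
begin

lemma word_value_closed: "w \<in> surface_words g \<Longrightarrow> word_value G A B w \<in> carrier G"
proof (induction w)
  case (Cons l w)
  then show ?case
    using gen_value_closed[OF A B] by (cases l) (auto simp: word_value_Cons surface_words_Cons)
qed simp

lemma word_value_append:
  "\<lbrakk>v \<in> surface_words g; w \<in> surface_words g\<rbrakk> \<Longrightarrow>
    word_value G A B (v @ w) = word_value G A B v \<otimes> word_value G A B w"
proof (induction v)
  case Nil
  then show ?case by (simp add: word_value_closed)
next
  case (Cons l v)
  obtain s b where l: "l = (s, b)" by (cases l)
  have "gen_value A B s \<in> carrier G" using Cons.prems gen_value_closed[OF A B] by (simp add: l surface_words_Cons)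
  then show ?case
    using Cons word_value_closed[of v] word_value_closed[of w]
    by (simp add: l word_value_Cons surface_words_Cons m_assoc)
qed

lemma word_value_inverse_word:
  "w \<in> surface_words g \<Longrightarrow> word_value G A B (inverse_word w) = inv (word_value G A B w)"
proof (induction w)
  case Nil
  then show ?case by (simp add: inverse_word_def)
next
  case (Cons l w)
  obtain s b where l: "l = (s, b)" by (cases l)
  have w: "w \<in> surface_words g" and s: "gen_index s < g" using Cons.prems by (auto simp: l surface_words_Cons)
  have gv: "gen_value A B s \<in> carrier G" using s gen_value_closed[OF A B] by simp
  have "inverse_word (l # w) = inverse_word w @ [(s, \<not> b)]" by (simp add: inverse_word_def l)
  moreover have "[(s, \<not> b)] \<in> surface_words g" using s by (simp add: surface_words_def)
  ultimately have "word_value G A B (inverse_word (l # w)) =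
      inv (word_value G A B w) \<otimes> word_value G A B [(s, \<not> b)]"
    using Cons.IH[OF w] inverse_word_closed[OF w] by (simp add: word_value_append)
  then show ?case
    using gv word_value_closed[OF w] by (simp add: l word_value_Cons inv_mult_group)
qed

end

text \<open>Closedness is asked at all indices because the context words v and w in the rules of
  \<open>word_equiv\<close> may contain letters of any index.\<close>

lemma word_value_word_equiv:
  assumes A: "\<And>i. A i \<in> carrier G" and B: "\<And>i. B i \<in> carrier G"
    and rel: "word_value G A B (surface_relator g) = \<one>"
    and "word_equiv g v w"
  shows "word_value G A B v = word_value G A B w"
proof -
  \<comment> \<open>A single word has letters below some bound n, which makes the lemmas on
    \<open>surface_words n\<close> available for it.\<close>
  have sw: "\<exists>n. u \<in> surface_words n" for u
  proof -
    have "\<forall>l\<in>set u. gen_index (fst l) < Suc (Max ((gen_index \<circ> fst) ` set u))"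
      by (auto simp: less_Suc_eq_le intro!: Max_ge)
    then show ?thesis by (auto simp: surface_words_def)
  qed
  have append: "word_value G A B (u @ u') = word_value G A B u \<otimes> word_value G A B u'" for u u'
  proof -
    obtain n where "u @ u' \<in> surface_words n" using sw by blast
    then show ?thesis using word_value_append[of n A B u u'] A B by (simp add: surface_words_append)
  qed
  have closed: "word_value G A B u \<in> carrier G" for u
  proof -
    obtain n where "u \<in> surface_words n" using sw by blast
    then show ?thesis using word_value_closed[of n A B u] A B by simp
  qed
  have gv: "gen_value A B s \<in> carrier G" for s using A B by (cases s) auto
  show ?thesis using assms(4)
  proof induction
    case (cancel s v b w)
    have "word_value G A B [(s, b), (s, \<not> b)] = \<one>"
      using gv by (simp add: word_value_Cons)
    then show ?case using closed by (simp add: append del: append_Cons)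
  next
    case (relation v w)
    then show ?case using closed rel by (simp add: append)
  qed simp_all
qed

end

lemma hom_word_value:
  assumes "group P" "group G" "f \<in> hom P G"
    and "\<And>i. i < g \<Longrightarrow> A i \<in> carrier P" "\<And>i. i < g \<Longrightarrow> B i \<in> carrier P"
    and "w \<in> surface_words g"
  shows "f (word_value P A B w) = word_value G (\<lambda>i. f (A i)) (\<lambda>i. f (B i)) w"
proof -
  interpret P: group P by fact
  interpret G: group G by fact
  interpret group_hom P G f using assms(3) by unfold_locales
  show ?thesis
    using assms(6)
  proof (induction w)
    case (Cons l w)
    obtain s b where l: "l = (s, b)" by (cases l)
    have w: "w \<in> surface_words g" and s: "gen_index s < g" using Cons.prems by (auto simp: l surface_words_Cons)
    have gv: "gen_value A B s \<in> carrier P" using s P.gen_value_closed[OF assms(4,5)] by simp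
    have "f (gen_value A B s) = gen_value (\<lambda>i. f (A i)) (\<lambda>i. f (B i)) s" by (cases s) auto
    then show ?case
      using Cons.IH[OF w] gv P.word_value_closed[OF assms(4,5) w] by (simp add: l word_value_Cons)
  qed simp
qed

lemma hom_eq_on_surface_group:
  assumes "group P" "group G" "surface_presentation P g A B" "f \<in> hom P G" "f' \<in> hom P G"
    and gens: "\<And>i. i < g \<Longrightarrow> A i \<in> carrier P" "\<And>i. i < g \<Longrightarrow> B i \<in> carrier P"
    and eq: "\<And>i. i < g \<Longrightarrow> f (A i) = f' (A i)" "\<And>i. i < g \<Longrightarrow> f (B i) = f' (B i)"
    and X: "X \<in> carrier P"
  shows "f X = f' X"
proof -
  obtain w where w: "w \<in> surface_words g" "X = word_value P A B w"
    using assms(3) X by (auto simp: surface_presentation_def)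
  have "word_value G (\<lambda>i. f (A i)) (\<lambda>i. f (B i)) w = word_value G (\<lambda>i. f' (A i)) (\<lambda>i. f' (B i)) w"
    using w(1)
  proof (induction w)
    case (Cons l w)
    obtain s b where l: "l = (s, b)" by (cases l)
    have "gen_value (\<lambda>i. f (A i)) (\<lambda>i. f (B i)) s = gen_value (\<lambda>i. f' (A i)) (\<lambda>i. f' (B i)) s"
      using Cons.prems eq by (cases s) (auto simp: l surface_words_Cons)
    then show ?case using Cons by (simp add: l word_value_Cons surface_words_Cons)
  qed simp
  then show ?thesis
    using hom_word_value[OF assms(1,2,4) gens w(1)] hom_word_value[OF assms(1,2,5) gens w(1)] w(2) by simp
qed

text \<open>The universal property of the presentation. Two words v and w for the same element give
  a word v w^-1 of value 1; it is equivalent to the empty word and so has value 1 in G as well.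
  Hence the value in G depends on the element alone.\<close>

lemma surface_group_hom_exists:
  assumes "group P" "group G" "surface_presentation P g A B"
    and gens: "\<And>i. i < g \<Longrightarrow> A i \<in> carrier P" "\<And>i. i < g \<Longrightarrow> B i \<in> carrier P"
    and ab: "\<And>i. a i \<in> carrier G" "\<And>i. b i \<in> carrier G"
    and rel: "word_value G a b (surface_relator g) = \<one>\<^bsub>G\<^esub>"
  shows "\<exists>f\<in>hom P G \<inter> extensional (carrier P). \<forall>i<g. f (A i) = a i \<and> f (B i) = b i"
proof -
  interpret P: group P by fact
  interpret G: group G by fact
  have sur: "\<exists>w\<in>surface_words g. word_value P A B w = X" if "X \<in> carrier P" for X
    using assms(3) that by (auto simp: surface_presentation_def)
  have triv: "word_equiv g w []" if "w \<in> surface_words g" "word_value P A B w = \<one>\<^bsub>P\<^esub>" for w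
    using assms(3) that by (auto simp: surface_presentation_def)
  have Pc: "word_value P A B w \<in> carrier P" if "w \<in> surface_words g" for w
    using P.word_value_closed[of g A B w] gens that by blast
  have Gc: "word_value G a b w \<in> carrier G" if "w \<in> surface_words g" for w
    using G.word_value_closed[of g a b w] ab that by blast
  have Pa: "word_value P A B (v @ w) = word_value P A B v \<otimes>\<^bsub>P\<^esub> word_value P A B w"
    if "v \<in> surface_words g" "w \<in> surface_words g" for v w
    using P.word_value_append[of g A B v w] gens that by blast
  have Pi: "word_value P A B (inverse_word w) = inv\<^bsub>P\<^esub> word_value P A B w" if "w \<in> surface_words g" for w
    using P.word_value_inverse_word[of g A B w] gens that by blast
  have wd: "word_value G a b v = word_value G a b w"
    if v: "v \<in> surface_words g" and w: "w \<in> surface_words g" and eq: "word_value P A B v = word_value P A B w" for v w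
  proof -
    note w' = inverse_word_closed[OF w]
    have "word_value P A B (v @ inverse_word w) = \<one>\<^bsub>P\<^esub>"
      using v w w' eq Pc[OF w] by (simp add: Pa Pi)
    then have "word_equiv g (v @ inverse_word w) []"
      using v w' by (intro triv) (simp_all add: surface_words_append)
    then have "word_value G a b (v @ inverse_word w) = \<one>\<^bsub>G\<^esub>"
      using G.word_value_word_equiv[OF ab rel] by fastforce
    then have "word_value G a b v \<otimes>\<^bsub>G\<^esub> inv\<^bsub>G\<^esub> word_value G a b w = \<one>\<^bsub>G\<^esub>"
      using v w w' ab by (simp add: G.word_value_append[of g] G.word_value_inverse_word[of g])
    then show ?thesis
      using Gc[OF v] Gc[OF w] by (metis G.inv_closed G.inv_equality G.inv_inv)
  qed
  define r where "r X = (SOME w. w \<in> surface_words g \<and> word_value P A B w = X)" for X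
  have r: "r X \<in> surface_words g" "word_value P A B (r X) = X" if "X \<in> carrier P" for X
    using someI_ex[of "\<lambda>w. w \<in> surface_words g \<and> word_value P A B w = X"] sur[OF that] unfolding r_def by blast+
  define f where "f = (\<lambda>X\<in>carrier P. word_value G a b (r X))"
  have f: "f (word_value P A B w) = word_value G a b w" if "w \<in> surface_words g" for w
    using wd[OF r(1)[OF Pc[OF that]] that r(2)[OF Pc[OF that]]] Pc[OF that] by (simp add: f_def)
  have "f \<in> hom P G"
  proof (rule homI)
    show "f X \<in> carrier G" if "X \<in> carrier P" for X using Gc[OF r(1)[OF that]] that by (simp add: f_def)
    fix X Y assume X: "X \<in> carrier P" and Y: "Y \<in> carrier P"
    have "word_value P A B (r X @ r Y) = X \<otimes>\<^bsub>P\<^esub> Y"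
      using r[OF X] r[OF Y] by (simp add: Pa)
    then have "f (X \<otimes>\<^bsub>P\<^esub> Y) = word_value G a b (r X @ r Y)"
      using f[of "r X @ r Y"] r(1)[OF X] r(1)[OF Y] by (simp add: surface_words_append)
    also have "\<dots> = f X \<otimes>\<^bsub>G\<^esub> f Y"
      using r(1)[OF X] r(1)[OF Y] X Y ab by (simp add: f_def G.word_value_append[of g])
    finally show "f (X \<otimes>\<^bsub>P\<^esub> Y) = f X \<otimes>\<^bsub>G\<^esub> f Y" .
  qed
  moreover have "f (A i) = a i" "f (B i) = b i" if "i < g" for i
    using f[of "[(Alpha i, True)]"] f[of "[(Beta i, True)]"] that gens ab
    by (simp_all add: surface_words_def word_value_Cons)
  ultimately show ?thesis by (intro bexI[of _ f]) (auto simp: f_def)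
qed

section \<open>Tensor powers of the dual of the double\<close>

context group
begin

definition conj_list :: "'a \<Rightarrow> ('a \<times> 'a) list \<Rightarrow> ('a \<times> 'a) list" where
  "conj_list k = map (\<lambda>(a, b). (k \<otimes> a \<otimes> inv k, k \<otimes> b \<otimes> inv k))"

text \<open>The degree in which the tensor of the list is homogeneous. The coproduct pairs
  \<delta>_c on the first factor with \<delta>_{h c^-1} on the rest, and h = (h c^-1) c puts the
  degree of the first factor last.\<close>

primrec list_degree :: "('a \<times> 'a) list \<Rightarrow> 'a" where
  "list_degree [] = \<one>"
| "list_degree (u # us) = list_degree us \<otimes> commutator G (inv (snd u)) (fst u)"

definition tuples :: "nat \<Rightarrow> ('a \<times> 'a) list set" where
  "tuples g = {us. length us = g \<and> set us \<subseteq> carrier G \<times> carrier G}"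

lemma commutator_closed: "\<lbrakk>a \<in> carrier G; b \<in> carrier G\<rbrakk> \<Longrightarrow> commutator G a b \<in> carrier G"
  by (simp add: commutator_def)

lemma conj_mult:
  "\<lbrakk>k \<in> carrier G; a \<in> carrier G; b \<in> carrier G\<rbrakk> \<Longrightarrow>
    (k \<otimes> a \<otimes> inv k) \<otimes> (k \<otimes> b \<otimes> inv k) = k \<otimes> (a \<otimes> b) \<otimes> inv k"
  by (simp add: m_assoc inv_mult_cancel)

lemma conj_inv:
  "\<lbrakk>k \<in> carrier G; a \<in> carrier G\<rbrakk> \<Longrightarrow> inv (k \<otimes> a \<otimes> inv k) = k \<otimes> inv a \<otimes> inv k"
  by (simp add: inv_mult_group m_assoc)

lemma conj_commutator:
  "\<lbrakk>k \<in> carrier G; a \<in> carrier G; b \<in> carrier G\<rbrakk> \<Longrightarrow>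
    commutator G (k \<otimes> a \<otimes> inv k) (k \<otimes> b \<otimes> inv k) = k \<otimes> commutator G a b \<otimes> inv k"
  by (simp only: commutator_def conj_inv conj_mult m_closed inv_closed)

lemma list_degree_closed: "set us \<subseteq> carrier G \<times> carrier G \<Longrightarrow> list_degree us \<in> carrier G"
  by (induction us) (auto simp: commutator_closed)

lemma list_degree_conj_list:
  "\<lbrakk>k \<in> carrier G; set us \<subseteq> carrier G \<times> carrier G\<rbrakk> \<Longrightarrow>
    list_degree (conj_list k us) = k \<otimes> list_degree us \<otimes> inv k"
proof (induction us)
  case (Cons u us)
  obtain a b where u: "u = (a, b)" "a \<in> carrier G" "b \<in> carrier G" using Cons.prems by (cases u) auto
  have "list_degree (conj_list k (u # us)) =
      list_degree (conj_list k us) \<otimes> commutator G (inv (k \<otimes> b \<otimes> inv k)) (k \<otimes> a \<otimes> inv k)"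
    by (simp add: conj_list_def u)
  also have "\<dots> = (k \<otimes> list_degree us \<otimes> inv k) \<otimes> (k \<otimes> commutator G (inv b) a \<otimes> inv k)"
    using Cons u by (simp add: conj_inv conj_commutator)
  also have "\<dots> = k \<otimes> list_degree (u # us) \<otimes> inv k"
    using Cons.prems u list_degree_closed[of us] by (simp add: conj_mult commutator_closed)
  finally show ?case .
qed (simp add: conj_list_def)

lemma finite_tuples: "finite (carrier G) \<Longrightarrow> finite (tuples g)"
  using finite_lists_length_eq[of "carrier G \<times> carrier G" g] by (simp add: tuples_def conj_commute)

lemma graded_gset_tuples:
  assumes "finite (carrier G)"
  shows "graded_gset G (tuples g) conj_list list_degree"
proof unfold_locales
  fix a b us assume ab: "a \<in> carrier G" and us: "us \<in> tuples g"
  then have us': "set us \<subseteq> carrier G \<times> carrier G" by (simp add: tuples_def)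
  show "conj_list a us \<in> tuples g" using ab us by (auto simp: conj_list_def tuples_def)
  show "list_degree (conj_list a us) = a \<otimes> list_degree us \<otimes> inv a" by (rule list_degree_conj_list[OF ab us'])
next
  fix a b us assume ab: "a \<in> carrier G" "b \<in> carrier G" and us: "us \<in> tuples g"
  then show "conj_list (a \<otimes> b) us = conj_list a (conj_list b us)"
    by (auto simp: conj_list_def tuples_def inv_mult_group m_assoc)
next
  fix us assume us: "us \<in> tuples g"
  then show "conj_list \<one> us = us" by (auto simp: conj_list_def tuples_def intro!: map_idI)
  show "list_degree us \<in> carrier G" using us by (auto simp: tuples_def intro: list_degree_closed)
qed (use assms finite_tuples in auto)

text \<open>A nonzero summand of the sum over c has c equal to the degree of the conjugated first
  factor. The remaining factors must then have degree h c^-1, which is why h is generalized in the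
  induction.\<close>

lemma dual_power_act_eq:
  assumes "finite (carrier G)" "k \<in> carrier G"
  shows "\<lbrakk>h \<in> carrier G; set us \<subseteq> carrier G \<times> carrier G\<rbrakk> \<Longrightarrow> dual_power_act G (h, k) us =
    (if h = list_degree (conj_list k us) then basis_vec (conj_list k us) else (\<lambda>_. 0 :: 'k::field))"
proof (induction us arbitrary: h)
  case Nil
  then show ?case by (simp add: conj_list_def)
next
  case (Cons u us)
  obtain a b where u: "u = (a, b)" "a \<in> carrier G" "b \<in> carrier G" using Cons.prems by (cases u) auto
  define u' where "u' = (k \<otimes> a \<otimes> inv k, k \<otimes> b \<otimes> inv k)"
  define e where "e = commutator G (inv (snd u')) (fst u')"
  have e: "e \<in> carrier G" using u assms(2) by (simp add: e_def u'_def commutator_closed)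
  have us: "set us \<subseteq> carrier G \<times> carrier G" using Cons.prems by simp
  let ?us = "conj_list k us"
  have us': "list_degree ?us \<in> carrier G"
    using us assms(2) list_degree_closed[of us] by (simp add: list_degree_conj_list)
  have cons: "conj_list k (u # us) = u' # ?us" by (simp add: conj_list_def u u'_def)
  have deg: "list_degree (u' # ?us) = list_degree ?us \<otimes> e" by (simp add: e_def)
  have d: "dual_act G (c, k) u w = (if c = e \<and> w = u' then 1 else 0 :: 'k)" for c w
    by (auto simp: dual_act_def u e_def u'_def Let_def basis_vec_def)
  have eq: "h \<otimes> inv e = list_degree ?us \<longleftrightarrow> h = list_degree ?us \<otimes> e"
    using Cons.prems(1) e us' by (metis inv_solve_right' m_closed inv_closed)
  show ?case
  proof
    fix ws
    show "(dual_power_act G (h, k) (u # us) ws :: 'k) =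
      (if h = list_degree (conj_list k (u # us)) then basis_vec (conj_list k (u # us)) else (\<lambda>_. 0)) ws"
    proof (cases ws)
      case Nil
      then show ?thesis by (simp add: cons basis_vec_def)
    next
      case (Cons w ws')
      have "(dual_power_act G (h, k) (u # us) ws :: 'k) =
          (\<Sum>c\<in>carrier G. if c = e then (if w = u' then dual_power_act G (h \<otimes> inv e, k) us ws' else 0) else 0)"
        unfolding Cons by (auto simp: d intro!: sum.cong)
      also have "\<dots> = (if w = u' then dual_power_act G (h \<otimes> inv e, k) us ws' else 0)"
        using assms(1) e by simp
      also have "dual_power_act G (h \<otimes> inv e, k) us =
          (if h \<otimes> inv e = list_degree ?us then basis_vec ?us else (\<lambda>_. 0 :: 'k))"
        using Cons.IH[of "h \<otimes> inv e"] \<open>h \<in> carrier G\<close> e us by simp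
      finally show ?thesis
        unfolding cons deg eq using Cons by (auto simp: basis_vec_def)
    qed
  qed
qed

lemma dual_power_eq: "dual_power G n = based_module (tuples n) (dual_power_act G)"
  by (simp add: dual_power_def tuples_def)

end

section \<open>The maps \<open>T\<close>, \<open>S\<close>, \<open>N\<close> on tuples\<close>

context group
begin

lemma mult_inv_cancel: "\<lbrakk>a \<in> carrier G; b \<in> carrier G\<rbrakk> \<Longrightarrow> a \<otimes> (inv a \<otimes> b) = b"
  using inv_mult_cancel[of "inv a" b] by simp

lemmas group_word_simps = m_assoc inv_mult_group inv_mult_cancel mult_inv_cancel

definition pair_conj :: "'a \<Rightarrow> 'a \<times> 'a \<Rightarrow> 'a \<times> 'a" where
  "pair_conj k = (\<lambda>(a, b). (k \<otimes> a \<otimes> inv k, k \<otimes> b \<otimes> inv k))"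

definition pair_degree :: "'a \<times> 'a \<Rightarrow> 'a" where
  "pair_degree u = commutator G (inv (snd u)) (fst u)"

lemma conj_list_map: "conj_list k = map (pair_conj k)"
  by (simp add: conj_list_def pair_conj_def)

lemma list_degree_Cons: "list_degree (u # us) = list_degree us \<otimes> pair_degree u"
  by (simp add: pair_degree_def)

text \<open>The conditions under which the linear extension of t is linear over the double.\<close>

definition degree_preserving_perm :: "nat \<Rightarrow> (('a \<times> 'a) list \<Rightarrow> ('a \<times> 'a) list) \<Rightarrow> bool" where
  "degree_preserving_perm g t \<longleftrightarrow> inj_on t (tuples g) \<and> t ` tuples g \<subseteq> tuples g \<and>
     (\<forall>k\<in>carrier G. \<forall>us\<in>tuples g. conj_list k (t us) = t (conj_list k us)) \<and>
     (\<forall>us\<in>tuples g. list_degree (t us) = list_degree us)"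

lemma tuples_nth: "\<lbrakk>us \<in> tuples g; i < g\<rbrakk> \<Longrightarrow> us ! i \<in> carrier G \<times> carrier G"
  unfolding tuples_def by (metis (mono_tags, lifting) mem_Collect_eq nth_mem subsetD)

lemma tuples_update: "\<lbrakk>us \<in> tuples g; u \<in> carrier G \<times> carrier G\<rbrakk> \<Longrightarrow> us[i := u] \<in> tuples g"
  unfolding tuples_def using set_update_subset_insert by fastforce

lemma list_degree_update:
  "\<lbrakk>i < length us; pair_degree u = pair_degree (us ! i)\<rbrakk> \<Longrightarrow> list_degree (us[i := u]) = list_degree us"
proof (induction us arbitrary: i)
  case (Cons v us)
  then show ?case by (cases i) (auto simp: list_degree_Cons simp del: list_degree.simps(2))
qed simp

text \<open>Neighbours in the list contribute neighbouring factors to the degree, in reversed order,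
  so it suffices that their product is preserved.\<close>

lemma list_degree_update2:
  assumes "set us \<subseteq> carrier G \<times> carrier G" "u \<in> carrier G \<times> carrier G" "u' \<in> carrier G \<times> carrier G"
    and "Suc l < length us" "pair_degree u' \<otimes> pair_degree u = pair_degree (us ! Suc l) \<otimes> pair_degree (us ! l)"
  shows "list_degree (us[l := u, Suc l := u']) = list_degree us"
  using assms(1,4,5)
proof (induction us arbitrary: l)
  case (Cons v us)
  have pd: "pair_degree w \<in> carrier G" if "w \<in> carrier G \<times> carrier G" for w
    using that by (auto simp: pair_degree_def commutator_closed)
  show ?case
  proof (cases l)
    case 0
    then obtain v' vs where us: "us = v' # vs" using Cons.prems by (cases us) auto
    have "list_degree vs \<in> carrier G" using Cons.prems by (intro list_degree_closed) (auto simp: us)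
    then show ?thesis
      using Cons.prems assms(2,3) pd
      by (simp add: 0 us list_degree_Cons m_assoc del: list_degree.simps(2))
  next
    case (Suc k)
    then show ?thesis using Cons by (simp add: list_degree_Cons del: list_degree.simps(2))
  qed
qed simp

lemma degree_preserving_perm_update:
  assumes "i < g" and closed: "\<And>u. u \<in> carrier G \<times> carrier G \<Longrightarrow> \<tau> u \<in> carrier G \<times> carrier G"
    and inj: "inj_on \<tau> (carrier G \<times> carrier G)"
    and conj: "\<And>k u. \<lbrakk>k \<in> carrier G; u \<in> carrier G \<times> carrier G\<rbrakk> \<Longrightarrow> pair_conj k (\<tau> u) = \<tau> (pair_conj k u)"
    and deg: "\<And>u. u \<in> carrier G \<times> carrier G \<Longrightarrow> pair_degree (\<tau> u) = pair_degree u"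
  shows "degree_preserving_perm g (\<lambda>us. us[i := \<tau> (us ! i)])"
  unfolding degree_preserving_perm_def
proof (intro conjI ballI)
  show "inj_on (\<lambda>us. us[i := \<tau> (us ! i)]) (tuples g)"
  proof (rule inj_onI)
    fix us vs assume us: "us \<in> tuples g" and vs: "vs \<in> tuples g" and eq: "us[i := \<tau> (us ! i)] = vs[i := \<tau> (vs ! i)]"
    have len: "length us = g" "length vs = g" using us vs by (auto simp: tuples_def)
    have "us ! j = vs ! j" if "j < g" for j
    proof (cases "j = i")
      case True
      have "\<tau> (us ! i) = \<tau> (vs ! i)" using arg_cong[OF eq, of "\<lambda>xs. xs ! i"] len assms(1) by simp
      then show ?thesis using inj_onD[OF inj] tuples_nth[OF us assms(1)] tuples_nth[OF vs assms(1)] True by simp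
    next
      case False
      then show ?thesis using arg_cong[OF eq, of "\<lambda>xs. xs ! j"] by simp
    qed
    then show "us = vs" using len by (intro nth_equalityI) auto
  qed
  show "(\<lambda>us. us[i := \<tau> (us ! i)]) ` tuples g \<subseteq> tuples g"
    by (auto intro!: tuples_update closed tuples_nth assms(1) simp del: mem_Sigma_iff)
  fix us assume us: "us \<in> tuples g"
  have len: "length us = g" using us by (simp add: tuples_def)
  show "list_degree (us[i := \<tau> (us ! i)]) = list_degree us"
    using deg[OF tuples_nth[OF us assms(1)]] len assms(1) by (intro list_degree_update) simp_all
  fix k assume k: "k \<in> carrier G"
  show "conj_list k (us[i := \<tau> (us ! i)]) = (conj_list k us)[i := \<tau> (conj_list k us ! i)]"
    using conj[OF k tuples_nth[OF us assms(1)]] len assms(1) by (simp add: conj_list_map map_update)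
qed

lemma degree_preserving_perm_update2:
  fixes \<tau> :: "('a \<times> 'a) \<times> ('a \<times> 'a) \<Rightarrow> ('a \<times> 'a) \<times> ('a \<times> 'a)"
  defines "Y \<equiv> (carrier G \<times> carrier G) \<times> (carrier G \<times> carrier G)"
  assumes "Suc l < g" and closed: "\<And>u. u \<in> Y \<Longrightarrow> \<tau> u \<in> Y"
    and inj: "inj_on \<tau> Y"
    and conj: "\<And>k u. \<lbrakk>k \<in> carrier G; u \<in> Y\<rbrakk> \<Longrightarrow> map_prod (pair_conj k) (pair_conj k) (\<tau> u) = \<tau> (map_prod (pair_conj k) (pair_conj k) u)"
    and deg: "\<And>u. u \<in> Y \<Longrightarrow> pair_degree (snd (\<tau> u)) \<otimes> pair_degree (fst (\<tau> u)) = pair_degree (snd u) \<otimes> pair_degree (fst u)"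
  shows "degree_preserving_perm g (\<lambda>us. us[l := fst (\<tau> (us ! l, us ! Suc l)), Suc l := snd (\<tau> (us ! l, us ! Suc l))])"
  unfolding degree_preserving_perm_def
proof (intro conjI ballI)
  let ?t = "\<lambda>us. us[l := fst (\<tau> (us ! l, us ! Suc l)), Suc l := snd (\<tau> (us ! l, us ! Suc l))]"
  have l: "l < g" using assms(2) by simp
  have inY: "(us ! l, us ! Suc l) \<in> Y" if "us \<in> tuples g" for us
    using tuples_nth[OF that l] tuples_nth[OF that assms(2)] unfolding Y_def by (rule SigmaI)
  have out: "fst (\<tau> (us ! l, us ! Suc l)) \<in> carrier G \<times> carrier G" "snd (\<tau> (us ! l, us ! Suc l)) \<in> carrier G \<times> carrier G"
    if "us \<in> tuples g" for us
    using closed[OF inY[OF that]] unfolding Y_def by (auto simp: mem_Times_iff)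
  show "inj_on ?t (tuples g)"
  proof (rule inj_onI)
    fix us vs assume us: "us \<in> tuples g" and vs: "vs \<in> tuples g" and eq: "?t us = ?t vs"
    have len: "length us = g" "length vs = g" using us vs by (auto simp: tuples_def)
    have "\<tau> (us ! l, us ! Suc l) = \<tau> (vs ! l, vs ! Suc l)"
      using arg_cong[OF eq, of "\<lambda>xs. xs ! l"] arg_cong[OF eq, of "\<lambda>xs. xs ! Suc l"] len assms(2) by (simp add: prod_eq_iff)
    then have *: "us ! l = vs ! l" "us ! Suc l = vs ! Suc l"
      using inj_onD[OF inj _ inY[OF us] inY[OF vs]] by auto
    have "us ! j = vs ! j" if "j < g" for j
    proof (cases "j = l \<or> j = Suc l")
      case False
      then show ?thesis using arg_cong[OF eq, of "\<lambda>xs. xs ! j"] by simp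
    qed (use * in auto)
    then show "us = vs" using len by (intro nth_equalityI) auto
  qed
  show "?t ` tuples g \<subseteq> tuples g"
    by (auto intro!: tuples_update out simp del: mem_Sigma_iff)
  fix us assume us: "us \<in> tuples g"
  have len: "length us = g" and set: "set us \<subseteq> carrier G \<times> carrier G" using us by (simp_all add: tuples_def)
  show "list_degree (?t us) = list_degree us"
    using deg[OF inY[OF us]] len assms(2) by (intro list_degree_update2[OF set out[OF us]]) simp_all
  fix k assume k: "k \<in> carrier G"
  show "conj_list k (?t us) = ?t (conj_list k us)"
    using arg_cong[OF conj[OF k inY[OF us]], of fst] arg_cong[OF conj[OF k inY[OF us]], of snd] len assms(2) l
    by (simp add: conj_list_map map_update)
qed

definition T_pair :: "'a \<times> 'a \<Rightarrow> 'a \<times> 'a" where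
  "T_pair = (\<lambda>(c, d). (c, c \<otimes> d))"

definition S_pair :: "'a \<times> 'a \<Rightarrow> 'a \<times> 'a" where
  "S_pair = (\<lambda>(c, d). (d, inv d \<otimes> inv c \<otimes> d))"

definition N_pairs :: "('a \<times> 'a) \<times> ('a \<times> 'a) \<Rightarrow> ('a \<times> 'a) \<times> ('a \<times> 'a)" where
  "N_pairs = (\<lambda>((c, d), (c', d')). let n = inv c' \<otimes> inv d \<otimes> c \<otimes> d
     in ((c, d \<otimes> n), (inv n \<otimes> c' \<otimes> n, inv n \<otimes> d')))"

definition T_perm where "T_perm i us = us[i := T_pair (us ! i)]"
definition S_perm where "S_perm i us = us[i := S_pair (us ! i)]"
definition N_perm where
  "N_perm l us = us[l := fst (N_pairs (us ! l, us ! Suc l)), Suc l := snd (N_pairs (us ! l, us ! Suc l))]"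

lemma T_at_eq: "T_at G i = lin_ext (\<lambda>us. basis_vec (T_perm i us))"
  by (auto simp: T_at_def T_perm_def T_pair_def split: prod.split intro!: arg_cong[of _ _ lin_ext])

lemma S_at_eq: "S_at G i = lin_ext (\<lambda>us. basis_vec (S_perm i us))"
  by (auto simp: S_at_def S_perm_def S_pair_def split: prod.split intro!: arg_cong[of _ _ lin_ext])

lemma N_at_eq: "N_at G l = lin_ext (\<lambda>us. basis_vec (N_perm l us))"
  by (auto simp: N_at_def N_perm_def N_pairs_def Let_def split: prod.split intro!: arg_cong[of _ _ lin_ext])

text \<open>The degree is kept since [d^-1, c] does not change when d is replaced by c d.\<close>

lemma degree_preserving_perm_T: "i < g \<Longrightarrow> degree_preserving_perm g (T_perm i)"
  unfolding T_perm_def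
  by (rule degree_preserving_perm_update)
    (auto simp: T_pair_def inj_on_def pair_conj_def pair_degree_def commutator_def group_word_simps)

text \<open>The degree is kept since [d^-1 c d, d] = [d^-1, c].\<close>

lemma degree_preserving_perm_S: "i < g \<Longrightarrow> degree_preserving_perm g (S_perm i)"
  unfolding S_perm_def
proof (rule degree_preserving_perm_update)
  show "inj_on S_pair (carrier G \<times> carrier G)"
  proof (rule inj_onI, clarify)
    fix a b a' b'
    assume ab: "a \<in> carrier G" "b \<in> carrier G" "a' \<in> carrier G" "b' \<in> carrier G" and "S_pair (a, b) = S_pair (a', b')"
    then have "b = b'" "inv b \<otimes> inv a \<otimes> b = inv b \<otimes> inv a' \<otimes> b" by (auto simp: S_pair_def)
    then have "b = b'" "inv a = inv a'" using ab by (simp_all add: m_assoc)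
    then show "a = a' \<and> b = b'" using ab inv_inv by metis
  qed
qed (auto simp: S_pair_def pair_conj_def pair_degree_def commutator_def group_word_simps)

lemma degree_preserving_perm_N: "Suc l < g \<Longrightarrow> degree_preserving_perm g (N_perm l)"
  unfolding N_perm_def
proof (rule degree_preserving_perm_update2)
  \<comment> \<open>Evaluated on the image, the formula for n gives n^-1 n n = n. So n can be read
    off from the image, and with it the original pairs.\<close>
  have recover: "inv (inv n \<otimes> c' \<otimes> n) \<otimes> inv (d \<otimes> n) \<otimes> c \<otimes> (d \<otimes> n) = n"
    if "c \<in> carrier G" "d \<in> carrier G" "c' \<in> carrier G" "n = inv c' \<otimes> inv d \<otimes> c \<otimes> d" for c d c' n
    using that by (simp add: group_word_simps)
  show "inj_on N_pairs ((carrier G \<times> carrier G) \<times> (carrier G \<times> carrier G))"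
  proof (rule inj_onI, clarify)
    fix c d c' d' a b a' b'
    assume cl: "c \<in> carrier G" "d \<in> carrier G" "c' \<in> carrier G" "d' \<in> carrier G"
      "a \<in> carrier G" "b \<in> carrier G" "a' \<in> carrier G" "b' \<in> carrier G"
      and eq: "N_pairs ((c, d), (c', d')) = N_pairs ((a, b), (a', b'))"
    define n where "n = inv c' \<otimes> inv d \<otimes> c \<otimes> d"
    define k where "k = inv a' \<otimes> inv b \<otimes> a \<otimes> b"
    have nk: "n \<in> carrier G" "k \<in> carrier G" using cl by (simp_all add: n_def k_def)
    have Npn: "N_pairs ((c, d), (c', d')) = ((c, d \<otimes> n), (inv n \<otimes> c' \<otimes> n, inv n \<otimes> d'))"
      and Npk: "N_pairs ((a, b), (a', b')) = ((a, b \<otimes> k), (inv k \<otimes> a' \<otimes> k, inv k \<otimes> b'))"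
      unfolding n_def k_def N_pairs_def Let_def by simp_all
    have e: "c = a" "d \<otimes> n = b \<otimes> k" "inv n \<otimes> c' \<otimes> n = inv k \<otimes> a' \<otimes> k" "inv n \<otimes> d' = inv k \<otimes> b'"
      using eq unfolding Npn Npk by simp_all
    have "n = k"
      using recover[OF cl(1-3) n_def] recover[OF cl(5,6,7) k_def] e by simp
    then show "((c, d) = (a, b)) \<and> ((c', d') = (a', b'))"
      using e cl nk by (simp add: m_assoc)
  qed
qed (auto simp: N_pairs_def Let_def pair_conj_def pair_degree_def commutator_def group_word_simps)

end

section \<open>The representation variety\<close>

context finite_gset
begin

lemma lin_ext_basis_compose:
  assumes t: "inj_on t X" "t ` X \<subseteq> X" and u: "inj_on u X" "u ` X \<subseteq> X"
    and s: "\<And>x. x \<in> X \<Longrightarrow> s x = u (t x)" and v: "v \<in> lin_space X"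
  shows "lin_ext (\<lambda>x. basis_vec (s x)) v = lin_ext (\<lambda>x. basis_vec (u x)) (lin_ext (\<lambda>x. basis_vec (t x)) v :: 'x \<Rightarrow> 'k::field)"
proof (rule lin_ext_basis_surj)
  note tv = lin_ext_basis_in_lin_space[OF finite_X v t(2)]
  have tX: "t x \<in> X" if "x \<in> X" for x using t(2) that by auto
  show "inj_on s X"
  proof (rule inj_onI)
    fix y z assume yz: "y \<in> X" "z \<in> X" and "s y = s z"
    then have "u (t y) = u (t z)" by (simp only: s)
    then have "t y = t z" using inj_onD[OF u(1)] tX yz by blast
    then show "y = z" using inj_onD[OF t(1)] yz by blast
  qed
  show "s ` X \<subseteq> X" using t(2) u(2) by (auto simp: s)
  show "lin_ext (\<lambda>x. basis_vec (u x)) (lin_ext (\<lambda>x. basis_vec (t x)) v) \<in> lin_space X"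
    by (rule lin_ext_basis_in_lin_space[OF finite_X tv u(2)])
  fix x assume x: "x \<in> X"
  have tx: "t x \<in> X" using t x by auto
  show "lin_ext (\<lambda>x. basis_vec (u x)) (lin_ext (\<lambda>x. basis_vec (t x)) v) (s x) = v x"
    by (simp add: s x lin_ext_basis_apply[OF finite_X tv u(1) tx] lin_ext_basis_apply[OF finite_X v t(1) x])
qed fact

lemma lin_ext_basis_id:
  assumes "\<And>x. x \<in> X \<Longrightarrow> t x = x" "v \<in> lin_space X"
  shows "lin_ext (\<lambda>x. basis_vec (t x)) v = v"
proof (rule lin_ext_basis_surj)
  show "inj_on t X" "t ` X \<subseteq> X" using assms(1) by (auto simp: inj_on_def)
qed (use assms in auto)

end

lemma (in ext_complex) Ext_map_id:
  assumes "\<And>v. v \<in> carrier N \<Longrightarrow> \<theta> v = v" "X \<in> carrier (Ext R P d N m)"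
  shows "Ext_map R P d N m \<theta> X = X"
  using assms(2)
proof (rule Ext_carrierE)
  interpret N: left_module R N by (rule N_module)
  fix f assume f: "f \<in> cocycles R P d N m" "X = cls m f"
  then have fh: "f \<in> mod_hom R (P m) N" using cocycles_subset by auto
  have "restrict \<theta> (carrier N) \<in> mod_hom R N N"
    using assms(1) by (intro mod_homI) (auto simp: N.smult_closed)
  moreover have "compose (carrier (P m)) \<theta> f = f"
    using assms(1) mod_hom_closed[OF fh] mod_hom_PiE[OF fh]
    by (auto simp: compose_def fun_eq_iff PiE_iff extensional_def)
  ultimately show ?thesis using f(2) Ext_map_cls[OF _ fh] by simp
qed

locale surface_reps = group G for G :: "('g, 'c) monoid_scheme" (structure) +
  fixes g :: nat and S :: "'s::t2_space set" and \<A> :: "'s chart set" and x :: 's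
    and \<alpha> \<beta> :: "nat \<Rightarrow> real \<Rightarrow> 's"
  assumes finite_G: "finite (carrier G)" and surface: "genus_surface g S \<A> x \<alpha> \<beta>"
begin

abbreviation "\<pi> \<equiv> fundamental_group S x"
abbreviation "A i \<equiv> path_class S (\<alpha> i)"
abbreviation "B i \<equiv> path_class S (\<beta> i)"
abbreviation "\<Omega> \<equiv> rep_variety S x G"

lemma closed_surface: "closed_oriented_surface S \<A>" and x_in_S: "x \<in> S"
  and presentation: "surface_presentation \<pi> g (\<lambda>i. A i) (\<lambda>i. B i)"
  using surface by (auto simp: genus_surface_def)

lemma gens_closed: "i < g \<Longrightarrow> A i \<in> carrier \<pi>" "i < g \<Longrightarrow> B i \<in> carrier \<pi>"
  using surface by (auto simp: genus_surface_def fundamental_group_def)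

sublocale pi: group \<pi>
  by (rule group_fundamental_group[OF x_in_S])

lemma rep_hom: "f \<in> \<Omega> \<Longrightarrow> f \<in> hom \<pi> G"
  by (simp add: rep_variety_def)

lemma rep_closed: "\<lbrakk>f \<in> \<Omega>; X \<in> carrier \<pi>\<rbrakk> \<Longrightarrow> f X \<in> carrier G"
  using rep_hom by (auto simp: hom_def)

lemma rep_mult: "\<lbrakk>f \<in> \<Omega>; X \<in> carrier \<pi>; Y \<in> carrier \<pi>\<rbrakk> \<Longrightarrow> f (X \<otimes>\<^bsub>\<pi>\<^esub> Y) = f X \<otimes> f Y"
  using rep_hom by (auto simp: hom_def)

lemma rep_inv: "\<lbrakk>f \<in> \<Omega>; X \<in> carrier \<pi>\<rbrakk> \<Longrightarrow> f (inv\<^bsub>\<pi>\<^esub> X) = inv (f X)"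
  using group_hom.hom_inv[of \<pi> G f X] rep_hom by (simp add: group_hom_def group_hom_axioms_def group_axioms pi.group_axioms)

lemma rep_eqI: "\<lbrakk>f \<in> \<Omega>; f' \<in> \<Omega>; \<And>X. X \<in> carrier \<pi> \<Longrightarrow> f X = f' X\<rbrakk> \<Longrightarrow> f = f'"
  by (rule extensionalityI[of _ "carrier \<pi>"]) (auto simp: rep_variety_def)

definition rep_tuple :: "((real \<Rightarrow> 's) set \<Rightarrow> 'g) \<Rightarrow> ('g \<times> 'g) list" where
  "rep_tuple f = map (\<lambda>i. (f (A i), inv (f (B i)))) [0..<g]"

lemma length_rep_tuple [simp]: "length (rep_tuple f) = g"
  by (simp add: rep_tuple_def)

lemma rep_tuple_nth: "i < g \<Longrightarrow> rep_tuple f ! i = (f (A i), inv (f (B i)))"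
  by (simp add: rep_tuple_def)

lemma rep_tuple_closed: "f \<in> \<Omega> \<Longrightarrow> rep_tuple f \<in> tuples g"
  using gens_closed rep_closed by (auto simp: rep_tuple_def tuples_def)

text \<open>The pair (a, b^-1) has degree [b, a] = [a, b]^-1, and inverting the relator reverses the
  order of the commutators just as the degree does. The induction runs over arbitrary lists of
  indices below g.\<close>

lemma list_degree_relator:
  assumes "\<And>i. i < g \<Longrightarrow> a i \<in> carrier G" "\<And>i. i < g \<Longrightarrow> b i \<in> carrier G"
  shows "list_degree (map (\<lambda>i. (a i, inv (b i))) [0..<g]) = inv (word_value G a b (surface_relator g))"
proof -
  let ?r = "\<lambda>i. [(Alpha i, True), (Beta i, True), (Alpha i, False), (Beta i, False)]"
  have "list_degree (map (\<lambda>i. (a i, inv (b i))) is) = inv (word_value G a b (concat (map ?r is)))"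
    if "set is \<subseteq> {..<g}" for "is"
    using that
  proof (induction "is")
    case (Cons i "is")
    have i: "i < g" "set is \<subseteq> {..<g}" using Cons.prems by auto
    note ab = assms[OF i(1)]
    have sw: "?r i \<in> surface_words g" "concat (map ?r is) \<in> surface_words g"
      using i by (auto simp: surface_words_def)
    have wc: "word_value G a b (concat (map ?r is)) \<in> carrier G"
      using word_value_closed[of g a b] assms sw(2) by blast
    have "word_value G a b (concat (map ?r (i # is))) = word_value G a b (?r i) \<otimes> word_value G a b (concat (map ?r is))"
      using word_value_append[of g a b "?r i" "concat (map ?r is)"] assms sw by simp
    moreover have "word_value G a b (?r i) = commutator G (a i) (b i)"
      using ab by (simp add: word_value_Cons commutator_def m_assoc)
    moreover have "inv (commutator G (a i) (b i)) = commutator G (b i) (a i)"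
      using ab by (simp add: commutator_def inv_mult_group m_assoc)
    ultimately show ?case
      using Cons.IH[OF i(2)] ab wc commutator_closed[OF ab] by (simp add: inv_mult_group)
  qed simp
  from this[of "[0..<g]"] show ?thesis by (simp add: surface_relator_def atLeast0LessThan)
qed

lemma surface_relator_closed: "surface_relator g \<in> surface_words g"
  by (auto simp: surface_relator_def surface_words_def)

lemma rep_tuple_degree:
  assumes "f \<in> \<Omega>"
  shows "list_degree (rep_tuple f) = \<one>"
proof -
  have "word_equiv g (surface_relator g) []" using word_equiv.relation[of g "[]" "[]"] by simp
  then have "word_value \<pi> (\<lambda>i. A i) (\<lambda>i. B i) (surface_relator g) = \<one>\<^bsub>\<pi>\<^esub>"
    using presentation surface_relator_closed by (auto simp: surface_presentation_def)
  moreover have "f (word_value \<pi> (\<lambda>i. A i) (\<lambda>i. B i) (surface_relator g)) =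
      word_value G (\<lambda>i. f (A i)) (\<lambda>i. f (B i)) (surface_relator g)"
    using hom_word_value[OF pi.group_axioms group_axioms rep_hom[OF assms], of g "\<lambda>i. A i" "\<lambda>i. B i"]
      gens_closed surface_relator_closed by blast
  moreover have "f \<one>\<^bsub>\<pi>\<^esub> = \<one>" using hom_one[OF rep_hom[OF assms] pi.group_axioms group_axioms] .
  ultimately have "word_value G (\<lambda>i. f (A i)) (\<lambda>i. f (B i)) (surface_relator g) = \<one>" by simp
  moreover have "list_degree (rep_tuple f) = inv (word_value G (\<lambda>i. f (A i)) (\<lambda>i. f (B i)) (surface_relator g))"
    unfolding rep_tuple_def by (rule list_degree_relator) (simp_all add: rep_closed[OF assms] gens_closed)
  ultimately show ?thesis by simp
qed

lemma rep_tuple_inj: "inj_on rep_tuple \<Omega>"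
proof (rule inj_onI)
  fix f f' assume f: "f \<in> \<Omega>" and f': "f' \<in> \<Omega>" and eq: "rep_tuple f = rep_tuple f'"
  have gens: "f (A i) = f' (A i)" "f (B i) = f' (B i)" if i: "i < g" for i
  proof -
    have "f (A i) = f' (A i) \<and> inv (f (B i)) = inv (f' (B i))"
      using arg_cong[OF eq, of "\<lambda>xs. xs ! i"] i by (simp add: rep_tuple_nth)
    then show "f (A i) = f' (A i)" "f (B i) = f' (B i)"
      using rep_closed[OF f gens_closed(2)[OF i]] rep_closed[OF f' gens_closed(2)[OF i]] by (metis inv_inv)+
  qed
  show "f = f'"
  proof (rule rep_eqI[OF f f'])
    fix X assume "X \<in> carrier \<pi>"
    then show "f X = f' X"
      using hom_eq_on_surface_group[OF pi.group_axioms group_axioms presentation rep_hom[OF f] rep_hom[OF f']]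
        gens_closed gens by blast
  qed
qed

text \<open>A tuple of degree 1 is a choice of values on the generators that satisfies the relation,
  and it therefore extends to a homomorphism.\<close>

lemma rep_tuple_image: "rep_tuple ` \<Omega> = {us \<in> tuples g. list_degree us = \<one>}"
proof
  show "rep_tuple ` \<Omega> \<subseteq> {us \<in> tuples g. list_degree us = \<one>}"
    using rep_tuple_closed rep_tuple_degree by auto
  show "{us \<in> tuples g. list_degree us = \<one>} \<subseteq> rep_tuple ` \<Omega>"
  proof
    fix us assume us: "us \<in> {us \<in> tuples g. list_degree us = \<one>}"
    \<comment> \<open>The value 1 from index g on is a filler:
      \<open>surface_group_hom_exists\<close> wants values at all indices.\<close>
    define a where "a i = (if i < g then fst (us ! i) else \<one>)" for i
    define b where "b i = (if i < g then inv (snd (us ! i)) else \<one>)" for i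
    have nth: "fst (us ! i) \<in> carrier G" "snd (us ! i) \<in> carrier G" if "i < g" for i
      using tuples_nth[of us g i] us that by (auto simp: mem_Times_iff)
    have ab: "a i \<in> carrier G" "b i \<in> carrier G" for i
      using nth by (auto simp: a_def b_def)
    have len: "length us = g" using us by (simp add: tuples_def)
    have us_eq: "map (\<lambda>i. (a i, inv (b i))) [0..<g] = us"
      using len nth by (intro nth_equalityI) (auto simp: a_def b_def)
    have "inv (word_value G a b (surface_relator g)) = \<one>"
      using list_degree_relator[of a b] ab us us_eq by simp
    moreover have "word_value G a b (surface_relator g) \<in> carrier G"
      using word_value_closed[of g a b] ab surface_relator_closed by blast
    ultimately have "word_value G a b (surface_relator g) = \<one>" by (metis inv_inv inv_one)
    then obtain f where f: "f \<in> hom \<pi> G \<inter> extensional (carrier \<pi>)" "\<forall>i<g. f (A i) = a i \<and> f (B i) = b i"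
      using surface_group_hom_exists[OF pi.group_axioms group_axioms presentation] gens_closed ab by blast
    have "rep_tuple f = us" unfolding us_eq[symmetric] rep_tuple_def using f(2) by simp
    then show "us \<in> rep_tuple ` \<Omega>" using f(1) by (auto simp: rep_variety_def)
  qed
qed

lemma finite_rep_variety: "finite \<Omega>"
proof -
  have "finite (rep_tuple ` \<Omega>)" unfolding rep_tuple_image using finite_tuples[OF finite_G] by simp
  then show ?thesis using rep_tuple_inj finite_imageD by blast
qed

lemma rep_conj_closed:
  assumes a: "a \<in> carrier G" and f: "f \<in> \<Omega>"
  shows "rep_conj S x G a f \<in> \<Omega>"
proof -
  have "rep_conj S x G a f \<in> hom \<pi> G"
  proof (rule homI)
    fix X Y assume XY: "X \<in> carrier \<pi>" "Y \<in> carrier \<pi>"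
    then show "rep_conj S x G a f (X \<otimes>\<^bsub>\<pi>\<^esub> Y) = rep_conj S x G a f X \<otimes> rep_conj S x G a f Y"
      using a f by (simp add: rep_conj_def rep_mult rep_closed group_word_simps)
  qed (use a f in \<open>simp add: rep_conj_def rep_closed\<close>)
  then show ?thesis by (simp add: rep_variety_def rep_conj_def)
qed

sublocale rep: finite_gset G \<Omega> "rep_conj S x G"
proof unfold_locales
  fix a b f assume "a \<in> carrier G" "b \<in> carrier G" "f \<in> \<Omega>"
  then show "rep_conj S x G (a \<otimes> b) f = rep_conj S x G a (rep_conj S x G b f)"
    by (auto simp: rep_conj_def rep_closed group_word_simps intro!: restrict_ext)
next
  fix f assume "f \<in> \<Omega>"
  then show "rep_conj S x G \<one> f = f"
    by (intro rep_eqI rep_conj_closed) (auto simp: rep_conj_def rep_closed)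
qed (use finite_G finite_rep_variety rep_conj_closed in auto)

lemma rep_module_eq: "rep_module S x G = rep.perm_module"
  by (simp add: rep_module_def)

lemma rep_tuple_conj:
  assumes a: "a \<in> carrier G" and f: "f \<in> \<Omega>"
  shows "rep_tuple (rep_conj S x G a f) = conj_list a (rep_tuple f)"
proof (rule nth_equalityI)
  show "length (rep_tuple (rep_conj S x G a f)) = length (conj_list a (rep_tuple f))" by (simp add: conj_list_def)
  fix i assume "i < length (rep_tuple (rep_conj S x G a f))"
  then have i: "i < g" by simp
  note fi = rep_closed[OF f gens_closed(1)[OF i]] rep_closed[OF f gens_closed(2)[OF i]]
  show "rep_tuple (rep_conj S x G a f) ! i = conj_list a (rep_tuple f) ! i"
    using i a fi gens_closed[OF i]
    by (simp add: rep_tuple_nth conj_list_def rep_conj_def conj_inv)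
qed

subsection \<open>Pulling back representations\<close>

definition rep_pull :: "((real \<Rightarrow> 's) set \<Rightarrow> (real \<Rightarrow> 's) set) \<Rightarrow> ((real \<Rightarrow> 's) set \<Rightarrow> 'g) \<Rightarrow> (real \<Rightarrow> 's) set \<Rightarrow> 'g" where
  "rep_pull a f = (\<lambda>X\<in>carrier \<pi>. f (a X))"

lemma rep_pull_closed:
  assumes "a \<in> hom \<pi> \<pi>" "f \<in> \<Omega>"
  shows "rep_pull a f \<in> \<Omega>"
proof -
  have ac: "a X \<in> carrier \<pi>" if "X \<in> carrier \<pi>" for X using assms(1) that by (auto simp: hom_def)
  have "rep_pull a f \<in> hom \<pi> G"
    using assms ac by (intro homI) (simp_all add: rep_pull_def rep_closed rep_mult hom_mult[OF assms(1)])
  then show ?thesis by (simp add: rep_variety_def rep_pull_def)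
qed

lemma rep_pull_conj:
  assumes "a \<in> hom \<pi> \<pi>" "k \<in> carrier G" "f \<in> \<Omega>"
  shows "rep_conj S x G k (rep_pull a f) = rep_pull a (rep_conj S x G k f)"
  using assms(1) by (auto simp: rep_pull_def rep_conj_def hom_def intro!: restrict_ext)

lemma rep_pull_inj:
  assumes "a \<in> hom \<pi> \<pi>" "a ` carrier \<pi> = carrier \<pi>"
  shows "inj_on (rep_pull a) \<Omega>"
proof (rule inj_onI)
  fix f f' assume f: "f \<in> \<Omega>" "f' \<in> \<Omega>" and eq: "rep_pull a f = rep_pull a f'"
  show "f = f'"
  proof (rule rep_eqI[OF f])
    fix Y assume "Y \<in> carrier \<pi>"
    then obtain X where "X \<in> carrier \<pi>" "Y = a X" using assms(2) by blast
    then show "f Y = f' Y" using fun_cong[OF eq, of X] by (simp add: rep_pull_def)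
  qed
qed

end

section \<open>The action of the mapping class group on group cohomology\<close>

lemma homeomorphism_selfD:
  assumes "homeomorphism S S \<phi> \<phi>'"
  shows "continuous_on S \<phi>" "\<phi> ` S \<subseteq> S" "continuous_on S \<phi>'" "\<phi>' ` S \<subseteq> S"
    "\<And>y. y \<in> S \<Longrightarrow> \<phi>' (\<phi> y) = y" "\<And>y. y \<in> S \<Longrightarrow> \<phi> (\<phi>' y) = y" "\<And>y. y \<in> S \<Longrightarrow> \<phi> y \<in> S"
  using assms by (auto simp: homeomorphism_def)

context surface_reps
begin

lemma carrier_pi: "carrier \<pi> = path_classes S x x"
  by (rule carrier_fundamental_group)

lemma based_map_hom: "\<lbrakk>homeomorphism S S \<phi> \<phi>'; a \<in> based_maps S x \<phi>\<rbrakk> \<Longrightarrow> a \<in> hom \<pi> \<pi>"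
  using based_maps_hom[OF x_in_S] homeomorphism_selfD by metis

lemma based_map_in: "\<lbrakk>homeomorphism S S \<phi> \<phi>'; a \<in> based_maps S x \<phi>; X \<in> carrier \<pi>\<rbrakk> \<Longrightarrow> a X \<in> carrier \<pi>"
  using based_map_hom by (auto simp: hom_def)

lemma based_maps_nonempty:
  assumes "homeomorphism S S \<phi> \<phi>'"
  shows "based_maps S x \<phi> \<noteq> {}"
  using path_classes_nonempty[OF path_connected_closed_oriented_surface[OF closed_surface] x_in_S, of "\<phi> x"]
    homeomorphism_selfD(7)[OF assms x_in_S] by (simp add: based_maps_def)

lemma id_based_map:
  assumes "\<And>y. y \<in> S \<Longrightarrow> \<phi> y = y"
  shows "\<exists>a\<in>based_maps S x \<phi>. \<forall>X\<in>carrier \<pi>. a X = X"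
proof -
  have "continuous_on S \<phi>" by (rule continuous_on_eq[OF continuous_on_id]) (simp add: assms)
  then obtain a where "a \<in> based_maps S x \<phi>" "\<forall>X\<in>path_classes S x x. a X = pi1_map S \<phi> X"
    using pi1_map_based_maps[OF x_in_S, of \<phi>] assms x_in_S by auto
  then show ?thesis using pi1_map_id[OF _ assms] unfolding carrier_pi by (intro bexI[of _ a]) auto
qed

lemma homeomorphism_eq_id:
  assumes "\<And>y. y \<in> S \<Longrightarrow> \<phi> y = y"
  shows "homeomorphism S S \<phi> \<phi>"
proof -
  have "continuous_on S \<phi>" by (rule continuous_on_eq[OF continuous_on_id]) (simp add: assms)
  then show ?thesis using assms by (auto simp: homeomorphism_def)
qed

lemma based_maps_comp:
  assumes "homeomorphism S S \<phi> \<phi>'" "homeomorphism S S \<psi> \<psi>'" "\<And>y. y \<in> S \<Longrightarrow> \<xi> y = \<phi> (\<psi> y)"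
    and "b \<in> based_maps S x \<phi>" "a \<in> based_maps S x \<psi>"
  shows "\<exists>e\<in>based_maps S x \<xi>. \<forall>X\<in>carrier \<pi>. b (a X) = e X"
  unfolding carrier_pi
  by (rule based_maps_compose[OF x_in_S homeomorphism_selfD(1,2)[OF assms(2)] homeomorphism_selfD(1,2)[OF assms(1)] _ assms(4,5)])
    (rule assms(3))

lemma based_map_conj:
  assumes "homeomorphism S S \<phi> \<phi>'" "a \<in> based_maps S x \<phi>" "b \<in> based_maps S x \<phi>"
  shows "\<exists>c\<in>carrier \<pi>. \<forall>X\<in>carrier \<pi>. b X = c \<otimes>\<^bsub>\<pi>\<^esub> (a X \<otimes>\<^bsub>\<pi>\<^esub> inv\<^bsub>\<pi>\<^esub> c)"
proof -
  obtain c where c: "c \<in> path_classes S x x"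
    "\<forall>X\<in>path_classes S x x. b X = class_mult S c (class_mult S (a X) (class_inv S c))"
    using based_maps_inner[OF x_in_S homeomorphism_selfD(1,2)[OF assms(1)] assms(2,3)] by blast
  then show ?thesis
    using inv_fundamental_group[OF x_in_S c(1)] by (intro bexI[of _ c]) (simp_all add: carrier_pi mult_fundamental_group)
qed

text \<open>If b belongs to the inverse homeomorphism, then a after b belongs to the identity and is
  an inner automorphism; its surjectivity gives that of a.\<close>

lemma based_map_surj:
  assumes \<phi>: "homeomorphism S S \<phi> \<phi>'" and a: "a \<in> based_maps S x \<phi>"
  shows "a ` carrier \<pi> = carrier \<pi>"
proof
  show "a ` carrier \<pi> \<subseteq> carrier \<pi>" using based_map_in[OF \<phi> a] by blast
  show "carrier \<pi> \<subseteq> a ` carrier \<pi>"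
  proof
    fix Y assume Y: "Y \<in> carrier \<pi>"
    note \<phi>' = homeomorphism_symD[OF \<phi>]
    obtain b where b: "b \<in> based_maps S x \<phi>'" using based_maps_nonempty[OF \<phi>'] by blast
    have id: "homeomorphism S S (\<lambda>y. y) (\<lambda>y. y)" by (rule homeomorphism_eq_id) simp
    obtain e where e: "e \<in> based_maps S x (\<lambda>y. y)" "\<forall>X\<in>carrier \<pi>. a (b X) = e X"
      using based_maps_comp[OF \<phi> \<phi>' _ a b, of "\<lambda>y. y"] homeomorphism_selfD(6)[OF \<phi>] by auto
    obtain i where i: "i \<in> based_maps S x (\<lambda>y. y)" "\<forall>X\<in>carrier \<pi>. i X = X"
      using id_based_map[of "\<lambda>y. y"] by auto
    obtain c where c: "c \<in> carrier \<pi>" "\<forall>X\<in>carrier \<pi>. e X = c \<otimes>\<^bsub>\<pi>\<^esub> (i X \<otimes>\<^bsub>\<pi>\<^esub> inv\<^bsub>\<pi>\<^esub> c)"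
      using based_map_conj[OF id i(1) e(1)] by blast
    \<comment> \<open>The solution of c X c^-1 = Y.\<close>
    define X where "X = inv\<^bsub>\<pi>\<^esub> c \<otimes>\<^bsub>\<pi>\<^esub> (Y \<otimes>\<^bsub>\<pi>\<^esub> c)"
    have X: "X \<in> carrier \<pi>" using c Y by (simp add: X_def)
    have "a (b X) = c \<otimes>\<^bsub>\<pi>\<^esub> (X \<otimes>\<^bsub>\<pi>\<^esub> inv\<^bsub>\<pi>\<^esub> c)" using e c i X by simp
    also have "\<dots> = Y" using c Y by (simp add: X_def pi.group_word_simps)
    finally show "Y \<in> a ` carrier \<pi>" using based_map_in[OF \<phi>' b X] by (metis imageI)
  qed
qed

definition pull_map :: "((real \<Rightarrow> 's) set \<Rightarrow> (real \<Rightarrow> 's) set)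
    \<Rightarrow> (((real \<Rightarrow> 's) set \<Rightarrow> 'g) \<Rightarrow> 'k::field) \<Rightarrow> ((real \<Rightarrow> 's) set \<Rightarrow> 'g) \<Rightarrow> 'k" where
  "pull_map a = lin_ext (\<lambda>f. basis_vec (rep_pull a f))"

lemma rep_pull_props:
  assumes "homeomorphism S S \<phi> \<phi>'" "a \<in> based_maps S x \<phi>"
  shows "inj_on (rep_pull a) \<Omega>" "rep_pull a ` \<Omega> \<subseteq> \<Omega>"
  using rep_pull_inj[OF based_map_hom[OF assms] based_map_surj[OF assms]] rep_pull_closed[OF based_map_hom[OF assms]] by auto

context
  fixes Q :: "nat \<Rightarrow> ('g \<Rightarrow> 'k::field, 'q) module" and e :: "nat \<Rightarrow> 'q \<Rightarrow> 'q" and \<epsilon>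
  assumes Q: "projective_resolution (group_algebra G) trivial_group_module Q e \<epsilon>"
begin

abbreviation "KG \<equiv> group_algebra G :: ('g \<Rightarrow> 'k) ring"
abbreviation "M \<equiv> rep_module S x G :: ('g \<Rightarrow> 'k, ((real \<Rightarrow> 's) set \<Rightarrow> 'g) \<Rightarrow> 'k) module"

lemma ring_KG: "ring KG"
  using Q left_module_ring by (auto simp: projective_resolution_def projective_module_def)

lemma M_module: "left_module KG M"
  unfolding rep_module_eq by (rule rep.left_module_perm_module[OF ring_KG])

lemma carrier_M: "carrier M = lin_space \<Omega>"
  by (simp add: rep_module_eq based_module_simps)

lemma M_complex: "ext_complex KG Q e M"
  using ext_complex_based_algebra[of _ _ _ trivial_group_module Q e \<epsilon> M] Q M_module by (simp add: group_algebra_def)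

interpretation E: ext_complex KG Q e M
  by (rule M_complex)

lemma pull_map_hom:
  assumes "homeomorphism S S \<phi> \<phi>'" "a \<in> based_maps S x \<phi>"
  shows "restrict (pull_map a) (carrier M) \<in> mod_hom KG M M"
  unfolding rep_module_eq pull_map_def
  by (rule rep.perm_module_hom[OF rep_pull_props[OF assms] _ ring_KG])
    (simp add: rep_pull_conj[OF based_map_hom[OF assms]])

text \<open>Since b is a followed by conjugation with c, pulling f back along b is pulling it back
  along a and then conjugating by f(c). With c = a(c') the conjugator is the value at c' of the
  pulled-back representation, so the second operation is a twist, which acts trivially on
  cohomology.\<close>

lemma pull_map_Ext_unique:
  assumes \<phi>: "homeomorphism S S \<phi> \<phi>'" and a: "a \<in> based_maps S x \<phi>" and b: "b \<in> based_maps S x \<phi>"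
    and Y: "Y \<in> carrier (Ext KG Q e M m)"
  shows "Ext_map KG Q e M m (pull_map b) Y = Ext_map KG Q e M m (pull_map a) Y"
proof -
  obtain c where c: "c \<in> carrier \<pi>" "\<And>X. X \<in> carrier \<pi> \<Longrightarrow> b X = c \<otimes>\<^bsub>\<pi>\<^esub> (a X \<otimes>\<^bsub>\<pi>\<^esub> inv\<^bsub>\<pi>\<^esub> c)"
    using based_map_conj[OF \<phi> a b] by blast
  have "c \<in> a ` carrier \<pi>" using based_map_surj[OF \<phi> a] c(1) by simp
  then obtain c' where c': "c' \<in> carrier \<pi>" "a c' = c" by (elim imageE) simp
  \<comment> \<open>Evaluation at c' is a degree for the conjugation action on representations,
    because conjugating f by a conjugates f(c') by a.\<close>
  interpret gr: graded_gset G \<Omega> "rep_conj S x G" "\<lambda>f. f c'"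
    by unfold_locales (simp_all add: rep_closed c'(1) rep_conj_def)
  let ?t = "\<lambda>f. rep_conj S x G (f c') f"
  have th: "restrict (lin_ext (\<lambda>f. basis_vec (?t f))) (carrier M) \<in> mod_hom KG M M"
    unfolding rep_module_eq by (rule rep.perm_module_hom[OF gr.twist_props(1,2) _ ring_KG]) (rule gr.twist_props(3))
  have eq: "rep_pull b f = ?t (rep_pull a f)" if f: "f \<in> \<Omega>" for f
    unfolding rep_pull_def rep_conj_def
  proof (rule restrict_ext)
    fix X assume X: "X \<in> carrier \<pi>"
    note aX = based_map_in[OF \<phi> a X]
    have "f (b X) = f c \<otimes> (f (a X) \<otimes> inv (f c))"
      using f X c(1) aX by (simp add: c(2) rep_mult rep_inv)
    also have "\<dots> = f c \<otimes> f (a X) \<otimes> inv (f c)"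
      using f c(1) aX by (simp add: m_assoc rep_closed)
    finally show "f (b X) = (\<lambda>X\<in>carrier \<pi>. f (a X)) c' \<otimes> (\<lambda>X\<in>carrier \<pi>. f (a X)) X \<otimes> inv (\<lambda>X\<in>carrier \<pi>. f (a X)) c'"
      using X c' by simp
  qed
  have "Ext_map KG Q e M m (pull_map b) Y =
      Ext_map KG Q e M m (lin_ext (\<lambda>f. basis_vec (?t f))) (Ext_map KG Q e M m (pull_map a) Y)"
  proof (rule E.Ext_map_compose[OF th pull_map_hom[OF \<phi> a] _ Y])
    fix v assume "v \<in> carrier M"
    then have v: "v \<in> lin_space \<Omega>" by (simp add: carrier_M)
    show "pull_map b v = lin_ext (\<lambda>f. basis_vec (?t f)) (pull_map a v)"
      unfolding pull_map_def
      by (rule rep.lin_ext_basis_compose[OF rep_pull_props[OF \<phi> a] gr.twist_props(1,2) eq v])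
  qed
  also have "\<dots> = Ext_map KG Q e M m (pull_map a) Y"
    using gr.Ext_map_twist[OF Q, of "Ext_map KG Q e M m (pull_map a) Y" m]
      E.Ext_map_closed[OF pull_map_hom[OF \<phi> a] Y] unfolding rep_module_eq by simp
  finally show ?thesis .
qed

text \<open>By \<open>pull_map_Ext_unique\<close> the choice of the connecting path does not matter.
  The action is by pullback and therefore contravariant.\<close>

definition homeo_act :: "nat \<Rightarrow> ('s \<Rightarrow> 's) \<Rightarrow> ('q \<Rightarrow> ((real \<Rightarrow> 's) set \<Rightarrow> 'g) \<Rightarrow> 'k) set
    \<Rightarrow> ('q \<Rightarrow> ((real \<Rightarrow> 's) set \<Rightarrow> 'g) \<Rightarrow> 'k) set" where
  "homeo_act m \<phi> = Ext_map KG Q e M m (pull_map (SOME a. a \<in> based_maps S x \<phi>))"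

lemma homeo_act_eq:
  assumes \<phi>: "homeomorphism S S \<phi> \<phi>'" and a: "a \<in> based_maps S x \<phi>"
    and Y: "Y \<in> carrier (Ext KG Q e M m)"
  shows "homeo_act m \<phi> Y = Ext_map KG Q e M m (pull_map a) Y"
  unfolding homeo_act_def using someI[of "\<lambda>a. a \<in> based_maps S x \<phi>", OF a] pull_map_Ext_unique[OF \<phi> a _ Y] by blast

lemma homeo_act_linear:
  assumes \<phi>: "homeomorphism S S \<phi> \<phi>'"
  shows "Y \<in> carrier (Ext KG Q e M m) \<Longrightarrow> homeo_act m \<phi> Y \<in> carrier (Ext KG Q e M m)"
    and "\<lbrakk>Y \<in> carrier (Ext KG Q e M m); Z \<in> carrier (Ext KG Q e M m)\<rbrakk> \<Longrightarrow>
      homeo_act m \<phi> (Y \<oplus>\<^bsub>Ext KG Q e M m\<^esub> Z) = homeo_act m \<phi> Y \<oplus>\<^bsub>Ext KG Q e M m\<^esub> homeo_act m \<phi> Z"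
    and "Y \<in> carrier (Ext KG Q e M m) \<Longrightarrow>
      homeo_act m \<phi> (k \<odot>\<^bsub>Ext KG Q e M m\<^esub> Y) = k \<odot>\<^bsub>Ext KG Q e M m\<^esub> homeo_act m \<phi> Y"
proof -
  define a where "a = (SOME a. a \<in> based_maps S x \<phi>)"
  have a: "a \<in> based_maps S x \<phi>"
    unfolding a_def using based_maps_nonempty[OF \<phi>] by (simp add: some_in_eq)
  have eq: "homeo_act m \<phi> = Ext_map KG Q e M m (pull_map a)" by (simp add: homeo_act_def a_def)
  note h = pull_map_hom[OF \<phi> a]
  show "Y \<in> carrier (Ext KG Q e M m) \<Longrightarrow> homeo_act m \<phi> Y \<in> carrier (Ext KG Q e M m)"
    unfolding eq by (rule E.Ext_map_closed[OF h])
  show "\<lbrakk>Y \<in> carrier (Ext KG Q e M m); Z \<in> carrier (Ext KG Q e M m)\<rbrakk> \<Longrightarrow>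
      homeo_act m \<phi> (Y \<oplus>\<^bsub>Ext KG Q e M m\<^esub> Z) = homeo_act m \<phi> Y \<oplus>\<^bsub>Ext KG Q e M m\<^esub> homeo_act m \<phi> Z"
    unfolding eq by (rule E.Ext_map_linear(1)[OF h])
  show "Y \<in> carrier (Ext KG Q e M m) \<Longrightarrow>
      homeo_act m \<phi> (k \<odot>\<^bsub>Ext KG Q e M m\<^esub> Y) = k \<odot>\<^bsub>Ext KG Q e M m\<^esub> homeo_act m \<phi> Y"
    unfolding eq by (rule E.Ext_map_linear(2)[OF h])
qed

lemma homeo_act_agree:
  assumes \<phi>: "homeomorphism S S \<phi> \<phi>'" and a: "a \<in> based_maps S x \<phi>"
    and Y: "Y \<in> carrier (Ext KG Q e M m)" and b: "\<And>X. X \<in> carrier \<pi> \<Longrightarrow> a X = b X"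
  shows "homeo_act m \<phi> Y = Ext_map KG Q e M m (pull_map b) Y"
proof -
  have "rep_pull a f = rep_pull b f" for f
    unfolding rep_pull_def using b by (intro restrict_ext) simp
  then have "pull_map b = (pull_map a :: _ \<Rightarrow> _ \<Rightarrow> 'k)" by (simp add: pull_map_def)
  then show ?thesis using homeo_act_eq[OF \<phi> a Y] by simp
qed

text \<open>A composite of chosen automorphisms belongs to the composite homeomorphism; it need not
  be the chosen one there, but it induces the same map on cohomology.\<close>

lemma homeo_act_comp:
  assumes \<phi>: "homeomorphism S S \<phi> \<phi>'" and \<psi>: "homeomorphism S S \<psi> \<psi>'" and \<xi>: "homeomorphism S S \<xi> \<xi>'"
    and eq: "\<And>y. y \<in> S \<Longrightarrow> \<xi> y = \<phi> (\<psi> y)" and Y: "Y \<in> carrier (Ext KG Q e M m)"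
  shows "homeo_act m \<xi> Y = homeo_act m \<psi> (homeo_act m \<phi> Y)"
proof -
  obtain a b where a: "a \<in> based_maps S x \<psi>" and b: "b \<in> based_maps S x \<phi>"
    using based_maps_nonempty[OF \<phi>] based_maps_nonempty[OF \<psi>] by blast
  obtain c where c: "c \<in> based_maps S x \<xi>" "\<forall>X\<in>carrier \<pi>. b (a X) = c X"
    using based_maps_comp[OF \<phi> \<psi> eq b a] by blast
  have pull: "rep_pull c f = rep_pull a (rep_pull b f)" if "f \<in> \<Omega>" for f
    unfolding rep_pull_def using c(2) based_map_in[OF \<psi> a] by (intro restrict_ext) simp
  have "homeo_act m \<xi> Y = Ext_map KG Q e M m (pull_map c) Y" by (rule homeo_act_eq[OF \<xi> c(1) Y])
  also have "\<dots> = Ext_map KG Q e M m (pull_map a) (Ext_map KG Q e M m (pull_map b) Y)"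
  proof (rule E.Ext_map_compose[OF pull_map_hom[OF \<psi> a] pull_map_hom[OF \<phi> b] _ Y])
    fix v assume "v \<in> carrier M"
    then have v: "v \<in> lin_space \<Omega>" by (simp add: carrier_M)
    show "pull_map c v = pull_map a (pull_map b v)"
      unfolding pull_map_def
      by (rule rep.lin_ext_basis_compose[OF rep_pull_props[OF \<phi> b] rep_pull_props[OF \<psi> a] pull v])
  qed
  also have "\<dots> = homeo_act m \<psi> (homeo_act m \<phi> Y)"
    using homeo_act_eq[OF \<phi> b Y] homeo_act_eq[OF \<psi> a] homeo_act_linear(1)[OF \<phi> Y] by simp
  finally show ?thesis .
qed

lemma homeo_act_trivial:
  assumes \<phi>: "homeomorphism S S \<phi> \<phi>'" and a: "a \<in> based_maps S x \<phi>" "\<And>X. X \<in> carrier \<pi> \<Longrightarrow> a X = X"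
    and Y: "Y \<in> carrier (Ext KG Q e M m)"
  shows "homeo_act m \<phi> Y = Y"
proof -
  have "rep_pull a f = f" if "f \<in> \<Omega>" for f
    using a(2) that rep_pull_closed[OF based_map_hom[OF \<phi> a(1)] that] by (intro rep_eqI) (auto simp: rep_pull_def)
  then have "pull_map a v = v" if "v \<in> carrier M" for v
    using that unfolding pull_map_def carrier_M by (intro rep.lin_ext_basis_id)
  then have "Ext_map KG Q e M m (pull_map a) Y = Y" using Y by (rule E.Ext_map_id)
  then show ?thesis using homeo_act_eq[OF \<phi> a(1) Y] by simp
qed

lemma homeo_act_id:
  assumes "\<And>y. y \<in> S \<Longrightarrow> \<phi> y = y" and Y: "Y \<in> carrier (Ext KG Q e M m)"
  shows "homeo_act m \<phi> Y = Y"
proof -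
  obtain a where "a \<in> based_maps S x \<phi>" "\<forall>X\<in>carrier \<pi>. a X = X" using id_based_map[OF assms(1)] by auto
  then show ?thesis using homeo_act_trivial[OF homeomorphism_eq_id[OF assms(1)] _ _ Y, of a] by blast
qed

lemma homeo_act_inverse:
  assumes \<phi>: "homeomorphism S S \<phi> \<phi>'" and Y: "Y \<in> carrier (Ext KG Q e M m)"
  shows "homeo_act m \<phi>' (homeo_act m \<phi> Y) = Y"
proof -
  have "homeo_act m (\<lambda>y. y) Y = homeo_act m \<phi>' (homeo_act m \<phi> Y)"
    by (rule homeo_act_comp[OF \<phi> homeomorphism_symD[OF \<phi>] _ _ Y])
      (auto intro: homeomorphism_eq_id simp: homeomorphism_selfD(6)[OF \<phi>])
  then show ?thesis using homeo_act_id[OF _ Y, of "\<lambda>y. y"] by simp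
qed

end

end

section \<open>Transport of actions; self-homeomorphisms\<close>

lemma (in ext_complex) Ext_closed:
  shows "\<lbrakk>X \<in> carrier (Ext R P d N m); Y \<in> carrier (Ext R P d N m)\<rbrakk> \<Longrightarrow>
      X \<oplus>\<^bsub>Ext R P d N m\<^esub> Y \<in> carrier (Ext R P d N m)"
    and "X \<in> carrier (Ext R P d N m) \<Longrightarrow> c \<odot>\<^bsub>Ext R P d N m\<^esub> X \<in> carrier (Ext R P d N m)"
  using cocycles_subset
  by (auto elim!: Ext_carrierE simp: Ext_add Ext_smult subset_iff intro!: cls_in_Ext cocycles_add cocycles_smult)

text \<open>V is a bare record, so closure under its operations is assumed explicitly. It allows
  equalities in V to be tested after applying \<phi>.\<close>

lemma transport_linear_action:
  assumes \<phi>: "linear_iso V W \<phi>" and \<sigma>: "linear_action \<Gamma> W \<sigma>"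
    and add: "\<And>v w. \<lbrakk>v \<in> carrier V; w \<in> carrier V\<rbrakk> \<Longrightarrow> v \<oplus>\<^bsub>V\<^esub> w \<in> carrier V"
    and smult: "\<And>c v. v \<in> carrier V \<Longrightarrow> c \<odot>\<^bsub>V\<^esub> v \<in> carrier V"
  defines "\<rho> \<equiv> \<lambda>X v. inv_into (carrier V) \<phi> (\<sigma> X (\<phi> v))"
  shows "linear_action \<Gamma> V \<rho>" "equivariant_iso \<Gamma> V \<rho> W \<sigma> \<phi>"
proof -
  have bij: "bij_betw \<phi> (carrier V) (carrier W)" using \<phi> by (simp add: linear_iso_def)
  have \<phi>_in: "\<phi> v \<in> carrier W" if "v \<in> carrier V" for v using bij_betwE[OF bij] that by blast
  have \<sigma>X: "linear_iso W W (\<sigma> X)" if "X \<in> carrier \<Gamma>" for X using \<sigma> that by (simp add: linear_action_def)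
  have \<sigma>bij: "bij_betw (\<sigma> X) (carrier W) (carrier W)" if "X \<in> carrier \<Gamma>" for X
    using \<sigma>X[OF that] by (simp add: linear_iso_def)
  have \<sigma>_in: "\<sigma> X w \<in> carrier W" if "X \<in> carrier \<Gamma>" "w \<in> carrier W" for X w
    using bij_betwE[OF \<sigma>bij[OF that(1)]] that(2) by blast
  have \<rho>_in: "\<rho> X v \<in> carrier V" and \<phi>\<rho>: "\<phi> (\<rho> X v) = \<sigma> X (\<phi> v)"
    if "X \<in> carrier \<Gamma>" "v \<in> carrier V" for X v
    using \<sigma>_in[OF that(1) \<phi>_in[OF that(2)]] bij unfolding \<rho>_def
    by (auto simp: bij_betw_def inv_into_into f_inv_into_f)
  have inj: "v = w" if "v \<in> carrier V" "w \<in> carrier V" "\<phi> v = \<phi> w" for v w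
    using bij that by (auto simp: bij_betw_def inj_on_def)
  have "linear_iso V V (\<rho> X)" if X: "X \<in> carrier \<Gamma>" for X
    unfolding linear_iso_def
  proof (intro conjI ballI allI)
    have "bij_betw (inv_into (carrier V) \<phi> \<circ> (\<sigma> X \<circ> \<phi>)) (carrier V) (carrier V)"
      by (intro bij_betw_trans[OF bij_betw_trans[OF bij \<sigma>bij[OF X]]] bij_betw_inv_into bij)
    then show "bij_betw (\<rho> X) (carrier V) (carrier V)" by (simp add: \<rho>_def o_def)
    fix v w assume v: "v \<in> carrier V" and w: "w \<in> carrier V"
    show "\<rho> X (v \<oplus>\<^bsub>V\<^esub> w) = \<rho> X v \<oplus>\<^bsub>V\<^esub> \<rho> X w"
    proof (rule inj)
      show "\<rho> X (v \<oplus>\<^bsub>V\<^esub> w) \<in> carrier V" "\<rho> X v \<oplus>\<^bsub>V\<^esub> \<rho> X w \<in> carrier V"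
        using X v w by (auto intro: \<rho>_in add)
      show "\<phi> (\<rho> X (v \<oplus>\<^bsub>V\<^esub> w)) = \<phi> (\<rho> X v \<oplus>\<^bsub>V\<^esub> \<rho> X w)"
        using \<phi> \<sigma>X[OF X] X v w by (simp add: \<phi>\<rho> add \<rho>_in linear_iso_def \<phi>_in)
    qed
  next
    fix c v assume v: "v \<in> carrier V"
    show "\<rho> X (c \<odot>\<^bsub>V\<^esub> v) = c \<odot>\<^bsub>V\<^esub> \<rho> X v"
    proof (rule inj)
      show "\<rho> X (c \<odot>\<^bsub>V\<^esub> v) \<in> carrier V" "c \<odot>\<^bsub>V\<^esub> \<rho> X v \<in> carrier V"
        using X v by (auto intro: \<rho>_in smult)
      show "\<phi> (\<rho> X (c \<odot>\<^bsub>V\<^esub> v)) = \<phi> (c \<odot>\<^bsub>V\<^esub> \<rho> X v)"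
        using \<phi> \<sigma>X[OF X] X v by (simp add: \<phi>\<rho> smult \<rho>_in linear_iso_def \<phi>_in)
    qed
  qed
  moreover have "\<rho> \<one>\<^bsub>\<Gamma>\<^esub> v = v" if v: "v \<in> carrier V" for v
    using \<sigma> \<phi>_in[OF v] bij v unfolding \<rho>_def by (simp add: linear_action_def bij_betw_def)
  moreover have "\<rho> (X \<otimes>\<^bsub>\<Gamma>\<^esub> Y) v = \<rho> X (\<rho> Y v)" if "X \<in> carrier \<Gamma>" "Y \<in> carrier \<Gamma>" "v \<in> carrier V" for X Y v
  proof -
    have "\<rho> X u = inv_into (carrier V) \<phi> (\<sigma> X (\<phi> u))" for u by (simp add: \<rho>_def)
    from this[of "\<rho> Y v"] have "\<rho> X (\<rho> Y v) = inv_into (carrier V) \<phi> (\<sigma> X (\<sigma> Y (\<phi> v)))"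
      unfolding \<phi>\<rho>[OF that(2,3)] .
    then show ?thesis using \<sigma> that \<phi>_in by (simp add: linear_action_def \<rho>_def)
  qed
  ultimately show "linear_action \<Gamma> V \<rho>" by (simp add: linear_action_def)
  show "equivariant_iso \<Gamma> V \<rho> W \<sigma> \<phi>" using \<phi> \<phi>\<rho> by (simp add: equivariant_iso_def)
qed

text \<open>Closure under composition is here a matter of continuity, and a homeomorphism is all
  that the construction of the action asks of a representative.\<close>

definition self_homeos :: "'a::topological_space set \<Rightarrow> ('a \<Rightarrow> 'a) set" where
  "self_homeos S = {\<psi> \<in> Bij S. continuous_on S \<psi> \<and> continuous_on S (inv_into S \<psi>)}"

text \<open>The inverse stands first because representations are moved by pulling back along
  it.\<close>

lemma self_homeos_homeomorphism: "\<psi> \<in> self_homeos S \<Longrightarrow> homeomorphism S S (inv_into S \<psi>) \<psi>"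
  using bij_betw_imp_surj_on[of \<psi> S S] bij_betw_imp_surj_on[OF bij_betw_inv_into, of \<psi> S S]
    bij_betw_inv_into_left[of \<psi> S S] bij_betw_inv_into_right[of \<psi> S S]
  by (auto simp: self_homeos_def Bij_def homeomorphism_def)

lemma inv_into_compose:
  assumes "\<psi> \<in> self_homeos S" "\<psi>' \<in> self_homeos S" "y \<in> S"
  shows "inv_into S (compose S \<psi> \<psi>') y = inv_into S \<psi>' (inv_into S \<psi> y)"
proof (rule inv_into_f_eq)
  note h = homeomorphism_selfD[OF self_homeos_homeomorphism[OF assms(1)]]
  note h' = homeomorphism_selfD[OF self_homeos_homeomorphism[OF assms(2)]]
  have "compose S \<psi> \<psi>' \<in> Bij S" using assms by (intro compose_Bij) (auto simp: self_homeos_def)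
  then show "inj_on (compose S \<psi> \<psi>') S" by (simp add: Bij_def bij_betw_def)
  show z: "inv_into S \<psi>' (inv_into S \<psi> y) \<in> S" using h(7) h'(7) assms(3) by simp
  show "compose S \<psi> \<psi>' (inv_into S \<psi>' (inv_into S \<psi> y)) = y"
    using z h(5,7) h'(5) assms(3) by (simp add: compose_eq)
qed

lemma self_homeos_compose:
  assumes "\<psi> \<in> self_homeos S" "\<psi>' \<in> self_homeos S"
  shows "compose S \<psi> \<psi>' \<in> self_homeos S"
proof -
  note h = homeomorphism_selfD[OF self_homeos_homeomorphism[OF assms(1)]]
  note h' = homeomorphism_selfD[OF self_homeos_homeomorphism[OF assms(2)]]
  have "continuous_on S (compose S \<psi> \<psi>')"
    by (rule continuous_on_eq[OF continuous_on_compose2[OF h(3) h'(3,4)]]) (simp add: compose_eq)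
  moreover have "continuous_on S (inv_into S (compose S \<psi> \<psi>'))"
    by (rule continuous_on_eq[OF continuous_on_compose2[OF h'(1) h(1,2)]]) (simp add: inv_into_compose[OF assms])
  ultimately show ?thesis
    using assms compose_Bij by (auto simp: self_homeos_def)
qed

section \<open>Mapping classes acting on group cohomology\<close>

context surface_reps
begin

abbreviation "\<Delta> \<equiv> diffeo_group S \<A>"

lemma diffeo_self_homeo: "\<psi> \<in> carrier \<Delta> \<Longrightarrow> \<psi> \<in> self_homeos S"
  using diffeo_groupD[OF closed_surface] by (auto simp: self_homeos_def)

lemma isotopic_diffeo: "h \<in> diffeos_isotopic_to_id S \<A> \<Longrightarrow> h \<in> carrier \<Delta>"
  by (simp add: diffeos_isotopic_to_id_def)

lemma mult_self_homeos: "\<lbrakk>\<psi> \<in> self_homeos S; \<psi>' \<in> self_homeos S\<rbrakk> \<Longrightarrow> \<psi> \<otimes>\<^bsub>\<Delta>\<^esub> \<psi>' = compose S \<psi> \<psi>'"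
  by (simp add: self_homeos_def diffeo_group_def BijGroup_def)

lemma mapping_class_iff:
  assumes "\<psi> \<in> carrier \<Delta>"
  shows "\<psi>' \<in> mapping_class S \<A> \<psi> \<longleftrightarrow> (\<exists>h\<in>diffeos_isotopic_to_id S \<A>. \<psi>' = compose S h \<psi>)"
  using mult_self_homeos[OF diffeo_self_homeo[OF isotopic_diffeo] diffeo_self_homeo[OF assms]]
  by (auto simp: mapping_class_def r_coset_def)

lemma mapping_class_groupE:
  assumes "X \<in> carrier (mapping_class_group S \<A>)"
  obtains \<psi> where "\<psi> \<in> carrier \<Delta>" "X = mapping_class S \<A> \<psi>"
  using assms by (auto simp: mapping_class_group_def FactGroup_def RCOSETS_def mapping_class_def)

lemma mapping_class_nonempty:
  assumes "\<psi> \<in> carrier \<Delta>"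
  shows "mapping_class S \<A> \<psi> \<noteq> {}"
  using id_isotopic_to_id[OF closed_surface] mapping_class_iff[OF assms] by blast

context
  fixes Q :: "nat \<Rightarrow> ('g \<Rightarrow> 'k::field, 'q) module" and e :: "nat \<Rightarrow> 'q \<Rightarrow> 'q" and \<epsilon> and m :: nat
  assumes Q: "projective_resolution (group_algebra G) trivial_group_module Q e \<epsilon>"
begin

abbreviation "W \<equiv> Ext (group_algebra G) Q e (rep_module S x G) m"
abbreviation "\<tau> \<psi> \<equiv> homeo_act Q e m (inv_into S \<psi>)"

text \<open>Passing to inverses and pulling back both reverse the order, so together they give an
  action from the left.\<close>

lemma tau_compose:
  assumes "\<psi> \<in> self_homeos S" "\<psi>' \<in> self_homeos S" "Y \<in> carrier W"
  shows "\<tau> (compose S \<psi> \<psi>') Y = \<tau> \<psi> (\<tau> \<psi>' Y)"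
  by (rule homeo_act_comp[OF Q self_homeos_homeomorphism[OF assms(2)] self_homeos_homeomorphism[OF assms(1)]
        self_homeos_homeomorphism[OF self_homeos_compose[OF assms(1,2)]] _ assms(3)])
    (rule inv_into_compose[OF assms(1,2)])

lemma tau_closed: "\<lbrakk>\<psi> \<in> self_homeos S; Y \<in> carrier W\<rbrakk> \<Longrightarrow> \<tau> \<psi> Y \<in> carrier W"
  by (rule homeo_act_linear(1)[OF Q self_homeos_homeomorphism])

text \<open>An isotopy from the identity to h moves x along a path, and with this connecting path h
  induces the identity of the fundamental group. The isotopy ends at h, whereas \<tau> uses the
  inverse of h; \<open>homeo_act_inverse\<close> passes from one to the other.\<close>

lemma tau_isotopic_to_id:
  assumes h: "h \<in> diffeos_isotopic_to_id S \<A>" and Y: "Y \<in> carrier W"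
  shows "\<tau> h Y = Y"
proof -
  note hom = self_homeos_homeomorphism[OF diffeo_self_homeo[OF isotopic_diffeo[OF h]]]
  obtain H where H: "continuous_on ({0..1} \<times> S) H"
    "\<And>t. t \<in> {0..1::real} \<Longrightarrow> (\<lambda>y\<in>S. H (t, y)) \<in> carrier \<Delta>"
    "\<And>y. y \<in> S \<Longrightarrow> H (0, y) = \<one>\<^bsub>\<Delta>\<^esub> y \<and> H (1, y) = h y"
    using h by (auto simp: diffeos_isotopic_to_id_def isotopic_def)
  have HS: "H (t, y) \<in> S" if "t \<in> {0..1}" "y \<in> S" for t y
    using bij_betwE[OF diffeo_groupD(1)[OF closed_surface H(2)[OF that(1)]]] that(2) by auto
  obtain a where a: "a \<in> based_maps S x h" "\<forall>X\<in>path_classes S x x. a X = X"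
    using homotopic_id_based_maps[OF x_in_S H(1) HS, of h] H(3) by (auto simp: diffeo_group_def BijGroup_def)
  have "homeo_act Q e m h Y = Y"
    using a(2) by (intro homeo_act_trivial[OF Q homeomorphism_symD[OF hom] a(1) _ Y]) (simp add: carrier_pi)
  then show ?thesis using homeo_act_inverse[OF Q homeomorphism_symD[OF hom] Y] by simp
qed

text \<open>All members of a mapping class act in the same way, so an arbitrary one may stand for
  the class.\<close>

definition mcg_act :: "('s \<Rightarrow> 's) set \<Rightarrow> ('q \<Rightarrow> ((real \<Rightarrow> 's) set \<Rightarrow> 'g) \<Rightarrow> 'k) set
    \<Rightarrow> ('q \<Rightarrow> ((real \<Rightarrow> 's) set \<Rightarrow> 'g) \<Rightarrow> 'k) set" where
  "mcg_act X = \<tau> (SOME \<psi>. \<psi> \<in> X)"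

lemma mcg_act_eq:
  assumes "X \<noteq> {}" "\<And>\<psi>. \<psi> \<in> X \<Longrightarrow> \<tau> \<psi> Y = Z"
  shows "mcg_act X Y = Z"
  unfolding mcg_act_def using assms by (simp add: some_in_eq)

lemma tau_mapping_class:
  assumes \<psi>: "\<psi> \<in> carrier \<Delta>" and "\<psi>' \<in> mapping_class S \<A> \<psi>" and Y: "Y \<in> carrier W"
  shows "\<psi>' \<in> self_homeos S" "\<tau> \<psi>' Y = \<tau> \<psi> Y"
proof -
  obtain h where h: "h \<in> diffeos_isotopic_to_id S \<A>" "\<psi>' = compose S h \<psi>"
    using assms(2) mapping_class_iff[OF \<psi>] by blast
  note hh = diffeo_self_homeo[OF isotopic_diffeo[OF h(1)]] and \<psi>h = diffeo_self_homeo[OF \<psi>]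
  show "\<psi>' \<in> self_homeos S" unfolding h(2) by (rule self_homeos_compose[OF hh \<psi>h])
  show "\<tau> \<psi>' Y = \<tau> \<psi> Y"
    unfolding h(2) tau_compose[OF hh \<psi>h Y] by (rule tau_isotopic_to_id[OF h(1) tau_closed[OF \<psi>h Y]])
qed

lemma mcg_act_mapping_class:
  assumes "\<psi> \<in> carrier \<Delta>" "Y \<in> carrier W"
  shows "mcg_act (mapping_class S \<A> \<psi>) Y = \<tau> \<psi> Y"
  using mapping_class_nonempty[OF assms(1)] tau_mapping_class(2)[OF assms(1) _ assms(2)] by (rule mcg_act_eq)

lemma linear_action_mcg: "linear_action (mapping_class_group S \<A>) W mcg_act"
  unfolding linear_action_def
proof (intro conjI ballI)
  fix X assume "X \<in> carrier (mapping_class_group S \<A>)"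
  then obtain \<psi> where \<psi>: "\<psi> \<in> carrier \<Delta>" "X = mapping_class S \<A> \<psi>" by (rule mapping_class_groupE)
  note eq = mcg_act_mapping_class[OF \<psi>(1), folded \<psi>(2)]
  note \<psi>h = diffeo_self_homeo[OF \<psi>(1)]
  note hom = self_homeos_homeomorphism[OF \<psi>h] and lin = homeo_act_linear[OF Q]
  interpret E: ext_complex "group_algebra G" Q e "rep_module S x G" by (rule M_complex[OF Q])
  show "linear_iso W W (mcg_act X)"
    unfolding linear_iso_def
  proof (intro conjI ballI allI)
    show "bij_betw (mcg_act X) (carrier W) (carrier W)"
    \<comment> \<open>\<tau> pulls back along the inverse of \<psi>, so pulling back along \<psi>
      itself is inverse to it.\<close>
    proof (rule bij_betw_byWitness[where f' = "homeo_act Q e m \<psi>"])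
      show "\<forall>Y\<in>carrier W. homeo_act Q e m \<psi> (mcg_act X Y) = Y"
        using homeo_act_inverse[OF Q hom] by (simp add: eq)
      show "\<forall>Y\<in>carrier W. mcg_act X (homeo_act Q e m \<psi> Y) = Y"
        using homeo_act_inverse[OF Q homeomorphism_symD[OF hom]] lin(1)[OF homeomorphism_symD[OF hom]] by (simp add: eq)
      show "mcg_act X ` carrier W \<subseteq> carrier W"
        using tau_closed[OF \<psi>h] by (auto simp: eq)
      show "homeo_act Q e m \<psi> ` carrier W \<subseteq> carrier W"
        using lin(1)[OF homeomorphism_symD[OF hom]] by auto
    qed
    show "mcg_act X (v \<oplus>\<^bsub>W\<^esub> w) = mcg_act X v \<oplus>\<^bsub>W\<^esub> mcg_act X w" if "v \<in> carrier W" "w \<in> carrier W" for v w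
      using that lin(2)[OF hom that] by (simp add: eq E.Ext_closed)
    show "mcg_act X (c \<odot>\<^bsub>W\<^esub> v) = c \<odot>\<^bsub>W\<^esub> mcg_act X v" if "v \<in> carrier W" for c v
      using that lin(3)[OF hom that] by (simp add: eq E.Ext_closed)
  qed
next
  fix v assume v: "v \<in> carrier W"
  have "\<one>\<^bsub>mapping_class_group S \<A>\<^esub> = diffeos_isotopic_to_id S \<A>"
    by (simp add: mapping_class_group_def FactGroup_def)
  then show "mcg_act \<one>\<^bsub>mapping_class_group S \<A>\<^esub> v = v"
    using id_isotopic_to_id[OF closed_surface] tau_isotopic_to_id[OF _ v] by (intro mcg_act_eq) auto
next
  fix X Y v assume X: "X \<in> carrier (mapping_class_group S \<A>)" and Y: "Y \<in> carrier (mapping_class_group S \<A>)"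
    and v: "v \<in> carrier W"
  from X obtain \<psi> where \<psi>: "\<psi> \<in> carrier \<Delta>" "X = mapping_class S \<A> \<psi>" by (rule mapping_class_groupE)
  from Y obtain \<psi>' where \<psi>': "\<psi>' \<in> carrier \<Delta>" "Y = mapping_class S \<A> \<psi>'" by (rule mapping_class_groupE)
  note \<psi>'v = tau_closed[OF diffeo_self_homeo[OF \<psi>'(1)] v]
  \<comment> \<open>The product of two classes is the set of all products of their members, and each
    of these acts as \<tau> \<psi> after \<tau> \<psi>'.\<close>
  have XY: "X \<otimes>\<^bsub>mapping_class_group S \<A>\<^esub> Y = {a \<otimes>\<^bsub>\<Delta>\<^esub> b | a b. a \<in> X \<and> b \<in> Y}"
    by (auto simp: mapping_class_group_def FactGroup_def set_mult_def)
  have "mcg_act (X \<otimes>\<^bsub>mapping_class_group S \<A>\<^esub> Y) v = \<tau> \<psi> (\<tau> \<psi>' v)"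
  proof (rule mcg_act_eq)
    show "X \<otimes>\<^bsub>mapping_class_group S \<A>\<^esub> Y \<noteq> {}"
      unfolding XY
      using mapping_class_nonempty[OF \<psi>(1), folded \<psi>(2)] mapping_class_nonempty[OF \<psi>'(1), folded \<psi>'(2)] by blast
    fix \<xi>' assume "\<xi>' \<in> X \<otimes>\<^bsub>mapping_class_group S \<A>\<^esub> Y"
    then obtain a b where ab: "a \<in> X" "b \<in> Y" "\<xi>' = a \<otimes>\<^bsub>\<Delta>\<^esub> b" by (auto simp: XY)
    have a: "a \<in> self_homeos S" using tau_mapping_class(1)[OF \<psi>(1) _ v] ab(1) \<psi>(2) by simp
    have b: "b \<in> self_homeos S" "\<tau> b v = \<tau> \<psi>' v" using tau_mapping_class[OF \<psi>'(1) _ v] ab(2) \<psi>'(2) by simp_all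
    have "\<tau> \<xi>' v = \<tau> a (\<tau> b v)"
      unfolding ab(3) mult_self_homeos[OF a b(1)] by (rule tau_compose[OF a b(1) v])
    also have "\<dots> = \<tau> \<psi> (\<tau> \<psi>' v)"
      unfolding b(2) using tau_mapping_class(2)[OF \<psi>(1) _ \<psi>'v] ab(1) \<psi>(2) by simp
    finally show "\<tau> \<xi>' v = \<tau> \<psi> (\<tau> \<psi>' v)" .
  qed
  then show "mcg_act (X \<otimes>\<^bsub>mapping_class_group S \<A>\<^esub> Y) v = mcg_act X (mcg_act Y v)"
    using mcg_act_mapping_class[OF \<psi>(1) \<psi>'v] mcg_act_mapping_class[OF \<psi>'(1) v] by (simp add: \<psi>(2) \<psi>'(2))
qed

lemma pointed_based_map:
  assumes "\<psi> \<in> pointed_diffeos S \<A> x"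
  shows "\<exists>a\<in>based_maps S x (inv_into S \<psi>). \<forall>X\<in>carrier \<pi>. a X = pi1_map S (inv_into S \<psi>) X"
proof -
  have \<psi>: "\<psi> \<in> carrier \<Delta>" "\<psi> x = x" using assms by (simp_all add: pointed_diffeos_def)
  note hom = homeomorphism_selfD[OF self_homeos_homeomorphism[OF diffeo_self_homeo[OF \<psi>(1)]]]
  have "inv_into S \<psi> x = x" using hom(6)[OF x_in_S] \<psi>(2) diffeo_groupD(1)[OF closed_surface \<psi>(1)] x_in_S
    by (metis bij_betw_inv_into_left)
  then show ?thesis unfolding carrier_pi by (rule pi1_map_based_maps[OF x_in_S hom(1,2)])
qed

text \<open>When \<psi> fixes x the constant path serves as connecting path, and pulling back along
  the resulting automorphism is the given action on representations.\<close>

lemma mcg_act_pointed: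
  assumes "\<psi> \<in> pointed_diffeos S \<A> x" and Y: "Y \<in> carrier W"
  shows "mcg_act (mapping_class S \<A> \<psi>) Y = Ext_map (group_algebra G) Q e (rep_module S x G) m (rep_module_diffeo S x \<psi>) Y"
proof -
  have \<psi>: "\<psi> \<in> carrier \<Delta>" using assms by (simp add: pointed_diffeos_def)
  obtain a where a: "a \<in> based_maps S x (inv_into S \<psi>)" "\<forall>X\<in>carrier \<pi>. a X = pi1_map S (inv_into S \<psi>) X"
    using pointed_based_map[OF assms(1)] by blast
  have "\<tau> \<psi> Y = Ext_map (group_algebra G) Q e (rep_module S x G) m (pull_map (pi1_map S (inv_into S \<psi>))) Y"
    using a(2) by (intro homeo_act_agree[OF Q self_homeos_homeomorphism[OF diffeo_self_homeo[OF \<psi>]] a(1) Y]) blast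
  moreover have "pull_map (pi1_map S (inv_into S \<psi>)) = (rep_module_diffeo S x \<psi> :: _ \<Rightarrow> _ \<Rightarrow> 'k)"
    by (simp add: pull_map_def rep_module_diffeo_def rep_pull_def rep_diffeo_def)
  ultimately show ?thesis using mcg_act_mapping_class[OF \<psi> Y] by simp
qed

lemma cohomology_action_mcg: "cohomology_action G S \<A> x Q e m mcg_act"
  using linear_action_mcg mcg_act_pointed by (simp add: cohomology_action_def Let_def)

end

end

section \<open>The comparison isomorphism\<close>

text \<open>The counit of the double is \<pi> followed by the augmentation of the group
  algebra.\<close>

lemma (in group) trivial_modules_compatible:
  fixes r :: "'a \<times> 'a \<Rightarrow> 'k::field"
  assumes "finite (carrier G)" "r \<in> lin_space (carrier G \<times> carrier G)"
  shows "r \<odot>\<^bsub>trivial_double_module G\<^esub> c = (\<lambda>a. r (\<one>, a)) \<odot>\<^bsub>trivial_group_module\<^esub> c"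
proof -
  have "(\<Sum>y | r y \<noteq> 0. r y * (case y of (a, b) \<Rightarrow> if a = \<one> then 1 else 0)) =
      (\<Sum>y\<in>carrier G \<times> carrier G. r y * (case y of (a, b) \<Rightarrow> if a = \<one> then 1 else 0))"
    using assms by (intro sum.mono_neutral_left) (auto simp: lin_space_def)
  also have "\<dots> = (\<Sum>b\<in>carrier G. \<Sum>a\<in>carrier G. if a = \<one> then r (\<one>, b) else 0)"
    unfolding sum.cartesian_product' by (subst sum.swap) (auto intro!: sum.cong)
  also have "\<dots> = (\<Sum>b\<in>carrier G. r (\<one>, b))" using assms(1) by simp
  also have "\<dots> = (\<Sum>b | r (\<one>, b) \<noteq> 0. r (\<one>, b) * 1)"
    using assms by (intro sum.mono_neutral_cong_right) (auto simp: lin_space_def)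
  finally show ?thesis by (simp add: trivial_double_module_def trivial_group_module_def character_module_def)
qed

context surface_reps
begin

interpretation dual: graded_gset G "tuples g" conj_list list_degree
  by (rule graded_gset_tuples[OF finite_G])

lemma rep_tuple_in: "f \<in> \<Omega> \<Longrightarrow> rep_tuple f \<in> tuples g \<and> list_degree (rep_tuple f) = \<one>"
  using rep_tuple_closed rep_tuple_degree by blast

lemma dual_power_act_graded:
  "\<lbrakk>h \<in> carrier G; a \<in> carrier G; us \<in> tuples g\<rbrakk> \<Longrightarrow> dual_power_act G (h, a) us =
    (if h = list_degree (conj_list a us) then basis_vec (conj_list a us) else (\<lambda>_. 0 :: 'k::field))"
  by (rule dual_power_act_eq[OF finite_G]) (simp_all add: tuples_def)

lemma carrier_dual_power: "carrier (dual_power G g) = lin_space (tuples g)"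
  by (simp add: dual_power_eq based_module_simps)

text \<open>\<open>restrict_rep\<close> is the projection of \<open>L\<^sup>g\<close> onto its component of degree \<open>1\<close>, which is
  identified with \<open>K[\<Omega>]\<close>, and \<open>extend_rep\<close> the inclusion of that component.\<close>

definition restrict_rep :: "(('g \<times> 'g) list \<Rightarrow> 'k::field) \<Rightarrow> ((real \<Rightarrow> 's) set \<Rightarrow> 'g) \<Rightarrow> 'k" where
  "restrict_rep v = (\<lambda>f. if f \<in> \<Omega> then v (rep_tuple f) else 0)"

definition extend_rep :: "(((real \<Rightarrow> 's) set \<Rightarrow> 'g) \<Rightarrow> 'k::field) \<Rightarrow> ('g \<times> 'g) list \<Rightarrow> 'k" where
  "extend_rep w = (\<lambda>us. if us \<in> rep_tuple ` \<Omega> then w (inv_into \<Omega> rep_tuple us) else 0)"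

lemma extend_rep_tuple [simp]: "f \<in> \<Omega> \<Longrightarrow> extend_rep w (rep_tuple f) = w f"
  by (simp add: extend_rep_def inv_into_f_f[OF rep_tuple_inj])

lemma extend_rep_outside: "us \<notin> rep_tuple ` \<Omega> \<Longrightarrow> extend_rep w us = 0"
  by (simp add: extend_rep_def)

lemma restrict_rep_closed: "restrict_rep v \<in> lin_space \<Omega>"
  by (rule lin_spaceI[OF finite_rep_variety]) (simp add: restrict_rep_def)

lemma extend_rep_closed: "extend_rep w \<in> lin_space (tuples g)"
  by (rule lin_spaceI[OF finite_tuples[OF finite_G]]) (use rep_tuple_closed in \<open>auto intro: extend_rep_outside\<close>)

lemma restrict_extend: "w \<in> lin_space \<Omega> \<Longrightarrow> restrict_rep (extend_rep w) = w"
  using lin_space_outside[of w \<Omega>] by (auto simp: restrict_rep_def)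

context
  fixes P :: "nat \<Rightarrow> ('g \<times> 'g \<Rightarrow> 'k::field, 'p) module" and d :: "nat \<Rightarrow> 'p \<Rightarrow> 'p" and \<epsilon>
    and Q :: "nat \<Rightarrow> ('g \<Rightarrow> 'k, 'q) module" and e :: "nat \<Rightarrow> 'q \<Rightarrow> 'q" and \<epsilon>' and m :: nat
  assumes P: "projective_resolution (drinfeld_double G) (trivial_double_module G) P d \<epsilon>"
    and Q: "projective_resolution (group_algebra G) trivial_group_module Q e \<epsilon>'"
begin

abbreviation "D \<equiv> drinfeld_double G :: ('g \<times> 'g \<Rightarrow> 'k) ring"
abbreviation "L \<equiv> dual_power G g :: ('g \<times> 'g \<Rightarrow> 'k, ('g \<times> 'g) list \<Rightarrow> 'k) module"
abbreviation "KGA \<equiv> group_algebra G :: ('g \<Rightarrow> 'k) ring"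
abbreviation "MG \<equiv> rep_module S x G :: ('g \<Rightarrow> 'k, ((real \<Rightarrow> 's) set \<Rightarrow> 'g) \<Rightarrow> 'k) module"

text \<open>The ring axioms of the double come with the modules of its resolution.\<close>

lemma ring_D: "ring D"
  using P left_module_ring by (auto simp: projective_resolution_def projective_module_def)

lemma L_module: "left_module D L"
  unfolding dual_power_eq by (rule dual.left_module_graded_module[OF dual_power_act_graded ring_D])

lemma L_complex: "ext_complex D P d L"
  using ext_complex_based_algebra[of _ _ _ "trivial_double_module G" P d \<epsilon> L] P L_module
  by (simp add: drinfeld_double_def)

lemma smult_L:
  assumes "r \<in> lin_space (carrier G \<times> carrier G)" "v \<in> lin_space (tuples g)"
  shows "(r \<odot>\<^bsub>L\<^esub> v) us = (if us \<in> tuples g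
    then \<Sum>a\<in>carrier G. r (list_degree us, a) * v (conj_list (inv a) us) else 0)"
  unfolding dual_power_eq by (rule dual.smult_graded_module[OF dual_power_act_graded ring_D assms])

lemma smult_M:
  assumes "r \<in> lin_space (carrier G)" "w \<in> lin_space \<Omega>"
  shows "(r \<odot>\<^bsub>MG\<^esub> w) f = (if f \<in> \<Omega> then \<Sum>a\<in>carrier G. r a * w (rep_conj S x G (inv a) f) else 0)"
  unfolding rep_module_eq by (rule rep.smult_perm_module[OF assms])

lemma first_component_closed:
  "r \<in> lin_space (carrier G \<times> carrier G) \<Longrightarrow> (\<lambda>a. r (\<one>, a)) \<in> lin_space (carrier G)" for r :: "'g \<times> 'g \<Rightarrow> 'k"
  using lin_space_outside[of r "carrier G \<times> carrier G"] by (intro lin_spaceI[OF finite_G]) auto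

lemma restrict_rep_smult:
  assumes r: "r \<in> lin_space (carrier G \<times> carrier G)" and v: "v \<in> lin_space (tuples g)"
  shows "restrict_rep (r \<odot>\<^bsub>L\<^esub> v) = (\<lambda>a. r (\<one>, a)) \<odot>\<^bsub>MG\<^esub> restrict_rep v"
proof
  fix f
  show "restrict_rep (r \<odot>\<^bsub>L\<^esub> v) f = ((\<lambda>a. r (\<one>, a)) \<odot>\<^bsub>MG\<^esub> restrict_rep v) f"
    unfolding smult_M[OF first_component_closed[OF r] restrict_rep_closed]
    using rep_tuple_in[of f] rep_conj_closed[of _ f]
    by (auto simp: restrict_rep_def smult_L[OF r v] rep_tuple_conj intro!: sum.cong)
qed

lemma extend_rep_smult:
  assumes r: "r \<in> lin_space (carrier G \<times> carrier G)" and w: "w \<in> lin_space \<Omega>"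
  shows "extend_rep ((\<lambda>a. r (\<one>, a)) \<odot>\<^bsub>MG\<^esub> w) = r \<odot>\<^bsub>L\<^esub> extend_rep w"
proof
  fix us
  show "extend_rep ((\<lambda>a. r (\<one>, a)) \<odot>\<^bsub>MG\<^esub> w) us = (r \<odot>\<^bsub>L\<^esub> extend_rep w) us"
  proof (cases "us \<in> rep_tuple ` \<Omega>")
    case True
    then obtain f where f: "f \<in> \<Omega>" "us = rep_tuple f" by blast
    have "extend_rep w (conj_list (inv a) us) = w (rep_conj S x G (inv a) f)" if a: "a \<in> carrier G" for a
      using extend_rep_tuple[OF rep_conj_closed[OF inv_closed[OF a] f(1)], of w] a f by (simp add: rep_tuple_conj)
    then show ?thesis
      using f rep_tuple_in[OF f(1)]
      by (simp add: smult_L[OF r extend_rep_closed] smult_M[OF first_component_closed[OF r] w])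
  next
    case False
    \<comment> \<open>Tuples of degree 1 are stable under conjugation, so off these tuples all
      conjugates contribute zero as well.\<close>
    have "extend_rep w (conj_list (inv a) us) = 0" if us: "us \<in> tuples g" and a: "a \<in> carrier G" for a
    proof (rule extend_rep_outside)
      show "conj_list (inv a) us \<notin> rep_tuple ` \<Omega>"
      proof
        assume "conj_list (inv a) us \<in> rep_tuple ` \<Omega>"
        then obtain f where f: "f \<in> \<Omega>" "conj_list (inv a) us = rep_tuple f" by blast
        have "us = rep_tuple (rep_conj S x G a f)"
          using dual.act_act_inv[OF a us] f a by (simp add: rep_tuple_conj)
        then show False using False rep_conj_closed[OF a f(1)] by blast
      qed
    qed
    then show ?thesis using False by (simp add: extend_rep_outside smult_L[OF r extend_rep_closed])
  qed
qed

text \<open>The element acting on v is \<iota> 1 = \<delta>_1 \<otimes> 1, the idempotent that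
  projects onto degree 1.\<close>

lemma extend_restrict:
  assumes v: "v \<in> lin_space (tuples g)"
  shows "extend_rep (restrict_rep v) = (\<lambda>(h, a). if h = \<one> then \<one>\<^bsub>KGA\<^esub> a else 0) \<odot>\<^bsub>L\<^esub> v"
proof
  let ?z = "\<lambda>(h, a). if h = \<one> then \<one>\<^bsub>KGA\<^esub> a else 0"
  have z: "?z \<in> lin_space (carrier G \<times> carrier G)"
    using finite_G by (intro lin_spaceI) (auto simp: basis_vec_def split: if_splits)
  fix us
  show "extend_rep (restrict_rep v) us = (?z \<odot>\<^bsub>L\<^esub> v) us"
  proof (cases "us \<in> rep_tuple ` \<Omega>")
    case True
    then obtain f where f: "f \<in> \<Omega>" "us = rep_tuple f" by blast
    have "(?z \<odot>\<^bsub>L\<^esub> v) us = (\<Sum>a\<in>carrier G. if a = \<one> then v (conj_list (inv a) us) else 0)"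
      using rep_tuple_in[OF f(1)] f(2) by (auto simp: smult_L[OF z v] basis_vec_def intro!: sum.cong)
    also have "\<dots> = v us" using finite_G rep_tuple_in[OF f(1)] f(2) by (simp add: dual.act_one)
    finally show ?thesis using f by (simp add: restrict_rep_def)
  next
    case False
    then show ?thesis
      unfolding rep_tuple_image by (auto simp: smult_L[OF z v] extend_rep_outside rep_tuple_image)
  qed
qed

lemma double_group_Ext_iso:
  "\<exists>\<phi>. linear_iso (Ext D P d L m) (Ext KGA Q e MG m) \<phi> \<and>
    (\<forall>\<theta> \<eta>. restrict \<theta> (carrier L) \<in> mod_hom D L L \<longrightarrow> restrict \<eta> (carrier MG) \<in> mod_hom KGA MG MG \<longrightarrow>
       (\<forall>v\<in>carrier L. restrict_rep (\<theta> v) = \<eta> (restrict_rep v)) \<longrightarrow>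
       (\<forall>X\<in>carrier (Ext D P d L m). \<phi> (Ext_map D P d L m \<theta> X) = Ext_map KGA Q e MG m \<eta> (\<phi> X)))"
proof (rule Ext_change_of_rings[OF ring_retract_double[OF finite_G ring_D ring_KG[OF Q]] P Q _ _ _ _ _ L_complex M_complex[OF Q],
      where i = extend_rep and j = restrict_rep])
  note cM = carrier_M[OF Q]
  show "abelian_group (trivial_double_module G)"
    by (simp add: trivial_double_module_def abelian_group_character_module)
  show "r \<odot>\<^bsub>trivial_double_module G\<^esub> c = (\<lambda>a. r (\<one>, a)) \<odot>\<^bsub>trivial_group_module\<^esub> c" if "r \<in> carrier D" for r c
    using that by (simp add: trivial_modules_compatible[OF finite_G])
  show "extend_rep w \<in> carrier L" for w by (simp add: carrier_dual_power extend_rep_closed)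
  show "restrict_rep v \<in> carrier MG" for v by (simp add: cM restrict_rep_closed)
  show "extend_rep (v \<oplus>\<^bsub>MG\<^esub> w) = extend_rep v \<oplus>\<^bsub>L\<^esub> extend_rep w" for v w
    by (auto simp: rep_module_eq dual_power_eq based_module_simps extend_rep_def)
  show "restrict_rep (v \<oplus>\<^bsub>L\<^esub> w) = restrict_rep v \<oplus>\<^bsub>MG\<^esub> restrict_rep w" for v w
    by (auto simp: rep_module_eq dual_power_eq based_module_simps restrict_rep_def)
  show "extend_rep ((\<lambda>a. r (\<one>, a)) \<odot>\<^bsub>MG\<^esub> w) = r \<odot>\<^bsub>L\<^esub> extend_rep w" if "r \<in> carrier D" "w \<in> carrier MG" for r w
    using that by (simp add: extend_rep_smult cM)
  show "restrict_rep (r \<odot>\<^bsub>L\<^esub> v) = (\<lambda>a. r (\<one>, a)) \<odot>\<^bsub>MG\<^esub> restrict_rep v" if "r \<in> carrier D" "v \<in> carrier L" for r v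
    using that by (simp add: restrict_rep_smult carrier_dual_power)
  show "restrict_rep (extend_rep w) = w" if "w \<in> carrier MG" for w
    using that by (simp add: restrict_extend cM)
  show "extend_rep (restrict_rep v) = (\<lambda>(h, a). if h = \<one> then \<one>\<^bsub>KGA\<^esub> a else 0) \<odot>\<^bsub>L\<^esub> v" if "v \<in> carrier L" for v
    using that by (simp add: extend_restrict carrier_dual_power del: one_group_algebra)
  show "(\<lambda>a. c * \<one>\<^bsub>D\<^esub> (\<one>, a)) = (\<lambda>a. c * \<one>\<^bsub>KGA\<^esub> a)" for c
    by (auto simp: basis_vec_def)
qed (simp_all add: trivial_double_module_def trivial_group_module_def character_module_def)

section \<open>Maps on tuples against the action of diffeomorphisms\<close>

lemma degree_preserving_perm_hom:
  assumes "degree_preserving_perm g t"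
  shows "restrict (lin_ext (\<lambda>us. basis_vec (t us))) (carrier L) \<in> mod_hom D L L"
  unfolding dual_power_eq
  by (rule dual.graded_module_hom[OF dual_power_act_graded ring_D])
    (use assms in \<open>auto simp: degree_preserving_perm_def\<close>)

lemma rep_diffeo_eq_pull: "rep_diffeo S x \<psi> = rep_pull (pi1_map S (inv_into S \<psi>))"
  by (simp add: rep_diffeo_def rep_pull_def fun_eq_iff)

lemma rep_diffeo_props:
  assumes "\<psi> \<in> pointed_diffeos S \<A> x"
  shows "inj_on (rep_diffeo S x \<psi>) \<Omega>" "rep_diffeo S x \<psi> ` \<Omega> \<subseteq> \<Omega>"
    and "restrict (rep_module_diffeo S x \<psi>) (carrier MG) \<in> mod_hom KGA MG MG"
proof -
  have \<psi>: "\<psi> \<in> carrier \<Delta>" using assms by (simp add: pointed_diffeos_def)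
  note hom = self_homeos_homeomorphism[OF diffeo_self_homeo[OF \<psi>]]
  obtain a where a: "a \<in> based_maps S x (inv_into S \<psi>)" "\<forall>X\<in>carrier \<pi>. a X = pi1_map S (inv_into S \<psi>) X"
    using pointed_based_map[OF Q assms] by blast
  have eq: "rep_diffeo S x \<psi> = rep_pull a"
    unfolding rep_diffeo_eq_pull rep_pull_def using a(2) by (intro ext restrict_ext) simp
  show "inj_on (rep_diffeo S x \<psi>) \<Omega>" "rep_diffeo S x \<psi> ` \<Omega> \<subseteq> \<Omega>"
    unfolding eq by (rule rep_pull_props[OF hom a(1)])+
  show "restrict (rep_module_diffeo S x \<psi>) (carrier MG) \<in> mod_hom KGA MG MG"
    using pull_map_hom[OF Q hom a(1)] by (simp add: rep_module_diffeo_def eq pull_map_def)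
qed

text \<open>It provides the commuting square between a permutation of tuples and the action of
  \<psi> on representations that naturality of the comparison isomorphism asks for.\<close>

lemma restrict_rep_perm:
  assumes \<psi>: "\<psi> \<in> pointed_diffeos S \<A> x" and t: "degree_preserving_perm g t"
    and eq: "\<And>f. f \<in> \<Omega> \<Longrightarrow> t (rep_tuple f) = rep_tuple (rep_diffeo S x \<psi> f)" and v: "v \<in> carrier L"
  shows "restrict_rep (lin_ext (\<lambda>us. basis_vec (t us)) v) = rep_module_diffeo S x \<psi> (restrict_rep v)"
proof -
  have v': "v \<in> lin_space (tuples g)" using v by (simp add: carrier_dual_power)
  note pr = rep_diffeo_props[OF \<psi>]
  have t': "inj_on t (tuples g)" using t by (simp add: degree_preserving_perm_def)
  have "lin_ext (\<lambda>f. basis_vec (rep_diffeo S x \<psi> f)) (restrict_rep v) = restrict_rep (lin_ext (\<lambda>us. basis_vec (t us)) v)"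
  proof (rule rep.lin_ext_basis_surj[OF pr(1,2) restrict_rep_closed restrict_rep_closed])
    fix f assume f: "f \<in> \<Omega>"
    have "rep_diffeo S x \<psi> f \<in> \<Omega>" using pr(2) f by blast
    then show "restrict_rep (lin_ext (\<lambda>us. basis_vec (t us)) v) (rep_diffeo S x \<psi> f) = restrict_rep v f"
      using f lin_ext_basis_apply[OF finite_tuples[OF finite_G] v' t' rep_tuple_closed[OF f]]
      by (simp add: restrict_rep_def eq)
  qed
  then show ?thesis by (simp add: rep_module_diffeo_def)
qed

subsection \<open>The generators\<close>

text \<open>The generators are described by their effect on loops, while representations are moved
  by the inverse. Evaluating the moved representation at the image of X gives f X; from these
  equations it can be solved for without computing the inverse on generators.\<close>

lemma rep_diffeo_pi1_map:
  assumes "\<psi> \<in> pointed_diffeos S \<A> x" "X \<in> carrier \<pi>"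
  shows "pi1_map S \<psi> X \<in> carrier \<pi>" "rep_diffeo S x \<psi> f (pi1_map S \<psi> X) = f X"
proof -
  have \<psi>: "\<psi> \<in> carrier \<Delta>" "\<psi> x = x" using assms by (simp_all add: pointed_diffeos_def)
  note hom = homeomorphism_selfD[OF self_homeos_homeomorphism[OF diffeo_self_homeo[OF \<psi>(1)]]]
  have X: "X \<in> path_classes S x x" using assms(2) by (simp add: carrier_pi)
  show F: "pi1_map S \<psi> X \<in> carrier \<pi>" using pi1_map_closed[OF hom(3,4) X] \<psi>(2) by (simp add: carrier_pi)
  have "pi1_map S (\<lambda>y. y) X = pi1_map S (inv_into S \<psi>) (pi1_map S \<psi> X)"
    by (rule pi1_map_compose[OF hom(3,4) hom(1,2) X]) (simp add: hom(6))
  then show "rep_diffeo S x \<psi> f (pi1_map S \<psi> X) = f X"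
    using F pi1_map_id[OF X, of "\<lambda>y. y"] by (simp add: rep_diffeo_def)
qed

context
  fixes \<psi> :: "'s \<Rightarrow> 's" and f :: "(real \<Rightarrow> 's) set \<Rightarrow> 'g"
  assumes \<psi>: "\<psi> \<in> pointed_diffeos S \<A> x" and f: "f \<in> \<Omega>"
begin

abbreviation "f' \<equiv> rep_diffeo S x \<psi> f"

lemma f'_in: "f' \<in> \<Omega>"
  using rep_diffeo_props(2)[OF \<psi>] f by blast

lemma f_gens: "i < g \<Longrightarrow> f (A i) \<in> carrier G" "i < g \<Longrightarrow> f (B i) \<in> carrier G"
  and f'_gens: "i < g \<Longrightarrow> f' (A i) \<in> carrier G" "i < g \<Longrightarrow> f' (B i) \<in> carrier G"
  using rep_closed[OF f] rep_closed[OF f'_in] gens_closed by auto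

lemma T_perm_rep_tuple:
  assumes "i < g" "acts_as_t \<pi> g (\<lambda>i. A i) (\<lambda>i. B i) i (pi1_map S \<psi>)"
  shows "T_perm i (rep_tuple f) = rep_tuple f'"
proof (rule nth_equalityI)
  have F: "pi1_map S \<psi> (A j) = A j" "pi1_map S \<psi> (B j) = (if j = i then B i \<otimes>\<^bsub>\<pi>\<^esub> A i else B j)" if "j < g" for j
    using assms(2) that by (auto simp: acts_as_t_def acts_on_gens_def)
  have a: "f' (A j) = f (A j)" if "j < g" for j
    using rep_diffeo_pi1_map(2)[OF \<psi> gens_closed(1)[OF that]] F(1)[OF that] by metis
  have b: "f' (B j) = f (B j)" if "j < g" "j \<noteq> i" for j
    using rep_diffeo_pi1_map(2)[OF \<psi> gens_closed(2)[OF that(1)]] F(2)[OF that(1)] that(2) by metis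
  \<comment> \<open>The image of \<beta>_i is \<beta>_i \<alpha>_i. Solved for the inverse of
    f'(\<beta>_i) this is c d, where c = f(\<alpha>_i) and d = f(\<beta>_i)^-1.\<close>
  have "f' (B i) \<otimes> f' (A i) = f (B i)"
    using rep_diffeo_pi1_map(2)[OF \<psi> gens_closed(2)[OF assms(1)], of f] F(2)[OF assms(1)]
      rep_mult[OF f'_in gens_closed(2,1)] assms(1) by simp
  then have "f (B i) = f' (B i) \<otimes> f (A i)" using a[OF assms(1)] by simp
  then have bi: "f (A i) \<otimes> inv (f (B i)) = inv (f' (B i))"
    using f_gens[OF assms(1)] f'_gens[OF assms(1)] by (simp add: group_word_simps)
  show "length (T_perm i (rep_tuple f)) = length (rep_tuple f')" by (simp add: T_perm_def)
  fix j assume "j < length (T_perm i (rep_tuple f))"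
  then have j: "j < g" by (simp add: T_perm_def)
  show "T_perm i (rep_tuple f) ! j = rep_tuple f' ! j"
    using j assms(1) a b bi by (cases "j = i") (simp_all add: T_perm_def T_pair_def rep_tuple_nth)
qed

lemma S_perm_rep_tuple:
  assumes "i < g" "acts_as_s \<pi> g (\<lambda>i. A i) (\<lambda>i. B i) i (pi1_map S \<psi>)"
  shows "S_perm i (rep_tuple f) = rep_tuple f'"
proof (rule nth_equalityI)
  have F: "pi1_map S \<psi> (A j) = (if j = i then A i \<otimes>\<^bsub>\<pi>\<^esub> B i \<otimes>\<^bsub>\<pi>\<^esub> inv\<^bsub>\<pi>\<^esub> A i else A j)"
    "pi1_map S \<psi> (B j) = (if j = i then inv\<^bsub>\<pi>\<^esub> A i else B j)" if "j < g" for j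
    using assms(2) that by (auto simp: acts_as_s_def acts_on_gens_def)
  have a: "f' (A j) = f (A j)" if "j < g" "j \<noteq> i" for j
    using rep_diffeo_pi1_map(2)[OF \<psi> gens_closed(1)[OF that(1)]] F(1)[OF that(1)] that(2) by metis
  have b: "f' (B j) = f (B j)" if "j < g" "j \<noteq> i" for j
    using rep_diffeo_pi1_map(2)[OF \<psi> gens_closed(2)[OF that(1)]] F(2)[OF that(1)] that(2) by metis
  note gi = gens_closed[OF assms(1)] and fi = f_gens[OF assms(1)] and fi' = f'_gens[OF assms(1)]
  have e1: "f' (A i) \<otimes> f' (B i) \<otimes> inv (f' (A i)) = f (A i)"
    using rep_diffeo_pi1_map(2)[OF \<psi> gi(1), of f] F(1)[OF assms(1)] gi
    by (simp add: rep_mult[OF f'_in] rep_inv[OF f'_in])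
  have "inv (f' (A i)) = f (B i)"
    using rep_diffeo_pi1_map(2)[OF \<psi> gi(2), of f] F(2)[OF assms(1)] gi by (simp add: rep_inv[OF f'_in])
  \<comment> \<open>The new first entry is the old second entry, as in
    \<open>S_pair\<close>.\<close>
  then have ai: "f' (A i) = inv (f (B i))" using fi' by (metis inv_inv)
  have bi: "f (B i) \<otimes> inv (f (A i)) \<otimes> inv (f (B i)) = inv (f' (B i))"
    unfolding e1[symmetric] ai using fi fi' by (simp add: group_word_simps)
  show "length (S_perm i (rep_tuple f)) = length (rep_tuple f')" by (simp add: S_perm_def)
  fix j assume "j < length (S_perm i (rep_tuple f))"
  then have j: "j < g" by (simp add: S_perm_def)
  show "S_perm i (rep_tuple f) ! j = rep_tuple f' ! j"
    using j assms(1) a b ai bi fi by (cases "j = i") (simp_all add: S_perm_def S_pair_def rep_tuple_nth)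
qed

lemma N_perm_rep_tuple:
  assumes l: "Suc l < g" and act: "acts_as_n \<pi> g (\<lambda>i. A i) (\<lambda>i. B i) l (pi1_map S \<psi>)"
  shows "N_perm l (rep_tuple f) = rep_tuple f'"
proof (rule nth_equalityI)
  define \<mu> where "\<mu> = inv\<^bsub>\<pi>\<^esub> A (Suc l) \<otimes>\<^bsub>\<pi>\<^esub> B l \<otimes>\<^bsub>\<pi>\<^esub> A l \<otimes>\<^bsub>\<pi>\<^esub> inv\<^bsub>\<pi>\<^esub> B l"
  have l': "l < g" using l by simp
  have F: "pi1_map S \<psi> (A j) = (if j = Suc l then \<mu> \<otimes>\<^bsub>\<pi>\<^esub> A (Suc l) \<otimes>\<^bsub>\<pi>\<^esub> inv\<^bsub>\<pi>\<^esub> \<mu> else A j)"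
    "pi1_map S \<psi> (B j) = (if j = Suc l then B (Suc l) \<otimes>\<^bsub>\<pi>\<^esub> inv\<^bsub>\<pi>\<^esub> \<mu> else if j = l then \<mu> \<otimes>\<^bsub>\<pi>\<^esub> B l else B j)"
    if "j < g" for j
    using act that by (auto simp: acts_as_n_def acts_on_gens_def Let_def \<mu>_def[symmetric])
  note gl = gens_closed[OF l'] gens_closed[OF l]
  have \<mu>: "\<mu> \<in> carrier \<pi>" using gl by (simp add: \<mu>_def)
  define n where "n = f' \<mu>"
  have n: "n \<in> carrier G" unfolding n_def by (rule rep_closed[OF f'_in \<mu>])
  note fl = f_gens[OF l'] f_gens[OF l] and fl' = f'_gens[OF l'] f'_gens[OF l]
  have a: "f' (A j) = f (A j)" if "j < g" "j \<noteq> Suc l" for j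
    using rep_diffeo_pi1_map(2)[OF \<psi> gens_closed(1)[OF that(1)]] F(1)[OF that(1)] that(2) by metis
  have b: "f' (B j) = f (B j)" if "j < g" "j \<noteq> l" "j \<noteq> Suc l" for j
    using rep_diffeo_pi1_map(2)[OF \<psi> gens_closed(2)[OF that(1)]] F(2)[OF that(1)] that(2,3) by metis
  have e1: "n \<otimes> f' (A (Suc l)) \<otimes> inv n = f (A (Suc l))"
    using rep_diffeo_pi1_map(2)[OF \<psi> gl(3), of f] F(1)[OF l] gl \<mu>
    by (simp add: rep_mult[OF f'_in] rep_inv[OF f'_in] n_def)
  have e2: "n \<otimes> f' (B l) = f (B l)"
    using rep_diffeo_pi1_map(2)[OF \<psi> gl(2), of f] F(2)[OF l'] gl \<mu>
    by (simp add: rep_mult[OF f'_in] n_def)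
  have e3: "f' (B (Suc l)) \<otimes> inv n = f (B (Suc l))"
    using rep_diffeo_pi1_map(2)[OF \<psi> gl(4), of f] F(2)[OF l] gl \<mu>
    by (simp add: rep_mult[OF f'_in] rep_inv[OF f'_in] n_def)
  have "n = inv (f' (A (Suc l))) \<otimes> f' (B l) \<otimes> f' (A l) \<otimes> inv (f' (B l))"
    unfolding n_def \<mu>_def using gl by (simp add: rep_mult[OF f'_in] rep_inv[OF f'_in])
  \<comment> \<open>In \<open>N_pairs\<close> the element n is computed from f, whereas here it is
    the value of f' at \<mu>. Expressing f through f' conjugates that value by n itself, so both are
    equal.\<close>
  moreover have "inv (f (A (Suc l))) \<otimes> f (B l) \<otimes> f (A l) \<otimes> inv (f (B l)) =
      n \<otimes> (inv (f' (A (Suc l))) \<otimes> f' (B l) \<otimes> f' (A l) \<otimes> inv (f' (B l))) \<otimes> inv n"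
    unfolding e1[symmetric] e2[symmetric] a[OF l' n_not_Suc_n, symmetric] using fl' n by (simp add: group_word_simps)
  ultimately have n_eq: "inv (f (A (Suc l))) \<otimes> f (B l) \<otimes> f (A l) \<otimes> inv (f (B l)) = n"
    using n by (simp add: m_assoc)
  have a': "inv n \<otimes> f (A (Suc l)) \<otimes> n = f' (A (Suc l))"
    unfolding e1[symmetric] using fl' n by (simp add: group_word_simps)
  have b': "inv (f (B l)) \<otimes> n = inv (f' (B l))"
    unfolding e2[symmetric] using fl' n by (simp add: group_word_simps)
  have b'': "inv n \<otimes> inv (f (B (Suc l))) = inv (f' (B (Suc l)))"
    unfolding e3[symmetric] using fl' n by (simp add: group_word_simps)
  have pairs: "N_pairs (rep_tuple f ! l, rep_tuple f ! Suc l) = (rep_tuple f' ! l, rep_tuple f' ! Suc l)"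
    using l l' fl a[OF l' n_not_Suc_n] by (simp add: rep_tuple_nth N_pairs_def Let_def n_eq a' b' b'')
  show "length (N_perm l (rep_tuple f)) = length (rep_tuple f')" by (simp add: N_perm_def)
  fix j assume "j < length (N_perm l (rep_tuple f))"
  then have j: "j < g" by (simp add: N_perm_def)
  show "N_perm l (rep_tuple f) ! j = rep_tuple f' ! j"
  proof (cases "j = l \<or> j = Suc l")
    case True
    then show ?thesis using l l' by (auto simp: N_perm_def pairs)
  next
    case False
    then show ?thesis using j a[OF j] b[OF j] by (simp add: N_perm_def rep_tuple_nth)
  qed
qed

end

text \<open>The block action is the cohomology action carried over by \<phi>. Its prescribed values
  on the generators follow from naturality of \<phi> and the effect of these generators on
  representations.\<close>

theorem block_space_iso:
  "\<exists>\<rho> \<sigma> \<phi>. block_action G g S \<A> x \<alpha> \<beta> P d m \<rho> \<and> cohomology_action G S \<A> x Q e m \<sigma> \<and>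
     equivariant_iso (mapping_class_group S \<A>) (Ext D P d L m) \<rho> (Ext KGA Q e MG m) \<sigma> \<phi>"
proof -
  interpret EL: ext_complex D P d L by (rule L_complex)
  define \<sigma> where "\<sigma> = mcg_act Q e m"
  let ?V = "Ext D P d L m" and ?W = "Ext KGA Q e MG m"
  obtain \<phi> where \<phi>: "linear_iso ?V ?W \<phi>"
    and nat: "\<And>\<theta> \<eta> X. \<lbrakk>restrict \<theta> (carrier L) \<in> mod_hom D L L; restrict \<eta> (carrier MG) \<in> mod_hom KGA MG MG;
       \<forall>v\<in>carrier L. restrict_rep (\<theta> v) = \<eta> (restrict_rep v); X \<in> carrier ?V\<rbrakk> \<Longrightarrow>
       \<phi> (Ext_map D P d L m \<theta> X) = Ext_map KGA Q e MG m \<eta> (\<phi> X)"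
    using double_group_Ext_iso by blast
  define \<rho> where "\<rho> = (\<lambda>X v. inv_into (carrier ?V) \<phi> (\<sigma> X (\<phi> v)))"
  have \<sigma>: "linear_action (mapping_class_group S \<A>) ?W \<sigma>"
    unfolding \<sigma>_def by (rule linear_action_mcg[OF Q])
  have \<rho>: "linear_action (mapping_class_group S \<A>) ?V \<rho>"
    "equivariant_iso (mapping_class_group S \<A>) ?V \<rho> ?W \<sigma> \<phi>"
    unfolding \<rho>_def by (rule transport_linear_action[OF \<phi> \<sigma> EL.Ext_closed]; assumption)+
  have \<phi>_bij: "bij_betw \<phi> (carrier ?V) (carrier ?W)" using \<phi> by (simp add: linear_iso_def)
  \<comment> \<open>The generators are treated alike; what distinguishes them is the permutation t
    of tuples.\<close>
  have gen: "\<rho> (mapping_class S \<A> \<psi>) v = Ext_map D P d L m (lin_ext (\<lambda>us. basis_vec (t us))) v"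
    if \<psi>: "\<psi> \<in> pointed_diffeos S \<A> x" and v: "v \<in> carrier ?V" and t: "degree_preserving_perm g t"
      and eq: "\<And>f. f \<in> \<Omega> \<Longrightarrow> t (rep_tuple f) = rep_tuple (rep_diffeo S x \<psi> f)" for \<psi> v t
  proof -
    let ?\<theta> = "lin_ext (\<lambda>us. basis_vec (t us)) :: (('g \<times> 'g) list \<Rightarrow> 'k) \<Rightarrow> _"
    have "\<phi> v \<in> carrier ?W" using bij_betwE[OF \<phi>_bij] v by blast
    then have "\<sigma> (mapping_class S \<A> \<psi>) (\<phi> v) = Ext_map KGA Q e MG m (rep_module_diffeo S x \<psi>) (\<phi> v)"
      unfolding \<sigma>_def by (rule mcg_act_pointed[OF Q \<psi>])
    also have "\<dots> = \<phi> (Ext_map D P d L m ?\<theta> v)"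
      using restrict_rep_perm[OF \<psi> t eq]
      by (intro nat[OF degree_preserving_perm_hom[OF t] rep_diffeo_props(3)[OF \<psi>] _ v, symmetric]) blast
    finally show ?thesis
      unfolding \<rho>_def
      using bij_betw_inv_into_left[OF \<phi>_bij EL.Ext_map_closed[OF degree_preserving_perm_hom[OF t] v]] by simp
  qed
  have "block_action G g S \<A> x \<alpha> \<beta> P d m \<rho>"
    unfolding block_action_def Let_def
  proof (intro conjI ballI allI impI)
    fix \<psi> v assume \<psi>: "\<psi> \<in> pointed_diffeos S \<A> x" and v: "v \<in> carrier ?V"
    show "\<rho> (mapping_class S \<A> \<psi>) v = Ext_map D P d L m (T_at G i) v"
      if "i < g" "acts_as_t \<pi> g (\<lambda>i. A i) (\<lambda>i. B i) i (pi1_map S \<psi>)" for i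
      unfolding T_at_eq
      by (rule gen[OF \<psi> v degree_preserving_perm_T[OF that(1)]]) (rule T_perm_rep_tuple[OF \<psi> _ that])
    show "\<rho> (mapping_class S \<A> \<psi>) v = Ext_map D P d L m (S_at G i) v"
      if "i < g" "acts_as_s \<pi> g (\<lambda>i. A i) (\<lambda>i. B i) i (pi1_map S \<psi>)" for i
      unfolding S_at_eq
      by (rule gen[OF \<psi> v degree_preserving_perm_S[OF that(1)]]) (rule S_perm_rep_tuple[OF \<psi> _ that])
    show "\<rho> (mapping_class S \<A> \<psi>) v = Ext_map D P d L m (N_at G l) v"
      if "Suc l < g" "acts_as_n \<pi> g (\<lambda>i. A i) (\<lambda>i. B i) l (pi1_map S \<psi>)" for l
      unfolding N_at_eq
      by (rule gen[OF \<psi> v degree_preserving_perm_N[OF that(1)]]) (rule N_perm_rep_tuple[OF \<psi> _ that])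
  qed (rule \<rho>(1))
  moreover have "cohomology_action G S \<A> x Q e m \<sigma>"
    unfolding \<sigma>_def by (rule cohomology_action_mcg[OF Q])
  ultimately show ?thesis using \<rho>(2) by blast
qed

end

end

theorem corollary5p4:
  fixes G :: "('g, 'c) monoid_scheme"
    and g m :: nat
    and S :: "'a::t2_space set" and \<A> :: "'a chart set" and x :: 'a
    and \<alpha> \<beta> :: "nat \<Rightarrow> real \<Rightarrow> 'a"
    and P :: "nat \<Rightarrow> ('g \<times> 'g \<Rightarrow> 'k::alg_closed_field, 'p) module"
    and Q :: "nat \<Rightarrow> ('g \<Rightarrow> 'k, 'q) module"
  assumes "group G" and "finite (carrier G)"
    and "genus_surface g S \<A> x \<alpha> \<beta>"
    and "projective_resolution (drinfeld_double G) (trivial_double_module G) P d \<epsilon>"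
    and "projective_resolution (group_algebra G) trivial_group_module Q d' \<epsilon>'"
  shows "\<exists>\<rho> \<sigma> \<phi>.
           block_action G g S \<A> x \<alpha> \<beta> P d m \<rho> \<and>
           cohomology_action G S \<A> x Q d' m \<sigma> \<and>
           equivariant_iso (mapping_class_group S \<A>)
             (Ext (drinfeld_double G) P d (dual_power G g) m) \<rho>
             (Ext (group_algebra G) Q d' (rep_module S x G) m) \<sigma> \<phi>"
proof -
  interpret surface_reps G g S \<A> x \<alpha> \<beta>
    using assms(1-3) by (intro surface_reps.intro surface_reps_axioms.intro)
  show ?thesis by (rule block_space_iso[OF assms(4,5)])
qed

end
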